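(* There exists a function $f\in\mathrm{Mult}(H^2_d)=H^\infty(\mathfrak{C}\mathfrak{B}_d)$ which is levelwise uniformly continuous, but not uniformly continuous on $\mathfrak{C}\mathfrak{B}_d$.
   Context: Here $d\in\mathbb{N}$ denotes the number of variables. $\mathbb{B}_d$ is the open Euclidean unit ball of $\mathbb{C}^d$. $H^2_d$ is the Drury--Arveson space, the reproducing kernel Hilbert space on $\mathbb{B}_d$ with kernel $\frac{1}{1-\langle z,w\rangle}$, and $\mathrm{Mult}(H^2_d)$ is its multiplier algebra. For a $d$-tuple $X=(X_1,\ldots,X_d)$ of matrices, $\|X\|=\|\sum_iX_iX_i^*\|^{1/2}$. $\mathfrak{C}\mathfrak{B}_d(n)$ is the set of $d$-tuples $X$ of commuting $n\times n$ complex matrices with $\|X\|<1$, and $\mathfrak{C}\mathfrak{B}_d=\bigsqcup_{n\ge1}\mathfrak{C}\mathfrak{B}_d(n)$ is the free commutative ball. $\mathrm{Mult}(H^2_d)$ is identified with the algebra $H^\infty(\mathfrak{C}\mathfrak{B}_d)$ of bounded noncommutative holomorphic functions on $\mathfrak{C}\mathfrak{B}_d$ via the functional calculus: $f\in\mathrm{Mult}(H^2_d)$ is evaluated at $X\in\mathfrak{C}\mathfrak{B}_d(n)$ by $f(X)$, the image of $f$ under the unique continuous homomorphism $\mathcal{O}(\mathbb{B}_d)\to M_n$ extending $p\mapsto p(X)$ on polynomials (where $\mathcal{O}(\mathbb{B}_d)$ is the algebra of holomorphic functions on $\mathbb{B}_d$ with the topology of uniform convergence on compact subsets, and $M_n$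 is the algebra of $n\times n$ complex matrices), and $\|f\|_{\mathrm{Mult}(H^2_d)}=\sup_{X\in\mathfrak{C}\mathfrak{B}_d}\|f(X)\|$. The function $f$ is uniformly continuous on $\mathfrak{C}\mathfrak{B}_d$ if for every $\epsilon>0$ there is $\delta>0$ such that for all $n$ and all $X,Y\in\mathfrak{C}\mathfrak{B}_d(n)$, $\|X-Y\|<\delta$ implies $\|f(X)-f(Y)\|<\epsilon$. It is levelwise uniformly continuous if for every $n$ and every $\epsilon>0$ there is $\delta>0$ (possibly depending on $n$) such that for all $X,Y\in\mathfrak{C}\mathfrak{B}_d(n)$, $\|X-Y\|<\delta$ implies $\|f(X)-f(Y)\|<\epsilon$.
   Formalization: The number of variables d is assumed to be at least 2; for d = 1 the claim fails, since by von Neumann's inequality a function uniformly continuous on the disc is uniformly continuous on the whole free ball (d = 0 fails trivially). *)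

theory Defs
  imports "HOL-Analysis.Analysis" "Jordan_Normal_Form.Schur_Decomposition"
begin

text \<open>
  The number of variables is the cardinality of a finite index type \<open>'d\<close>, so that
  \<open>complex ^ 'd\<close> is $\mathbb{C}^d$ with its Euclidean norm and \<open>ball 0 1\<close> is the unit ball.
  Since the matrix size has to be quantified inside the statement, matrices are those of
  Jordan_Normal_Form, whose size is a value, and \<open>d\<close>-tuples of matrices are functions
  \<open>'d \<Rightarrow> complex mat\<close>.
\<close>


subsection \<open>Reproducing kernel Hilbert spaces and multipliers\<close>

text \<open>
  A function on a set \<open>S\<close> is represented by a total function that vanishes outside \<open>S\<close>.
  The inner product is linear in the first argument.
\<close>

locale rkhs =
  fixes S :: "'a set"
    and K :: "'a \<Rightarrow> 'a \<Rightarrow> complex"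
    and H :: "('a \<Rightarrow> complex) set"
    and ip :: "('a \<Rightarrow> complex) \<Rightarrow> ('a \<Rightarrow> complex) \<Rightarrow> complex"
  assumes supported: "\<And>f x. f \<in> H \<Longrightarrow> x \<notin> S \<Longrightarrow> f x = 0"
    and zero_mem: "(\<lambda>x. 0) \<in> H"
    and add_mem: "\<And>f g. f \<in> H \<Longrightarrow> g \<in> H \<Longrightarrow> (\<lambda>x. f x + g x) \<in> H"
    and scale_mem: "\<And>c f. f \<in> H \<Longrightarrow> (\<lambda>x. c * f x) \<in> H"
    and ip_add: "\<And>f g h. f \<in> H \<Longrightarrow> g \<in> H \<Longrightarrow> h \<in> H \<Longrightarrow>
                    ip (\<lambda>x. f x + g x) h = ip f h + ip g h"
    and ip_scale: "\<And>c f h. f \<in> H \<Longrightarrow> h \<in> H \<Longrightarrow> ip (\<lambda>x. c * f x) h = c * ip f h"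
    and ip_cnj: "\<And>f g. f \<in> H \<Longrightarrow> g \<in> H \<Longrightarrow> ip g f = cnj (ip f g)"
    and ip_nonneg: "\<And>f. f \<in> H \<Longrightarrow> 0 \<le> Re (ip f f)"
    and ip_definite: "\<And>f. f \<in> H \<Longrightarrow> ip f f = 0 \<Longrightarrow> f = (\<lambda>x. 0)"
    and complete:
      "\<And>F :: nat \<Rightarrow> 'a \<Rightarrow> complex.
        (\<And>k. F k \<in> H) \<Longrightarrow>
        (\<And>\<epsilon>. \<epsilon> > 0 \<Longrightarrow> \<exists>N. \<forall>j\<ge>N. \<forall>k\<ge>N.
            sqrt (Re (ip (\<lambda>x. F j x - F k x) (\<lambda>x. F j x - F k x))) < \<epsilon>) \<Longrightarrow>
        \<exists>f\<in>H. (\<lambda>k. sqrt (Re (ip (\<lambda>x. F k x - f x) (\<lambda>x. F k x - f x)))) \<longlonglongrightarrow> 0"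
    and kernel_mem: "\<And>w. w \<in> S \<Longrightarrow> (\<lambda>z. if z \<in> S then K z w else 0) \<in> H"
    and reproducing: "\<And>f w. f \<in> H \<Longrightarrow> w \<in> S \<Longrightarrow> ip f (\<lambda>z. if z \<in> S then K z w else 0) = f w"

definition multipliers :: "'a set \<Rightarrow> ('a \<Rightarrow> complex) set \<Rightarrow> ('a \<Rightarrow> complex) set" where
  "multipliers S H =
     {\<phi>. (\<forall>x. x \<notin> S \<longrightarrow> \<phi> x = 0) \<and> (\<forall>h\<in>H. (\<lambda>x. \<phi> x * h x) \<in> H)}"

definition herm_inner :: "complex ^ 'd::finite \<Rightarrow> complex ^ 'd \<Rightarrow> complex" where
  "herm_inner z w = (\<Sum>i\<in>UNIV. vec_nth z i * cnj (vec_nth w i))"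

definition drury_arveson ::
  "(complex ^ 'd::finite \<Rightarrow> complex) set
    \<Rightarrow> ((complex ^ 'd \<Rightarrow> complex) \<Rightarrow> (complex ^ 'd \<Rightarrow> complex) \<Rightarrow> complex) \<Rightarrow> bool" where
  "drury_arveson H ip \<longleftrightarrow> rkhs (ball 0 1) (\<lambda>z w. 1 / (1 - herm_inner z w)) H ip"

text \<open>
  A reproducing kernel Hilbert space is determined by its kernel (Moore--Aronszajn), so the
  existential quantifier below only names the Drury--Arveson space.
\<close>

definition mult_drury_arveson :: "(complex ^ 'd::finite \<Rightarrow> complex) set" where
  "mult_drury_arveson = {\<phi>. \<exists>H ip. drury_arveson H ip \<and> \<phi> \<in> multipliers (ball 0 1) H}"


subsection \<open>The free commutative ball\<close>

definition cvec_norm :: "complex Matrix.vec \<Rightarrow> real" where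
  "cvec_norm v = L2_set (\<lambda>i. cmod (vec_index v i)) {..<dim_vec v}"

definition opnorm :: "complex Matrix.mat \<Rightarrow> real" where
  "opnorm A = (SUP v\<in>{v \<in> carrier_vec (dim_col A). cvec_norm v \<le> 1}. cvec_norm (A *\<^sub>v v))"

text \<open>
  The matrix $\sum_i X_i X_i^*$ is formed entrywise, as Jordan_Normal_Form matrices of varying
  size are not an instance of the type classes used by \<^const>\<open>sum\<close>.
\<close>

definition row_norm :: "nat \<Rightarrow> ('d::finite \<Rightarrow> complex Matrix.mat) \<Rightarrow> real" where
  "row_norm n X =
     sqrt (opnorm (Matrix.mat n n (\<lambda>jk. \<Sum>i\<in>UNIV. (X i * mat_adjoint (X i)) $$ jk)))"

definition comm_ball :: "nat \<Rightarrow> ('d::finite \<Rightarrow> complex Matrix.mat) set" where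
  "comm_ball n =
     {X. (\<forall>i. X i \<in> carrier_mat n n) \<and> (\<forall>i j. X i * X j = X j * X i) \<and> row_norm n X < 1}"


subsection \<open>Functional calculus\<close>

definition holomorphic_on_ball :: "(complex ^ 'd::finite \<Rightarrow> complex) \<Rightarrow> bool" where
  "holomorphic_on_ball f \<longleftrightarrow>
     (\<forall>z\<in>ball 0 1. \<exists>D. (f has_derivative D) (at z) \<and> (\<forall>c v. D (c *s v) = c * D v))"

text \<open>
  \<open>\<Phi>\<close> is a continuous unital algebra homomorphism from the holomorphic functions on the ball,
  with the topology of uniform convergence on compact subsets, to the \<open>n \<times> n\<close> matrices. It sends
  the coordinate functions to the entries of \<open>X\<close>, which for a unital homomorphism means that it
  extends \<open>p \<mapsto> p(X)\<close> on polynomials. Continuity makes \<open>\<Phi>\<close> insensitive to the values of its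
  argument outside the ball.
\<close>

definition is_calculus ::
  "nat \<Rightarrow> ('d::finite \<Rightarrow> complex Matrix.mat)
    \<Rightarrow> ((complex ^ 'd \<Rightarrow> complex) \<Rightarrow> complex Matrix.mat) \<Rightarrow> bool" where
  "is_calculus n X \<Phi> \<longleftrightarrow>
     (\<forall>f. holomorphic_on_ball f \<longrightarrow> \<Phi> f \<in> carrier_mat n n) \<and>
     (\<forall>f g. holomorphic_on_ball f \<longrightarrow> holomorphic_on_ball g \<longrightarrow>
        \<Phi> (\<lambda>z. f z + g z) = \<Phi> f + \<Phi> g \<and> \<Phi> (\<lambda>z. f z * g z) = \<Phi> f * \<Phi> g) \<and>
     (\<forall>c f. holomorphic_on_ball f \<longrightarrow> \<Phi> (\<lambda>z. c * f z) = c \<cdot>\<^sub>m \<Phi> f) \<and>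
     \<Phi> (\<lambda>z. 1) = 1\<^sub>m n \<and>
     (\<forall>i. \<Phi> (\<lambda>z. vec_nth z i) = X i) \<and>
     (\<forall>f. holomorphic_on_ball f \<longrightarrow> (\<forall>\<epsilon>>0. \<exists>L \<delta>. compact L \<and> L \<subseteq> ball 0 1 \<and> \<delta> > 0 \<and>
        (\<forall>g. holomorphic_on_ball g \<longrightarrow> (\<forall>z\<in>L. cmod (g z - f z) < \<delta>) \<longrightarrow>
             opnorm (\<Phi> g - \<Phi> f) < \<epsilon>)))"

text \<open>
  Any two such homomorphisms agree on holomorphic functions, since polynomials are dense; the
  definite description is therefore applied to the value and not to \<open>\<Phi>\<close>, which is unconstrained
  on functions that are not holomorphic.
\<close>

definition eval_at ::
  "nat \<Rightarrow> (complex ^ 'd::finite \<Rightarrow> complex) \<Rightarrow> ('d \<Rightarrow> complex Matrix.mat) \<Rightarrow> complex Matrix.mat" where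
  "eval_at n f X = (THE A. \<exists>\<Phi>. is_calculus n X \<Phi> \<and> A = \<Phi> f)"


subsection \<open>Uniform continuity\<close>

definition uniformly_continuous_free :: "(complex ^ 'd::finite \<Rightarrow> complex) \<Rightarrow> bool" where
  "uniformly_continuous_free f \<longleftrightarrow>
     (\<forall>\<epsilon>>0. \<exists>\<delta>>0. \<forall>n\<ge>1. \<forall>X\<in>comm_ball n. \<forall>Y\<in>comm_ball n.
        row_norm n (\<lambda>i. X i - Y i) < \<delta> \<longrightarrow> opnorm (eval_at n f X - eval_at n f Y) < \<epsilon>)"

definition levelwise_uniformly_continuous_free :: "(complex ^ 'd::finite \<Rightarrow> complex) \<Rightarrow> bool" where
  "levelwise_uniformly_continuous_free f \<longleftrightarrow>
     (\<forall>n\<ge>1. \<forall>\<epsilon>>0. \<exists>\<delta>>0. \<forall>X\<in>comm_ball n. \<forall>Y\<in>comm_ball n.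
        row_norm n (\<lambda>i. X i - Y i) < \<delta> \<longrightarrow> opnorm (eval_at n f X - eval_at n f Y) < \<epsilon>)"

end

theory Submission
  imports Defs "Jordan_Normal_Form.Spectral_Radius" "HOL-Complex_Analysis.Complex_Analysis"
begin

text \<open>
  Let \<open>a \<noteq> b\<close> be two coordinates and \<open>w = 2 z\<^sub>a z\<^sub>b\<close>. On the ball \<open>|w| \<le> 1\<close>, whereas the powers of
  \<open>w\<close> have squared norm \<open>\<omega>\<^sub>m = 4\<^sup>m / binomial (2m) m\<close> in $H^2_d$, which grows like the square root of
  \<open>m\<close>. The function is \<open>f = (\<Sum>i. c\<^sub>i w\<^sup>i)\<close>, where the coefficients \<open>c\<^sub>i \<ge> 0\<close> form a gliding hump: for
  each number \<open>L\<close> of the rapidly increasing sequence \<open>blk k\<close>, they equal \<open>1 / L\<^sup>7\<close> on the window of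
  length \<open>L\<^sup>4\<close> that starts at \<open>L\<^bsup>16\<^esup>\<close>. The three properties rest on three different sizes of one hump.

  As a multiplier, a hump has norm of order one. Multiplication by \<open>w\<close> moves a monomial along a chain
  \<open>z\<^sup>\<beta> w\<^sup>m\<close>, and in normalized monomials every such chain is dominated by the weighted shift with
  weights \<open>sqrt (\<omega>\<^bsub>m+1\<^esub> / \<omega>\<^sub>m)\<close> (lemma \<open>multinom_lift\<close>). A Cauchy--Schwarz estimate for the resulting
  scalar matrix splits the input of each hump into low, middle and high levels. The low and high parts
  are summable over the humps; the middle parts are bounded, and they start and arrive in pairwise
  disjoint blocks, so they do not add up (\<open>bcoef_multiplier\<close>). Hence \<open>f\<close> is a multiplier
  (\<open>hump_fun_multiplier\<close>).

  On matrices of a fixed size \<open>n\<close> a hump is small. By averaging over roots of unity \<open>\<zeta>\<close>,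
  \<open>(2 X\<^sub>a X\<^sub>b)\<^sup>k\<close> equals \<open>\<omega>\<^sub>k\<close> times the mean of \<open>\<zeta>\<^bsup>-k\<^esup> ((X\<^sub>a + \<zeta> X\<^sub>b) / sqrt 2)\<^bsup>2k\<^esup>\<close>, a mean of
  contractions. A power of such a contraction can be large only if its spectral radius is close to
  one, and at most \<open>n\<^sup>2\<close> pairs of eigenvalues are available to bring that about, each for a small
  proportion of the \<open>\<zeta>\<close>. This improves the bound \<open>\<omega>\<^sub>k\<close>, of order \<open>k\<^bsup>1/2\<^esup>\<close>, to a multiple of
  \<open>k\<^bsup>1/8\<^esup>\<close> that depends on \<open>n\<close> only (\<open>product_power_bound\<close>). A hump then contributes about
  \<open>L\<^sup>4 L\<^bsup>-7\<^esup> L\<^sup>2 = 1 / L\<close>, so on each level \<open>f\<close> is a uniform limit of polynomials and is uniformly continuous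
  (\<open>hump_fun_levelwise\<close>).

  On matrices of all sizes the norm of a hump is bounded below, which is seen on the compressions of
  the $d$-shift to a finite square of monomials in \<open>z\<^sub>a\<close> and \<open>z\<^sub>b\<close>. For a fixed \<open>r < 1\<close>, scaling such a
  tuple by \<open>r\<close> moves it by at most \<open>1 - r\<close>, but it multiplies the hump at \<open>L\<^bsup>16\<^esup>\<close> by a factor that tends
  to zero as \<open>L\<close> grows. So the values of \<open>f\<close> at the two tuples stay apart (\<open>hump_fun_shift_gap\<close>).

  Two constructions give access to the definitions. The Drury--Arveson space is realized as the
  space of square-summable combinations of the functions
  \<open>sqrt (|\<gamma>|! / \<gamma>!) z\<^sup>\<gamma>\<close> (\<open>drury_arveson_feature_space\<close>). The functional calculus at a tuple of row norm
  less than one exists because polynomials are dense among the holomorphic functions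
  (\<open>polyfun_dense\<close>) and because the entries of \<open>p(X)\<close> are bounded by a multiple of the supremum of \<open>|p|\<close>
  over a smaller ball (\<open>span_mat_bound\<close>).
\<close>

section \<open>Norms of vectors, matrices and row tuples\<close>

lemma cvec_norm_sq: "(cvec_norm v)\<^sup>2 = (\<Sum>i<dim_vec v. (cmod (vec_index v i))\<^sup>2)"
  unfolding cvec_norm_def L2_set_def by (simp add: sum_nonneg)

text \<open>
  Absorption: an estimate by Cauchy--Schwarz produces the quantity to be bounded once on the right.
\<close>

lemma le_of_mult_self_le:
  fixes x y :: real
  assumes "x * x \<le> x * y" "0 \<le> x" "0 \<le> y"
  shows "x \<le> y"
  using assms mult_left_le_imp_le[of x x y] by (cases "x = 0") auto

lemma cvec_norm_nonneg [simp]: "0 \<le> cvec_norm v"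
  unfolding cvec_norm_def by simp

lemma cvec_norm_zero [simp]: "cvec_norm (0\<^sub>v n) = 0"
  unfolding cvec_norm_def by (simp add: L2_set_eq_0_iff)

lemma cvec_norm_eq_0: "v \<in> carrier_vec n \<Longrightarrow> cvec_norm v = 0 \<longleftrightarrow> v = 0\<^sub>v n"
  unfolding cvec_norm_def by (auto simp: L2_set_eq_0_iff)

lemma cvec_norm_smult: "cvec_norm (c \<cdot>\<^sub>v v) = cmod c * cvec_norm v"
  unfolding cvec_norm_def by (auto simp: norm_mult L2_set_right_distrib intro!: L2_set_cong)

lemma cvec_norm_triangle:
  assumes "v \<in> carrier_vec n" "w \<in> carrier_vec n"
  shows "cvec_norm (v + w) \<le> cvec_norm v + cvec_norm w"
proof -
  have "cvec_norm (v + w) = L2_set (\<lambda>i. cmod (vec_index v i + vec_index w i)) {..<n}"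
    unfolding cvec_norm_def using assms by (auto intro!: L2_set_cong)
  also have "\<dots> \<le> L2_set (\<lambda>i. cmod (vec_index v i) + cmod (vec_index w i)) {..<n}"
    by (intro L2_set_mono norm_triangle_ineq) auto
  also have "\<dots> \<le> cvec_norm v + cvec_norm w"
    unfolding cvec_norm_def carrier_vecD[OF assms(1)] carrier_vecD[OF assms(2)] by (rule L2_set_triangle_ineq)
  finally show ?thesis .
qed

lemma cvec_norm_triangle_minus:
  assumes "v \<in> carrier_vec n" "w \<in> carrier_vec n"
  shows "cvec_norm (v - w) \<le> cvec_norm v + cvec_norm w"
proof -
  have "v - w = v + (-1) \<cdot>\<^sub>v w" using assms by auto
  then have "cvec_norm (v - w) \<le> cvec_norm v + cvec_norm ((-1) \<cdot>\<^sub>v w)"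
    using cvec_norm_triangle[of v n "(-1) \<cdot>\<^sub>v w"] assms by simp
  then show ?thesis by (simp add: cvec_norm_smult)
qed

lemma cmod_vec_index_le: "i < dim_vec v \<Longrightarrow> cmod (vec_index v i) \<le> cvec_norm v"
  unfolding cvec_norm_def by (rule member_le_L2_set[where f = "\<lambda>i. cmod (vec_index v i)"]) auto

definition hip :: "complex Matrix.vec \<Rightarrow> complex Matrix.vec \<Rightarrow> complex" where
  "hip v w = (\<Sum>i<dim_vec v. vec_index v i * cnj (vec_index w i))"

lemma hip_self: "hip v v = of_real ((cvec_norm v)\<^sup>2)"
  unfolding hip_def cvec_norm_sq of_real_sum by (rule sum.cong[OF refl]) (simp only: complex_norm_square)

lemma hip_cauchy_schwarz:
  assumes "v \<in> carrier_vec n" "w \<in> carrier_vec n"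
  shows "cmod (hip v w) \<le> cvec_norm v * cvec_norm w"
proof -
  have "cmod (hip v w) \<le> (\<Sum>i<n. \<bar>cmod (vec_index v i)\<bar> * \<bar>cmod (vec_index w i)\<bar>)"
    unfolding hip_def using assms by (auto intro!: sum_norm_le simp: norm_mult)
  also have "\<dots> \<le> L2_set (\<lambda>i. cmod (vec_index v i)) {..<n} * L2_set (\<lambda>i. cmod (vec_index w i)) {..<n}"
    by (rule L2_set_mult_ineq)
  finally show ?thesis unfolding cvec_norm_def carrier_vecD[OF assms(1)] carrier_vecD[OF assms(2)] .
qed

lemma mult_mat_vec_index:
  assumes "A \<in> carrier_mat n m" "v \<in> carrier_vec m" "i < n"
  shows "vec_index (A *\<^sub>v v) i = (\<Sum>j<m. A $$ (i, j) * vec_index v j)"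
  using assms by (auto simp: scalar_prod_def lessThan_atLeast0 intro!: sum.cong)

lemma mat_adjoint_carrier [simp]: "A \<in> carrier_mat n m \<Longrightarrow> mat_adjoint A \<in> carrier_mat m n"
  unfolding mat_adjoint_def by (auto simp: mat_of_rows_def)

lemma mat_adjoint_index:
  assumes "A \<in> carrier_mat n m" "i < m" "j < n"
  shows "mat_adjoint A $$ (i, j) = cnj (A $$ (j, i))"
  using assms unfolding mat_adjoint_def mat_of_rows_def by auto

lemma hip_adjoint:
  assumes A: "A \<in> carrier_mat n m" and v: "v \<in> carrier_vec m" and w: "w \<in> carrier_vec n"
  shows "hip (A *\<^sub>v v) w = hip v (mat_adjoint A *\<^sub>v w)"
proof -
  have "hip (A *\<^sub>v v) w = (\<Sum>i<n. \<Sum>j<m. A $$ (i, j) * vec_index v j * cnj (vec_index w i))"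
    unfolding hip_def using A v by (auto simp: mult_mat_vec_index sum_distrib_right simp del: index_mult_mat_vec intro!: sum.cong)
  also have "\<dots> = (\<Sum>j<m. \<Sum>i<n. A $$ (i, j) * vec_index v j * cnj (vec_index w i))"
    by (rule sum.swap)
  also have "\<dots> = (\<Sum>j<m. vec_index v j * cnj (\<Sum>i<n. mat_adjoint A $$ (j, i) * vec_index w i))"
    using A by (auto simp: mat_adjoint_index sum_distrib_left intro!: sum.cong)
  also have "\<dots> = hip v (mat_adjoint A *\<^sub>v w)"
    unfolding hip_def using A v w
    by (auto simp: mult_mat_vec_index[OF mat_adjoint_carrier[OF A] w] simp del: index_mult_mat_vec intro!: sum.cong)
  finally show ?thesis .
qed

lemma mat_adjoint_adjoint:
  fixes A :: "complex Matrix.mat"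
  assumes A: "A \<in> carrier_mat n m"
  shows "mat_adjoint (mat_adjoint A) = A"
proof (rule eq_matI)
  note c = mat_adjoint_carrier[OF A] mat_adjoint_carrier[OF mat_adjoint_carrier[OF A]]
  show "dim_row (mat_adjoint (mat_adjoint A)) = dim_row A" "dim_col (mat_adjoint (mat_adjoint A)) = dim_col A"
    using carrier_matD[OF A] carrier_matD[OF c(2)] by simp_all
  fix i j assume "i < dim_row A" "j < dim_col A"
  then have ij: "i < n" "j < m" using A by auto
  show "mat_adjoint (mat_adjoint A) $$ (i, j) = A $$ (i, j)"
    by (simp only: mat_adjoint_index[OF c(1) ij] mat_adjoint_index[OF A ij(2) ij(1)] complex_cnj_cnj)
qed

lemma mat_adjoint_mult:
  fixes A B :: "complex Matrix.mat"
  assumes A: "A \<in> carrier_mat n m" and B: "B \<in> carrier_mat m l"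
  shows "mat_adjoint (A * B) = mat_adjoint B * mat_adjoint A"
proof (rule eq_matI)
  have AB: "A * B \<in> carrier_mat n l" using A B by (rule mult_carrier_mat)
  note c = mat_adjoint_carrier[OF A] mat_adjoint_carrier[OF B] mat_adjoint_carrier[OF AB]
  show "dim_row (mat_adjoint (A * B)) = dim_row (mat_adjoint B * mat_adjoint A)"
    "dim_col (mat_adjoint (A * B)) = dim_col (mat_adjoint B * mat_adjoint A)" using c by auto
  fix i j assume "i < dim_row (mat_adjoint B * mat_adjoint A)" "j < dim_col (mat_adjoint B * mat_adjoint A)"
  then have ij: "i < l" "j < n" using c by auto
  have "mat_adjoint (A * B) $$ (i, j) = (\<Sum>k<m. cnj (A $$ (j, k)) * cnj (B $$ (k, i)))"
    using ij A B by (simp add: mat_adjoint_index[OF AB] scalar_prod_def lessThan_atLeast0)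
  also have "\<dots> = (\<Sum>k<m. mat_adjoint B $$ (i, k) * mat_adjoint A $$ (k, j))"
    using ij by (intro sum.cong refl) (simp add: mat_adjoint_index[OF A] mat_adjoint_index[OF B])
  also have "\<dots> = (mat_adjoint B * mat_adjoint A) $$ (i, j)"
    using ij c by (simp add: scalar_prod_def lessThan_atLeast0)
  finally show "mat_adjoint (A * B) $$ (i, j) = (mat_adjoint B * mat_adjoint A) $$ (i, j)" .
qed

subsection \<open>Operator norm\<close>

lemma cvec_norm_mult_le_entries:
  assumes A: "A \<in> carrier_mat n m" and v: "v \<in> carrier_vec m"
  shows "cvec_norm (A *\<^sub>v v) \<le> (\<Sum>i<n. \<Sum>j<m. cmod (A $$ (i, j))) * cvec_norm v"
proof -
  have "cvec_norm (A *\<^sub>v v) \<le> (\<Sum>i<n. cmod (vec_index (A *\<^sub>v v) i))"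
    unfolding cvec_norm_def using A L2_set_le_sum[of "{..<n}" "\<lambda>i. cmod (vec_index (A *\<^sub>v v) i)"] by auto
  also have "\<dots> \<le> (\<Sum>i<n. (\<Sum>j<m. cmod (A $$ (i, j)) * cvec_norm v))"
  proof (rule sum_mono)
    fix i assume "i \<in> {..<n}"
    then have "cmod (vec_index (A *\<^sub>v v) i) = cmod (\<Sum>j<m. A $$ (i, j) * vec_index v j)"
      by (simp only: mult_mat_vec_index[OF A v] lessThan_iff)
    also have "\<dots> \<le> (\<Sum>j<m. cmod (A $$ (i, j)) * cvec_norm v)"
      using v by (intro sum_norm_le) (auto simp: norm_mult intro!: mult_left_mono cmod_vec_index_le)
    finally show "cmod (vec_index (A *\<^sub>v v) i) \<le> \<dots>" .
  qed
  finally show ?thesis by (simp add: sum_distrib_right)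
qed

lemma opnorm_bdd:
  assumes A: "A \<in> carrier_mat n m"
  shows "bdd_above ((\<lambda>v. cvec_norm (A *\<^sub>v v)) ` {v \<in> carrier_vec (dim_col A). cvec_norm v \<le> 1})"
proof (rule bdd_aboveI2)
  fix v assume v: "v \<in> {v \<in> carrier_vec (dim_col A). cvec_norm v \<le> 1}"
  have "cvec_norm (A *\<^sub>v v) \<le> (\<Sum>i<n. \<Sum>j<m. cmod (A $$ (i, j))) * cvec_norm v"
    using cvec_norm_mult_le_entries[OF A] v A by auto
  also have "\<dots> \<le> (\<Sum>i<n. \<Sum>j<m. cmod (A $$ (i, j))) * 1"
    using v by (intro mult_left_mono) (auto intro!: sum_nonneg)
  finally show "cvec_norm (A *\<^sub>v v) \<le> (\<Sum>i<n. \<Sum>j<m. cmod (A $$ (i, j)))" by simp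
qed

lemma opnorm_le:
  assumes A: "A \<in> carrier_mat n m" and "0 \<le> C"
    and *: "\<And>v. v \<in> carrier_vec m \<Longrightarrow> cvec_norm (A *\<^sub>v v) \<le> C * cvec_norm v"
  shows "opnorm A \<le> C"
  unfolding opnorm_def
proof (rule cSUP_least)
  have "0\<^sub>v (dim_col A) \<in> {v \<in> carrier_vec (dim_col A). cvec_norm v \<le> 1}" by simp
  then show "{v \<in> carrier_vec (dim_col A). cvec_norm v \<le> 1} \<noteq> {}" by blast
  fix v assume v: "v \<in> {v \<in> carrier_vec (dim_col A). cvec_norm v \<le> 1}"
  then have "cvec_norm (A *\<^sub>v v) \<le> C * cvec_norm v" using * A by auto
  also have "\<dots> \<le> C * 1" using v \<open>0 \<le> C\<close> by (intro mult_left_mono) auto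
  finally show "cvec_norm (A *\<^sub>v v) \<le> C" by simp
qed

lemma cvec_norm_le_opnorm:
  assumes A: "A \<in> carrier_mat n m" and v: "v \<in> carrier_vec m"
  shows "cvec_norm (A *\<^sub>v v) \<le> opnorm A * cvec_norm v"
proof (cases "cvec_norm v = 0")
  case True
  then have "v = 0\<^sub>v m" using cvec_norm_eq_0[OF v] by simp
  then have "A *\<^sub>v v = 0\<^sub>v n" using A by auto
  then show ?thesis using True by simp
next
  case False
  define c where "c = complex_of_real (1 / cvec_norm v)"
  have c: "cmod c = 1 / cvec_norm v" unfolding c_def norm_of_real by simp
  have "cvec_norm (A *\<^sub>v (c \<cdot>\<^sub>v v)) \<le> opnorm A"
    unfolding opnorm_def
    by (rule cSUP_upper[OF _ opnorm_bdd[OF A]]) (use A v False c in \<open>auto simp: cvec_norm_smult\<close>)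
  moreover have "A *\<^sub>v (c \<cdot>\<^sub>v v) = c \<cdot>\<^sub>v (A *\<^sub>v v)" using A v by (rule mult_mat_vec)
  moreover have "0 < cvec_norm v" using False cvec_norm_nonneg[of v] by linarith
  ultimately show ?thesis using c by (simp add: cvec_norm_smult pos_divide_le_eq)
qed

lemma opnorm_nonneg:
  assumes A: "A \<in> carrier_mat n m"
  shows "0 \<le> opnorm A"
proof -
  have z: "0\<^sub>v (dim_col A) \<in> {v \<in> carrier_vec (dim_col A). cvec_norm v \<le> 1}" by simp
  show ?thesis unfolding opnorm_def by (rule cSUP_upper2[OF opnorm_bdd[OF A] z]) simp
qed

lemma opnorm_le_entries:
  assumes A: "A \<in> carrier_mat n m"
  shows "opnorm A \<le> (\<Sum>i<n. \<Sum>j<m. cmod (A $$ (i, j)))"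
  by (rule opnorm_le[OF A]) (auto intro!: sum_nonneg cvec_norm_mult_le_entries[OF A])

lemma cmod_entry_le_opnorm:
  assumes A: "A \<in> carrier_mat n m" and ij: "i < n" "j < m"
  shows "cmod (A $$ (i, j)) \<le> opnorm A"
proof -
  have u: "cvec_norm (unit_vec m j) = 1"
  proof -
    have "(\<Sum>i<m. (cmod (vec_index (unit_vec m j) i))\<^sup>2) = (\<Sum>i<m. if i = j then 1 else 0)"
      using ij by (intro sum.cong) auto
    then show ?thesis unfolding cvec_norm_def L2_set_def using ij by simp
  qed
  have "vec_index (A *\<^sub>v unit_vec m j) i = A $$ (i, j)"
    using A ij by (simp)
  then have "cmod (A $$ (i, j)) \<le> cvec_norm (A *\<^sub>v unit_vec m j)"
    using cmod_vec_index_le[of i "A *\<^sub>v unit_vec m j"] A ij by auto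
  also have "\<dots> \<le> opnorm A" using cvec_norm_le_opnorm[OF A, of "unit_vec m j"] u by auto
  finally show ?thesis .
qed

lemma opnorm_mult:
  assumes A: "A \<in> carrier_mat n m" and B: "B \<in> carrier_mat m l"
  shows "opnorm (A * B) \<le> opnorm A * opnorm B"
proof (rule opnorm_le[OF mult_carrier_mat[OF A B]])
  show "0 \<le> opnorm A * opnorm B" using opnorm_nonneg[OF A] opnorm_nonneg[OF B] by simp
  fix v :: "complex Matrix.vec" assume v: "v \<in> carrier_vec l"
  have "cvec_norm (A * B *\<^sub>v v) = cvec_norm (A *\<^sub>v (B *\<^sub>v v))" using A B v by simp
  also have "\<dots> \<le> opnorm A * cvec_norm (B *\<^sub>v v)" using A B v by (intro cvec_norm_le_opnorm) auto
  also have "\<dots> \<le> opnorm A * (opnorm B * cvec_norm v)"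
    using opnorm_nonneg[OF A] cvec_norm_le_opnorm[OF B v] by (rule mult_left_mono[rotated])
  finally show "cvec_norm (A * B *\<^sub>v v) \<le> opnorm A * opnorm B * cvec_norm v" by simp
qed

lemma opnorm_add:
  assumes A: "A \<in> carrier_mat n m" and B: "B \<in> carrier_mat n m"
  shows "opnorm (A + B) \<le> opnorm A + opnorm B"
proof (rule opnorm_le[of _ n m])
  show "A + B \<in> carrier_mat n m" "0 \<le> opnorm A + opnorm B" using opnorm_nonneg[OF A] opnorm_nonneg[OF B] A B by auto
  fix v :: "complex Matrix.vec" assume v: "v \<in> carrier_vec m"
  have "cvec_norm ((A + B) *\<^sub>v v) = cvec_norm (A *\<^sub>v v + B *\<^sub>v v)"
    using A B v by (simp add: add_mult_distrib_mat_vec)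
  also have "\<dots> \<le> cvec_norm (A *\<^sub>v v) + cvec_norm (B *\<^sub>v v)"
    using A B v by (intro cvec_norm_triangle[of _ n]) auto
  finally show "cvec_norm ((A + B) *\<^sub>v v) \<le> (opnorm A + opnorm B) * cvec_norm v"
    using cvec_norm_le_opnorm[OF A v] cvec_norm_le_opnorm[OF B v] by (simp add: ring_distribs)
qed

lemma opnorm_smult:
  assumes A: "A \<in> carrier_mat n m"
  shows "opnorm (c \<cdot>\<^sub>m A) \<le> cmod c * opnorm A"
proof (rule opnorm_le[of _ n m])
  show "c \<cdot>\<^sub>m A \<in> carrier_mat n m" "0 \<le> cmod c * opnorm A" using opnorm_nonneg[OF A] A by auto
  fix v :: "complex Matrix.vec" assume v: "v \<in> carrier_vec m"
  have "(c \<cdot>\<^sub>m A) *\<^sub>v v = c \<cdot>\<^sub>v (A *\<^sub>v v)" using A v by auto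
  then show "cvec_norm ((c \<cdot>\<^sub>m A) *\<^sub>v v) \<le> cmod c * opnorm A * cvec_norm v"
    using cvec_norm_le_opnorm[OF A v] by (simp add: cvec_norm_smult mult.assoc mult_left_mono)
qed

lemma opnorm_diff_triangle:
  assumes A: "A \<in> carrier_mat n m" and B: "B \<in> carrier_mat n m" and C: "C \<in> carrier_mat n m"
  shows "opnorm (A - C) \<le> opnorm (A - B) + opnorm (B - C)"
proof -
  have "A - C = (A - B) + (B - C)" using A B C by (intro eq_matI) auto
  then show ?thesis using opnorm_add[OF minus_carrier_mat[OF B] minus_carrier_mat[OF C], of A B] by simp
qed

lemma opnorm_minus_commute:
  assumes A: "A \<in> carrier_mat n m" and B: "B \<in> carrier_mat n m"
  shows "opnorm (A - B) = opnorm (B - A)"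
proof -
  have *: "opnorm (X - Y) \<le> opnorm (Y - X)" if "X \<in> carrier_mat n m" "Y \<in> carrier_mat n m" for X Y
  proof -
    have "X - Y = (-1) \<cdot>\<^sub>m (Y - X)" using that by (intro eq_matI) auto
    then show ?thesis using opnorm_smult[OF minus_carrier_mat[OF that(1)], of "-1" Y] by simp
  qed
  show ?thesis using *[OF A B] *[OF B A] by simp
qed

lemma cvec_norm_adjoint_mult_le:
  assumes A: "A \<in> carrier_mat n m" and "0 \<le> C"
    and *: "\<And>v. v \<in> carrier_vec m \<Longrightarrow> cvec_norm (A *\<^sub>v v) \<le> C * cvec_norm v"
    and w: "w \<in> carrier_vec n"
  shows "cvec_norm (mat_adjoint A *\<^sub>v w) \<le> C * cvec_norm w"
proof -
  define u where "u = mat_adjoint A *\<^sub>v w"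
  have u: "u \<in> carrier_vec m" unfolding u_def by (rule mult_mat_vec_carrier[OF mat_adjoint_carrier[OF A] w])
  have "(cvec_norm u)\<^sup>2 = cmod (hip u u)" by (simp add: hip_self norm_power)
  also have "hip u u = hip (A *\<^sub>v u) w" using hip_adjoint[OF A u w] u_def by simp
  also have "cmod \<dots> \<le> cvec_norm (A *\<^sub>v u) * cvec_norm w"
    using A u w by (intro hip_cauchy_schwarz[of _ n]) auto
  also have "\<dots> \<le> C * cvec_norm u * cvec_norm w" using *[OF u] by (intro mult_right_mono) auto
  finally have "cvec_norm u * cvec_norm u \<le> cvec_norm u * (C * cvec_norm w)"
    by (simp add: power2_eq_square mult_ac)
  then have "cvec_norm u \<le> C * cvec_norm w"
    by (rule le_of_mult_self_le) (use \<open>0 \<le> C\<close> in auto)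
  then show ?thesis unfolding u_def .
qed

lemma opnorm_le_adjoint:
  assumes A: "A \<in> carrier_mat n n" and "0 \<le> C"
    and "\<And>v. v \<in> carrier_vec n \<Longrightarrow> cvec_norm (mat_adjoint A *\<^sub>v v) \<le> C * cvec_norm v"
  shows "opnorm A \<le> C"
  using cvec_norm_adjoint_mult_le[OF mat_adjoint_carrier[OF A]] mat_adjoint_adjoint[OF A] assms
  by (intro opnorm_le[OF A]) auto

subsection \<open>Row norm\<close>

definition row_gram :: "nat \<Rightarrow> ('d::finite \<Rightarrow> complex Matrix.mat) \<Rightarrow> complex Matrix.mat" where
  "row_gram n X = Matrix.mat n n (\<lambda>jk. \<Sum>i\<in>UNIV. (X i * mat_adjoint (X i)) $$ jk)"

lemma row_gram_carrier: "row_gram n X \<in> carrier_mat n n"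
  unfolding row_gram_def by simp

lemma row_norm_eq: "row_norm n X = sqrt (opnorm (row_gram n X))"
  unfolding row_norm_def row_gram_def ..

lemma hip_row_gram:
  fixes X :: "'d::finite \<Rightarrow> complex Matrix.mat"
  assumes X: "\<forall>i. X i \<in> carrier_mat n n" and v: "v \<in> carrier_vec n" and w: "w \<in> carrier_vec n"
  shows "hip (row_gram n X *\<^sub>v v) w = (\<Sum>i\<in>UNIV. hip (mat_adjoint (X i) *\<^sub>v v) (mat_adjoint (X i) *\<^sub>v w))"
proof -
  have a: "mat_adjoint (X i) \<in> carrier_mat n n" for i using X by simp
  have assoc: "(X i * mat_adjoint (X i)) *\<^sub>v v = X i *\<^sub>v (mat_adjoint (X i) *\<^sub>v v)" for i
    by (rule assoc_mult_mat_vec[OF X[rule_format] a v])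
  define G where "G i = X i * mat_adjoint (X i)" for i
  have c: "G i \<in> carrier_mat n n" for i unfolding G_def using X[rule_format] a by (rule mult_carrier_mat)
  define S where "S = Matrix.mat n n (\<lambda>jk. \<Sum>i\<in>UNIV. G i $$ jk)"
  have S: "S \<in> carrier_mat n n" unfolding S_def by simp
  have Sx: "S $$ (j, k) = (\<Sum>i\<in>UNIV. G i $$ (j, k))" if "j < n" "k < n" for j k
    unfolding S_def using that by simp
  have "hip (S *\<^sub>v v) w = (\<Sum>j<n. (\<Sum>k<n. S $$ (j,k) * vec_index v k) * cnj (vec_index w j))"
    unfolding hip_def carrier_vecD[OF mult_mat_vec_carrier[OF S v]]
    by (rule sum.cong[OF refl]) (simp only: mult_mat_vec_index[OF S v] lessThan_iff)
  also have "\<dots> = (\<Sum>j<n. \<Sum>k<n. \<Sum>i\<in>UNIV. G i $$ (j,k) * vec_index v k * cnj (vec_index w j))"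
    by (simp add: Sx sum_distrib_right)
  also have "\<dots> = (\<Sum>j<n. \<Sum>i\<in>UNIV. \<Sum>k<n. G i $$ (j,k) * vec_index v k * cnj (vec_index w j))"
    by (intro sum.cong[OF refl] sum.swap)
  also have "\<dots> = (\<Sum>i\<in>UNIV. \<Sum>j<n. \<Sum>k<n. G i $$ (j,k) * vec_index v k * cnj (vec_index w j))"
    by (rule sum.swap)
  also have "\<dots> = (\<Sum>i\<in>UNIV. hip (G i *\<^sub>v v) w)"
    unfolding hip_def carrier_vecD[OF mult_mat_vec_carrier[OF c v]]
    by (intro sum.cong[OF refl]) (simp only: mult_mat_vec_index[OF c v] lessThan_iff sum_distrib_right)
  also have "\<dots> = (\<Sum>i\<in>UNIV. hip (mat_adjoint (X i) *\<^sub>v v) (mat_adjoint (X i) *\<^sub>v w))"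
    unfolding G_def assoc
    by (intro sum.cong[OF refl] hip_adjoint[OF X[rule_format] mult_mat_vec_carrier[OF a v] w])
  finally show ?thesis unfolding row_gram_def S_def G_def .
qed

lemma row_norm_nonneg: "0 \<le> row_norm n X"
  unfolding row_norm_eq by (simp add: opnorm_nonneg[OF row_gram_carrier])

lemma sum_adjoint_le_row_norm:
  fixes X :: "'d::finite \<Rightarrow> complex Matrix.mat"
  assumes X: "\<forall>i. X i \<in> carrier_mat n n" and v: "v \<in> carrier_vec n"
  shows "(\<Sum>i\<in>UNIV. (cvec_norm (mat_adjoint (X i) *\<^sub>v v))\<^sup>2) \<le> (row_norm n X)\<^sup>2 * (cvec_norm v)\<^sup>2"
proof -
  note g = row_gram_carrier[of n X]
  define s where "s = (\<Sum>i\<in>UNIV. (cvec_norm (mat_adjoint (X i) *\<^sub>v v))\<^sup>2)"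
  have s0: "0 \<le> s" unfolding s_def by (intro sum_nonneg) simp
  have s: "hip (row_gram n X *\<^sub>v v) v = of_real s"
    unfolding hip_row_gram[OF X v v] hip_self s_def of_real_sum ..
  have "s = cmod (hip (row_gram n X *\<^sub>v v) v)" using s0 unfolding s norm_of_real by simp
  also have "\<dots> \<le> cvec_norm (row_gram n X *\<^sub>v v) * cvec_norm v"
    by (rule hip_cauchy_schwarz[OF mult_mat_vec_carrier[OF g v] v])
  also have "\<dots> \<le> (opnorm (row_gram n X) * cvec_norm v) * cvec_norm v"
    by (intro mult_right_mono cvec_norm_le_opnorm[OF g v]) auto
  finally have "s \<le> opnorm (row_gram n X) * (cvec_norm v)\<^sup>2" by (simp only: power2_eq_square mult.assoc)
  then show ?thesis
    unfolding row_norm_eq s_def real_sqrt_pow2[OF opnorm_nonneg[OF g]] .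
qed

text \<open>
  The row norm is the least constant for which the adjoints form a column contraction up to scale;
  this lemma and \<open>sum_adjoint_le_row_norm\<close> let all later estimates work with adjoints on vectors instead of
  with the matrix $\sum_i X_i X_i^*$.
\<close>

lemma row_norm_le:
  fixes X :: "'d::finite \<Rightarrow> complex Matrix.mat"
  assumes X: "\<forall>i. X i \<in> carrier_mat n n" and c: "0 \<le> c"
    and *: "\<And>v. v \<in> carrier_vec n \<Longrightarrow> (\<Sum>i\<in>UNIV. (cvec_norm (mat_adjoint (X i) *\<^sub>v v))\<^sup>2) \<le> c\<^sup>2 * (cvec_norm v)\<^sup>2"
  shows "row_norm n X \<le> c"
proof -
  note g = row_gram_carrier[of n X]
  have a: "mat_adjoint (X i) *\<^sub>v v \<in> carrier_vec n" if "v \<in> carrier_vec n" for v i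
    using mult_mat_vec_carrier[OF mat_adjoint_carrier[OF X[rule_format]] that] .
  have root: "L2_set (\<lambda>i. cvec_norm (mat_adjoint (X i) *\<^sub>v v)) UNIV \<le> c * cvec_norm v"
    if "v \<in> carrier_vec n" for v
    unfolding L2_set_def using *[OF that] c by (intro real_le_lsqrt) (auto intro: sum_nonneg simp: power_mult_distrib)
  have "opnorm (row_gram n X) \<le> c\<^sup>2"
  proof (rule opnorm_le[OF g])
    fix v :: "complex Matrix.vec" assume v: "v \<in> carrier_vec n"
    define u where "u = row_gram n X *\<^sub>v v"
    have u: "u \<in> carrier_vec n" unfolding u_def using mult_mat_vec_carrier[OF g v] .
    have "(cvec_norm u)\<^sup>2 = cmod (hip u u)" by (simp add: hip_self norm_power)
    also have "hip u u = (\<Sum>i\<in>UNIV. hip (mat_adjoint (X i) *\<^sub>v v) (mat_adjoint (X i) *\<^sub>v u))"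
      using hip_row_gram[OF X v u] unfolding u_def[symmetric] .
    also have "cmod \<dots> \<le> (\<Sum>i\<in>UNIV. \<bar>cvec_norm (mat_adjoint (X i) *\<^sub>v v)\<bar> * \<bar>cvec_norm (mat_adjoint (X i) *\<^sub>v u)\<bar>)"
      by (rule sum_norm_le) (simp only: abs_of_nonneg[OF cvec_norm_nonneg] hip_cauchy_schwarz[OF a[OF v] a[OF u]])
    also have "\<dots> \<le> L2_set (\<lambda>i. cvec_norm (mat_adjoint (X i) *\<^sub>v v)) UNIV * L2_set (\<lambda>i. cvec_norm (mat_adjoint (X i) *\<^sub>v u)) UNIV"
      by (rule L2_set_mult_ineq)
    also have "\<dots> \<le> (c * cvec_norm v) * (c * cvec_norm u)"
      by (intro mult_mono root[OF u] root[OF v] L2_set_nonneg mult_nonneg_nonneg c cvec_norm_nonneg)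
    finally have "cvec_norm u * cvec_norm u \<le> cvec_norm u * (c\<^sup>2 * cvec_norm v)"
      by (simp add: power2_eq_square mult_ac)
    then show "cvec_norm (row_gram n X *\<^sub>v v) \<le> c\<^sup>2 * cvec_norm v"
      unfolding u_def[symmetric]
      by (rule le_of_mult_self_le) auto
  qed simp
  then show ?thesis unfolding row_norm_eq using c by (intro real_le_lsqrt) auto
qed

lemma opnorm_le_row_norm:
  fixes X :: "'d::finite \<Rightarrow> complex Matrix.mat"
  assumes X: "\<forall>i. X i \<in> carrier_mat n n"
  shows "opnorm (X i) \<le> row_norm n X"
proof (rule opnorm_le_adjoint[OF X[rule_format] row_norm_nonneg])
  fix v :: "complex Matrix.vec" assume v: "v \<in> carrier_vec n"
  have "(cvec_norm (mat_adjoint (X i) *\<^sub>v v))\<^sup>2 \<le> (\<Sum>i\<in>UNIV. (cvec_norm (mat_adjoint (X i) *\<^sub>v v))\<^sup>2)"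
    by (rule member_le_sum) auto
  also have "\<dots> \<le> (row_norm n X * cvec_norm v)\<^sup>2"
    using sum_adjoint_le_row_norm[OF X v] by (simp add: power_mult_distrib)
  finally show "cvec_norm (mat_adjoint (X i) *\<^sub>v v) \<le> row_norm n X * cvec_norm v"
    by (rule power2_le_imp_le) (simp add: row_norm_nonneg)
qed

section \<open>The weights and the gliding hump\<close>

text \<open>
  The squared norm of \<open>(2 z\<^sub>a z\<^sub>b)\<^sup>m\<close> in the Drury--Arveson space, namely \<open>4\<^sup>m / binomial (2m) m\<close>
  (lemma \<open>omg_binomial\<close>); the product form makes the ratio of consecutive weights explicit.
\<close>

definition omg :: "nat \<Rightarrow> real" where
  "omg m = (\<Prod>i<m. (2 * real i + 2) / (2 * real i + 1))"

lemma omg_0 [simp]: "omg 0 = 1"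
  by (simp add: omg_def)

lemma omg_Suc: "omg (Suc m) = omg m * ((2 * real m + 2) / (2 * real m + 1))"
  by (simp add: omg_def)

lemma omg_pos [simp]: "0 < omg m"
  unfolding omg_def by (intro prod_pos) auto

lemma omg_nonneg [simp]: "0 \<le> omg m"
  using omg_pos[of m] by linarith

lemma omg_mono: "m \<le> l \<Longrightarrow> omg m \<le> omg l"
proof (induction l rule: dec_induct)
  case (step l)
  have "omg l * 1 \<le> omg (Suc l)" unfolding omg_Suc by (intro mult_left_mono) auto
  then show ?case using step by linarith
qed simp

text \<open>
  Both bounds compare \<open>((2m+2)/(2m+1))\<^sup>2\<close> with a ratio of consecutive linear terms. The
  weights thus grow like the square root of \<open>m\<close>.
\<close>

lemma omg_sq_bounds: "2 * real m + 1 \<le> (omg m)\<^sup>2" "(omg m)\<^sup>2 \<le> 4 * real m + 1"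
proof -
  have "2 * real m + 1 \<le> (omg m)\<^sup>2 \<and> (m > 0 \<longrightarrow> (omg m)\<^sup>2 \<le> 4 * real m)"
  proof (induction m)
    case (Suc m)
    have sq: "(omg (Suc m))\<^sup>2 = (omg m)\<^sup>2 * ((2 * real m + 2)\<^sup>2 / (2 * real m + 1)\<^sup>2)"
      by (simp add: omg_Suc power_mult_distrib power_divide)
    have "2 * real (Suc m) + 1 \<le> (2 * real m + 2)\<^sup>2 / (2 * real m + 1)"
      by (subst pos_le_divide_eq) (auto simp: power2_eq_square algebra_simps)
    also have "\<dots> = (2 * real m + 1) * ((2 * real m + 2)\<^sup>2 / (2 * real m + 1)\<^sup>2)"
      by (simp add: power2_eq_square)
    also have "\<dots> \<le> (omg (Suc m))\<^sup>2"
      unfolding sq using Suc.IH by (intro mult_right_mono) auto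
    finally have 1: "2 * real (Suc m) + 1 \<le> (omg (Suc m))\<^sup>2" .
    have 2: "(omg (Suc m))\<^sup>2 \<le> 4 * real (Suc m)"
    proof (cases "m = 0")
      case True
      then show ?thesis by (simp add: omg_def)
    next
      case False
      then have "(omg (Suc m))\<^sup>2 \<le> 4 * real m * ((2 * real m + 2)\<^sup>2 / (2 * real m + 1)\<^sup>2)"
        unfolding sq using Suc.IH by (intro mult_right_mono) auto
      also have "\<dots> = 4 * real m * (2 * real m + 2)\<^sup>2 / (2 * real m + 1)\<^sup>2" by simp
      also have "\<dots> \<le> 4 * real (Suc m)"
        by (subst pos_divide_le_eq, simp, simp add: power2_eq_square algebra_simps)
      finally show ?thesis .
    qed
    show ?case using 1 2 by simp
  qed simp
  then show "2 * real m + 1 \<le> (omg m)\<^sup>2" "(omg m)\<^sup>2 \<le> 4 * real m + 1" by (cases "m = 0"; simp)+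
qed

lemma omg_lower: "sqrt (2 * real m + 1) \<le> omg m"
  using omg_sq_bounds(1) by (intro real_le_lsqrt) auto

lemma omg_upper: "omg m \<le> sqrt (4 * real m + 1)"
  using omg_sq_bounds(2) by (rule real_le_rsqrt)

lemma omg_binomial: "omg m * real (2 * m choose m) = 4 ^ m"
proof (induction m)
  case (Suc m)
  have "Suc m * (2 * Suc m choose Suc m) = 2 * Suc m * (2 * m + 1 choose m)"
    using Suc_times_binomial[of m "2 * m + 1"] by simp
  moreover have "Suc m * (2 * m + 1 choose m) = (2 * m + 1) * (2 * m choose m)"
    using binomial_absorb_comp[of "2 * m + 1" m] by simp
  ultimately have "Suc m * (Suc m * (2 * Suc m choose Suc m)) = 2 * Suc m * ((2 * m + 1) * (2 * m choose m))"
    by (metis mult.assoc mult.left_commute)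
  then have "real (Suc m * (Suc m * (2 * Suc m choose Suc m))) = real (2 * Suc m * ((2 * m + 1) * (2 * m choose m)))"
    by (rule arg_cong)
  then have "real (Suc m) * (real (Suc m) * real (2 * Suc m choose Suc m)) = real (Suc m) * (2 * (2 * real m + 1) * real (2 * m choose m))"
    by (simp only: of_nat_mult of_nat_add mult_ac) simp
  then have "real (Suc m) * real (2 * Suc m choose Suc m) = 2 * (2 * real m + 1) * real (2 * m choose m)"
    by (simp only: mult_cancel_left) simp
  then have *: "real (2 * Suc m choose Suc m) = 2 * (2 * real m + 1) * real (2 * m choose m) / real (Suc m)"
    by (simp add: field_simps)
  have "omg (Suc m) * real (2 * Suc m choose Suc m) = 4 * (omg m * real (2 * m choose m))"
    unfolding * omg_Suc by (simp add: divide_simps) (simp add: algebra_simps)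
  then show ?case using Suc by simp
qed simp

text \<open>
  The inverse weights decay like \<open>m\<^bsup>-1/2\<^esup>\<close>, so their partial sums telescope against the square root.
\<close>

lemma sum_inverse_omg: "(\<Sum>m<K. 1 / omg m) \<le> sqrt (2 * real K)"
proof (induction K)
  case (Suc K)
  define a b c where "a = sqrt (2 * real K)" and "b = sqrt (2 * real K + 1)" and "c = sqrt (2 * real K + 2)"
  have sq: "a\<^sup>2 = 2 * real K" "b\<^sup>2 = 2 * real K + 1" "c\<^sup>2 = 2 * real K + 2" and nn: "0 \<le> a" "0 < b" "0 < c"
    unfolding a_def b_def c_def by auto
  have "(a + c)\<^sup>2 + (a - c)\<^sup>2 = (2 * b)\<^sup>2" using sq by (simp add: power2_eq_square algebra_simps)
  then have "(a + c)\<^sup>2 \<le> (2 * b)\<^sup>2" using zero_le_power2[of "a - c"] by linarith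
  then have "a + c \<le> 2 * b" by (rule power2_le_imp_le) (use nn in simp)
  have "(c - a) * (c + a) = 2" using sq by (simp add: power2_eq_square algebra_simps)
  moreover have "(c - a) * (c + a) \<le> (c - a) * (2 * b)"
    using \<open>a + c \<le> 2 * b\<close> sq nn by (intro mult_left_mono) (auto simp: a_def c_def)
  ultimately have "1 / b \<le> c - a" using nn by (simp add: field_simps)
  moreover have "1 / omg K \<le> 1 / b" unfolding b_def using omg_lower[of K] by (intro divide_left_mono) auto
  ultimately show ?case using Suc by (simp add: a_def c_def algebra_simps)
qed simp

text \<open>
  The scales of the humps. The exponent 16 separates them: the window of a hump starts at the
  sixteenth power of its scale and its length is only the fourth power.
\<close>

definition blk :: "nat \<Rightarrow> nat" where "blk k = 2 ^ (16 ^ k)"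

lemma blk_Suc: "blk (Suc k) = blk k ^ 16"
  unfolding blk_def by (simp add: power_mult[symmetric] mult.commute)

lemma blk_ge: "2 ^ (2 * k) < blk k" "2 \<le> blk k"
proof -
  have "2 * k < 16 ^ k" by (induction k) auto
  then show "2 ^ (2 * k) < blk k" unfolding blk_def by (simp add: power_strict_increasing)
  have "2 ^ 1 \<le> blk k" unfolding blk_def by (rule power_increasing) auto
  then show "2 \<le> blk k" by simp
qed

lemma blk_gt: "k < blk k"
proof -
  have "k < 2 ^ k" by simp
  also have "(2::nat) ^ k \<le> 2 ^ (2 * k)" by (rule power_increasing) auto
  finally show ?thesis using blk_ge(1)[of k] by linarith
qed

lemma blk_mono: "j \<le> k \<Longrightarrow> blk j \<le> blk k"
  unfolding blk_def by (intro power_increasing) auto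

lemma blk_power_le: "i \<le> j \<Longrightarrow> blk k ^ i \<le> blk k ^ j"
  using blk_ge(2)[of k] by (intro power_increasing) auto

lemma blk_3: "3 * blk k \<le> blk (Suc k)"
proof -
  have "3 * blk k \<le> 2 ^ 2 * blk k" by simp
  also have "\<dots> \<le> blk k ^ 2 * blk k" using blk_ge(2)[of k] by (intro mult_right_mono power_mono) auto
  also have "\<dots> = blk k ^ 3" by (simp add: power2_eq_square power3_eq_cube)
  also have "\<dots> \<le> blk k ^ 16" by (rule blk_power_le) simp
  finally show ?thesis by (simp add: blk_Suc)
qed

text \<open>
  The exponents are in balance. A window of length \<open>L\<^sup>4\<close> at \<open>L\<^bsup>16\<^esup>\<close>, applied to levels of size \<open>L\<^sup>4\<close>,
  meets weight ratios of total size \<open>L\<^sup>8 L\<^sup>2\<close> and spreads each entry over \<open>L\<^sup>4\<close> places, so the squared norm of the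
  hump is of order \<open>L\<^bsup>-14\<^esup> L\<^bsup>10\<^esup> L\<^sup>4 = 1\<close>. Its coefficient sum \<open>L\<^sup>4 L\<^bsup>-7\<^esup>\<close> is small at the same time.
\<close>

definition hump :: "nat \<Rightarrow> nat \<Rightarrow> real" where
  "hump k i = (if blk (Suc k) \<le> i \<and> i < blk (Suc k) + blk k ^ 4 then 1 / real (blk k) ^ 7 else 0)"

text \<open>
  The sum over all humps; since hump \<open>k\<close> starts beyond \<open>k\<close>, the humps up to index \<open>i\<close> are all that
  can be nonzero at \<open>i\<close> (lemma \<open>bcoef_eq\<close>).
\<close>

definition bcoef :: "nat \<Rightarrow> real" where
  "bcoef i = (\<Sum>k\<le>i. hump k i)"

lemma hump_nonneg [simp]: "0 \<le> hump k i"
  by (simp add: hump_def)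

lemma bcoef_nonneg [simp]: "0 \<le> bcoef i"
  unfolding bcoef_def by (intro sum_nonneg) simp

lemma hump_eq_0: "i < k \<Longrightarrow> hump k i = 0"
  using blk_gt[of "Suc k"] by (auto simp: hump_def)

lemma bcoef_eq: "i \<le> K \<Longrightarrow> bcoef i = (\<Sum>k\<le>K. hump k i)"
  unfolding bcoef_def by (rule sum.mono_neutral_left) (auto intro: hump_eq_0)

lemma hump_le_bcoef: "hump k i \<le> bcoef i"
proof (cases "k \<le> i")
  case True
  then show ?thesis unfolding bcoef_def by (intro member_le_sum) auto
qed (simp add: hump_eq_0)

lemma sum_geometric_half: "(\<Sum>k\<le>K. 1 / 2 ^ k) \<le> (2::real)"
proof -
  have "(\<Sum>k\<le>K. 1 / 2 ^ k) = (2::real) - 1 / 2 ^ K"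
    by (induction K) (simp_all add: field_simps)
  then show ?thesis by simp
qed

text \<open>
  On its window \<open>i + 1\<close> is at most of order \<open>L\<^bsup>16\<^esup>\<close>, hence \<open>(i + 1) powr (1/8)\<close> of order \<open>L\<^sup>2\<close>, and the
  \<open>L\<^sup>4\<close> terms add up to \<open>L\<^sup>4 L\<^bsup>-7\<^esup> L\<^sup>2 = 1 / L\<close>.
\<close>

lemma sum_hump_powr_le:
  assumes "\<And>i. B i \<le> C * (real i + 1) powr (1/8)" "0 \<le> C"
  shows "(\<Sum>i\<le>K. hump k i * B i) \<le> 2 * C / 2 ^ k"
proof -
  define L where "L = real (blk k)"
  have L: "2 \<le> L" "2 ^ k \<le> L" 
    using blk_ge[of k] of_nat_mono[OF blk_ge(2)[of k], where 'a = real]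
    using of_nat_mono[OF less_imp_le[OF order.strict_trans1[OF power_increasing[of k "2 * k" "2::nat"] blk_ge(1)[of k]]], where 'a = real]
    by (auto simp: L_def)
  have "(\<Sum>i\<le>K. hump k i * B i) \<le> (\<Sum>i\<in>{blk (Suc k)..<blk (Suc k) + blk k ^ 4}. 1 / L ^ 7 * (C * (2 * L ^ 2)))"
  proof -
    have "(\<Sum>i\<le>K. hump k i * B i) \<le> (\<Sum>i\<le>K. if i \<in> {blk (Suc k)..<blk (Suc k) + blk k ^ 4} then 1 / L ^ 7 * (C * (2 * L ^ 2)) else 0)"
    proof (rule sum_mono)
      fix i
      show "hump k i * B i \<le> (if i \<in> {blk (Suc k)..<blk (Suc k) + blk k ^ 4} then 1 / L ^ 7 * (C * (2 * L ^ 2)) else 0)"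
      proof (cases "i \<in> {blk (Suc k)..<blk (Suc k) + blk k ^ 4}")
        case True
        then have "i + 1 \<le> blk k ^ 16 + blk k ^ 4" by (simp add: blk_Suc)
        also have "\<dots> \<le> 2 * blk k ^ 16" using blk_power_le[of 4 16 k] by simp
        finally have "real (i + 1) \<le> real (2 * blk k ^ 16)" by (rule of_nat_mono)
        then have "real i + 1 \<le> 2 * L ^ 16" by (simp add: L_def)
        also have "\<dots> \<le> 2 ^ 8 * L ^ 16" using L by simp
        also have "\<dots> = (2 * L ^ 2) ^ 8" by (simp add: power_mult_distrib)
        finally have "(real i + 1) powr (1/8) \<le> ((2 * L ^ 2) ^ 8) powr (1/8)" by (intro powr_mono2) auto
        also have "\<dots> = 2 * L ^ 2" proof -
          have "((2 * L ^ 2) ^ 8) powr (1/8) = ((2 * L ^ 2) powr 8) powr (1/8)"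
            using L powr_realpow[of "2 * L ^ 2" 8] by simp
          then show ?thesis using L by (simp only: powr_powr) simp
        qed
        finally have "B i \<le> C * (2 * L ^ 2)" using assms(1)[of i] mult_left_mono[OF _ assms(2)] by (meson order_trans)
        then show ?thesis using True L by (auto simp: hump_def L_def intro!: mult_left_mono divide_right_mono)
      next
        case False
        then show ?thesis by (auto simp: hump_def)
      qed
    qed
    also have "\<dots> = (\<Sum>i\<in>{..K} \<inter> {blk (Suc k)..<blk (Suc k) + blk k ^ 4}. 1 / L ^ 7 * (C * (2 * L ^ 2)))"
      by (rule sum.inter_restrict[symmetric]) simp
    also have "\<dots> \<le> (\<Sum>i\<in>{blk (Suc k)..<blk (Suc k) + blk k ^ 4}. 1 / L ^ 7 * (C * (2 * L ^ 2)))"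
      using assms(2) L by (intro sum_mono2) auto
    finally show ?thesis .
  qed
  also have "\<dots> = 2 * C / L"
    using L power_Suc[of L 6] by (simp add: L_def[symmetric] field_simps flip: power_add)
  also have "\<dots> \<le> 2 * C / 2 ^ k" using L assms(2) by (intro divide_left_mono) auto
  finally show ?thesis .
qed

text \<open>
  Growth of order \<open>powr (1/8)\<close> is what the power bound for matrices of fixed size provides.
\<close>

lemma summable_bcoef_powr:
  assumes B: "\<And>i. 0 \<le> B i" "\<And>i. B i \<le> C * (real i + 1) powr (1/8)"
  shows "summable (\<lambda>i. bcoef i * B i)"
proof -
  have C: "0 \<le> C" using B(1)[of 0] B(2)[of 0] by simp
  have "(\<Sum>i<n. bcoef i * B i) \<le> 4 * C" for n
  proof -
    have "(\<Sum>i<n. bcoef i * B i) \<le> (\<Sum>i\<le>n. bcoef i * B i)" using B by (intro sum_mono2) auto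
    also have "\<dots> = (\<Sum>i\<le>n. \<Sum>k\<le>n. hump k i * B i)"
      by (intro sum.cong refl) (simp add: bcoef_eq[of _ n] sum_distrib_right)
    also have "\<dots> = (\<Sum>k\<le>n. \<Sum>i\<le>n. hump k i * B i)" by (rule sum.swap)
    also have "\<dots> \<le> (\<Sum>k\<le>n. 2 * C * (1 / 2 ^ k))"
      using sum_hump_powr_le[OF B(2) C] by (intro sum_mono) simp
    also have "\<dots> = 2 * C * (\<Sum>k\<le>n. 1 / 2 ^ k)" by (simp only: sum_distrib_left)
    also have "\<dots> \<le> 2 * C * 2" using C by (intro mult_left_mono sum_geometric_half) auto
    finally show ?thesis by simp
  qed
  then show ?thesis using B(1) by (intro summableI_nonneg_bounded[where x = "4 * C"]) auto
qed

lemma summable_bcoef: "summable bcoef"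
  using summable_bcoef_powr[of "\<lambda>_. 1" 1] by (simp add: ge_one_powr_ge_zero)

section \<open>A weighted convolution bounded on square-summable sequences\<close>

text \<open>
  The input levels \<open>m\<close> from which hump \<open>k\<close> reaches the output level \<open>l\<close>.
\<close>

definition hwin :: "nat \<Rightarrow> nat \<Rightarrow> nat set" where
  "hwin k l = {m. m \<le> l \<and> blk (Suc k) \<le> l - m \<and> l - m < blk (Suc k) + blk k ^ 4}"

text \<open>
  The contribution of hump \<open>k\<close> to the output at level \<open>l\<close>, restricted to input levels in \<open>D\<close>.
\<close>

definition hout :: "nat \<Rightarrow> nat set \<Rightarrow> (nat \<Rightarrow> real) \<Rightarrow> nat \<Rightarrow> real" where
  "hout k D u l = (\<Sum>m\<in>hwin k l \<inter> D. 1 / real (blk k) ^ 7 * sqrt (omg l / omg m) * u m)"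

lemma finite_hwin [simp]: "finite (hwin k l)"
  by (rule finite_subset[of _ "{..l}"]) (auto simp: hwin_def)

lemma nat_window_subset:
  fixes l N M :: nat
  shows "{m. m \<le> l \<and> N \<le> l - m \<and> l - m < N + M} \<subseteq> {l + 1 - N - M..<l + 1 - N - M + M}"
proof
  fix m assume "m \<in> {m. m \<le> l \<and> N \<le> l - m \<and> l - m < N + M}"
  then have "m \<le> l" "N \<le> l - m" "l - m < N + M" by auto
  then have "l + 1 - N - M \<le> m" "m < l + 1 - N - M + M" by arith+
  then show "m \<in> {l + 1 - N - M..<l + 1 - N - M + M}" by simp
qed

lemma hwin_subset: "hwin k l \<subseteq> {l + 1 - blk (Suc k) - blk k ^ 4..<l + 1 - blk (Suc k) - blk k ^ 4 + blk k ^ 4}"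
  unfolding hwin_def by (rule nat_window_subset)

text \<open>
  Cauchy--Schwarz in the sum over \<open>m\<close> bounds the square of the output at \<open>l\<close> by \<open>Q\<close> times the energy of
  the input in the window of \<open>l\<close>; each input level lies in at most \<open>L\<^sup>4\<close> windows.
\<close>

lemma L2_hout_le:
  assumes Q: "\<And>l. (\<Sum>m\<in>hwin k l \<inter> D. omg l / omg m) \<le> Q"
    and fin: "1 / real (blk k) ^ 14 * Q * real (blk k) ^ 4 \<le> P\<^sup>2" and "0 \<le> P"
  shows "L2_set (hout k D u) {..K} \<le> P * L2_set u ({..K} \<inter> D)"
proof -
  define \<beta> where "\<beta> = 1 / real (blk k) ^ 7"
  have Q0: "0 \<le> Q" using Q[of 0] by (rule order_trans[rotated]) (intro sum_nonneg divide_nonneg_nonneg omg_nonneg)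
  have pt: "(hout k D u l)\<^sup>2 \<le> \<beta>\<^sup>2 * Q * (\<Sum>m\<in>hwin k l \<inter> D. (u m)\<^sup>2)" for l
  proof -
    have "hout k D u l = \<beta> * (\<Sum>m\<in>hwin k l \<inter> D. sqrt (omg l / omg m) * u m)"
      unfolding hout_def \<beta>_def by (simp add: sum_distrib_left mult.assoc)
    then have "(hout k D u l)\<^sup>2 = \<beta>\<^sup>2 * (\<Sum>m\<in>hwin k l \<inter> D. sqrt (omg l / omg m) * u m)\<^sup>2"
      by (simp add: power_mult_distrib)
    also have "\<dots> \<le> \<beta>\<^sup>2 * ((\<Sum>m\<in>hwin k l \<inter> D. (sqrt (omg l / omg m))\<^sup>2) * (\<Sum>m\<in>hwin k l \<inter> D. (u m)\<^sup>2))"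
      by (intro mult_left_mono Cauchy_Schwarz_ineq_sum) auto
    also have "\<dots> = \<beta>\<^sup>2 * ((\<Sum>m\<in>hwin k l \<inter> D. omg l / omg m) * (\<Sum>m\<in>hwin k l \<inter> D. (u m)\<^sup>2))"
      by simp
    also have "\<dots> \<le> \<beta>\<^sup>2 * (Q * (\<Sum>m\<in>hwin k l \<inter> D. (u m)\<^sup>2))"
      by (intro mult_left_mono mult_right_mono Q sum_nonneg) auto
    finally show ?thesis by (simp add: mult.assoc)
  qed
  have "(\<Sum>l\<le>K. \<Sum>m\<in>hwin k l \<inter> D. (u m)\<^sup>2) = (\<Sum>l\<le>K. \<Sum>m\<in>{..K} \<inter> D. if m \<in> hwin k l then (u m)\<^sup>2 else 0)"
  proof (rule sum.cong[OF refl])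
    fix l assume "l \<in> {..K}"
    then have "hwin k l \<inter> D = {m \<in> {..K} \<inter> D. m \<in> hwin k l}" by (auto simp: hwin_def)
    then show "(\<Sum>m\<in>hwin k l \<inter> D. (u m)\<^sup>2) = (\<Sum>m\<in>{..K} \<inter> D. if m \<in> hwin k l then (u m)\<^sup>2 else 0)"
      by (simp only: sum.inter_filter[OF finite_Int[OF disjI1[OF finite_atMost]]])
  qed
  also have "\<dots> = (\<Sum>m\<in>{..K} \<inter> D. \<Sum>l\<le>K. if m \<in> hwin k l then (u m)\<^sup>2 else 0)" by (rule sum.swap)
  also have "\<dots> \<le> (\<Sum>m\<in>{..K} \<inter> D. real (blk k ^ 4) * (u m)\<^sup>2)"
  proof (rule sum_mono)
    fix m
    have "(\<Sum>l\<le>K. if m \<in> hwin k l then (u m)\<^sup>2 else 0) = real (card {l \<in> {..K}. m \<in> hwin k l}) * (u m)\<^sup>2"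
      by (simp add: sum.inter_filter[symmetric])
    also have "\<dots> \<le> real (blk k ^ 4) * (u m)\<^sup>2"
    proof (intro mult_right_mono of_nat_mono)
      have "card {l \<in> {..K}. m \<in> hwin k l} \<le> card {m + blk (Suc k)..<m + blk (Suc k) + blk k ^ 4}"
        by (intro card_mono) (auto simp: hwin_def)
      then show "card {l \<in> {..K}. m \<in> hwin k l} \<le> blk k ^ 4" by simp
    qed simp
    finally show "(\<Sum>l\<le>K. if m \<in> hwin k l then (u m)\<^sup>2 else 0) \<le> real (blk k ^ 4) * (u m)\<^sup>2" .
  qed
  finally have cnt: "(\<Sum>l\<le>K. \<Sum>m\<in>hwin k l \<inter> D. (u m)\<^sup>2) \<le> real (blk k) ^ 4 * (\<Sum>m\<in>{..K} \<inter> D. (u m)\<^sup>2)"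
    by (simp add: sum_distrib_left)
  have "(\<Sum>l\<le>K. (hout k D u l)\<^sup>2) \<le> (\<Sum>l\<le>K. \<beta>\<^sup>2 * Q * (\<Sum>m\<in>hwin k l \<inter> D. (u m)\<^sup>2))"
    by (intro sum_mono pt)
  also have "\<dots> = \<beta>\<^sup>2 * Q * (\<Sum>l\<le>K. \<Sum>m\<in>hwin k l \<inter> D. (u m)\<^sup>2)" by (simp only: sum_distrib_left)
  also have "\<dots> \<le> \<beta>\<^sup>2 * Q * (real (blk k) ^ 4 * (\<Sum>m\<in>{..K} \<inter> D. (u m)\<^sup>2))"
    using Q0 by (intro mult_left_mono cnt) auto
  also have "\<dots> = (1 / real (blk k) ^ 14 * Q * real (blk k) ^ 4) * (\<Sum>m\<in>{..K} \<inter> D. (u m)\<^sup>2)"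
    by (simp add: \<beta>_def power_divide flip: power_mult)
  also have "\<dots> \<le> P\<^sup>2 * (\<Sum>m\<in>{..K} \<inter> D. (u m)\<^sup>2)"
    by (intro mult_right_mono fin sum_nonneg) auto
  finally show ?thesis
    unfolding L2_set_def using \<open>0 \<le> P\<close> by (simp add: real_sqrt_mult[symmetric] real_le_lsqrt power_mult_distrib sum_nonneg)
qed

lemma sqrt_le_of_sq: "x \<le> y\<^sup>2 \<Longrightarrow> 0 \<le> y \<Longrightarrow> sqrt x \<le> y"
  by (rule real_le_lsqrt)

text \<open>
  For inputs below \<open>L = blk k\<close> the inverse weights add up to order \<open>L\<^bsup>1/2\<^esup>\<close> only, instead of \<open>L\<^sup>2\<close> for a full
  window; this leaves a factor that is summable over the humps.
\<close>

lemma L2_hout_low: "L2_set (hout k {..<blk k} u) {..K} \<le> 3 / 2 ^ k * L2_set u ({..K} \<inter> {..<blk k})"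
proof -
  define L where "L = real (blk k)"
  have L: "2 \<le> L" using of_nat_mono[OF blk_ge(2)[of k], where 'a = real] by (simp add: L_def)
  have Lk: "2 ^ (2 * k) \<le> L" using of_nat_mono[OF less_imp_le[OF blk_ge(1)[of k]], where 'a = real] by (simp add: L_def)
  show ?thesis
  proof (rule L2_hout_le)
    fix l
    show "(\<Sum>m\<in>hwin k l \<inter> {..<blk k}. omg l / omg m) \<le> 6 * L ^ 9"
    proof (cases "hwin k l \<inter> {..<blk k} = {}")
      case False
      then have "l \<le> blk (Suc k) + blk k ^ 4 + blk k" by (auto simp: hwin_def)
      also have "\<dots> \<le> 3 * blk k ^ 16" using blk_power_le[of 4 16 k] blk_power_le[of 1 16 k] by (simp add: blk_Suc)
      finally have "real l \<le> real (3 * blk k ^ 16)" by (rule of_nat_mono)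
      then have "real l \<le> 3 * L ^ 16" unfolding L_def by simp
      moreover have "1 \<le> L ^ 16" using L by simp
      ultimately have "4 * real l + 1 \<le> 13 * L ^ 16" by linarith
      moreover have "(4 * L ^ 8)\<^sup>2 = 16 * L ^ 16" by (simp add: power_mult_distrib flip: power_mult)
      ultimately have "4 * real l + 1 \<le> (4 * L ^ 8)\<^sup>2" using \<open>1 \<le> L ^ 16\<close> by linarith
      then have "sqrt (4 * real l + 1) \<le> 4 * L ^ 8" using L by (intro sqrt_le_of_sq) auto
      then have ol: "omg l \<le> 4 * L ^ 8" using omg_upper[of l] by linarith
      have "(\<Sum>m\<in>hwin k l \<inter> {..<blk k}. omg l / omg m) = omg l * (\<Sum>m\<in>hwin k l \<inter> {..<blk k}. 1 / omg m)"
        by (simp add: sum_distrib_left)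
      also have "\<dots> \<le> omg l * (\<Sum>m<blk k. 1 / omg m)"
        by (intro mult_left_mono sum_mono2) (auto simp: less_imp_le)
      also have "\<dots> \<le> 4 * L ^ 8 * sqrt (2 * L)"
        using sum_inverse_omg[of "blk k"] L unfolding L_def[symmetric] by (intro mult_mono ol) (auto intro!: sum_nonneg simp: less_imp_le)
      also have "\<dots> \<le> 4 * L ^ 8 * L" using L by (intro mult_left_mono sqrt_le_of_sq) (auto simp: power2_eq_square)
      also have "\<dots> \<le> 6 * L ^ 9" using L power_Suc2[of L 8] by simp
      finally show ?thesis .
    qed (use L in simp)
  next
    have "1 / L ^ 14 * (6 * L ^ 9) * L ^ 4 = 6 / L"
      using L by (simp add: field_simps flip: power_add power_Suc)
    also have "\<dots> \<le> 9 / 2 ^ (2 * k)" using L Lk by (intro frac_le) auto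
    also have "\<dots> = (3 / 2 ^ k)\<^sup>2" by (simp add: power_divide power_mult[symmetric] mult.commute)
    finally show "1 / real (blk k) ^ 14 * (6 * L ^ 9) * real (blk k) ^ 4 \<le> (3 / 2 ^ k)\<^sup>2"
      unfolding L_def .
  qed simp
qed

text \<open>
  For inputs at levels beyond \<open>L\<^bsup>16\<^esup>\<close> the output level is comparable to the input level, so the
  weight ratios are bounded.
\<close>

lemma L2_hout_high: "L2_set (hout k {blk (Suc k)..} u) {..K} \<le> 2 / 2 ^ k * L2_set u ({..K} \<inter> {blk (Suc k)..})"
proof -
  define L where "L = real (blk k)"
  have L: "2 \<le> L" using of_nat_mono[OF blk_ge(2)[of k], where 'a = real] by (simp add: L_def)
  have Lk: "2 ^ (2 * k) \<le> L" using of_nat_mono[OF less_imp_le[OF blk_ge(1)[of k]], where 'a = real] by (simp add: L_def)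
  show ?thesis
  proof (rule L2_hout_le)
    fix l
    have "(\<Sum>m\<in>hwin k l \<inter> {blk (Suc k)..}. omg l / omg m) \<le> (\<Sum>m\<in>hwin k l \<inter> {blk (Suc k)..}. 3)"
    proof (rule sum_mono)
      fix m assume m: "m \<in> hwin k l \<inter> {blk (Suc k)..}"
      have "blk k ^ 4 \<le> blk (Suc k)" unfolding blk_Suc by (rule blk_power_le) simp
      then have "l \<le> 3 * m" using m by (auto simp: hwin_def)
      then have "real l \<le> 3 * real m" by linarith
      have "omg l \<le> sqrt (4 * real l + 1)" by (rule omg_upper)
      also have "\<dots> \<le> sqrt (9 * (2 * real m + 1))" using \<open>real l \<le> 3 * real m\<close> by (intro real_sqrt_le_mono) auto
      also have "\<dots> = 3 * sqrt (2 * real m + 1)" by (simp only: real_sqrt_mult) simp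
      also have "\<dots> \<le> 3 * omg m" using omg_lower[of m] by simp
      finally show "omg l / omg m \<le> 3" by (simp add: divide_le_eq)
    qed
    also have "\<dots> = 3 * real (card (hwin k l \<inter> {blk (Suc k)..}))" by simp
    also have "card (hwin k l \<inter> {blk (Suc k)..}) \<le> blk k ^ 4"
    proof -
      have "card (hwin k l \<inter> {blk (Suc k)..}) \<le> card {l + 1 - blk (Suc k) - blk k ^ 4..<l + 1 - blk (Suc k) - blk k ^ 4 + blk k ^ 4}"
        using hwin_subset[of k l] by (intro card_mono) auto
      then show ?thesis by (simp only: card_atLeastLessThan add_diff_cancel_left')
    qed
    finally show "(\<Sum>m\<in>hwin k l \<inter> {blk (Suc k)..}. omg l / omg m) \<le> 3 * L ^ 4" by (simp add: L_def)
  next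
    have "1 / L ^ 14 * (3 * L ^ 4) * L ^ 4 = 3 / L ^ 6"
      using L by (simp add: field_simps flip: power_add)
    also have "\<dots> \<le> 3 / L ^ 1" using L by (intro divide_left_mono power_increasing) auto
    also have "\<dots> \<le> 4 / 2 ^ (2 * k)" using L Lk by (intro frac_le) auto
    also have "\<dots> = (2 / 2 ^ k)\<^sup>2" by (simp add: power_divide power_mult[symmetric] mult.commute)
    finally show "1 / real (blk k) ^ 14 * (3 * L ^ 4) * real (blk k) ^ 4 \<le> (2 / 2 ^ k)\<^sup>2"
      unfolding L_def .
  qed simp
qed

text \<open>
  This is the critical range, where the bound is of order one and does not improve with \<open>k\<close>.
\<close>

lemma L2_hout_mid: "L2_set (hout k {blk k..<blk (Suc k)} u) {..K} \<le> 3 * L2_set u ({..K} \<inter> {blk k..<blk (Suc k)})"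
proof -
  define L where "L = real (blk k)"
  have L: "2 \<le> L" using of_nat_mono[OF blk_ge(2)[of k], where 'a = real] by (simp add: L_def)
  show ?thesis
  proof (rule L2_hout_le)
    fix l
    show "(\<Sum>m\<in>hwin k l \<inter> {blk k..<blk (Suc k)}. omg l / omg m) \<le> 8 * L ^ 10"
    proof (cases "hwin k l \<inter> {blk k..<blk (Suc k)} = {}")
      case False
      then have "l \<le> blk (Suc k) + blk k ^ 4 + blk (Suc k)" by (auto simp: hwin_def)
      also have "\<dots> \<le> 3 * blk k ^ 16" using blk_power_le[of 4 16 k] by (simp add: blk_Suc)
      finally have "real l \<le> real (3 * blk k ^ 16)" by (rule of_nat_mono)
      then have "real l \<le> 3 * L ^ 16" unfolding L_def by simp
      moreover have "1 \<le> L ^ 16" using L by simp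
      ultimately have "4 * real l + 1 \<le> 13 * L ^ 16" by linarith
      moreover have "(4 * L ^ 8)\<^sup>2 = 16 * L ^ 16" by (simp add: power_mult_distrib flip: power_mult)
      ultimately have "4 * real l + 1 \<le> (4 * L ^ 8)\<^sup>2" using \<open>1 \<le> L ^ 16\<close> by linarith
      then have "sqrt (4 * real l + 1) \<le> 4 * L ^ 8" using L by (intro sqrt_le_of_sq) auto
      then have ol: "omg l \<le> 4 * L ^ 8" using omg_upper[of l] by linarith
      define a where "a = l + 1 - blk (Suc k) - blk k ^ 4"
      have "(\<Sum>m\<in>hwin k l \<inter> {blk k..<blk (Suc k)}. omg l / omg m) = omg l * (\<Sum>m\<in>hwin k l \<inter> {blk k..<blk (Suc k)}. 1 / omg m)"
        by (simp add: sum_distrib_left)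
      also have "\<dots> \<le> omg l * (\<Sum>m\<in>{a..<a + blk k ^ 4}. 1 / omg m)"
        using hwin_subset[of k l] unfolding a_def
        by (intro mult_left_mono sum_mono2) (auto simp: less_imp_le)
      also have "(\<Sum>m\<in>{a..<a + blk k ^ 4}. 1 / omg m) = (\<Sum>m<blk k ^ 4. 1 / omg (a + m))"
        using sum.shift_bounds_nat_ivl[of "\<lambda>m. 1 / omg m" 0 a "blk k ^ 4"]
        by (simp add: lessThan_atLeast0 add.commute)
      also have "omg l * \<dots> \<le> omg l * (\<Sum>m<blk k ^ 4. 1 / omg m)"
        by (intro mult_left_mono sum_mono divide_left_mono omg_mono) auto
      also have "\<dots> \<le> 4 * L ^ 8 * sqrt (2 * real (blk k ^ 4))"
        using sum_inverse_omg[of "blk k ^ 4"] L by (intro mult_mono ol) (auto intro!: sum_nonneg simp: less_imp_le)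
      also have "\<dots> \<le> 4 * L ^ 8 * (2 * L ^ 2)"
        using L by (intro mult_left_mono sqrt_le_of_sq) (auto simp: power_mult_distrib L_def simp flip: power_mult)
      also have "\<dots> = 8 * L ^ 10" by (simp flip: power_add)
      finally show ?thesis .
    qed (use L in simp)
  next
    have "1 / L ^ 14 * (8 * L ^ 10) * L ^ 4 = 8"
      using L by (simp add: field_simps flip: power_add)
    then show "1 / real (blk k) ^ 14 * (8 * L ^ 10) * real (blk k) ^ 4 \<le> 3\<^sup>2"
      unfolding L_def by simp
  qed simp
qed

lemma square_sum_at_most_one:
  fixes f :: "'b \<Rightarrow> real"
  assumes "finite A" and "\<And>i j. i \<in> A \<Longrightarrow> j \<in> A \<Longrightarrow> f i \<noteq> 0 \<Longrightarrow> f j \<noteq> 0 \<Longrightarrow> i = j"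
  shows "(\<Sum>i\<in>A. f i)\<^sup>2 = (\<Sum>i\<in>A. (f i)\<^sup>2)"
proof (cases "\<exists>i\<in>A. f i \<noteq> 0")
  case True
  then obtain i where i: "i \<in> A" "f i \<noteq> 0" by blast
  then have "(\<Sum>j\<in>A. f j) = f i" "(\<Sum>j\<in>A. (f j)\<^sup>2) = (f i)\<^sup>2"
    using assms by (auto intro!: sum.remove[OF assms(1) i(1), THEN trans] sum.neutral)
  then show ?thesis by simp
next
  case False
  then show ?thesis by simp
qed

text \<open>
  The middle part of hump \<open>k\<close> reads the block from \<open>blk k\<close> to \<open>blk (k+1)\<close> and writes into the next one.
  These blocks are disjoint for different \<open>k\<close>, so the energies add and the bound of a single hump
  holds for the sum.
\<close>

lemma L2_sum_hout_mid:
  "L2_set (\<lambda>l. \<Sum>k\<le>K. hout k {blk k..<blk (Suc k)} u l) {..K} \<le> 3 * L2_set u {..K}"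
proof -
  let ?D = "\<lambda>k. {blk k..<blk (Suc k)}"
  have range: "blk (Suc k) \<le> l \<and> l < blk (Suc (Suc k))" if "hout k (?D k) u l \<noteq> 0" for k l
  proof -
    have "hwin k l \<inter> ?D k \<noteq> {}" using that by (auto simp: hout_def)
    then obtain m where m: "m \<le> l" "blk (Suc k) \<le> l - m" "l - m < blk (Suc k) + blk k ^ 4" "m < blk (Suc k)"
      by (auto simp: hwin_def)
    have "blk k ^ 4 \<le> blk (Suc k)" unfolding blk_Suc by (rule blk_power_le) simp
    then show ?thesis using m blk_3[of "Suc k"] by linarith
  qed
  have uniq: "i = j" if "hout i (?D i) u l \<noteq> 0" "hout j (?D j) u l \<noteq> 0" for i j l
  proof (rule ccontr)
    assume "i \<noteq> j"
    then consider "Suc i \<le> j" | "Suc j \<le> i" by linarith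
    then show False using range[OF that(1)] range[OF that(2)] blk_mono[of "Suc (Suc i)" "Suc j"] blk_mono[of "Suc (Suc j)" "Suc i"]
      by cases auto
  qed
  have "(\<Sum>l\<le>K. (\<Sum>k\<le>K. hout k (?D k) u l)\<^sup>2) = (\<Sum>l\<le>K. \<Sum>k\<le>K. (hout k (?D k) u l)\<^sup>2)"
    by (intro sum.cong refl square_sum_at_most_one) (auto intro: uniq)
  also have "\<dots> = (\<Sum>k\<le>K. \<Sum>l\<le>K. (hout k (?D k) u l)\<^sup>2)" by (rule sum.swap)
  also have "\<dots> \<le> (\<Sum>k\<le>K. 9 * (\<Sum>m\<in>{..K} \<inter> ?D k. (u m)\<^sup>2))"
  proof (rule sum_mono)
    fix k
    have "(L2_set (hout k (?D k) u) {..K})\<^sup>2 \<le> (3 * L2_set u ({..K} \<inter> ?D k))\<^sup>2"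
      by (intro power_mono L2_hout_mid) simp
    then show "(\<Sum>l\<le>K. (hout k (?D k) u l)\<^sup>2) \<le> 9 * (\<Sum>m\<in>{..K} \<inter> ?D k. (u m)\<^sup>2)"
      by (simp add: L2_set_def power_mult_distrib sum_nonneg)
  qed
  also have "\<dots> = 9 * (\<Sum>k\<le>K. \<Sum>m\<in>{..K} \<inter> ?D k. (u m)\<^sup>2)" by (simp only: sum_distrib_left)
  also have "(\<Sum>k\<le>K. \<Sum>m\<in>{..K} \<inter> ?D k. (u m)\<^sup>2) = (\<Sum>m\<in>(\<Union>k\<le>K. {..K} \<inter> ?D k). (u m)\<^sup>2)"
  proof (rule sum.UNION_disjoint[symmetric])
    show "\<forall>i\<in>{..K}. \<forall>j\<in>{..K}. i \<noteq> j \<longrightarrow> ({..K} \<inter> ?D i) \<inter> ({..K} \<inter> ?D j) = {}"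
    proof (intro ballI impI)
      fix i j :: nat assume "i \<noteq> j"
      then consider "Suc i \<le> j" | "Suc j \<le> i" by linarith
      then show "({..K} \<inter> ?D i) \<inter> ({..K} \<inter> ?D j) = {}"
        using blk_mono[of "Suc i" j] blk_mono[of "Suc j" i] by cases auto
    qed
  qed auto
  also have "\<dots> \<le> (\<Sum>m\<le>K. (u m)\<^sup>2)" by (intro sum_mono2) auto
  finally have "(\<Sum>l\<le>K. (\<Sum>k\<le>K. hout k (?D k) u l)\<^sup>2) \<le> 9 * (\<Sum>m\<le>K. (u m)\<^sup>2)" by simp
  then have "sqrt (\<Sum>l\<le>K. (\<Sum>k\<le>K. hout k (?D k) u l)\<^sup>2) \<le> sqrt (3\<^sup>2 * (\<Sum>m\<le>K. (u m)\<^sup>2))" by simp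
  then show ?thesis unfolding L2_set_def real_sqrt_mult by simp
qed

lemma L2_set_sum_le: "L2_set (\<lambda>l. \<Sum>k\<in>A. f k l) S \<le> (\<Sum>k\<in>A. L2_set (f k) S)"
proof (induction A rule: infinite_finite_induct)
  case (insert k A)
  have "L2_set (\<lambda>l. \<Sum>k\<in>insert k A. f k l) S = L2_set (\<lambda>l. f k l + (\<Sum>k\<in>A. f k l)) S"
    using insert by simp
  also have "\<dots> \<le> L2_set (f k) S + L2_set (\<lambda>l. \<Sum>k\<in>A. f k l) S" by (rule L2_set_triangle_ineq)
  finally show ?case using insert by simp
qed (simp_all add: L2_set_def)

lemma L2_set_subset_le: "A \<subseteq> B \<Longrightarrow> finite B \<Longrightarrow> L2_set u A \<le> L2_set u B"
  unfolding L2_set_def by (intro real_sqrt_le_mono sum_mono2) auto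

text \<open>
  The geometric sums of the low and high parts contribute \<open>6 + 4\<close> and the middle parts contribute \<open>3\<close>.
\<close>

lemma bcoef_multiplier:
  "L2_set (\<lambda>l. \<Sum>m\<le>l. bcoef (l - m) * sqrt (omg l / omg m) * u m) {..K} \<le> 13 * L2_set u {..K}"
proof -
  let ?U = "L2_set u {..K}"
  let ?D1 = "\<lambda>k. {..<blk k}" and ?D2 = "\<lambda>k. {blk k..<blk (Suc k)}" and ?D3 = "\<lambda>k. {blk (Suc k)..}"
  have split: "(\<Sum>m\<le>l. bcoef (l - m) * sqrt (omg l / omg m) * u m) =
      (\<Sum>k\<le>K. hout k (?D1 k) u l) + (\<Sum>k\<le>K. hout k (?D2 k) u l) + (\<Sum>k\<le>K. hout k (?D3 k) u l)"
    if "l \<in> {..K}" for l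
  proof -
    have "(\<Sum>m\<le>l. bcoef (l - m) * sqrt (omg l / omg m) * u m) = (\<Sum>m\<le>l. \<Sum>k\<le>K. hump k (l - m) * sqrt (omg l / omg m) * u m)"
      using that by (intro sum.cong refl) (simp add: bcoef_eq[of _ K] sum_distrib_right)
    also have "\<dots> = (\<Sum>k\<le>K. \<Sum>m\<le>l. hump k (l - m) * sqrt (omg l / omg m) * u m)" by (rule sum.swap)
    also have "\<dots> = (\<Sum>k\<le>K. hout k (?D1 k) u l + hout k (?D2 k) u l + hout k (?D3 k) u l)"
    proof (rule sum.cong[OF refl])
      fix k
      let ?g = "\<lambda>m. 1 / real (blk k) ^ 7 * sqrt (omg l / omg m) * u m"
      have "(\<Sum>m\<le>l. hump k (l - m) * sqrt (omg l / omg m) * u m) = (\<Sum>m\<in>hwin k l. ?g m)"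
        by (rule sum.mono_neutral_cong_right) (auto simp: hwin_def hump_def)
      also have "hwin k l = (hwin k l \<inter> ?D1 k) \<union> (hwin k l \<inter> ?D2 k) \<union> (hwin k l \<inter> ?D3 k)"
        by auto
      also have "sum ?g \<dots> = sum ?g ((hwin k l \<inter> ?D1 k) \<union> (hwin k l \<inter> ?D2 k)) + sum ?g (hwin k l \<inter> ?D3 k)"
        using blk_mono[of k "Suc k"] by (intro sum.union_disjoint) auto
      also have "sum ?g ((hwin k l \<inter> ?D1 k) \<union> (hwin k l \<inter> ?D2 k)) = sum ?g (hwin k l \<inter> ?D1 k) + sum ?g (hwin k l \<inter> ?D2 k)"
        by (intro sum.union_disjoint) auto
      finally show "(\<Sum>m\<le>l. hump k (l - m) * sqrt (omg l / omg m) * u m) = hout k (?D1 k) u l + hout k (?D2 k) u l + hout k (?D3 k) u l"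
        by (simp add: hout_def)
    qed
    finally show ?thesis by (simp add: sum.distrib)
  qed
  have "L2_set (\<lambda>l. \<Sum>m\<le>l. bcoef (l - m) * sqrt (omg l / omg m) * u m) {..K} =
      L2_set (\<lambda>l. (\<Sum>k\<le>K. hout k (?D1 k) u l) + (\<Sum>k\<le>K. hout k (?D2 k) u l) + (\<Sum>k\<le>K. hout k (?D3 k) u l)) {..K}"
    by (rule L2_set_cong[OF refl]) (rule split)
  also have "\<dots> \<le> L2_set (\<lambda>l. (\<Sum>k\<le>K. hout k (?D1 k) u l) + (\<Sum>k\<le>K. hout k (?D2 k) u l)) {..K}
      + L2_set (\<lambda>l. \<Sum>k\<le>K. hout k (?D3 k) u l) {..K}" by (rule L2_set_triangle_ineq)
  also have "\<dots> \<le> L2_set (\<lambda>l. \<Sum>k\<le>K. hout k (?D1 k) u l) {..K} + L2_set (\<lambda>l. \<Sum>k\<le>K. hout k (?D2 k) u l) {..K}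
      + L2_set (\<lambda>l. \<Sum>k\<le>K. hout k (?D3 k) u l) {..K}" by (intro add_right_mono L2_set_triangle_ineq)
  also have "\<dots> \<le> 6 * ?U + 3 * ?U + 4 * ?U"
  proof (intro add_mono L2_sum_hout_mid)
    have "L2_set (\<lambda>l. \<Sum>k\<le>K. hout k (?D1 k) u l) {..K} \<le> (\<Sum>k\<le>K. L2_set (hout k (?D1 k) u) {..K})"
      by (rule L2_set_sum_le)
    also have "\<dots> \<le> (\<Sum>k\<le>K. 3 * (1 / 2 ^ k) * ?U)"
    proof (rule sum_mono)
      fix k
      have "L2_set (hout k (?D1 k) u) {..K} \<le> 3 / 2 ^ k * L2_set u ({..K} \<inter> ?D1 k)" by (rule L2_hout_low)
      also have "\<dots> \<le> 3 / 2 ^ k * ?U" by (intro mult_left_mono L2_set_subset_le) auto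
      finally show "L2_set (hout k (?D1 k) u) {..K} \<le> 3 * (1 / 2 ^ k) * ?U" by simp
    qed
    also have "\<dots> = 3 * (\<Sum>k\<le>K. 1 / 2 ^ k) * ?U" by (simp only: sum_distrib_left sum_distrib_right)
    also have "\<dots> \<le> 3 * 2 * ?U" by (intro mult_right_mono mult_left_mono sum_geometric_half) auto
    finally show "L2_set (\<lambda>l. \<Sum>k\<le>K. hout k (?D1 k) u l) {..K} \<le> 6 * ?U" by simp
    have "L2_set (\<lambda>l. \<Sum>k\<le>K. hout k (?D3 k) u l) {..K} \<le> (\<Sum>k\<le>K. L2_set (hout k (?D3 k) u) {..K})"
      by (rule L2_set_sum_le)
    also have "\<dots> \<le> (\<Sum>k\<le>K. 2 * (1 / 2 ^ k) * ?U)"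
    proof (rule sum_mono)
      fix k
      have "L2_set (hout k (?D3 k) u) {..K} \<le> 2 / 2 ^ k * L2_set u ({..K} \<inter> ?D3 k)" by (rule L2_hout_high)
      also have "\<dots> \<le> 2 / 2 ^ k * ?U" by (intro mult_left_mono L2_set_subset_le) auto
      finally show "L2_set (hout k (?D3 k) u) {..K} \<le> 2 * (1 / 2 ^ k) * ?U" by simp
    qed
    also have "\<dots> = 2 * (\<Sum>k\<le>K. 1 / 2 ^ k) * ?U" by (simp only: sum_distrib_left sum_distrib_right)
    also have "\<dots> \<le> 2 * 2 * ?U" by (intro mult_right_mono mult_left_mono sum_geometric_half) auto
    finally show "L2_set (\<lambda>l. \<Sum>k\<le>K. hout k (?D3 k) u l) {..K} \<le> 4 * ?U" by simp
  qed
  finally show ?thesis by simp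
qed

section \<open>Roots of unity\<close>

definition unity_root :: "nat \<Rightarrow> complex" where
  "unity_root M = cis (2 * pi / real M)"

lemma cmod_unity_root [simp]: "cmod (unity_root M) = 1"
  by (simp add: unity_root_def)

lemma unity_root_pow_cnj:
  "unity_root M ^ a * cnj (unity_root M) ^ b = cis (2 * pi * (real a - real b) / real M)"
proof -
  have "cnj (unity_root M) ^ b = cis (- (real b * (2 * pi / real M)))"
    unfolding unity_root_def cis_cnj using Complex.DeMoivre[of "- (2 * pi / real M)" b] by (simp only: mult_minus_right)
  moreover have "unity_root M ^ a = cis (real a * (2 * pi / real M))"
    unfolding unity_root_def Complex.DeMoivre ..
  ultimately show ?thesis
    by (simp only: cis_mult) (simp add: algebra_simps diff_divide_distrib)
qed

text \<open>
  Discrete orthogonality of characters, which stands in for integration over the circle.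
\<close>

lemma sum_unity_root:
  assumes "0 < M"
  shows "(\<Sum>j<M. (unity_root M ^ j) ^ a * cnj (unity_root M ^ j) ^ b) = (if a mod M = b mod M then of_nat M else 0)"
proof -
  define x where "x = unity_root M ^ a * cnj (unity_root M) ^ b"
  have trm: "(unity_root M ^ j) ^ a * cnj (unity_root M ^ j) ^ b = x ^ j" for j
    unfolding x_def by (simp add: power_mult_distrib mult.commute flip: power_mult)
  have x: "x = cis (2 * pi * (real a - real b) / real M)" unfolding x_def by (rule unity_root_pow_cnj)
  have xM: "x ^ M = 1"
  proof -
    have "x ^ M = cis (real M * (2 * pi * (real a - real b) / real M))"
      unfolding x by (rule Complex.DeMoivre)
    also have "real M * (2 * pi * (real a - real b) / real M) = 2 * pi * of_int (int a - int b)"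
      using assms by simp
    finally have "x ^ M = cis (2 * pi * of_int (int a - int b))" .
    then show ?thesis by (simp only: cis_multiple_2pi[OF Ints_of_int])
  qed
  have x1: "x = 1 \<longleftrightarrow> a mod M = b mod M"
  proof
    assume "x = 1"
    then have "cos (2 * pi * (real a - real b) / real M) = 1" unfolding x by (simp add: complex_eq_iff)
    then obtain n :: int where n: "2 * pi * (real a - real b) / real M = of_int n * 2 * pi"
      using cos_one_2pi_int by auto
    then have "2 * pi * (real a - real b) = of_int n * 2 * pi * real M" using assms by (simp add: divide_eq_eq)
    then have "(2 * pi) * (real a - real b) = (2 * pi) * (of_int n * real M)" by (simp only: mult_ac)
    then have "real a - real b = of_int n * real M" by (simp only: mult_cancel_left) simp
    then have "of_int (int a - int b) = (of_int (n * int M) :: real)" by simp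
    then have "int a - int b = n * int M" by (simp only: of_int_eq_iff)
    then have "int M dvd int a - int b" by simp
    then show "a mod M = b mod M"
      by (metis mod_eq_dvd_iff of_nat_eq_iff of_nat_mod)
  next
    assume "a mod M = b mod M"
    then have "int M dvd int a - int b" by (metis mod_eq_dvd_iff of_nat_mod)
    then obtain n where "int a - int b = int M * n" by (elim dvdE)
    then have "of_int (int a - int b) = (of_int (int M * n) :: real)" by simp
    then have "real a - real b = real M * of_int n" by simp
    then have "2 * pi * (real a - real b) / real M = 2 * pi * of_int n" using assms by simp
    then have "x = cis (2 * pi * of_int n)" unfolding x by (rule arg_cong)
    then show "x = 1" by (simp only: cis_multiple_2pi[OF Ints_of_int])
  qed
  show ?thesis
  proof (cases "x = 1")
    case True
    then show ?thesis unfolding trm using x1 by simp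
  next
    case False
    then show ?thesis unfolding trm using x1 geometric_sum[OF False, of M] xM by simp
  qed
qed

section \<open>Triangularization\<close>

text \<open>
  The coordinate flag of a Schur form, transported back by the similarity.
\<close>

lemma spectral_flag:
  fixes A :: "complex Matrix.mat"
  assumes A: "A \<in> carrier_mat n n"
  obtains V :: "nat \<Rightarrow> complex Matrix.vec set" and e :: "nat \<Rightarrow> complex"
  where "\<And>k. k < n \<Longrightarrow> eigenvalue A (e k)" "V 0 = {0\<^sub>v n}" "V n = carrier_vec n"
    "\<And>k. V k \<subseteq> carrier_vec n"
    "\<And>k v. k < n \<Longrightarrow> v \<in> V (Suc k) \<Longrightarrow> A *\<^sub>v v - e k \<cdot>\<^sub>v v \<in> V k"
proof -
  obtain es where es: "char_poly A = (\<Prod>a\<leftarrow>es. [:- a, 1:])"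
    using char_poly_factorized[OF A] by blast
  obtain B P Q where BPQ: "schur_decomposition A es = (B, P, Q)" by (cases "schur_decomposition A es") auto
  have wit: "similar_mat_wit A B P Q" and tri: "upper_triangular B" and diag: "diag_mat B = es"
    using schur_decomposition[OF A es BPQ] by auto
  note W = similar_mat_witD2[OF A wit]
  have QA: "Q * A = B * Q"
  proof -
    have "Q * A = Q * (P * B * Q)" using W by simp
    also have "P * B * Q = P * (B * Q)" using W by (intro assoc_mult_mat[of _ n n _ n _ n]) auto
    also have "Q * (P * (B * Q)) = Q * P * (B * Q)"
      using W by (intro assoc_mult_mat[symmetric, of _ n n _ n _ n]) auto
    finally show ?thesis using W by simp
  qed
  define e where "e k = B $$ (k, k)" for k
  define V where "V k = {v \<in> carrier_vec n. \<forall>i<n. k \<le> i \<longrightarrow> vec_index (Q *\<^sub>v v) i = 0}" for k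
  show ?thesis
  proof
    fix k assume k: "k < n"
    have "e k \<in> set es" unfolding diag[symmetric] e_def diag_mat_def using k W by auto
    then have "poly (char_poly A) (e k) = 0" unfolding es poly_prod_list prod_list_zero_iff by force
    then show "eigenvalue A (e k)" using eigenvalue_root_char_poly[OF A] by simp
  next
    show "V 0 = {0\<^sub>v n}"
    proof (intro equalityI subsetI)
      fix v :: "complex Matrix.vec" assume "v \<in> V 0"
      then have v: "v \<in> carrier_vec n" "\<forall>i<n. vec_index (Q *\<^sub>v v) i = 0" by (auto simp: V_def)
      have "Q *\<^sub>v v = 0\<^sub>v n" using v W by (intro eq_vecI) auto
      then have "P *\<^sub>v (Q *\<^sub>v v) = 0\<^sub>v n" using W by auto
      moreover have "P *\<^sub>v (Q *\<^sub>v v) = v"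
        using assoc_mult_mat_vec[OF W(6) W(7) v(1)] W v by simp
      ultimately show "v \<in> {0\<^sub>v n}" by simp
    next
      fix v :: "complex Matrix.vec" assume "v \<in> {0\<^sub>v n}"
      moreover have "Q *\<^sub>v 0\<^sub>v n = 0\<^sub>v n" using W by auto
      ultimately show "v \<in> V 0" by (auto simp: V_def)
    qed
    show "V n = carrier_vec n" by (auto simp: V_def)
    show "V k \<subseteq> carrier_vec n" for k by (auto simp: V_def)
  next
    fix k v assume k: "k < n" and "v \<in> V (Suc k)"
    then have v: "v \<in> carrier_vec n" and z: "\<And>i. i < n \<Longrightarrow> Suc k \<le> i \<Longrightarrow> vec_index (Q *\<^sub>v v) i = 0"
      by (auto simp: V_def)
    define u where "u = Q *\<^sub>v v"
    have u: "u \<in> carrier_vec n" unfolding u_def using W v by (intro mult_mat_vec_carrier) auto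
    have c: "A *\<^sub>v v - e k \<cdot>\<^sub>v v \<in> carrier_vec n"
      using mult_mat_vec_carrier[OF A v] v by auto
    have "Q *\<^sub>v (A *\<^sub>v v - e k \<cdot>\<^sub>v v) = Q *\<^sub>v (A *\<^sub>v v) - Q *\<^sub>v (e k \<cdot>\<^sub>v v)"
      by (rule mult_minus_distrib_mat_vec[OF W(7) mult_mat_vec_carrier[OF A v]]) (use v in simp)
    also have "Q *\<^sub>v (A *\<^sub>v v) = (Q * A) *\<^sub>v v" by (rule assoc_mult_mat_vec[OF W(7) A v, symmetric])
    also have "\<dots> = B *\<^sub>v u" unfolding QA u_def by (rule assoc_mult_mat_vec[OF W(5) W(7) v])
    also have "Q *\<^sub>v (e k \<cdot>\<^sub>v v) = e k \<cdot>\<^sub>v u" unfolding u_def by (rule mult_mat_vec[OF W(7) v])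
    finally have eq: "Q *\<^sub>v (A *\<^sub>v v - e k \<cdot>\<^sub>v v) = B *\<^sub>v u - e k \<cdot>\<^sub>v u" .
    have "vec_index (B *\<^sub>v u - e k \<cdot>\<^sub>v u) i = 0" if i: "i < n" "k \<le> i" for i
    proof -
      have "vec_index (B *\<^sub>v u) i = (\<Sum>j<n. B $$ (i, j) * vec_index u j)"
        by (rule mult_mat_vec_index[OF W(5) u i(1)])
      also have "\<dots> = (\<Sum>j<n. if j = i then e k * vec_index u i else 0)"
      proof (rule sum.cong[OF refl])
        fix j assume j: "j \<in> {..<n}"
        consider "j < i" | "j = i" | "i < j" by linarith
        then show "B $$ (i, j) * vec_index u j = (if j = i then e k * vec_index u i else 0)"
        proof cases
          case 1
          then show ?thesis using tri W i by (auto simp: upper_triangular_def)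
        next
          case 2
          then show ?thesis using z[of i] i by (cases "i = k") (auto simp: e_def u_def simp del: index_mult_mat_vec)
        next
          case 3
          then show ?thesis using z[of j] i j unfolding u_def by (auto simp del: index_mult_mat_vec)
        qed
      qed
      also have "\<dots> = e k * vec_index u i" using i by simp
      finally show ?thesis using u W i by (auto simp del: index_mult_mat_vec)
    qed
    then show "A *\<^sub>v v - e k \<cdot>\<^sub>v v \<in> V k" using c eq by (auto simp: V_def simp del: index_mult_mat_vec)
  qed
qed

text \<open>
  Take an eigenvector of \<open>A\<close> as low as possible in a flag of \<open>B\<close>. The map \<open>B - e k\<close> preserves the
  eigenspace of \<open>A\<close> and lowers the position in the flag, so it annihilates that vector.
\<close>

lemma common_eigenvector:
  fixes A B :: "complex Matrix.mat"
  assumes A: "A \<in> carrier_mat n n" and B: "B \<in> carrier_mat n n" and AB: "A * B = B * A"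
    and ev: "eigenvalue A \<alpha>"
  obtains v \<beta> where "v \<in> carrier_vec n" "v \<noteq> 0\<^sub>v n" "A *\<^sub>v v = \<alpha> \<cdot>\<^sub>v v" "B *\<^sub>v v = \<beta> \<cdot>\<^sub>v v" "eigenvalue B \<beta>"
proof -
  obtain V e where V: "\<And>k. k < n \<Longrightarrow> eigenvalue B (e k)" "V 0 = {0\<^sub>v n}" "V n = carrier_vec n"
    "\<And>k. V k \<subseteq> carrier_vec n"
    "\<And>k v. k < n \<Longrightarrow> v \<in> V (Suc k) \<Longrightarrow> B *\<^sub>v v - e k \<cdot>\<^sub>v v \<in> V k"
    by (rule spectral_flag[OF B]) blast
  have *: "\<exists>v \<beta>. v \<in> carrier_vec n \<and> v \<noteq> 0\<^sub>v n \<and> A *\<^sub>v v = \<alpha> \<cdot>\<^sub>v v \<and> B *\<^sub>v v = \<beta> \<cdot>\<^sub>v v \<and> eigenvalue B \<beta>"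
    if "k \<le> n" "u \<in> V k" "u \<noteq> 0\<^sub>v n" "A *\<^sub>v u = \<alpha> \<cdot>\<^sub>v u" for k u
    using that
  proof (induction k arbitrary: u)
    case 0
    then show ?case using V by simp
  next
    case (Suc k)
    have u: "u \<in> carrier_vec n" using Suc V by blast
    define w where "w = B *\<^sub>v u - e k \<cdot>\<^sub>v u"
    have w: "w \<in> V k" unfolding w_def using Suc by (intro V) auto
    show ?case
    proof (cases "w = 0\<^sub>v n")
      case True
      have Bu: "B *\<^sub>v u \<in> carrier_vec n" using B u by auto
      have "B *\<^sub>v u = e k \<cdot>\<^sub>v u"
      proof (rule eq_vecI)
        fix i assume "i < dim_vec (e k \<cdot>\<^sub>v u)"
        then have i: "i < n" using u by simp
        have "vec_index w i = 0" using True i by simp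
        then show "vec_index (B *\<^sub>v u) i = vec_index (e k \<cdot>\<^sub>v u) i"
          unfolding w_def using i u Bu by (auto simp del: index_mult_mat_vec)
      qed (use u B in auto)
      then show ?thesis using Suc u V(1)[of k] by auto
    next
      case False
      have "A *\<^sub>v w = A *\<^sub>v (B *\<^sub>v u) - A *\<^sub>v (e k \<cdot>\<^sub>v u)"
        unfolding w_def using A B u by (intro mult_minus_distrib_mat_vec) auto
      also have "A *\<^sub>v (B *\<^sub>v u) = (B * A) *\<^sub>v u" using A B u AB assoc_mult_mat_vec[OF A B u] by simp
      also have "\<dots> = B *\<^sub>v (\<alpha> \<cdot>\<^sub>v u)" using A B u Suc by simp
      also have "\<dots> = \<alpha> \<cdot>\<^sub>v (B *\<^sub>v u)" by (rule mult_mat_vec[OF B u])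
      also have "A *\<^sub>v (e k \<cdot>\<^sub>v u) = e k \<cdot>\<^sub>v (\<alpha> \<cdot>\<^sub>v u)" using mult_mat_vec[OF A u] Suc by simp
      also have "\<alpha> \<cdot>\<^sub>v (B *\<^sub>v u) - e k \<cdot>\<^sub>v (\<alpha> \<cdot>\<^sub>v u) = \<alpha> \<cdot>\<^sub>v w"
        unfolding w_def using B u by (intro eq_vecI) (auto simp: algebra_simps simp del: index_mult_mat_vec)
      finally have "A *\<^sub>v w = \<alpha> \<cdot>\<^sub>v w" .
      then show ?thesis using Suc.IH[OF _ w False] Suc.prems by simp
    qed
  qed
  obtain u where "eigenvector A u \<alpha>" using ev by (auto simp: eigenvalue_def)
  then have "u \<in> V n" "u \<noteq> 0\<^sub>v n" "A *\<^sub>v u = \<alpha> \<cdot>\<^sub>v u" using A V by (auto simp: eigenvector_def)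
  then show ?thesis using *[of n u] that by blast
qed

lemma pow_mat_vec:
  assumes A: "A \<in> carrier_mat n n" and v: "v \<in> carrier_vec n"
  shows "(A ^\<^sub>m k) *\<^sub>v v = ((\<lambda>v. A *\<^sub>v v) ^^ k) v"
  using v
proof (induction k arbitrary: v)
  case 0
  then show ?case using A by simp
next
  case (Suc k)
  have "(A ^\<^sub>m Suc k) *\<^sub>v v = (A ^\<^sub>m k) *\<^sub>v (A *\<^sub>v v)"
    using A Suc.prems by (simp add: assoc_mult_mat_vec[OF pow_carrier_mat[OF A] A])
  also have "\<dots> = ((\<lambda>v. A *\<^sub>v v) ^^ k) (A *\<^sub>v v)" using A Suc by auto
  finally show ?case by (simp only: funpow_Suc_right o_def)
qed

lemma funpow_mat_carrier:
  assumes A: "A \<in> carrier_mat n n" and v: "v \<in> carrier_vec n"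
  shows "((\<lambda>v. A *\<^sub>v v) ^^ k) v \<in> carrier_vec n"
  using A v by (induction k) auto

text \<open>
  The powers of a contraction whose spectrum lies in a disc of radius \<open>r\<close> decay like \<open>r\<^sup>m\<close> up to a
  factor polynomial in \<open>m\<close> of degree the size of the matrix. The induction runs up the flag: on each
  step the operator is a scalar of modulus at most \<open>r\<close> plus a map into the previous subspace.
\<close>

lemma contraction_power_bound:
  fixes A :: "complex Matrix.mat"
  assumes A: "A \<in> carrier_mat n n" and r: "0 < r" "r \<le> 1"
    and contr: "\<And>v. v \<in> carrier_vec n \<Longrightarrow> cvec_norm (A *\<^sub>v v) \<le> cvec_norm v"
    and ev: "\<And>\<alpha>. eigenvalue A \<alpha> \<Longrightarrow> cmod \<alpha> \<le> r"
    and v: "v \<in> carrier_vec n"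
  shows "r ^ n * cvec_norm (((\<lambda>v. A *\<^sub>v v) ^^ m) v) \<le> (2 * real m + 1) ^ n * r ^ m * cvec_norm v"
proof -
  obtain V e where V: "\<And>k. k < n \<Longrightarrow> eigenvalue A (e k)" "V 0 = {0\<^sub>v n}" "V n = carrier_vec n"
    "\<And>k. V k \<subseteq> carrier_vec n"
    "\<And>k v. k < n \<Longrightarrow> v \<in> V (Suc k) \<Longrightarrow> A *\<^sub>v v - e k \<cdot>\<^sub>v v \<in> V k"
    by (rule spectral_flag[OF A]) blast
  let ?f = "\<lambda>v. A *\<^sub>v v"
  note carr = funpow_mat_carrier[OF A]
  have "r ^ k * cvec_norm ((?f ^^ m) v) \<le> (2 * real m + 1) ^ k * r ^ m * cvec_norm v"
    if "k \<le> n" "v \<in> V k" for k m v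
    using that
  proof (induction k arbitrary: m v)
    case 0
    have A0: "A *\<^sub>v 0\<^sub>v n = 0\<^sub>v n" using A by auto
    have "v = 0\<^sub>v n" using 0 V by simp
    moreover have "(?f ^^ m) (0\<^sub>v n) = 0\<^sub>v n" by (induction m) (auto simp: A0)
    ultimately show ?case by simp
  next
    case (Suc k)
    define w where "w = A *\<^sub>v v - e k \<cdot>\<^sub>v v"
    have v: "v \<in> carrier_vec n" using Suc V by blast
    have wV: "w \<in> V k" unfolding w_def using Suc by (intro V) auto
    then have w: "w \<in> carrier_vec n" using V by blast
    have ek: "cmod (e k) \<le> r" using Suc by (intro ev V) auto
    have wn: "cvec_norm w \<le> 2 * cvec_norm v"
    proof -
      have "cvec_norm w \<le> cvec_norm (A *\<^sub>v v) + cvec_norm (e k \<cdot>\<^sub>v v)"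
        unfolding w_def using A v by (intro cvec_norm_triangle_minus[of _ n]) auto
      also have "\<dots> \<le> 1 * cvec_norm v + 1 * cvec_norm v"
        unfolding cvec_norm_smult using contr[OF v] ek r by (intro add_mono mult_right_mono) auto
      finally show ?thesis by simp
    qed
    have step: "cvec_norm ((?f ^^ Suc m) v) \<le> r * cvec_norm ((?f ^^ m) v) + cvec_norm ((?f ^^ m) w)" for m
    proof -
      have Av: "A *\<^sub>v v = w + e k \<cdot>\<^sub>v v"
        unfolding w_def using A v by (intro eq_vecI) (auto simp del: index_mult_mat_vec)
      have "(?f ^^ Suc m) v = (?f ^^ m) (A *\<^sub>v v)" by (simp only: funpow_Suc_right o_def)
      also have "\<dots> = (A ^\<^sub>m m) *\<^sub>v (w + e k \<cdot>\<^sub>v v)"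
        unfolding Av using A v w by (intro pow_mat_vec[symmetric]) auto
      also have "\<dots> = (A ^\<^sub>m m) *\<^sub>v w + (A ^\<^sub>m m) *\<^sub>v (e k \<cdot>\<^sub>v v)"
        using A v w by (intro mult_add_distrib_mat_vec[of _ n n]) auto
      also have "\<dots> = (?f ^^ m) w + e k \<cdot>\<^sub>v (?f ^^ m) v"
        using mult_mat_vec[OF pow_carrier_mat[OF A] v] by (simp add: pow_mat_vec[OF A v] pow_mat_vec[OF A w])
      finally have eq: "(?f ^^ Suc m) v = (?f ^^ m) w + e k \<cdot>\<^sub>v (?f ^^ m) v" .
      have "cvec_norm ((?f ^^ Suc m) v) \<le> cvec_norm ((?f ^^ m) w) + cvec_norm (e k \<cdot>\<^sub>v (?f ^^ m) v)"
        unfolding eq using carr[OF w] carr[OF v] by (intro cvec_norm_triangle[of _ n]) auto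
      also have "\<dots> \<le> cvec_norm ((?f ^^ m) w) + r * cvec_norm ((?f ^^ m) v)"
        unfolding cvec_norm_smult using ek by (intro add_left_mono mult_right_mono) auto
      finally show ?thesis by simp
    qed
    note outer_IH = Suc.IH
    show ?case
    proof (induction m)
      case 0
      have "r ^ Suc k * cvec_norm v \<le> 1 * cvec_norm v"
        using r by (intro mult_right_mono power_le_one) auto
      then show ?case by simp
    next
      case (Suc m)
      let ?x = "2 * real m + 1"
      have IHw: "r ^ k * cvec_norm ((?f ^^ m) w) \<le> ?x ^ k * r ^ m * cvec_norm w"
        using \<open>Suc k \<le> n\<close> wV by (intro outer_IH) auto
      have "r ^ Suc k * cvec_norm ((?f ^^ Suc m) v) \<le> r ^ Suc k * (r * cvec_norm ((?f ^^ m) v) + cvec_norm ((?f ^^ m) w))"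
        using r by (intro mult_left_mono step) auto
      also have "\<dots> = r * (r ^ Suc k * cvec_norm ((?f ^^ m) v)) + r * (r ^ k * cvec_norm ((?f ^^ m) w))"
        by (simp add: algebra_simps)
      also have "\<dots> \<le> r * (?x ^ Suc k * r ^ m * cvec_norm v) + r * (?x ^ k * r ^ m * (2 * cvec_norm v))"
      proof (intro add_mono mult_left_mono)
        show "r ^ Suc k * cvec_norm ((?f ^^ m) v) \<le> ?x ^ Suc k * r ^ m * cvec_norm v" by (rule Suc)
        have "?x ^ k * r ^ m * cvec_norm w \<le> ?x ^ k * r ^ m * (2 * cvec_norm v)"
          using r by (intro mult_left_mono wn) auto
        then show "r ^ k * cvec_norm ((?f ^^ m) w) \<le> ?x ^ k * r ^ m * (2 * cvec_norm v)" using IHw by linarith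
      qed (use r in auto)
      also have "\<dots> = (?x ^ k * (?x + 2)) * (r ^ Suc m * cvec_norm v)" by (simp add: algebra_simps)
      also have "\<dots> \<le> ((?x + 2) ^ k * (?x + 2)) * (r ^ Suc m * cvec_norm v)"
        using r by (intro mult_right_mono power_mono) auto
      also have "\<dots> = (2 * real (Suc m) + 1) ^ Suc k * r ^ Suc m * cvec_norm v"
        by (simp add: algebra_simps)
      finally show ?case .
    qed
  qed
  from this[of n v m] show ?thesis using V v by simp
qed

section \<open>Powers of a product of two commuting matrices\<close>

text \<open>
  Parseval's identity for a polynomial of degree less than the number of roots of unity.
\<close>

lemma sum_norm_sq_unity_root:
  assumes "m < M"
  shows "(\<Sum>j<M. (cmod (\<Sum>i\<le>m. c i * (unity_root M ^ j) ^ i))\<^sup>2) = real M * (\<Sum>i\<le>m. (cmod (c i))\<^sup>2)"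
proof -
  let ?z = "\<lambda>j. unity_root M ^ j"
  have "complex_of_real (\<Sum>j<M. (cmod (\<Sum>i\<le>m. c i * ?z j ^ i))\<^sup>2) =
      (\<Sum>j<M. (\<Sum>i\<le>m. c i * ?z j ^ i) * cnj (\<Sum>k\<le>m. c k * ?z j ^ k))"
    unfolding of_real_sum by (simp only: complex_norm_square)
  also have "\<dots> = (\<Sum>j<M. \<Sum>i\<le>m. \<Sum>k\<le>m. c i * cnj (c k) * (?z j ^ i * cnj (?z j) ^ k))"
    by (simp add: sum_product mult_ac)
  also have "\<dots> = (\<Sum>i\<le>m. \<Sum>j<M. \<Sum>k\<le>m. c i * cnj (c k) * (?z j ^ i * cnj (?z j) ^ k))"
    by (rule sum.swap)
  also have "\<dots> = (\<Sum>i\<le>m. \<Sum>k\<le>m. \<Sum>j<M. c i * cnj (c k) * (?z j ^ i * cnj (?z j) ^ k))"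
    by (intro sum.cong[OF refl] sum.swap)
  also have "\<dots> = (\<Sum>i\<le>m. \<Sum>k\<le>m. c i * cnj (c k) * (if i mod M = k mod M then of_nat M else 0))"
    using assms by (simp only: sum_distrib_left[symmetric] sum_unity_root)
  also have "\<dots> = (\<Sum>i\<le>m. \<Sum>k\<le>m. if k = i then c i * cnj (c i) * of_nat M else 0)"
    using assms by (intro sum.cong refl) auto
  also have "\<dots> = (\<Sum>i\<le>m. c i * cnj (c i) * of_nat M)" by simp
  also have "\<dots> = complex_of_real (real M * (\<Sum>i\<le>m. (cmod (c i))\<^sup>2))"
    by (simp only: of_real_mult of_real_sum of_real_of_nat_eq complex_norm_square sum_distrib_left mult_ac)
  finally show ?thesis by (simp only: of_real_eq_iff)
qed

text \<open>
  By Parseval applied to \<open>(b + \<zeta> m)\<^bsup>2q\<^esup>\<close>, the mean of the \<open>4q\<close>-th power is a sum of squared binomial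
  coefficients times \<open>|b|\<^bsup>2i\<^esup> |m|\<^bsup>2(2q-i)\<^esup>\<close>. Bounding one of the two factors by the central binomial coefficient
  leaves \<open>(|b|\<^sup>2 + |m|\<^sup>2)\<^bsup>2q\<^esup>\<close>.
\<close>

lemma sum_pencil_moment_le:
  assumes "2 * q < M" and bm: "(cmod b)\<^sup>2 + (cmod m)\<^sup>2 \<le> 1"
  shows "(\<Sum>j<M. (cmod (b + unity_root M ^ j * m) / sqrt 2) ^ (4 * q)) \<le> real M / omg q"
proof -
  define c where "c i = of_nat (2 * q choose i) * m ^ i * b ^ (2 * q - i)" for i
  have "(cmod (b + unity_root M ^ j * m) / sqrt 2) ^ (4 * q) = (cmod (\<Sum>i\<le>2 * q. c i * (unity_root M ^ j) ^ i))\<^sup>2 / 4 ^ q" for j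
  proof -
    have "(\<Sum>i\<le>2 * q. c i * (unity_root M ^ j) ^ i) = (unity_root M ^ j * m + b) ^ (2 * q)"
      unfolding binomial_ring c_def by (intro sum.cong refl) (simp add: power_mult_distrib mult_ac)
    then have 1: "(cmod (\<Sum>i\<le>2 * q. c i * (unity_root M ^ j) ^ i))\<^sup>2 = cmod (b + unity_root M ^ j * m) ^ (4 * q)"
      by (simp add: norm_power add.commute flip: power_mult)
    have "sqrt 2 ^ (4 * q) = ((sqrt 2)\<^sup>2) ^ (2 * q)" by (simp only: power_mult[symmetric]) simp
    also have "\<dots> = 4 ^ q" by (simp add: power_mult)
    finally show ?thesis unfolding 1 power_divide by simp
  qed
  then have "(\<Sum>j<M. (cmod (b + unity_root M ^ j * m) / sqrt 2) ^ (4 * q)) =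
      (\<Sum>j<M. (cmod (\<Sum>i\<le>2 * q. c i * (unity_root M ^ j) ^ i))\<^sup>2) / 4 ^ q"
    by (simp add: sum_divide_distrib)
  also have "\<dots> = real M * (\<Sum>i\<le>2 * q. (cmod (c i))\<^sup>2) / 4 ^ q"
    using sum_norm_sq_unity_root[OF assms(1)] by simp
  also have "(\<Sum>i\<le>2 * q. (cmod (c i))\<^sup>2) \<le> (\<Sum>i\<le>2 * q. real (2 * q choose q) * (real (2 * q choose i) * ((cmod m)\<^sup>2) ^ i * ((cmod b)\<^sup>2) ^ (2 * q - i)))"
  proof (rule sum_mono)
    fix i
    have "(cmod (c i))\<^sup>2 = real (2 * q choose i) * (real (2 * q choose i) * ((cmod m)\<^sup>2) ^ i * ((cmod b)\<^sup>2) ^ (2 * q - i))"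
      unfolding c_def norm_mult norm_power norm_of_nat power_mult_distrib
      by (simp add: power2_eq_square[of "real _"] mult_ac flip: power_mult)
    also have "\<dots> \<le> real (2 * q choose q) * (real (2 * q choose i) * ((cmod m)\<^sup>2) ^ i * ((cmod b)\<^sup>2) ^ (2 * q - i))"
      using binomial_maximum'[of q i] by (intro mult_right_mono) auto
    finally show "(cmod (c i))\<^sup>2 \<le> \<dots>" .
  qed
  also have "\<dots> = real (2 * q choose q) * ((cmod m)\<^sup>2 + (cmod b)\<^sup>2) ^ (2 * q)"
    by (simp add: binomial_ring sum_distrib_left)
  also have "\<dots> \<le> real (2 * q choose q) * 1"
    using bm by (intro mult_left_mono power_le_one) (auto simp: add.commute)
  finally have "(\<Sum>j<M. (cmod (b + unity_root M ^ j * m) / sqrt 2) ^ (4 * q)) \<le> real M * real (2 * q choose q) / 4 ^ q"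
    by (simp add: mult_left_mono divide_right_mono)
  also have "\<dots> = real M / omg q"
    unfolding omg_binomial[of q, symmetric] by (simp add: field_simps)
  finally show ?thesis .
qed

lemma pascal_sum:
  fixes e :: "nat \<Rightarrow> nat \<Rightarrow> complex"
  shows "(\<Sum>i\<le>Suc m. of_nat (Suc m choose i) * z ^ (Suc m - i) * e i (Suc m - i)) =
    (\<Sum>i\<le>m. of_nat (m choose i) * z ^ (m - i) * e (Suc i) (m - i)) +
    z * (\<Sum>i\<le>m. of_nat (m choose i) * z ^ (m - i) * e i (Suc (m - i)))"
proof -
  have "z * (\<Sum>i\<le>m. of_nat (m choose i) * z ^ (m - i) * e i (Suc (m - i))) =
      (\<Sum>i\<le>m. of_nat (m choose i) * z ^ (Suc m - i) * e i (Suc m - i))"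
    unfolding sum_distrib_left by (intro sum.cong refl) (simp add: Suc_diff_le mult_ac)
  also have "\<dots> = (\<Sum>i\<le>Suc m. of_nat (m choose i) * z ^ (Suc m - i) * e i (Suc m - i))" by simp
  also have "\<dots> = z ^ Suc m * e 0 (Suc m) + (\<Sum>i\<le>m. of_nat (m choose Suc i) * z ^ (m - i) * e (Suc i) (m - i))"
    by (simp add: sum.atMost_Suc_shift del: sum.atMost_Suc)
  finally show ?thesis
    by (simp add: sum.atMost_Suc_shift ring_distribs sum.distrib del: sum.atMost_Suc)
qed

lemma funpow_mat_commute:
  fixes A :: "complex Matrix.mat"
  assumes A: "A \<in> carrier_mat n n" and B: "B \<in> carrier_mat n n" and AB: "A * B = B * A"
    and v: "v \<in> carrier_vec n"
  shows "((\<lambda>v. A *\<^sub>v v) ^^ k) (B *\<^sub>v v) = B *\<^sub>v ((\<lambda>v. A *\<^sub>v v) ^^ k) v"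
proof (induction k)
  case (Suc k)
  let ?w = "((\<lambda>v. A *\<^sub>v v) ^^ k) v"
  have w: "?w \<in> carrier_vec n" by (rule funpow_mat_carrier[OF A v])
  have "((\<lambda>v. A *\<^sub>v v) ^^ Suc k) (B *\<^sub>v v) = A *\<^sub>v (B *\<^sub>v ?w)" using Suc by simp
  also have "\<dots> = B *\<^sub>v (A *\<^sub>v ?w)"
    using assoc_mult_mat_vec[OF A B w] assoc_mult_mat_vec[OF B A w] AB by simp
  finally show ?case by simp
qed simp

lemma funpow_mat_smult:
  fixes A :: "complex Matrix.mat"
  assumes A: "A \<in> carrier_mat n n" and v: "v \<in> carrier_vec n"
  shows "((\<lambda>v. A *\<^sub>v v) ^^ k) (c \<cdot>\<^sub>v v) = c \<cdot>\<^sub>v ((\<lambda>v. A *\<^sub>v v) ^^ k) v"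
  by (induction k) (simp_all add: mult_mat_vec[OF A funpow_mat_carrier[OF A v]])

lemma funpow_mat_add:
  fixes A :: "complex Matrix.mat"
  assumes A: "A \<in> carrier_mat n n" and v: "v \<in> carrier_vec n" and w: "w \<in> carrier_vec n"
  shows "((\<lambda>v. A *\<^sub>v v) ^^ k) (v + w) = ((\<lambda>v. A *\<^sub>v v) ^^ k) v + ((\<lambda>v. A *\<^sub>v v) ^^ k) w"
  by (induction k) (simp_all add: mult_add_distrib_mat_vec[OF A funpow_mat_carrier[OF A v] funpow_mat_carrier[OF A w]])

lemma funpow_smult_mat:
  fixes A :: "complex Matrix.mat"
  assumes A: "A \<in> carrier_mat n n" and v: "v \<in> carrier_vec n"
  shows "((\<lambda>v. (c \<cdot>\<^sub>m A) *\<^sub>v v) ^^ k) v = c ^ k \<cdot>\<^sub>v ((\<lambda>v. A *\<^sub>v v) ^^ k) v"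
proof (induction k)
  case (Suc k)
  let ?w = "((\<lambda>v. A *\<^sub>v v) ^^ k) v"
  have w: "?w \<in> carrier_vec n" by (rule funpow_mat_carrier[OF A v])
  have "((\<lambda>v. (c \<cdot>\<^sub>m A) *\<^sub>v v) ^^ Suc k) v = (c \<cdot>\<^sub>m A) *\<^sub>v (c ^ k \<cdot>\<^sub>v ?w)" using Suc by simp
  also have "\<dots> = c \<cdot>\<^sub>v (A *\<^sub>v (c ^ k \<cdot>\<^sub>v ?w))" using A w by auto
  also have "\<dots> = c \<cdot>\<^sub>v (c ^ k \<cdot>\<^sub>v (A *\<^sub>v ?w))" by (simp only: mult_mat_vec[OF A w])
  finally show ?case by (simp add: smult_smult_assoc)
qed simp

lemma pencil_power_index:
  fixes Y1 Y2 :: "complex Matrix.mat"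
  assumes Y1: "Y1 \<in> carrier_mat n n" and Y2: "Y2 \<in> carrier_mat n n" and comm: "Y1 * Y2 = Y2 * Y1"
    and v: "v \<in> carrier_vec n" and p: "p < n"
  shows "vec_index (((\<lambda>v. (Y1 + z \<cdot>\<^sub>m Y2) *\<^sub>v v) ^^ m) v) p =
    (\<Sum>i\<le>m. of_nat (m choose i) * z ^ (m - i) *
      vec_index (((\<lambda>v. Y1 *\<^sub>v v) ^^ i) (((\<lambda>v. Y2 *\<^sub>v v) ^^ (m - i)) v)) p)"
  using v
proof (induction m arbitrary: v)
  case 0
  then show ?case by simp
next
  case (Suc m)
  let ?y1 = "\<lambda>v. Y1 *\<^sub>v v" and ?y2 = "\<lambda>v. Y2 *\<^sub>v v" and ?Z = "Y1 + z \<cdot>\<^sub>m Y2"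
  note v = Suc.prems
  have Z: "?Z \<in> carrier_mat n n" using Y1 Y2 by simp
  have c: "Y1 *\<^sub>v v \<in> carrier_vec n" "Y2 *\<^sub>v v \<in> carrier_vec n" using Y1 Y2 v by auto
  have "?Z *\<^sub>v v = Y1 *\<^sub>v v + (z \<cdot>\<^sub>m Y2) *\<^sub>v v"
    using Y1 Y2 v by (intro add_mult_distrib_mat_vec[of _ n n]) auto
  also have "(z \<cdot>\<^sub>m Y2) *\<^sub>v v = z \<cdot>\<^sub>v (Y2 *\<^sub>v v)" using Y2 v by auto
  finally have Zv: "?Z *\<^sub>v v = Y1 *\<^sub>v v + z \<cdot>\<^sub>v (Y2 *\<^sub>v v)" .
  have "((\<lambda>v. ?Z *\<^sub>v v) ^^ Suc m) v = ((\<lambda>v. ?Z *\<^sub>v v) ^^ m) (Y1 *\<^sub>v v + z \<cdot>\<^sub>v (Y2 *\<^sub>v v))"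
    by (simp only: funpow_Suc_right o_def Zv)
  also have "\<dots> = ((\<lambda>v. ?Z *\<^sub>v v) ^^ m) (Y1 *\<^sub>v v) + z \<cdot>\<^sub>v ((\<lambda>v. ?Z *\<^sub>v v) ^^ m) (Y2 *\<^sub>v v)"
    using funpow_mat_add[OF Z c(1) iffD2[OF smult_carrier_vec c(2)]] funpow_mat_smult[OF Z c(2)] by simp
  finally have "vec_index (((\<lambda>v. ?Z *\<^sub>v v) ^^ Suc m) v) p =
      vec_index (((\<lambda>v. ?Z *\<^sub>v v) ^^ m) (Y1 *\<^sub>v v)) p + z * vec_index (((\<lambda>v. ?Z *\<^sub>v v) ^^ m) (Y2 *\<^sub>v v)) p"
    using funpow_mat_carrier[OF Z c(1), of m] funpow_mat_carrier[OF Z c(2), of m] p by auto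
  also have "\<dots> = (\<Sum>i\<le>m. of_nat (m choose i) * z ^ (m - i) * vec_index ((?y1 ^^ Suc i) ((?y2 ^^ (m - i)) v)) p) +
      z * (\<Sum>i\<le>m. of_nat (m choose i) * z ^ (m - i) * vec_index ((?y1 ^^ i) ((?y2 ^^ Suc (m - i)) v)) p)"
  proof -
    have 1: "(?y1 ^^ i) ((?y2 ^^ k) (Y1 *\<^sub>v v)) = (?y1 ^^ Suc i) ((?y2 ^^ k) v)" for i k
      unfolding funpow_mat_commute[OF Y2 Y1 comm[symmetric] v] funpow_Suc_right o_def ..
    have 2: "(?y2 ^^ k) (Y2 *\<^sub>v v) = (?y2 ^^ Suc k) v" for k
      unfolding funpow_Suc_right o_def ..
    show ?thesis unfolding Suc.IH[OF c(1)] Suc.IH[OF c(2)] 1 2 ..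
  qed
  also have "\<dots> = (\<Sum>i\<le>Suc m. of_nat (Suc m choose i) * z ^ (Suc m - i) *
      vec_index ((?y1 ^^ i) ((?y2 ^^ (Suc m - i)) v)) p)"
    by (rule pascal_sum[symmetric, where e = "\<lambda>i k. vec_index ((?y1 ^^ i) ((?y2 ^^ k) v)) p"])
  finally show ?case .
qed

lemma funpow_product:
  fixes Y1 Y2 :: "complex Matrix.mat"
  assumes Y1: "Y1 \<in> carrier_mat n n" and Y2: "Y2 \<in> carrier_mat n n" and comm: "Y1 * Y2 = Y2 * Y1"
    and v: "v \<in> carrier_vec n"
  shows "((\<lambda>v. 2 \<cdot>\<^sub>v (Y1 *\<^sub>v (Y2 *\<^sub>v v))) ^^ k) v =
    2 ^ k \<cdot>\<^sub>v ((\<lambda>v. Y1 *\<^sub>v v) ^^ k) (((\<lambda>v. Y2 *\<^sub>v v) ^^ k) v)"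
proof (induction k)
  case (Suc k)
  let ?y1 = "\<lambda>v. Y1 *\<^sub>v v" and ?y2 = "\<lambda>v. Y2 *\<^sub>v v"
  have c2: "(?y2 ^^ k) v \<in> carrier_vec n" by (rule funpow_mat_carrier[OF Y2 v])
  let ?w = "(?y1 ^^ k) ((?y2 ^^ k) v)"
  have w: "?w \<in> carrier_vec n" by (rule funpow_mat_carrier[OF Y1 c2])
  have "((\<lambda>v. 2 \<cdot>\<^sub>v (Y1 *\<^sub>v (Y2 *\<^sub>v v))) ^^ Suc k) v = 2 \<cdot>\<^sub>v (Y1 *\<^sub>v (Y2 *\<^sub>v (2 ^ k \<cdot>\<^sub>v ?w)))"
    using Suc by simp
  also have "\<dots> = 2 \<cdot>\<^sub>v (2 ^ k \<cdot>\<^sub>v (Y1 *\<^sub>v (Y2 *\<^sub>v ?w)))"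
    using mult_mat_vec[OF Y2 w] mult_mat_vec[OF Y1 mult_mat_vec_carrier[OF Y2 w]] by simp
  also have "Y2 *\<^sub>v ?w = (?y1 ^^ k) ((?y2 ^^ Suc k) v)"
    using funpow_mat_commute[OF Y1 Y2 comm c2] by simp
  finally show ?case by (simp add: smult_smult_assoc)
qed simp

lemma sum_le_sqrt2:
  fixes a b x :: real
  assumes "a\<^sup>2 + b\<^sup>2 \<le> x\<^sup>2" "0 \<le> x"
  shows "a + b \<le> sqrt 2 * x"
proof (rule power2_le_imp_le)
  have "(a + b)\<^sup>2 = 2 * (a\<^sup>2 + b\<^sup>2) - (a - b)\<^sup>2" by (simp add: power2_eq_square algebra_simps)
  also have "\<dots> \<le> 2 * (a\<^sup>2 + b\<^sup>2)" by simp
  also have "\<dots> \<le> 2 * x\<^sup>2" using assms(1) by (rule mult_left_mono) simp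
  finally have "(a + b)\<^sup>2 \<le> 2 * x\<^sup>2" .
  then show "(a + b)\<^sup>2 \<le> (sqrt 2 * x)\<^sup>2" by (simp add: power_mult_distrib)
qed (use assms in simp)

text \<open>
  The average over directions with a cut at spectral radius \<open>r\<close>. Directions whose
  contraction has an eigenvalue beyond \<open>r\<close> are counted by the moment of order \<open>4q\<close> and Markov's inequality,
  which gives the first summand; the powers in all other directions decay, which gives the second.
\<close>

lemma product_power_estimate:
  fixes Y1 Y2 :: "complex Matrix.mat"
  assumes Y1: "Y1 \<in> carrier_mat N N" and Y2: "Y2 \<in> carrier_mat N N" and comm: "Y1 * Y2 = Y2 * Y1"
    and col: "\<And>v. v \<in> carrier_vec N \<Longrightarrow> (cvec_norm (Y1 *\<^sub>v v))\<^sup>2 + (cvec_norm (Y2 *\<^sub>v v))\<^sup>2 \<le> (cvec_norm v)\<^sup>2"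
    and v: "v \<in> carrier_vec N" and q: "q \<le> n" and r: "0 < r" "r \<le> 1"
  shows "cvec_norm (((\<lambda>v. 2 \<cdot>\<^sub>v (Y1 *\<^sub>v (Y2 *\<^sub>v v))) ^^ n) v) \<le>
    omg n * (real (N * N) / (omg q * r ^ (4 * q)) + (4 * real n + 1) ^ N * r ^ (2 * n) / r ^ N) * cvec_norm v"
proof -
  \<comment> \<open>The roots of unity must separate the exponents from 0 to 2n.\<close>
  define M where "M = 2 * n + 1"
  define z where "z j = unity_root M ^ j" for j
  have M: "0 < M" "2 * q < M" using q by (auto simp: M_def)
  have z1: "cmod (z j) = 1" for j by (simp add: z_def norm_power)
  \<comment> \<open>By Cauchy--Schwarz the pencil has norm at most the square root of 2.\<close>
  define c where "c = complex_of_real (1 / sqrt 2)"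
  have cn: "cmod c = 1 / sqrt 2" unfolding c_def norm_of_real by simp
  define Z where "Z j = Y1 + z j \<cdot>\<^sub>m Y2" for j
  define A where "A j = c \<cdot>\<^sub>m Z j" for j
  have Z: "Z j \<in> carrier_mat N N" for j using Y1 Y2 by (simp add: Z_def)
  have A: "A j \<in> carrier_mat N N" for j using Z by (simp add: A_def)
  have Av: "A j *\<^sub>v u = c \<cdot>\<^sub>v (Y1 *\<^sub>v u + z j \<cdot>\<^sub>v (Y2 *\<^sub>v u))" if u: "u \<in> carrier_vec N" for j u
  proof -
    have "A j *\<^sub>v u = c \<cdot>\<^sub>v (Z j *\<^sub>v u)" using Z[of j] u unfolding A_def by auto
    also have "Z j *\<^sub>v u = Y1 *\<^sub>v u + (z j \<cdot>\<^sub>m Y2) *\<^sub>v u"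
      unfolding Z_def using Y1 Y2 u by (intro add_mult_distrib_mat_vec[of _ N N]) auto
    also have "(z j \<cdot>\<^sub>m Y2) *\<^sub>v u = z j \<cdot>\<^sub>v (Y2 *\<^sub>v u)" using Y2 u by auto
    finally show ?thesis .
  qed
  have contr: "cvec_norm (A j *\<^sub>v u) \<le> cvec_norm u" if u: "u \<in> carrier_vec N" for j u
  proof -
    have cc: "Y1 *\<^sub>v u \<in> carrier_vec N" "Y2 *\<^sub>v u \<in> carrier_vec N" using Y1 Y2 u by auto
    have "cvec_norm (Y1 *\<^sub>v u + z j \<cdot>\<^sub>v (Y2 *\<^sub>v u)) \<le> cvec_norm (Y1 *\<^sub>v u) + cvec_norm (z j \<cdot>\<^sub>v (Y2 *\<^sub>v u))"
      using cc by (intro cvec_norm_triangle[of _ N]) auto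
    also have "\<dots> = cvec_norm (Y1 *\<^sub>v u) + cvec_norm (Y2 *\<^sub>v u)" by (simp add: cvec_norm_smult z1)
    also have "\<dots> \<le> sqrt 2 * cvec_norm u" using col[OF u] by (intro sum_le_sqrt2) auto
    finally show ?thesis unfolding Av[OF u] cvec_norm_smult cn by (simp add: field_simps)
  qed
  have contr_pow: "cvec_norm (((\<lambda>v. A j *\<^sub>v v) ^^ k) v) \<le> cvec_norm v" for j k
  proof (induction k)
    case (Suc k)
    then show ?case using contr[OF funpow_mat_carrier[OF A v, of k j], of j] by simp
  qed simp
  define E where "E p i = vec_index (((\<lambda>v. Y1 *\<^sub>v v) ^^ i) (((\<lambda>v. Y2 *\<^sub>v v) ^^ (2 * n - i)) v)) p" for p i
  let ?t = "((\<lambda>v. 2 \<cdot>\<^sub>v (Y1 *\<^sub>v (Y2 *\<^sub>v v))) ^^ n) v"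
  let ?a = "\<lambda>j. ((\<lambda>v. A j *\<^sub>v v) ^^ (2 * n)) v"
  have dim_t: "dim_vec ?t = N"
    unfolding funpow_product[OF Y1 Y2 comm v]
    using funpow_mat_carrier[OF Y1 funpow_mat_carrier[OF Y2 v]] by auto
  have dim_a: "dim_vec (?a j) = N" for j using funpow_mat_carrier[OF A v, of "2 * n" j] by auto
  \<comment> \<open>The average picks the middle term of the binomial expansion of the pencil, and the weight cancels its
    binomial coefficient.\<close>
  have avg: "vec_index ?t p = of_real (omg n / real M) * (\<Sum>j<M. cnj (z j) ^ n * vec_index (?a j) p)" if p: "p < N" for p
  proof -
    have c2n: "c ^ (2 * n) = 1 / 2 ^ n"
      unfolding c_def by (simp add: power_mult power_divide flip: of_real_power)
    have aj: "vec_index (?a j) p = (1 / 2 ^ n) * (\<Sum>i\<le>2 * n. of_nat (2 * n choose i) * z j ^ (2 * n - i) * E p i)" for j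
    proof -
      have "?a j = c ^ (2 * n) \<cdot>\<^sub>v ((\<lambda>v. Z j *\<^sub>v v) ^^ (2 * n)) v"
        unfolding A_def by (rule funpow_smult_mat[OF Z v])
      then have "vec_index (?a j) p = c ^ (2 * n) * vec_index (((\<lambda>v. Z j *\<^sub>v v) ^^ (2 * n)) v) p"
        using funpow_mat_carrier[OF Z v, of "2 * n" j] p by auto
      then show ?thesis unfolding c2n Z_def pencil_power_index[OF Y1 Y2 comm v p] E_def .
    qed
    have "(\<Sum>j<M. cnj (z j) ^ n * vec_index (?a j) p) =
        (\<Sum>j<M. \<Sum>i\<le>2 * n. (1 / 2 ^ n) * of_nat (2 * n choose i) * E p i * (z j ^ (2 * n - i) * cnj (z j) ^ n))"
      unfolding aj sum_distrib_left by (intro sum.cong refl) (simp add: mult_ac)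
    also have "\<dots> = (\<Sum>i\<le>2 * n. \<Sum>j<M. (1 / 2 ^ n) * of_nat (2 * n choose i) * E p i * (z j ^ (2 * n - i) * cnj (z j) ^ n))"
      by (rule sum.swap)
    also have "\<dots> = (\<Sum>i\<le>2 * n. (1 / 2 ^ n) * of_nat (2 * n choose i) * E p i * (if (2 * n - i) mod M = n mod M then of_nat M else 0))"
      unfolding z_def using M by (simp only: sum_distrib_left[symmetric] sum_unity_root)
    also have "\<dots> = (\<Sum>i\<le>2 * n. if i = n then (1 / 2 ^ n) * of_nat (2 * n choose n) * E p n * of_nat M else 0)"
      by (intro sum.cong refl) (auto simp: M_def)
    also have "\<dots> = (1 / 2 ^ n) * of_nat (2 * n choose n) * E p n * of_nat M" by simp
    finally have S: "(\<Sum>j<M. cnj (z j) ^ n * vec_index (?a j) p) = (1 / 2 ^ n) * of_nat (2 * n choose n) * E p n * of_nat M" .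
    have "complex_of_real (omg n) * of_nat (2 * n choose n) = of_real (omg n * real (2 * n choose n))" by simp
    also have "\<dots> = 4 ^ n" unfolding omg_binomial by simp
    finally have om: "complex_of_real (omg n) * of_nat (2 * n choose n) = 4 ^ n" .
    have "of_real (omg n / real M) * ((1 / 2 ^ n) * of_nat (2 * n choose n) * E p n * of_nat M) =
        (complex_of_real (omg n) * of_nat (2 * n choose n)) / 2 ^ n * E p n"
      using M by simp
    also have "\<dots> = 2 ^ n * E p n"
      unfolding om using power_mult_distrib[of "2::complex" 2 n] by simp
    also have "\<dots> = vec_index ?t p"
      unfolding funpow_product[OF Y1 Y2 comm v] E_def
      using funpow_mat_carrier[OF Y1 funpow_mat_carrier[OF Y2 v], of n n] p by auto
    finally show ?thesis unfolding S by simp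
  qed
  \<comment> \<open>Bad directions have a large eigenvalue. A joint eigenvector of the commuting pair turns it into a
    pair of eigenvalues in the unit ball of dimension two, and there are at most \<open>N\<^sup>2\<close> such pairs.\<close>
  define Bd where "Bd = {j\<in>{..<M}. \<exists>\<alpha>. eigenvalue (A j) \<alpha> \<and> r < cmod \<alpha>}"
  define S where "S = {(b, m) \<in> spectrum Y1 \<times> spectrum Y2. (cmod b)\<^sup>2 + (cmod m)\<^sup>2 \<le> 1}"
  define G where "G bm = {j\<in>{..<M}. r \<le> cmod (fst bm + z j * snd bm) / sqrt 2}" for bm :: "complex \<times> complex"
  have finS: "finite S"
    unfolding S_def using card_finite_spectrum[OF Y1] card_finite_spectrum[OF Y2]
    by (intro finite_subset[OF _ finite_cartesian_product[of "spectrum Y1" "spectrum Y2"]]) auto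
  have cardS: "card S \<le> N * N"
  proof -
    have "card S \<le> card (spectrum Y1 \<times> spectrum Y2)"
      unfolding S_def using card_finite_spectrum[OF Y1] card_finite_spectrum[OF Y2] by (intro card_mono) auto
    also have "\<dots> \<le> N * N"
      unfolding card_cartesian_product using card_finite_spectrum[OF Y1] card_finite_spectrum[OF Y2] by (intro mult_le_mono) auto
    finally show ?thesis .
  qed
  have Bd_sub: "Bd \<subseteq> (\<Union>bm\<in>S. G bm)"
  proof
    fix j assume "j \<in> Bd"
    then obtain \<alpha> where j: "j < M" and \<alpha>: "eigenvalue (A j) \<alpha>" "r < cmod \<alpha>" by (auto simp: Bd_def)
    have AY: "A j * Y1 = Y1 * A j"
    proof -
      have "Z j * Y1 = Y1 * Y1 + (z j \<cdot>\<^sub>m Y2) * Y1" unfolding Z_def using Y1 Y2 by (intro add_mult_distrib_mat[of _ N N]) auto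
      also have "(z j \<cdot>\<^sub>m Y2) * Y1 = Y1 * (z j \<cdot>\<^sub>m Y2)" using Y1 Y2 comm by (simp add: mult_smult_distrib[OF Y1 Y2] mult_smult_assoc_mat[OF Y2 Y1])
      also have "Y1 * Y1 + Y1 * (z j \<cdot>\<^sub>m Y2) = Y1 * Z j" unfolding Z_def using Y1 Y2 by (intro mult_add_distrib_mat[symmetric, of _ N N]) auto
      finally have "Z j * Y1 = Y1 * Z j" .
      then show ?thesis unfolding A_def by (simp add: mult_smult_distrib[OF Y1 Z] mult_smult_assoc_mat[OF Z Y1])
    qed
    obtain u b where u: "u \<in> carrier_vec N" "u \<noteq> 0\<^sub>v N" "A j *\<^sub>v u = \<alpha> \<cdot>\<^sub>v u" "Y1 *\<^sub>v u = b \<cdot>\<^sub>v u" "eigenvalue Y1 b"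
      by (rule common_eigenvector[OF A Y1 AY \<alpha>(1)])
    define m where "m = (\<alpha> / c - b) / z j"
    have nz: "z j \<noteq> 0" "c \<noteq> 0" using z1[of j] cn by auto
    have Y2u: "Y2 *\<^sub>v u = m \<cdot>\<^sub>v u"
    proof (rule eq_vecI)
      fix p assume "p < dim_vec (m \<cdot>\<^sub>v u)"
      then have p: "p < N" using u by simp
      have cc: "Y2 *\<^sub>v u \<in> carrier_vec N" using Y2 u by auto
      have "\<alpha> \<cdot>\<^sub>v u = c \<cdot>\<^sub>v (b \<cdot>\<^sub>v u + z j \<cdot>\<^sub>v (Y2 *\<^sub>v u))"
        using Av[OF u(1), of j] unfolding u(3) u(4) .
      then have "vec_index (\<alpha> \<cdot>\<^sub>v u) p = vec_index (c \<cdot>\<^sub>v (b \<cdot>\<^sub>v u + z j \<cdot>\<^sub>v (Y2 *\<^sub>v u))) p"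
        by (rule arg_cong)
      then have "\<alpha> * vec_index u p = vec_index (c \<cdot>\<^sub>v (b \<cdot>\<^sub>v u + z j \<cdot>\<^sub>v (Y2 *\<^sub>v u))) p"
        using u p by (simp only: index_smult_vec carrier_vecD)
      also have "\<dots> = c * (b * vec_index u p + z j * vec_index (Y2 *\<^sub>v u) p)"
        using carrier_vecD[OF cc] carrier_vecD[OF u(1)] p by (simp del: index_mult_mat_vec dim_mult_mat_vec)
      finally show "vec_index (Y2 *\<^sub>v u) p = vec_index (m \<cdot>\<^sub>v u) p"
        using nz u p unfolding m_def by (simp add: field_simps del: index_mult_mat_vec)
    qed (use u Y2 in auto)
    then have "eigenvalue Y2 m" using u Y2 by (auto simp: eigenvalue_def eigenvector_def)
    have un: "0 < cvec_norm u" using cvec_norm_eq_0[OF u(1)] u(2) cvec_norm_nonneg[of u] by linarith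
    have "((cmod b)\<^sup>2 + (cmod m)\<^sup>2) * (cvec_norm u)\<^sup>2 \<le> 1 * (cvec_norm u)\<^sup>2"
      using col[OF u(1)] unfolding Y2u u(4) by (simp add: cvec_norm_smult power_mult_distrib ring_distribs)
    then have "(cmod b)\<^sup>2 + (cmod m)\<^sup>2 \<le> 1" by (rule mult_right_le_imp_le) (use un in simp)
    then have "(b, m) \<in> S" using \<open>eigenvalue Y2 m\<close> u by (auto simp: S_def spectrum_def)
    moreover have "\<alpha> = c * (b + z j * m)" using nz unfolding m_def by (simp add: field_simps)
    then have "cmod \<alpha> = cmod (b + z j * m) / sqrt 2" by (simp add: norm_mult cn)
    then have "j \<in> G (b, m)" using \<alpha> j by (simp add: G_def)
    ultimately show "j \<in> (\<Union>bm\<in>S. G bm)" by blast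
  qed
  have cardG: "real (card (G bm)) \<le> real M / (omg q * r ^ (4 * q))" if "bm \<in> S" for bm
  proof -
    have bm: "(cmod (fst bm))\<^sup>2 + (cmod (snd bm))\<^sup>2 \<le> 1" using that by (auto simp: S_def)
    have "real (card (G bm)) * r ^ (4 * q) = (\<Sum>j\<in>G bm. r ^ (4 * q))" by simp
    also have "\<dots> \<le> (\<Sum>j\<in>G bm. (cmod (fst bm + z j * snd bm) / sqrt 2) ^ (4 * q))"
      using r by (intro sum_mono power_mono) (auto simp: G_def)
    also have "\<dots> \<le> (\<Sum>j<M. (cmod (fst bm + z j * snd bm) / sqrt 2) ^ (4 * q))"
      by (intro sum_mono2) (auto simp: G_def)
    also have "\<dots> \<le> real M / omg q" unfolding z_def using sum_pencil_moment_le[OF M(2) bm] .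
    finally show ?thesis using r by (simp add: field_simps)
  qed
  have "card Bd \<le> (\<Sum>bm\<in>S. card (G bm))"
  proof -
    have "card Bd \<le> card (\<Union>bm\<in>S. G bm)" using finS Bd_sub by (intro card_mono) (auto simp: G_def)
    also have "\<dots> \<le> (\<Sum>bm\<in>S. card (G bm))" using finS by (rule card_UN_le)
    finally show ?thesis .
  qed
  then have "real (card Bd) \<le> (\<Sum>bm\<in>S. real (card (G bm)))" by (metis of_nat_le_iff of_nat_sum)
  also have "\<dots> \<le> (\<Sum>bm\<in>S. real M / (omg q * r ^ (4 * q)))" by (intro sum_mono cardG)
  also have "\<dots> \<le> real (N * N) * (real M / (omg q * r ^ (4 * q)))"
    using cardS r unfolding sum_constant by (intro mult_right_mono of_nat_mono) auto
  finally have cardBd: "real (card Bd) \<le> real (N * N) * (real M / (omg q * r ^ (4 * q)))" .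
  define R where "R = (4 * real n + 1) ^ N * r ^ (2 * n) / r ^ N"
  have R0: "0 \<le> R" unfolding R_def using r by simp
  have good: "cvec_norm (?a j) \<le> R * cvec_norm v" if "j \<in> {..<M} - Bd" for j
  proof -
    have ev: "cmod \<alpha> \<le> r" if "eigenvalue (A j) \<alpha>" for \<alpha>
      using that \<open>j \<in> {..<M} - Bd\<close> unfolding Bd_def by force
    have "r ^ N * cvec_norm (?a j) \<le> (2 * real (2 * n) + 1) ^ N * r ^ (2 * n) * cvec_norm v"
      by (rule contraction_power_bound[OF A r contr ev v])
    then show ?thesis unfolding R_def using r by (simp add: field_simps)
  qed
  have fB: "Bd \<subseteq> {..<M}" by (auto simp: Bd_def)
  have "(\<Sum>j<M. cvec_norm (?a j)) = (\<Sum>j\<in>Bd. cvec_norm (?a j)) + (\<Sum>j\<in>{..<M} - Bd. cvec_norm (?a j))"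
    using sum.subset_diff[OF fB, of "\<lambda>j. cvec_norm (?a j)"] by simp
  also have "\<dots> \<le> (\<Sum>j\<in>Bd. cvec_norm v) + (\<Sum>j\<in>{..<M} - Bd. R * cvec_norm v)"
    by (intro add_mono sum_mono contr_pow good)
  also have "\<dots> \<le> (\<Sum>j\<in>Bd. cvec_norm v) + (\<Sum>j<M. R * cvec_norm v)"
    using R0 by (intro add_left_mono sum_mono2) auto
  also have "\<dots> = real (card Bd) * cvec_norm v + real M * (R * cvec_norm v)" by simp
  also have "\<dots> \<le> real (N * N) * (real M / (omg q * r ^ (4 * q))) * cvec_norm v + real M * (R * cvec_norm v)"
    by (intro add_right_mono mult_right_mono cardBd) simp
  also have "\<dots> = real M * ((real (N * N) / (omg q * r ^ (4 * q)) + R) * cvec_norm v)"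
    by (simp add: algebra_simps)
  finally have sum_a: "(\<Sum>j<M. cvec_norm (?a j)) \<le> real M * ((real (N * N) / (omg q * r ^ (4 * q)) + R) * cvec_norm v)" .
  have "cvec_norm ?t \<le> omg n / real M * (\<Sum>j<M. cvec_norm (?a j))"
  proof -
    have "cvec_norm ?t \<le> L2_set (\<lambda>p. omg n / real M * (\<Sum>j<M. cmod (vec_index (?a j) p))) {..<N}"
      unfolding cvec_norm_def dim_t
    proof (rule L2_set_mono)
      fix p assume "p \<in> {..<N}"
      then have "cmod (vec_index ?t p) = omg n / real M * cmod (\<Sum>j<M. cnj (z j) ^ n * vec_index (?a j) p)"
        using avg by (simp add: norm_mult norm_divide)
      also have "\<dots> \<le> omg n / real M * (\<Sum>j<M. cmod (vec_index (?a j) p))"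
        by (intro mult_left_mono sum_norm_le) (auto simp: norm_mult norm_power z1)
      finally show "cmod (vec_index ?t p) \<le> omg n / real M * (\<Sum>j<M. cmod (vec_index (?a j) p))" .
    qed simp
    also have "\<dots> = omg n / real M * L2_set (\<lambda>p. \<Sum>j<M. cmod (vec_index (?a j) p)) {..<N}"
      by (rule L2_set_right_distrib[symmetric]) simp
    also have "\<dots> \<le> omg n / real M * (\<Sum>j<M. L2_set (\<lambda>p. cmod (vec_index (?a j) p)) {..<N})"
      by (intro mult_left_mono L2_set_sum_le) simp
    finally show ?thesis unfolding cvec_norm_def dim_a .
  qed
  also have "\<dots> \<le> omg n / real M * (real M * ((real (N * N) / (omg q * r ^ (4 * q)) + R) * cvec_norm v))"
    by (intro mult_left_mono sum_a) simp
  also have "\<dots> = omg n * (real (N * N) / (omg q * r ^ (4 * q)) + R) * cvec_norm v"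
    using M by simp
  finally show ?thesis unfolding R_def .
qed

lemma power_le_fact_exp:
  fixes x :: real
  assumes "0 \<le> x"
  shows "x ^ k \<le> fact k * exp x"
proof -
  have "(\<Sum>n\<in>{k}. x ^ n /\<^sub>R fact n) \<le> (\<Sum>n. x ^ n /\<^sub>R fact n)"
    using assms sums_summable[OF exp_converges[of x]] by (intro sum_le_suminf) auto
  then have "x ^ k / fact k \<le> exp x" using sums_unique[OF exp_converges[of x]] by (simp add: divide_inverse mult.commute)
  then show ?thesis by (simp add: divide_le_eq mult.commute)
qed

text \<open>
  The choice of the free parameters in the previous estimate: \<open>q\<close> about \<open>n\<^bsup>3/4\<^esup>\<close> and \<open>r\<^sup>2 = 1 - 1/(4q)\<close>. Then
  \<open>r\<^bsup>4q\<^esup>\<close> stays away from zero and \<open>\<omega>\<^sub>n / \<omega>\<^sub>q\<close> is of order \<open>n\<^bsup>1/8\<^esup>\<close>, while \<open>r\<^bsup>2n\<^esup>\<close> is at most \<open>exp (- n\<^bsup>1/4\<^esup> / 4)\<close> and absorbs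
  every power of \<open>n\<close>.
\<close>

lemma product_power_bound:
  obtains C where "0 \<le> C"
    "\<And>Y1 Y2 n v. Y1 \<in> carrier_mat N N \<Longrightarrow> Y2 \<in> carrier_mat N N \<Longrightarrow> Y1 * Y2 = Y2 * Y1 \<Longrightarrow>
      (\<And>v. v \<in> carrier_vec N \<Longrightarrow> (cvec_norm (Y1 *\<^sub>v v))\<^sup>2 + (cvec_norm (Y2 *\<^sub>v v))\<^sup>2 \<le> (cvec_norm v)\<^sup>2) \<Longrightarrow>
      v \<in> carrier_vec N \<Longrightarrow>
      cvec_norm (((\<lambda>v. 2 \<cdot>\<^sub>v (Y1 *\<^sub>v (Y2 *\<^sub>v v))) ^^ n) v) \<le> C * (real n + 1) powr (1/8) * cvec_norm v"
proof -
  define K where "K = 4 * N + 2"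
  define D where "D = 3 * 10 ^ N * (4 ^ K * fact K :: real)"
  define C where "C = 6 * real (N * N) + D + 1"
  have D0: "0 \<le> D" unfolding D_def by simp
  have C0: "0 \<le> C" unfolding C_def using D0 by simp
  have "cvec_norm (((\<lambda>v. 2 \<cdot>\<^sub>v (Y1 *\<^sub>v (Y2 *\<^sub>v v))) ^^ n) v) \<le> C * (real n + 1) powr (1/8) * cvec_norm v"
    if Y: "Y1 \<in> carrier_mat N N" "Y2 \<in> carrier_mat N N" "Y1 * Y2 = Y2 * Y1"
      "\<And>v. v \<in> carrier_vec N \<Longrightarrow> (cvec_norm (Y1 *\<^sub>v v))\<^sup>2 + (cvec_norm (Y2 *\<^sub>v v))\<^sup>2 \<le> (cvec_norm v)\<^sup>2"
      and v: "v \<in> carrier_vec N" for Y1 Y2 n v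
  proof (cases "n = 0")
    case True
    have "1 \<le> C" unfolding C_def using D0 by simp
    from mult_right_mono[OF this, of "cvec_norm v"] show ?thesis using True by simp
  next
    case False
    define x where "x = real n powr (1/4)"
    have x1: "1 \<le> x" unfolding x_def using False by (intro ge_one_powr_ge_zero) auto
    have x4: "x ^ 4 = real n" unfolding x_def using False by (simp add: powr_powr flip: powr_realpow)
    define q where "q = nat \<lfloor>x ^ 3\<rfloor>"
    have x31: "1 \<le> x ^ 3" using x1 by simp
    have q1: "1 \<le> q" using x31 unfolding q_def by (simp add: le_nat_floor)
    have qx: "real q \<le> x ^ 3" using x1 unfolding q_def by (intro of_nat_floor) simp
    have xq: "x ^ 3 \<le> 2 * real q + 1"
    proof -
      have "x ^ 3 < real q + 1" using x31 unfolding q_def by linarith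
      then show ?thesis by simp
    qed
    have "x ^ 3 \<le> x ^ 4" using x1 by (intro power_increasing) auto
    then have qn: "q \<le> n" using qx x4 by linarith
    define s where "s = 1 - 1 / (4 * real q)"
    have s: "3 / 4 \<le> s" "s \<le> 1" unfolding s_def using q1 by (auto simp: field_simps)
    define r where "r = sqrt s"
    have r2: "r\<^sup>2 = s" unfolding r_def using s by simp
    have r: "0 < r" "r \<le> 1" unfolding r_def using s by auto
    have rh: "1 / 2 \<le> r" unfolding r_def using s by (intro real_le_rsqrt) (simp add: power2_eq_square)
    have r4q: "1 / 2 \<le> r ^ (4 * q)"
    proof -
      have "1 + real (2 * q) * (- 1 / (4 * real q)) \<le> (1 + (- 1 / (4 * real q))) ^ (2 * q)"
        using q1 by (intro Bernoulli_inequality) (auto simp: field_simps)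
      then have "1 / 2 \<le> s ^ (2 * q)" unfolding s_def using q1 by simp
      also have "s ^ (2 * q) = r ^ (4 * q)" unfolding r2[symmetric] by (simp flip: power_mult)
      finally show ?thesis .
    qed
    have r2n: "r ^ (2 * n) \<le> exp (- (x / 4))"
    proof -
      have "r ^ (2 * n) = s ^ n" unfolding r2[symmetric] by (simp flip: power_mult)
      also have "\<dots> \<le> exp (- 1 / (4 * real q)) ^ n"
        unfolding s_def using s(1) exp_ge_add_one_self[of "- 1 / (4 * real q)"] by (intro power_mono) (auto simp: s_def)
      also have "\<dots> = exp (- (real n / (4 * real q)))" by (simp flip: exp_of_nat_mult)
      also have "\<dots> \<le> exp (- (x / 4))"
      proof -
        have "x * real q \<le> x * x ^ 3" using qx x1 by (intro mult_left_mono) auto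
        also have "\<dots> = real n" unfolding x4[symmetric] by (simp add: power_Suc[symmetric] del: power_Suc)
        finally have "x / 4 \<le> real n / (4 * real q)" using q1 by (simp add: field_simps)
        then show ?thesis by simp
      qed
      finally show ?thesis .
    qed
    have on: "omg n \<le> 3 * x ^ 2"
    proof -
      have "omg n \<le> sqrt (4 * real n + 1)" by (rule omg_upper)
      also have "\<dots> \<le> 3 * x ^ 2"
      proof (rule real_le_lsqrt)
        have "(3 * x ^ 2)\<^sup>2 = 9 * x ^ 4" by (simp add: power_mult_distrib flip: power_mult)
        then show "4 * real n + 1 \<le> (3 * x ^ 2)\<^sup>2" unfolding x4 using False by simp
      qed (use x1 in auto)
      finally show ?thesis .
    qed
    have oq: "sqrt (x ^ 3) \<le> omg q"
      using omg_lower[of q] real_sqrt_le_mono[OF xq] by linarith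
    have 1: "omg n * (real (N * N) / (omg q * r ^ (4 * q))) \<le> 6 * real (N * N) * sqrt x"
    proof -
      have "sqrt x * sqrt (x ^ 3) = sqrt (x * x ^ 3)" by (simp only: real_sqrt_mult)
      also have "x * x ^ 3 = x ^ 4" by (simp only: power3_eq_cube power4_eq_xxxx mult.assoc)
      also have "sqrt (x ^ 4) = x ^ 2" by (rule real_sqrt_unique) (auto simp flip: power_mult)
      finally have "3 * x ^ 2 = 3 * sqrt x * sqrt (x ^ 3)" by simp
      have "3 * sqrt x * sqrt (x ^ 3) \<le> 3 * sqrt x * omg q" using oq x1 by (intro mult_left_mono) auto
      then have a: "omg n \<le> 3 * sqrt x * omg q"
        using on \<open>3 * x ^ 2 = 3 * sqrt x * sqrt (x ^ 3)\<close> by linarith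
      have "omg n * (real (N * N) / (omg q * r ^ (4 * q))) = real (N * N) * (omg n / omg q) * (1 / r ^ (4 * q))"
        by simp
      also have "\<dots> \<le> real (N * N) * (3 * sqrt x) * 2"
      proof (intro mult_mono mult_left_mono)
        show "omg n / omg q \<le> 3 * sqrt x" using a by (simp add: divide_le_eq)
        show "1 / r ^ (4 * q) \<le> 2" using r4q r by (simp add: field_simps)
      qed (use x1 r in auto)
      finally show ?thesis by simp
    qed
    have 2: "omg n * ((4 * real n + 1) ^ N * r ^ (2 * n) / r ^ N) \<le> D"
    proof -
      have "(4 * real n + 1) ^ N \<le> (5 * x ^ 4) ^ N" using False unfolding x4 by (intro power_mono) auto
      moreover have "1 / r ^ N \<le> 2 ^ N"
      proof -
        have "(1 / 2) ^ N \<le> r ^ N" using rh by (intro power_mono) auto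
        then show ?thesis using r by (simp add: field_simps power_divide)
      qed
      ultimately have "omg n * ((4 * real n + 1) ^ N * r ^ (2 * n) * (1 / r ^ N)) \<le>
          3 * x ^ 2 * ((5 * x ^ 4) ^ N * exp (- (x / 4)) * 2 ^ N)"
        using on r2n r x1 by (intro mult_mono) auto
      also have "\<dots> = 3 * 10 ^ N * x ^ K * exp (- (x / 4))"
        unfolding K_def using power_mult_distrib[of "5::real" 2 N]
        by (simp add: power_mult_distrib power_add power_mult[symmetric] mult_ac, simp add: power2_eq_square)
      also have "x ^ K = 4 ^ K * (x / 4) ^ K" by (simp add: power_divide)
      also have "3 * 10 ^ N * (4 ^ K * (x / 4) ^ K) * exp (- (x / 4)) \<le> 3 * 10 ^ N * (4 ^ K * (fact K * exp (x / 4))) * exp (- (x / 4))"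
        using x1 by (intro mult_right_mono mult_left_mono power_le_fact_exp) auto
      also have "\<dots> = D" unfolding D_def by (simp add: exp_minus)
      finally show ?thesis by simp
    qed
    have sx: "sqrt x \<le> (real n + 1) powr (1/8)" "1 \<le> (real n + 1) powr (1/8)"
    proof -
      have "sqrt x = real n powr (1/8)" unfolding x_def powr_half_sqrt[symmetric, OF powr_ge_zero] by (simp add: powr_powr)
      also have "\<dots> \<le> (real n + 1) powr (1/8)" by (intro powr_mono2) auto
      finally show "sqrt x \<le> (real n + 1) powr (1/8)" .
      show "1 \<le> (real n + 1) powr (1/8)" by (intro ge_one_powr_ge_zero) auto
    qed
    have "omg n * (real (N * N) / (omg q * r ^ (4 * q)) + (4 * real n + 1) ^ N * r ^ (2 * n) / r ^ N)
        \<le> 6 * real (N * N) * sqrt x + D * 1"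
      using add_mono[OF 1 2] by (simp only: distrib_left mult_1_right)
    also have "\<dots> \<le> 6 * real (N * N) * (real n + 1) powr (1/8) + D * (real n + 1) powr (1/8)"
      using sx D0 by (intro add_mono mult_left_mono) auto
    also have "\<dots> \<le> C * (real n + 1) powr (1/8)"
      unfolding C_def by (simp add: algebra_simps)
    finally have "omg n * (real (N * N) / (omg q * r ^ (4 * q)) + (4 * real n + 1) ^ N * r ^ (2 * n) / r ^ N) * cvec_norm v
        \<le> C * (real n + 1) powr (1/8) * cvec_norm v" by (rule mult_right_mono) simp
    then show ?thesis using product_power_estimate[OF Y v qn r] by (rule order_trans[rotated])
  qed
  then show ?thesis using that C0 by blast
qed

section \<open>Polynomial approximation on the ball\<close>

text \<open>
  Polynomials as functions, generated from constants and coordinates.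
\<close>

inductive_set polyfun :: "(complex ^ 'd::finite \<Rightarrow> complex) set" where
  const: "(\<lambda>z. c) \<in> polyfun"
| coord: "(\<lambda>z. vec_nth z i) \<in> polyfun"
| add: "p \<in> polyfun \<Longrightarrow> q \<in> polyfun \<Longrightarrow> (\<lambda>z. p z + q z) \<in> polyfun"
| mult: "p \<in> polyfun \<Longrightarrow> q \<in> polyfun \<Longrightarrow> (\<lambda>z. p z * q z) \<in> polyfun"

lemma polyfun_sum: "(\<And>k. k \<in> A \<Longrightarrow> p k \<in> polyfun) \<Longrightarrow> (\<lambda>z. \<Sum>k\<in>A. p k z) \<in> polyfun"
  by (induction A rule: infinite_finite_induct) (auto intro: polyfun.intros)

lemma polyfun_power: "p \<in> polyfun \<Longrightarrow> (\<lambda>z. p z ^ k) \<in> polyfun"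
  by (induction k) (auto intro: polyfun.intros)

definition set_coord :: "complex ^ 'd \<Rightarrow> 'd \<Rightarrow> complex \<Rightarrow> complex ^ 'd::finite" where
  "set_coord z i t = (\<chi> j. if j = i then t else vec_nth z j)"

lemma set_coord_nth [simp]: "vec_nth (set_coord z i t) j = (if j = i then t else vec_nth z j)"
  by (simp add: set_coord_def)

lemma set_coord_affine: "set_coord z i t = set_coord z i 0 + t *s axis i 1"
  by (simp add: Finite_Cartesian_Product.vec_eq_iff axis_def)

lemma set_coord_self: "set_coord z i (vec_nth z i) = z"
  by (simp add: Finite_Cartesian_Product.vec_eq_iff)

lemma set_coord_commute: "i \<noteq> l \<Longrightarrow> set_coord (set_coord z l t) i w = set_coord (set_coord z i w) l t"
  by (simp add: Finite_Cartesian_Product.vec_eq_iff)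

text \<open>
  The coefficients of a polynomial of degree at most \<open>n\<close> are averages of its values at the roots of unity
  of order \<open>n + 1\<close>.
\<close>

lemma polynomial_coeff_average:
  assumes "\<And>t. g t = (\<Sum>k\<le>n. q k * t ^ k)"
  shows "g t = (\<Sum>k\<le>n. (1 / of_nat (Suc n)) * (\<Sum>j<Suc n. cnj (unity_root (Suc n) ^ j) ^ k * g (unity_root (Suc n) ^ j)) * t ^ k)"
proof -
  let ?z = "\<lambda>j. unity_root (Suc n) ^ j"
  have "(\<Sum>j<Suc n. cnj (?z j) ^ k * g (?z j)) = of_nat (Suc n) * q k" if "k \<le> n" for k
  proof -
    have "(\<Sum>j<Suc n. cnj (?z j) ^ k * g (?z j)) = (\<Sum>j<Suc n. \<Sum>l\<le>n. q l * (?z j ^ l * cnj (?z j) ^ k))"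
      unfolding assms sum_distrib_left by (intro sum.cong refl) (simp add: mult_ac)
    also have "\<dots> = (\<Sum>l\<le>n. \<Sum>j<Suc n. q l * (?z j ^ l * cnj (?z j) ^ k))" by (rule sum.swap)
    also have "\<dots> = (\<Sum>l\<le>n. q l * (if l mod Suc n = k mod Suc n then of_nat (Suc n) else 0))"
      by (simp only: sum_distrib_left[symmetric] sum_unity_root[OF zero_less_Suc])
    also have "\<dots> = (\<Sum>l\<le>n. if l = k then q k * of_nat (Suc n) else 0)"
      using that by (intro sum.cong refl) auto
    also have "\<dots> = of_nat (Suc n) * q k" using that by simp
    finally show ?thesis .
  qed
  then show ?thesis unfolding assms[of t] by (intro sum.cong refl) (simp del: of_nat_Suc)
qed

text \<open>
  With a uniform bound on the degrees, the averages at roots of unity express the coefficients with respect to one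
  variable through values of \<open>g\<close> with that variable frozen; these depend on one variable less, and
  induction over the set of variables applies.
\<close>

lemma polyfun_if_separately_polynomial:
  fixes g :: "complex ^ 'd::finite \<Rightarrow> complex"
  assumes "\<And>z i. \<exists>q. \<forall>t. g (set_coord z i t) = (\<Sum>k\<le>n. q k * t ^ k)"
  shows "g \<in> polyfun"
proof -
  have *: "g \<in> polyfun"
    if "finite S" "\<And>z i. \<exists>q. \<forall>t. g (set_coord z i t) = (\<Sum>k\<le>n. q k * t ^ k)"
      "\<And>z z'. (\<forall>j\<in>S. vec_nth z j = vec_nth z' j) \<Longrightarrow> g z = g z'" for S and g :: "complex ^ 'd \<Rightarrow> complex"
    using that
  proof (induction S arbitrary: g rule: finite_induct)
    case empty
    have "g = (\<lambda>z. g 0)" by (rule ext, rule empty.prems(2)) simp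
    then show ?case using polyfun.const by metis
  next
    case (insert i S)
    let ?z = "\<lambda>j. unity_root (Suc n) ^ j"
    have h: "(\<lambda>z. g (set_coord z i w)) \<in> polyfun" for w
    proof (rule insert.IH)
      fix z l
      show "\<exists>q. \<forall>t. g (set_coord (set_coord z l t) i w) = (\<Sum>k\<le>n. q k * t ^ k)"
      proof (cases "l = i")
        case True
        have "(\<Sum>k\<le>n. (if k = 0 then g (set_coord z i w) else 0) * t ^ k) = g (set_coord z i w)" for t
        proof -
          have "(\<Sum>k\<le>n. (if k = 0 then g (set_coord z i w) else 0) * t ^ k) = (\<Sum>k\<le>n. if k = 0 then g (set_coord z i w) else 0)"
            by (intro sum.cong) auto
          then show ?thesis by simp
        qed
        moreover have "set_coord (set_coord z l t) i w = set_coord z i w" for t using True by (simp add: Finite_Cartesian_Product.vec_eq_iff)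
        ultimately show ?thesis by (intro exI[of _ "\<lambda>k. if k = 0 then g (set_coord z i w) else 0"]) simp
      next
        case False
        then show ?thesis using insert.prems(1)[of "set_coord z i w" l] set_coord_commute[of i l z] by simp
      qed
    next
      fix z z' :: "complex ^ 'd" assume "\<forall>j\<in>S. vec_nth z j = vec_nth z' j"
      then show "g (set_coord z i w) = g (set_coord z' i w)" by (intro insert.prems(2)) auto
    qed
    have "g z = (\<Sum>k\<le>n. (1 / of_nat (Suc n)) * (\<Sum>j<Suc n. cnj (?z j) ^ k * g (set_coord z i (?z j))) * (vec_nth z i) ^ k)" for z
    proof -
      obtain q where "\<forall>t. g (set_coord z i t) = (\<Sum>k\<le>n. q k * t ^ k)" using insert.prems(1) by blast
      then show ?thesis
        using polynomial_coeff_average[of "\<lambda>t. g (set_coord z i t)" q n "vec_nth z i"] by (simp add: set_coord_self)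
    qed
    then have "g = (\<lambda>z. \<Sum>k\<le>n. (1 / of_nat (Suc n)) * (\<Sum>j<Suc n. cnj (?z j) ^ k * g (set_coord z i (?z j))) * (vec_nth z i) ^ k)"
      by (rule ext)
    moreover have "\<dots> \<in> polyfun"
      by (intro polyfun_sum polyfun.mult polyfun.const polyfun_power polyfun.coord h)
    ultimately show ?case by simp
  qed
  show ?thesis
  proof (rule *[OF finite[of UNIV] assms])
    fix z z' :: "complex ^ 'd" assume "\<forall>j\<in>UNIV. vec_nth z j = vec_nth z' j"
    then have "z = z'" by (simp add: Finite_Cartesian_Product.vec_eq_iff)
    then show "g z = g z'" by simp
  qed
qed

lemma norm_vector_scalar_mult: "norm (c *s (z :: complex ^ 'd::finite)) = cmod c * norm z"
  by (simp add: norm_vec_def L2_set_right_distrib norm_mult)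

lemma holomorphic_on_line:
  fixes f :: "complex ^ 'd::finite \<Rightarrow> complex"
  assumes f: "holomorphic_on_ball f" and S: "open S" "\<And>t. t \<in> S \<Longrightarrow> a + t *s b \<in> ball 0 1"
  shows "(\<lambda>t. f (a + t *s b)) holomorphic_on S"
proof (rule holomorphic_onI)
  fix t assume t: "t \<in> S"
  obtain D where D: "(f has_derivative D) (at (a + t *s b))" "\<And>c v. D (c *s v) = c * D v"
    using f S(2)[OF t] unfolding holomorphic_on_ball_def by blast
  have "bounded_linear (\<lambda>h. h *s b)"
  proof (rule bounded_linear_intro)
    show "(x + y) *s b = x *s b + y *s b" for x y by (simp add: Finite_Cartesian_Product.vec_eq_iff algebra_simps)
    show "(r *\<^sub>R x) *s b = r *\<^sub>R (x *s b)" for r x by (simp add: Finite_Cartesian_Product.vec_eq_iff)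
    show "norm (x *s b) \<le> norm x * norm b" for x by (simp add: norm_vector_scalar_mult)
  qed
  then have "((\<lambda>t. t *s b) has_derivative (\<lambda>h. h *s b)) (at t)" by (rule bounded_linear_imp_has_derivative)
  then have "((\<lambda>t. a + t *s b) has_derivative (\<lambda>h. h *s b)) (at t)" by (auto intro!: derivative_eq_intros)
  then have "((\<lambda>t. f (a + t *s b)) has_derivative (\<lambda>h. D (h *s b))) (at t)"
    using D(1) by (rule has_derivative_compose)
  then have "((\<lambda>t. f (a + t *s b)) has_field_derivative D b) (at t)"
  proof -
    have "(\<lambda>h. D (h *s b)) = (*) (D b)" by (auto simp: fun_eq_iff D(2))
    then show ?thesis using \<open>((\<lambda>t. f (a + t *s b)) has_derivative (\<lambda>h. D (h *s b))) (at t)\<close>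
      unfolding has_field_derivative_def by simp
  qed
  then show "(\<lambda>t. f (a + t *s b)) field_differentiable at t within S"
    by (meson field_differentiable_at_within field_differentiable_def)
qed

lemma holomorphic_on_ball_continuous:
  assumes "holomorphic_on_ball f" "S \<subseteq> ball 0 1"
  shows "continuous_on S f"
  using assms unfolding holomorphic_on_ball_def
  by (meson continuous_at_imp_continuous_on has_derivative_continuous subsetD)

text \<open>
  The homogeneous component of degree \<open>n\<close> of the power series of \<open>f\<close> at the origin, read off along the complex line
  through \<open>z\<close>; this form makes sense for all \<open>z\<close> and requires no multivariate power series.
\<close>

definition hom_part :: "(complex ^ 'd::finite \<Rightarrow> complex) \<Rightarrow> nat \<Rightarrow> complex ^ 'd \<Rightarrow> complex" where
  "hom_part f n z = (deriv ^^ n) (\<lambda>t. f (t *s z)) 0 / fact n"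

text \<open>
  Cauchy's estimate on the line through \<open>z\<close>.
\<close>

lemma hom_part_bound:
  fixes f :: "complex ^ 'd::finite \<Rightarrow> complex"
  assumes f: "holomorphic_on_ball f" and R: "0 < R" "R < 1" and M: "\<And>z. norm z \<le> R \<Longrightarrow> cmod (f z) \<le> M"
  shows "cmod (hom_part f n z) \<le> M * (norm z / R) ^ n"
proof -
  have M0: "0 \<le> M" using M[of 0] R norm_ge_zero order_trans by (metis norm_zero less_imp_le)
  show ?thesis
  proof (cases "z = 0")
    case True
    have "hom_part f n z = (if n = 0 then f 0 else 0)"
      unfolding hom_part_def True by (simp add: higher_deriv_const)
    then show ?thesis using M[of 0] M0 R True by auto
  next
    case False
    define r where "r = R / norm z"
    have r: "0 < r" unfolding r_def using R False by simp
    have in_ball: "t *s z \<in> ball 0 1" if "cmod t \<le> r" for t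
    proof -
      have "norm (t *s z) \<le> r * norm z" unfolding norm_vector_scalar_mult using that by (rule mult_right_mono) simp
      then show ?thesis using False R unfolding r_def by simp
    qed
    have hol: "(\<lambda>t. f (0 + t *s z)) holomorphic_on ball 0 r"
      using in_ball by (intro holomorphic_on_line[OF f]) auto
    have "cmod ((deriv ^^ n) (\<lambda>t. f (t *s z)) 0) \<le> fact n * M / r ^ n"
    proof (rule Cauchy_inequality)
      show "(\<lambda>t. f (t *s z)) holomorphic_on ball 0 r" using hol by simp
      have "continuous_on (cball 0 r) (\<lambda>t. t *s z)"
        unfolding vector_scalar_mult_def by (intro continuous_intros)
      then show "continuous_on (cball 0 r) (\<lambda>t. f (t *s z))"
        by (rule continuous_on_compose2[OF holomorphic_on_ball_continuous[OF f order_refl]]) (use in_ball in auto)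
      fix x assume "cmod (0 - x) = r"
      then show "cmod (f (x *s z)) \<le> M" using False R by (intro M) (simp add: norm_vector_scalar_mult r_def)
    qed (use r in auto)
    then have "cmod (hom_part f n z) \<le> M / r ^ n"
      unfolding hom_part_def by (simp add: norm_divide divide_le_eq mult.commute)
    also have "\<dots> = M * (norm z / R) ^ n" unfolding r_def by (simp add: power_divide)
    finally show ?thesis .
  qed
qed

lemma hom_part_sums:
  fixes f :: "complex ^ 'd::finite \<Rightarrow> complex"
  assumes f: "holomorphic_on_ball f" and c: "norm (c *s z) < 1"
  shows "(\<lambda>n. hom_part f n z * c ^ n) sums f (c *s z)"
proof -
  define r where "r = (if z = 0 then cmod c + 1 else 1 / norm z)"
  have cr: "cmod c < r" using c unfolding r_def norm_vector_scalar_mult by (auto simp: field_simps)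
  have "(\<lambda>t. f (0 + t *s z)) holomorphic_on ball 0 r"
    by (intro holomorphic_on_line[OF f]) (auto simp: r_def norm_vector_scalar_mult field_simps split: if_splits)
  then have "(\<lambda>n. (deriv ^^ n) (\<lambda>t. f (t *s z)) 0 / fact n * (c - 0) ^ n) sums f (c *s z)"
    using cr by (intro holomorphic_power_series) auto
  then show ?thesis by (simp add: hom_part_def)
qed

lemma hom_part_tail:
  fixes f :: "complex ^ 'd::finite \<Rightarrow> complex"
  assumes f: "holomorphic_on_ball f" and R: "0 < R" "R < 1" and M: "\<And>z. norm z \<le> R \<Longrightarrow> cmod (f z) \<le> M"
    and \<theta>: "0 \<le> \<theta>" "\<theta> < 1" and c: "norm (c *s z) \<le> \<theta> * R"
  shows "cmod (f (c *s z) - (\<Sum>k<n. hom_part f k z * c ^ k)) \<le> M * \<theta> ^ n / (1 - \<theta>)"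
proof -
  have M0: "0 \<le> M" using M[of 0] R norm_ge_zero order_trans by (metis norm_zero less_imp_le)
  have "\<theta> * R < 1" using \<theta> R by (metis less_imp_le mult_less_cancel_right1 mult_less_le_imp_less mult_1 order_less_trans le_less_trans mult_le_cancel_right1 not_le)
  then have "norm (c *s z) < 1" using c by linarith
  then have s: "(\<lambda>n. hom_part f n z * c ^ n) sums f (c *s z)" by (rule hom_part_sums[OF f])
  have tail: "(\<lambda>k. hom_part f (k + n) z * c ^ (k + n)) sums (f (c *s z) - (\<Sum>k<n. hom_part f k z * c ^ k))"
    using s by (rule sums_split_initial_segment)
  have bound: "cmod (hom_part f (k + n) z * c ^ (k + n)) \<le> M * \<theta> ^ n * \<theta> ^ k" for k
  proof -
    have "cmod (hom_part f (k + n) z * c ^ (k + n)) \<le> M * (norm z / R) ^ (k + n) * cmod c ^ (k + n)"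
      unfolding norm_mult norm_power using hom_part_bound[OF f R M] by (intro mult_right_mono) auto
    also have "\<dots> = M * (norm (c *s z) / R) ^ (k + n)"
      by (simp add: norm_vector_scalar_mult power_divide power_mult_distrib)
    also have "\<dots> \<le> M * \<theta> ^ (k + n)"
      using M0 c R by (intro mult_left_mono power_mono) (auto simp: divide_le_eq)
    finally show ?thesis by (simp add: power_add mult_ac)
  qed
  have g: "(\<lambda>k. M * \<theta> ^ n * \<theta> ^ k) sums (M * \<theta> ^ n * (1 / (1 - \<theta>)))"
    using \<theta> by (intro sums_mult geometric_sums) simp
  have "cmod (\<Sum>k. hom_part f (k + n) z * c ^ (k + n)) \<le> (\<Sum>k. M * \<theta> ^ n * \<theta> ^ k)"
    by (intro norm_suminf_le bound sums_summable[OF g])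
  then show ?thesis unfolding sums_unique[OF tail, symmetric] sums_unique[OF g, symmetric] by simp
qed

lemma holomorphic_on_ball_bounded:
  fixes f :: "complex ^ 'd::finite \<Rightarrow> complex"
  assumes f: "holomorphic_on_ball f" and R: "R < 1"
  obtains M where "\<And>z. norm z \<le> R \<Longrightarrow> cmod (f z) \<le> M"
proof -
  have "compact (f ` cball 0 R)"
    using R by (intro compact_continuous_image holomorphic_on_ball_continuous[OF f]) auto
  then have "bounded (f ` cball 0 R)" by (rule compact_imp_bounded)
  then obtain M where "\<forall>x\<in>f ` cball 0 R. cmod x \<le> M" by (auto simp: bounded_iff)
  then show ?thesis by (intro that[of M]) auto
qed

lemma polyfun_entire_line: "p \<in> polyfun \<Longrightarrow> (\<lambda>t. p (a + t *s b)) holomorphic_on S"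
  by (induction rule: polyfun.induct) (auto intro!: holomorphic_intros)

text \<open>
  By induction on \<open>n\<close>, the homogeneous component is the limit of
  \<open>(f (c z) - lower components) / c\<^sup>n\<close> as \<open>c\<close> tends to zero. The limit is locally uniform, and the
  functions are holomorphic on balls that exhaust the space, so the component is entire on every
  line. By Cauchy's estimate it grows with exponent at most \<open>n\<close>, so it is a polynomial of degree at most \<open>n\<close> in each
  variable.
\<close>

lemma hom_part_polyfun:
  fixes f :: "complex ^ 'd::finite \<Rightarrow> complex"
  assumes f: "holomorphic_on_ball f"
  shows "hom_part f n \<in> polyfun"
proof (induction n rule: less_induct)
  case (less n)
  obtain M where M: "\<And>z. norm z \<le> 1/2 \<Longrightarrow> cmod (f z) \<le> M"
    using holomorphic_on_ball_bounded[OF f, of "1/2"] by auto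
  have M0: "0 \<le> M" using M[of 0] by (metis norm_ge_zero norm_zero order_trans zero_le_divide_1_iff zero_le_numeral)
  define F where "F c z = (f (c *s z) - (\<Sum>k<n. hom_part f k z * c ^ k)) / c ^ n" for c z
  have Fdist: "cmod (F c z - hom_part f n z) \<le> M * (2 * B) ^ Suc n * cmod c * 2"
    if "c \<noteq> 0" "cmod c * (4 * B) \<le> 1" "norm z \<le> B" for c z B
  proof -
    define \<theta> where "\<theta> = cmod c * (2 * B)"
    have B0: "0 \<le> B" using that(3) norm_ge_zero order_trans by blast
    have \<theta>: "0 \<le> \<theta>" "\<theta> \<le> 1/2" unfolding \<theta>_def using that B0 by auto
    have "norm (c *s z) \<le> \<theta> * (1/2)"
      unfolding norm_vector_scalar_mult \<theta>_def using that(3) by (simp add: mult_left_mono)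
    then have "cmod (f (c *s z) - (\<Sum>k<Suc n. hom_part f k z * c ^ k)) \<le> M * \<theta> ^ Suc n / (1 - \<theta>)"
      using \<theta> by (intro hom_part_tail[OF f _ _ M, of "1/2"]) auto
    also have "\<dots> \<le> M * \<theta> ^ Suc n / (1/2)"
      using \<theta> M0 by (intro divide_left_mono) auto
    finally have a: "cmod (f (c *s z) - (\<Sum>k<Suc n. hom_part f k z * c ^ k)) \<le> M * \<theta> ^ Suc n * 2" by simp
    have "F c z - hom_part f n z = (f (c *s z) - (\<Sum>k<Suc n. hom_part f k z * c ^ k)) / c ^ n"
      unfolding F_def using that(1) by (simp add: field_simps)
    then have "cmod (F c z - hom_part f n z) = cmod (f (c *s z) - (\<Sum>k<Suc n. hom_part f k z * c ^ k)) / cmod c ^ n"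
      by (simp only: norm_divide norm_power)
    also have "\<dots> \<le> M * \<theta> ^ Suc n * 2 / cmod c ^ n" by (intro divide_right_mono a) simp
    also have "\<dots> = M * (2 * B) ^ Suc n * cmod c * 2"
      unfolding \<theta>_def using that(1) by (simp add: power_mult_distrib)
    finally show ?thesis .
  qed
  have line: "(\<lambda>t. hom_part f n (a + t *s b)) holomorphic_on ball 0 T" for a b T
  proof -
    define B where "B = norm a + \<bar>T\<bar> * norm b + 1"
    have B1: "1 \<le> B" unfolding B_def by simp
    have nB: "norm (a + t *s b) \<le> B" if "t \<in> ball 0 T" for t
    proof -
      have "norm (a + t *s b) \<le> norm a + cmod t * norm b"
        using norm_triangle_ineq[of a "t *s b"] by (simp add: norm_vector_scalar_mult)
      also have "\<dots> \<le> norm a + \<bar>T\<bar> * norm b" using that by (intro add_left_mono mult_right_mono) auto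
      finally show ?thesis unfolding B_def by simp
    qed
    define c where "c j = complex_of_real (1 / (4 * B * (real j + 1)))" for j
    have cn: "cmod (c j) = 1 / (4 * B * (real j + 1))" for j unfolding c_def norm_of_real using B1 by simp
    have c0: "c j \<noteq> 0" for j
    proof -
      have "0 < cmod (c j)" unfolding cn using B1 by (intro divide_pos_pos mult_pos_pos) auto
      then show ?thesis by simp
    qed
    have cB: "cmod (c j) * (4 * B) \<le> 1" for j
    proof -
      have "cmod (c j) * (4 * B) = 1 / (real j + 1)" unfolding cn using B1 by simp
      then show ?thesis by simp
    qed
    show ?thesis
    proof (rule holomorphic_uniform_sequence[where f = "\<lambda>j t. F (c j) (a + t *s b)"])
      show "open (ball (0::complex) T)" by simp
      fix j
      have "(\<lambda>t. f (c j *s a + t *s (c j *s b))) holomorphic_on ball 0 T"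
      proof (rule holomorphic_on_line[OF f])
        fix t :: complex assume t: "t \<in> ball 0 T"
        have "c j *s a + t *s (c j *s b) = c j *s (a + t *s b)"
          by (simp add: Finite_Cartesian_Product.vec_eq_iff algebra_simps)
        then have "norm (c j *s a + t *s (c j *s b)) = cmod (c j) * norm (a + t *s b)"
          by (simp only: norm_vector_scalar_mult)
        also have "\<dots> \<le> cmod (c j) * B" by (intro mult_left_mono nB t) simp
        also have "\<dots> < 1"
        proof -
          have "4 * (cmod (c j) * B) \<le> 1" using cB[of j] by (simp only: mult_ac)
          then show ?thesis by simp
        qed
        finally show "c j *s a + t *s (c j *s b) \<in> ball 0 1" by simp
      qed simp
      moreover have "(\<lambda>t. f (c j *s a + t *s (c j *s b))) = (\<lambda>t. f (c j *s (a + t *s b)))"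
        by (intro ext arg_cong[where f = f]) (simp add: Finite_Cartesian_Product.vec_eq_iff algebra_simps)
      ultimately have "(\<lambda>t. f (c j *s (a + t *s b))) holomorphic_on ball 0 T" by (simp only:)
      then show "(\<lambda>t. F (c j) (a + t *s b)) holomorphic_on ball 0 T"
      proof -
        have "(\<lambda>z. \<Sum>k<n. hom_part f k z * c j ^ k) \<in> polyfun"
          by (intro polyfun_sum polyfun.mult polyfun.const less.IH) simp
        then have "(\<lambda>t. \<Sum>k<n. hom_part f k (a + t *s b) * c j ^ k) holomorphic_on ball 0 T"
          by (rule polyfun_entire_line)
        then show ?thesis
          unfolding F_def using c0 \<open>(\<lambda>t. f (c j *s (a + t *s b))) holomorphic_on ball 0 T\<close>
          by (intro holomorphic_on_divide holomorphic_on_diff holomorphic_on_const) auto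
      qed
    next
      fix x :: complex assume "x \<in> ball 0 T"
      then obtain d where d: "0 < d" "cball x d \<subseteq> ball 0 T"
        using open_contains_cball[THEN iffD1, OF open_ball] by blast
      have "uniform_limit (cball x d) (\<lambda>j t. F (c j) (a + t *s b)) (\<lambda>t. hom_part f n (a + t *s b)) sequentially"
      proof (rule uniform_limitI)
        fix e :: real assume e: "0 < e"
        have "(\<lambda>j. 1 / (4 * B) * inverse (real (Suc j))) \<longlonglongrightarrow> 1 / (4 * B) * 0"
          by (intro tendsto_mult_left LIMSEQ_inverse_real_of_nat)
        moreover have "1 / (4 * B) * inverse (real (Suc j)) = cmod (c j)" for j
          unfolding cn by (simp add: inverse_eq_divide add.commute)
        ultimately have "(\<lambda>j. cmod (c j)) \<longlonglongrightarrow> 0" by simp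
        then have "(\<lambda>j. M * (2 * B) ^ Suc n * cmod (c j) * 2) \<longlonglongrightarrow> M * (2 * B) ^ Suc n * 0 * 2"
          by (intro tendsto_mult_left tendsto_mult_right)
        then have "\<forall>\<^sub>F j in sequentially. M * (2 * B) ^ Suc n * cmod (c j) * 2 < e"
          using e by (intro order_tendstoD) auto
        then show "\<forall>\<^sub>F j in sequentially. \<forall>t\<in>cball x d. dist (F (c j) (a + t *s b)) (hom_part f n (a + t *s b)) < e"
        proof (rule eventually_mono, intro ballI)
          fix j t assume j: "M * (2 * B) ^ Suc n * cmod (c j) * 2 < e" and "t \<in> cball x d"
          then have "cmod (F (c j) (a + t *s b) - hom_part f n (a + t *s b)) \<le> M * (2 * B) ^ Suc n * cmod (c j) * 2"
            using d by (intro Fdist c0 cB nB) auto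
          then show "dist (F (c j) (a + t *s b)) (hom_part f n (a + t *s b)) < e" using j by (simp only: dist_norm)
        qed
      qed
      then show "\<exists>d>0. cball x d \<subseteq> ball 0 T \<and> uniform_limit (cball x d) (\<lambda>j t. F (c j) (a + t *s b)) (\<lambda>t. hom_part f n (a + t *s b)) sequentially"
        using d by blast
    qed
  qed
  show ?case
  proof (rule polyfun_if_separately_polynomial)
    fix z :: "complex ^ 'd" and i
    define g where "g t = hom_part f n (set_coord z i t)" for t
    let ?a = "set_coord z i 0" and ?b = "axis i 1 :: complex ^ 'd"
    have g: "g = (\<lambda>t. hom_part f n (?a + t *s ?b))" unfolding g_def using set_coord_affine by metis
    have "g holomorphic_on UNIV"
      unfolding holomorphic_on_def
    proof
      fix t :: complex
      have "t \<in> ball 0 (cmod t + 1)" by simp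
      then have "g field_differentiable at t within ball 0 (cmod t + 1)"
        using line[of ?a ?b "cmod t + 1"] unfolding g holomorphic_on_def by blast
      then show "g field_differentiable at t within UNIV"
        using at_within_open[of t "ball 0 (cmod t + 1)"] by simp
    qed
    moreover have "cmod (g t) \<le> (M * (2 * (norm ?a + norm ?b)) ^ n) * cmod t ^ n" if "1 \<le> cmod t" for t
    proof -
      have "norm (?a + t *s ?b) \<le> norm ?a + cmod t * norm ?b"
        using norm_triangle_ineq[of ?a "t *s ?b"] by (simp add: norm_vector_scalar_mult)
      also have "\<dots> \<le> cmod t * norm ?a + cmod t * norm ?b"
        using mult_right_mono[OF that norm_ge_zero[of ?a]] by simp
      finally have n: "norm (?a + t *s ?b) \<le> cmod t * (norm ?a + norm ?b)" by (simp add: algebra_simps)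
      have "cmod (g t) \<le> M * (norm (?a + t *s ?b) / (1/2)) ^ n"
        unfolding g by (intro hom_part_bound[OF f _ _ M]) auto
      also have "\<dots> \<le> M * (2 * (cmod t * (norm ?a + norm ?b))) ^ n"
        using n M0 by (intro mult_left_mono power_mono) auto
      finally show ?thesis by (simp add: power_mult_distrib mult_ac)
    qed
    ultimately have "g t = (\<Sum>k\<le>n. (deriv ^^ k) g 0 / fact k * t ^ k)" for t
      by (rule Liouville_polynomial)
    then show "\<exists>q. \<forall>t. hom_part f n (set_coord z i t) = (\<Sum>k\<le>n. q k * t ^ k)"
      by (intro exI[of _ "\<lambda>k. (deriv ^^ k) g 0 / fact k"]) (simp only: g_def[symmetric], simp)
  qed
qed

text \<open>
  The partial sums of the homogeneous expansion converge geometrically on every smaller ball.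
\<close>

lemma polyfun_dense:
  fixes f :: "complex ^ 'd::finite \<Rightarrow> complex"
  assumes f: "holomorphic_on_ball f" and R: "0 < R" "R < 1" and e: "0 < e"
  obtains p where "p \<in> polyfun" "\<And>z. norm z \<le> R \<Longrightarrow> cmod (p z - f z) < e"
proof -
  define R' where "R' = (1 + R) / 2"
  have R': "0 < R'" "R' < 1" "R < R'" unfolding R'_def using R by auto
  obtain M where M: "\<And>z. norm z \<le> R' \<Longrightarrow> cmod (f z) \<le> M" using holomorphic_on_ball_bounded[OF f R'(2)] by auto
  define \<theta> where "\<theta> = R / R'"
  have \<theta>: "0 \<le> \<theta>" "\<theta> < 1" unfolding \<theta>_def using R R' by auto
  have "(\<lambda>n. M * \<theta> ^ n / (1 - \<theta>)) \<longlonglongrightarrow> 0"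
    using LIMSEQ_power_zero[of \<theta>] \<theta> by (intro tendsto_eq_intros) auto
  then have "\<forall>\<^sub>F n in sequentially. M * \<theta> ^ n / (1 - \<theta>) < e" using e by (rule order_tendstoD)
  then obtain n where n: "M * \<theta> ^ n / (1 - \<theta>) < e" by (auto simp: eventually_sequentially)
  show ?thesis
  proof
    show "(\<lambda>z. \<Sum>k<n. hom_part f k z) \<in> polyfun" by (intro polyfun_sum hom_part_polyfun[OF f])
    fix z :: "complex ^ 'd" assume z: "norm z \<le> R"
    have "cmod (f (1 *s z) - (\<Sum>k<n. hom_part f k z * 1 ^ k)) \<le> M * \<theta> ^ n / (1 - \<theta>)"
      using z R' by (intro hom_part_tail[OF f R'(1,2) M \<theta>]) (auto simp: \<theta>_def)
    then show "cmod ((\<Sum>k<n. hom_part f k z) - f z) < e" using n by (simp add: norm_minus_commute)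
  qed
qed

section \<open>Torus averages\<close>

definition zpow :: "complex ^ 'd::finite \<Rightarrow> ('d \<Rightarrow> nat) \<Rightarrow> complex" where
  "zpow z g = (\<Prod>i\<in>UNIV. vec_nth z i ^ g i)"

abbreviation box :: "nat \<Rightarrow> ('d::finite \<Rightarrow> nat) set" where
  "box M \<equiv> PiE UNIV (\<lambda>_. {..<M})"

definition torus_point :: "nat \<Rightarrow> ('d::finite \<Rightarrow> real) \<Rightarrow> ('d \<Rightarrow> nat) \<Rightarrow> complex ^ 'd" where
  "torus_point M r w = (\<chi> i. of_real (r i) * unity_root M ^ w i)"

text \<open>
  The coefficient of \<open>z\<^sup>g\<close>, times the value of the monomial at the radii \<open>r\<close>, as an average over a
  discrete torus; it is exact once \<open>M\<close> exceeds the degrees that occur.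
\<close>

definition torus_coeff :: "nat \<Rightarrow> ('d::finite \<Rightarrow> real) \<Rightarrow> ('d \<Rightarrow> nat) \<Rightarrow> (complex ^ 'd \<Rightarrow> complex) \<Rightarrow> complex" where
  "torus_coeff M r g p = (\<Sum>w\<in>box M. (\<Prod>i\<in>UNIV. cnj (unity_root M ^ w i) ^ g i) * p (torus_point M r w)) / of_nat M ^ CARD('d)"

lemma card_box: "card (box M :: ('d::finite \<Rightarrow> nat) set) = M ^ CARD('d)"
  by (simp add: card_PiE)

lemma finite_box [simp]: "finite (box M :: ('d::finite \<Rightarrow> nat) set)"
  by (intro finite_PiE) auto

lemma torus_coeff_zpow:
  fixes g h :: "'d::finite \<Rightarrow> nat"
  assumes M: "0 < M"
  shows "torus_coeff M r g (\<lambda>z. zpow z h) =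
    (if \<forall>i. h i mod M = g i mod M then (\<Prod>i\<in>UNIV. of_real (r i) ^ h i) else 0)"
proof -
  have "(\<Sum>w\<in>box M. (\<Prod>i\<in>UNIV. cnj (unity_root M ^ w i) ^ g i) * zpow (torus_point M r w) h) =
      (\<Sum>w\<in>box M. \<Prod>i\<in>UNIV. of_real (r i) ^ h i * ((unity_root M ^ w i) ^ h i * cnj (unity_root M ^ w i) ^ g i))"
    unfolding zpow_def torus_point_def
    by (intro sum.cong refl) (simp add: power_mult_distrib prod.distrib mult_ac)
  also have "\<dots> = (\<Prod>i\<in>UNIV. \<Sum>j<M. of_real (r i) ^ h i * ((unity_root M ^ j) ^ h i * cnj (unity_root M ^ j) ^ g i))"
    by (rule prod_sum_PiE[symmetric]) auto
  also have "\<dots> = (\<Prod>i\<in>UNIV. of_real (r i) ^ h i * (if h i mod M = g i mod M then of_nat M else 0))"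
    by (simp only: sum_distrib_left[symmetric] sum_unity_root[OF M])
  also have "\<dots> = (\<Prod>i\<in>UNIV. of_real (r i) ^ h i) * (if \<forall>i. h i mod M = g i mod M then of_nat M ^ CARD('d) else 0)"
    by (simp add: prod.distrib) (auto simp: prod_zero_iff)
  finally show ?thesis unfolding torus_coeff_def using M by simp
qed

lemma torus_coeff_add: "torus_coeff M r g (\<lambda>z. p z + q z) = torus_coeff M r g p + torus_coeff M r g q"
  unfolding torus_coeff_def by (simp add: ring_distribs sum.distrib add_divide_distrib)

lemma torus_coeff_mult: "torus_coeff M r g (\<lambda>z. c * p z) = c * torus_coeff M r g p"
  unfolding torus_coeff_def by (simp add: sum_distrib_left mult_ac)

lemma norm_torus_point: "norm (torus_point M r w) = sqrt (\<Sum>i\<in>UNIV. (r i)\<^sup>2)"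
  unfolding norm_vec_def L2_set_def torus_point_def by (simp add: norm_mult norm_power)

lemma torus_coeff_bound:
  fixes p :: "complex ^ 'd::finite \<Rightarrow> complex"
  assumes "0 < M" and "\<And>z. norm z = sqrt (\<Sum>i\<in>UNIV. (r i)\<^sup>2) \<Longrightarrow> cmod (p z) \<le> D"
  shows "cmod (torus_coeff M r g p) \<le> D"
proof -
  have "cmod (\<Sum>w\<in>box M. (\<Prod>i\<in>UNIV. cnj (unity_root M ^ w i) ^ g i) * p (torus_point M r w)) \<le> (\<Sum>w\<in>(box M :: ('d \<Rightarrow> nat) set). D)"
    by (intro sum_norm_le) (simp add: norm_mult norm_power prod_norm[symmetric] assms(2) norm_torus_point)
  also have "\<dots> = real M ^ CARD('d) * D" by (simp add: card_box)
  finally show ?thesis unfolding torus_coeff_def using assms(1)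
    by (simp add: norm_divide norm_power divide_le_eq mult.commute)
qed

section \<open>Monomials in a commuting tuple\<close>

text \<open>
  The relation avoids a choice of order for the factors of a monomial in the tuple; for a commuting tuple it is
  functional (lemma \<open>mono_mat_unique\<close>).
\<close>

inductive mono_mat :: "nat \<Rightarrow> ('d::finite \<Rightarrow> complex Matrix.mat) \<Rightarrow> ('d \<Rightarrow> nat) \<Rightarrow> complex Matrix.mat \<Rightarrow> bool"
  for n X where
  one: "mono_mat n X (\<lambda>_. 0) (1\<^sub>m n)"
| step: "mono_mat n X g A \<Longrightarrow> mono_mat n X (g(i := Suc (g i))) (X i * A)"

context
  fixes n :: nat and X :: "'d::finite \<Rightarrow> complex Matrix.mat"
  assumes X: "\<And>i. X i \<in> carrier_mat n n" and comm: "\<And>i j. X i * X j = X j * X i"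
begin

lemma mono_mat_carrier: "mono_mat n X g A \<Longrightarrow> A \<in> carrier_mat n n"
  by (induction rule: mono_mat.induct) (auto intro: mult_carrier_mat[OF X])

lemma mono_mat_peel:
  assumes "mono_mat n X g A" "0 < g i"
  shows "\<exists>B. mono_mat n X (g(i := g i - 1)) B \<and> A = X i * B"
  using assms
proof (induction rule: mono_mat.induct)
  case (step g A k)
  have A: "A \<in> carrier_mat n n" using mono_mat_carrier step by blast
  show ?case
  proof (cases "k = i")
    case True
    have e: "(g(i := Suc (g i)))(i := (g(i := Suc (g i))) i - 1) = g" by auto
    show ?thesis unfolding True e using step(1) by blast
  next
    case False
    then have "0 < g i" using step.prems by simp
    then obtain B where B: "mono_mat n X (g(i := g i - 1)) B" "A = X i * B" using step.IH by blast
    have Bc: "B \<in> carrier_mat n n" using mono_mat_carrier B by blast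
    have "mono_mat n X ((g(i := g i - 1))(k := Suc ((g(i := g i - 1)) k))) (X k * B)" by (rule mono_mat.step[OF B(1)])
    moreover have "(g(i := g i - 1))(k := Suc ((g(i := g i - 1)) k)) = (g(k := Suc (g k)))(i := (g(k := Suc (g k))) i - 1)"
      using False by auto
    moreover have "X k * A = X i * (X k * B)"
      unfolding B(2) using assoc_mult_mat[OF X X Bc, of k i] assoc_mult_mat[OF X X Bc, of i k] comm[of k i] by simp
    ultimately show ?thesis by metis
  qed
qed simp

lemma mono_mat_0: "mono_mat n X g A \<Longrightarrow> g = (\<lambda>_. 0) \<Longrightarrow> A = 1\<^sub>m n"
  by (induction rule: mono_mat.induct) (metis fun_upd_same nat.distinct(1))+

lemma mono_mat_unique:
  assumes "mono_mat n X g A" "mono_mat n X g B"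
  shows "A = B"
  using assms
proof (induction "\<Sum>i\<in>UNIV. g i" arbitrary: g A B)
  case 0
  then have "g = (\<lambda>_. 0)" by (auto simp: fun_eq_iff)
  then show ?case using mono_mat_0 0 by metis
next
  case (Suc m)
  then have "\<exists>i. 0 < g i" by (metis gr0I nat.distinct(1) sum.neutral)
  then obtain i where i: "0 < g i" by blast
  obtain A' where A': "mono_mat n X (g(i := g i - 1)) A'" "A = X i * A'" using mono_mat_peel[OF Suc(3) i] by blast
  obtain B' where B': "mono_mat n X (g(i := g i - 1)) B'" "B = X i * B'" using mono_mat_peel[OF Suc(4) i] by blast
  have "(\<Sum>j\<in>UNIV. (g(i := g i - 1)) j) = m"
  proof -
    have "(\<Sum>j\<in>UNIV. g j) = g i + (\<Sum>j\<in>UNIV - {i}. g j)" by (rule sum.remove) auto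
    moreover have "(\<Sum>j\<in>UNIV. (g(i := g i - 1)) j) = (g i - 1) + (\<Sum>j\<in>UNIV - {i}. g j)"
      by (subst sum.remove[of _ i]) auto
    ultimately show ?thesis using Suc(2) i by linarith
  qed
  then have "A' = B'" using Suc(1) A' B' by metis
  then show ?case using A' B' by simp
qed

lemma mono_mat_mult:
  assumes "mono_mat n X g A" "mono_mat n X h B"
  shows "mono_mat n X (\<lambda>i. g i + h i) (A * B)"
  using assms
proof (induction rule: mono_mat.induct)
  case one
  then show ?case using left_mult_one_mat[OF mono_mat_carrier[OF one]] by simp
next
  case (step g A k)
  have "mono_mat n X ((\<lambda>i. g i + h i)(k := Suc (g k + h k))) (X k * (A * B))"
    using step mono_mat.step by blast
  moreover have "(\<lambda>i. g i + h i)(k := Suc (g k + h k)) = (\<lambda>i. (g(k := Suc (g k))) i + h i)" by auto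
  moreover have "X k * (A * B) = X k * A * B"
    using step mono_mat_carrier X by (intro assoc_mult_mat[symmetric, of _ n n _ n _ n]) auto
  ultimately show ?case by simp
qed

text \<open>
  The bound $\|X^g\|^2 \le \frac{g!}{|g|!} \rho^{2|g|}$ for a tuple of row norm at most \<open>\<rho>\<close>. Summing the induction
  hypothesis over the ways to split off one factor, weighted by the multiplicities \<open>g i\<close>, uses the row
  norm once per degree.
\<close>

lemma mono_mat_adjoint_bound:
  assumes \<rho>: "\<And>v. v \<in> carrier_vec n \<Longrightarrow> (\<Sum>i\<in>UNIV. (cvec_norm (mat_adjoint (X i) *\<^sub>v v))\<^sup>2) \<le> \<rho>\<^sup>2 * (cvec_norm v)\<^sup>2"
    and "mono_mat n X g A" "v \<in> carrier_vec n"
  shows "fact (\<Sum>i\<in>UNIV. g i) * (cvec_norm (mat_adjoint A *\<^sub>v v))\<^sup>2 \<le>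
    (\<Prod>i\<in>UNIV. fact (g i)) * \<rho> ^ (2 * (\<Sum>i\<in>UNIV. g i)) * (cvec_norm v)\<^sup>2"
  using assms(2,3)
proof (induction "\<Sum>i\<in>UNIV. g i" arbitrary: g A v)
  case 0
  then have "g = (\<lambda>_. 0)" by (auto simp: fun_eq_iff)
  then have "A = 1\<^sub>m n" using mono_mat_0 0 by blast
  moreover have "mat_adjoint (1\<^sub>m n) = (1\<^sub>m n :: complex Matrix.mat)"
  proof (rule eq_matI)
    have c: "(1\<^sub>m n :: complex Matrix.mat) \<in> carrier_mat n n" by simp
    note c' = mat_adjoint_carrier[OF c]
    show "dim_row (mat_adjoint (1\<^sub>m n :: complex Matrix.mat)) = dim_row (1\<^sub>m n :: complex Matrix.mat)"
      "dim_col (mat_adjoint (1\<^sub>m n :: complex Matrix.mat)) = dim_col (1\<^sub>m n :: complex Matrix.mat)"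
      using carrier_matD[OF c'] by simp_all
    fix i j assume "i < dim_row (1\<^sub>m n :: complex Matrix.mat)" "j < dim_col (1\<^sub>m n :: complex Matrix.mat)"
    then show "mat_adjoint (1\<^sub>m n) $$ (i, j) = (1\<^sub>m n :: complex Matrix.mat) $$ (i, j)"
      by (simp add: mat_adjoint_index[OF c])
  qed
  ultimately show ?case using \<open>g = (\<lambda>_. 0)\<close> 0 by simp
next
  case (Suc m)
  note v = \<open>v \<in> carrier_vec n\<close>
  let ?P = "\<Prod>i\<in>UNIV. fact (g i) :: real"
  have i_bound: "real (g i) * (fact m * (cvec_norm (mat_adjoint A *\<^sub>v v))\<^sup>2) \<le> ?P * \<rho> ^ (2 * m) * (cvec_norm (mat_adjoint (X i) *\<^sub>v v))\<^sup>2" for i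
  proof (cases "g i = 0")
    case True
    have "0 \<le> ?P * \<rho> ^ (2 * m) * (cvec_norm (mat_adjoint (X i) *\<^sub>v v))\<^sup>2"
      by (intro mult_nonneg_nonneg prod_nonneg) (auto simp: power_mult)
    then show ?thesis using True by simp
  next
    case False
    then have i: "0 < g i" by simp
    obtain B where B: "mono_mat n X (g(i := g i - 1)) B" "A = X i * B" using mono_mat_peel[OF Suc(3) i] by blast
    have Bc: "B \<in> carrier_mat n n" using mono_mat_carrier B by blast
    have sm: "(\<Sum>j\<in>UNIV. (g(i := g i - 1)) j) = m"
    proof -
      have "(\<Sum>j\<in>UNIV. g j) = g i + (\<Sum>j\<in>UNIV - {i}. g j)" by (rule sum.remove) auto
      moreover have "(\<Sum>j\<in>UNIV. (g(i := g i - 1)) j) = (g i - 1) + (\<Sum>j\<in>UNIV - {i}. g j)"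
        by (subst sum.remove[of _ i]) auto
      ultimately show ?thesis using Suc(2) i by linarith
    qed
    have pf: "real (g i) * (\<Prod>j\<in>UNIV. fact ((g(i := g i - 1)) j)) = ?P"
    proof -
      have "?P = fact (g i) * (\<Prod>j\<in>UNIV - {i}. fact (g j))" by (rule prod.remove) auto
      moreover have "(\<Prod>j\<in>UNIV. fact ((g(i := g i - 1)) j)) = fact (g i - 1) * (\<Prod>j\<in>UNIV - {i}. fact (g j) :: real)"
        by (subst prod.remove[of _ i]) auto
      moreover have "fact (g i) = real (g i) * fact (g i - 1)" using i by (rule fact_reduce)
      ultimately show ?thesis by simp
    qed
    have w: "mat_adjoint (X i) *\<^sub>v v \<in> carrier_vec n" by (rule mult_mat_vec_carrier[OF mat_adjoint_carrier[OF X] v])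
    have eq: "mat_adjoint A *\<^sub>v v = mat_adjoint B *\<^sub>v (mat_adjoint (X i) *\<^sub>v v)"
      unfolding B(2) mat_adjoint_mult[OF X Bc]
      by (rule assoc_mult_mat_vec[OF mat_adjoint_carrier[OF Bc] mat_adjoint_carrier[OF X] v])
    have "fact m * (cvec_norm (mat_adjoint A *\<^sub>v v))\<^sup>2 \<le>
        (\<Prod>j\<in>UNIV. fact ((g(i := g i - 1)) j)) * \<rho> ^ (2 * m) * (cvec_norm (mat_adjoint (X i) *\<^sub>v v))\<^sup>2"
      using Suc(1)[OF sm[symmetric] B(1) w] unfolding sm eq .
    then have "real (g i) * (fact m * (cvec_norm (mat_adjoint A *\<^sub>v v))\<^sup>2) \<le>
        real (g i) * ((\<Prod>j\<in>UNIV. fact ((g(i := g i - 1)) j)) * \<rho> ^ (2 * m) * (cvec_norm (mat_adjoint (X i) *\<^sub>v v))\<^sup>2)"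
      by (rule mult_left_mono) simp
    also have "\<dots> = (real (g i) * (\<Prod>j\<in>UNIV. fact ((g(i := g i - 1)) j))) * \<rho> ^ (2 * m) * (cvec_norm (mat_adjoint (X i) *\<^sub>v v))\<^sup>2"
      by (simp only: mult.assoc)
    finally show ?thesis unfolding pf .
  qed
  have "fact (Suc m) * (cvec_norm (mat_adjoint A *\<^sub>v v))\<^sup>2 = (\<Sum>i\<in>UNIV. real (g i)) * (fact m * (cvec_norm (mat_adjoint A *\<^sub>v v))\<^sup>2)"
  proof -
    have "(\<Sum>i\<in>UNIV. real (g i)) = real (Suc m)" unfolding Suc(2) by simp
    then show ?thesis by (simp only: fact_Suc of_nat_mult mult.assoc of_nat_id)
  qed
  also have "\<dots> = (\<Sum>i\<in>UNIV. real (g i) * (fact m * (cvec_norm (mat_adjoint A *\<^sub>v v))\<^sup>2))"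
    by (rule sum_distrib_right)
  also have "\<dots> \<le> (\<Sum>i\<in>UNIV. ?P * \<rho> ^ (2 * m) * (cvec_norm (mat_adjoint (X i) *\<^sub>v v))\<^sup>2)"
    by (intro sum_mono i_bound)
  also have "\<dots> = ?P * \<rho> ^ (2 * m) * (\<Sum>i\<in>UNIV. (cvec_norm (mat_adjoint (X i) *\<^sub>v v))\<^sup>2)"
    by (simp only: sum_distrib_left)
  also have "\<dots> \<le> ?P * \<rho> ^ (2 * m) * (\<rho>\<^sup>2 * (cvec_norm v)\<^sup>2)"
    by (intro mult_left_mono \<rho> v mult_nonneg_nonneg prod_nonneg) (auto simp: power_mult)
  also have "\<dots> = ?P * \<rho> ^ (2 * Suc m) * (cvec_norm v)\<^sup>2" by (simp add: power2_eq_square)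
  finally show ?case using Suc(2) by simp
qed

text \<open>
  \<open>span_mat p A\<close> relates a polynomial function to its value at \<open>X\<close>. As a relation it needs no proof that the
  value is independent of the presentation of the polynomial; that follows from \<open>span_mat_bound\<close>.
\<close>

inductive span_mat :: "(complex ^ 'd \<Rightarrow> complex) \<Rightarrow> complex Matrix.mat \<Rightarrow> bool" where
  zero: "span_mat (\<lambda>z. 0) (0\<^sub>m n n)"
| step: "span_mat p A \<Longrightarrow> mono_mat n X g B \<Longrightarrow> span_mat (\<lambda>z. p z + c * zpow z g) (A + c \<cdot>\<^sub>m B)"

lemma span_mat_carrier: "span_mat p A \<Longrightarrow> A \<in> carrier_mat n n"
proof (induction rule: span_mat.induct)
  case (step p A g B c)
  then show ?case using mono_mat_carrier[OF step.hyps(2)] by simp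
qed simp

lemma span_mat_add:
  assumes "span_mat p A" "span_mat q B"
  shows "span_mat (\<lambda>z. p z + q z) (A + B)"
  using assms(2,1)
proof (induction rule: span_mat.induct)
  case zero
  then show ?case using span_mat_carrier by simp
next
  case (step q B g C c)
  have "span_mat (\<lambda>z. (p z + q z) + c * zpow z g) ((A + B) + c \<cdot>\<^sub>m C)"
    using step by (intro span_mat.step) auto
  moreover have "(A + B) + c \<cdot>\<^sub>m C = A + (B + c \<cdot>\<^sub>m C)"
    using step span_mat_carrier mono_mat_carrier by (intro assoc_add_mat[of _ n n]) auto
  moreover have "(\<lambda>z. (p z + q z) + c * zpow z g) = (\<lambda>z. p z + (q z + c * zpow z g))" by (simp add: add.assoc)
  ultimately show ?case by simp
qed

lemma zpow_add: "zpow z (\<lambda>i. g i + h i) = zpow z g * zpow z h"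
  unfolding zpow_def by (simp add: power_add prod.distrib)

lemma span_mat_mono_mult:
  assumes "span_mat p A" "mono_mat n X g B"
  shows "span_mat (\<lambda>z. c * zpow z g * p z) ((c \<cdot>\<^sub>m B) * A)"
  using assms
proof (induction rule: span_mat.induct)
  case zero
  have "(c \<cdot>\<^sub>m B) * 0\<^sub>m n n = 0\<^sub>m n n" using mono_mat_carrier[OF zero] by (intro right_mult_zero_mat) auto
  then show ?case using span_mat.zero by simp
next
  case (step p A h C e)
  note Bc = mono_mat_carrier[OF step.prems] and Cc = mono_mat_carrier[OF step.hyps(2)] and Ac = span_mat_carrier[OF step.hyps(1)]
  have "span_mat (\<lambda>z. c * zpow z g * p z + (c * e) * zpow z (\<lambda>i. g i + h i)) ((c \<cdot>\<^sub>m B) * A + (c * e) \<cdot>\<^sub>m (B * C))"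
    using step by (intro span_mat.step mono_mat_mult) auto
  moreover have "(c \<cdot>\<^sub>m B) * A + (c * e) \<cdot>\<^sub>m (B * C) = (c \<cdot>\<^sub>m B) * (A + e \<cdot>\<^sub>m C)"
  proof -
    have "(c \<cdot>\<^sub>m B) * (A + e \<cdot>\<^sub>m C) = (c \<cdot>\<^sub>m B) * A + (c \<cdot>\<^sub>m B) * (e \<cdot>\<^sub>m C)"
      using Bc Ac Cc by (intro mult_add_distrib_mat[of _ n n _ n]) auto
    also have "(c \<cdot>\<^sub>m B) * (e \<cdot>\<^sub>m C) = (c * e) \<cdot>\<^sub>m (B * C)"
    proof -
      have "(c \<cdot>\<^sub>m B) * (e \<cdot>\<^sub>m C) = e \<cdot>\<^sub>m ((c \<cdot>\<^sub>m B) * C)"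
        using Bc Cc by (intro mult_smult_distrib[of _ n n _ n]) auto
      also have "(c \<cdot>\<^sub>m B) * C = c \<cdot>\<^sub>m (B * C)" using Bc Cc by (intro mult_smult_assoc_mat[of _ n n _ n]) auto
      finally show ?thesis using Bc Cc by (intro eq_matI) auto
    qed
    finally show ?thesis by simp
  qed
  moreover have "(\<lambda>z. c * zpow z g * p z + (c * e) * zpow z (\<lambda>i. g i + h i)) = (\<lambda>z. c * zpow z g * (p z + e * zpow z h))"
    by (simp add: zpow_add algebra_simps)
  ultimately show ?case by simp
qed

lemma span_mat_mult:
  assumes "span_mat p A" "span_mat q B"
  shows "span_mat (\<lambda>z. p z * q z) (A * B)"
  using assms
proof (induction rule: span_mat.induct)
  case zero
  then show ?case using left_mult_zero_mat[OF span_mat_carrier[OF zero]] span_mat.zero by simp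
next
  case (step p A g C c)
  note Bc = span_mat_carrier[OF step.prems] and Cc = mono_mat_carrier[OF step.hyps(2)] and Ac = span_mat_carrier[OF step.hyps(1)]
  have "span_mat (\<lambda>z. p z * q z + c * zpow z g * q z) (A * B + (c \<cdot>\<^sub>m C) * B)"
    using step by (intro span_mat_add span_mat_mono_mult) auto
  moreover have "A * B + (c \<cdot>\<^sub>m C) * B = (A + c \<cdot>\<^sub>m C) * B"
    using Ac Bc Cc by (intro add_mult_distrib_mat[symmetric, of _ n n _ _ n]) auto
  ultimately show ?case by (simp add: algebra_simps)
qed

lemma span_mat_mono:
  assumes "mono_mat n X g B"
  shows "span_mat (\<lambda>z. c * zpow z g) (c \<cdot>\<^sub>m B)"
  using span_mat.step[OF span_mat.zero assms, of c] mono_mat_carrier[OF assms] by simp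

lemma span_mat_const: "span_mat (\<lambda>z. c) (c \<cdot>\<^sub>m 1\<^sub>m n)"
  using span_mat_mono[OF mono_mat.one, of c] by (simp add: zpow_def)

lemma span_mat_coord: "span_mat (\<lambda>z. vec_nth z i) (X i)"
proof -
  have m: "mono_mat n X ((\<lambda>_. 0)(i := Suc 0)) (X i * 1\<^sub>m n)" using mono_mat.step[OF mono_mat.one[of n X], of i] by simp
  have "zpow z ((\<lambda>_. 0)(i := Suc 0)) = vec_nth z i" for z :: "complex ^ 'd"
  proof -
    have "zpow z ((\<lambda>_. 0)(i := Suc 0)) = (\<Prod>j\<in>UNIV. if j = i then vec_nth z i else 1)"
      unfolding zpow_def by (intro prod.cong) auto
    then show ?thesis by simp
  qed
  moreover have "1 \<cdot>\<^sub>m (X i * 1\<^sub>m n) = X i" using X[of i] by (intro eq_matI) auto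
  ultimately show ?thesis using span_mat_mono[OF m, of 1] by simp
qed

lemma span_mat_smult: "span_mat p A \<Longrightarrow> span_mat (\<lambda>z. c * p z) (c \<cdot>\<^sub>m A)"
proof -
  assume p: "span_mat p A"
  have "(c \<cdot>\<^sub>m 1\<^sub>m n) * A = c \<cdot>\<^sub>m A"
    using span_mat_carrier[OF p] by (simp add: mult_smult_assoc_mat[of _ n n _ n])
  then show ?thesis using span_mat_mult[OF span_mat_const p, of c] by simp
qed

lemma span_mat_polyfun: "p \<in> polyfun \<Longrightarrow> \<exists>A. span_mat p A"
proof (induction rule: polyfun.induct)
  case (const c)
  then show ?case using span_mat_const by blast
next
  case (coord i)
  then show ?case using span_mat_coord by blast
next
  case (add p q)
  then show ?case using span_mat_add by blast
next
  case (mult p q)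
  then show ?case using span_mat_mult by blast
qed

text \<open>
  A polynomial evaluated at \<open>X\<close> is recovered from its values on tori. The radii may depend on the
  monomial, which is essential for the estimate that follows.
\<close>

lemma span_mat_expansion:
  assumes "span_mat p A"
  shows "\<exists>M0. \<forall>M\<ge>M0. \<forall>r B. (\<forall>g i. 0 < g i \<longrightarrow> r g i \<noteq> (0::real)) \<longrightarrow> (\<forall>g A. mono_mat n X g A \<longrightarrow> B g = A) \<longrightarrow>
    (\<forall>i<n. \<forall>j<n. A $$ (i, j) = (\<Sum>g\<in>box M. torus_coeff M (r g) g p / (\<Prod>k\<in>UNIV. of_real (r g k) ^ g k) * B g $$ (i, j)))"
  using assms
proof (induction rule: span_mat.induct)
  case zero
  have "torus_coeff M r g (\<lambda>z. 0) = 0" for M r and g :: "'d \<Rightarrow> nat" by (simp add: torus_coeff_def)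
  then show ?case by simp
next
  case (step p A h C c)
  then obtain M0 where M0: "\<forall>M\<ge>M0. \<forall>r B. (\<forall>g i. 0 < g i \<longrightarrow> r g i \<noteq> (0::real)) \<longrightarrow> (\<forall>g A. mono_mat n X g A \<longrightarrow> B g = A) \<longrightarrow>
    (\<forall>i<n. \<forall>j<n. A $$ (i, j) = (\<Sum>g\<in>box M. torus_coeff M (r g) g p / (\<Prod>k\<in>UNIV. of_real (r g k) ^ g k) * B g $$ (i, j)))"
    by blast
  note Cc = mono_mat_carrier[OF step.hyps(2)] and Ac = span_mat_carrier[OF step.hyps(1)]
  define M1 where "M1 = max M0 (Suc (\<Sum>i\<in>UNIV. h i))"
  show ?case
  proof (intro exI[of _ M1] allI impI)
    fix M and r :: "('d \<Rightarrow> nat) \<Rightarrow> 'd \<Rightarrow> real" and B i j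
    assume M: "M1 \<le> M" and r: "\<forall>g i. 0 < g i \<longrightarrow> r g i \<noteq> (0::real)" and B: "\<forall>g A. mono_mat n X g A \<longrightarrow> B g = A" and ij: "i < n" "j < n"
    have hM: "h k < M" for k
    proof -
      have "h k \<le> (\<Sum>i\<in>UNIV. h i)" by (rule member_le_sum) auto
      then show ?thesis using M by (simp add: M1_def)
    qed
    then have Mpos: "0 < M" by (metis gr_zeroI less_nat_zero_code)
    have hb: "h \<in> box M" using hM by auto
    have tc: "torus_coeff M (r g) g (\<lambda>z. zpow z h) / (\<Prod>k\<in>UNIV. of_real (r g k) ^ g k) = (if g = h then 1 else 0)" if "g \<in> box M" for g
    proof -
      have "h k mod M = g k mod M \<longleftrightarrow> h k = g k" for k
      proof -
        have "g k < M" using that by (auto simp: PiE_iff)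
        then show ?thesis using hM[of k] by simp
      qed
      then have "(\<forall>k. h k mod M = g k mod M) \<longleftrightarrow> g = h" by (auto simp: fun_eq_iff)
      moreover have "(\<Prod>k\<in>UNIV. of_real (r h k) ^ h k) \<noteq> (0::complex)"
        using r by (auto simp: prod_zero_iff)
      ultimately show ?thesis unfolding torus_coeff_zpow[OF Mpos] by auto
    qed
    have "(\<Sum>g\<in>box M. torus_coeff M (r g) g (\<lambda>z. p z + c * zpow z h) / (\<Prod>k\<in>UNIV. of_real (r g k) ^ g k) * B g $$ (i, j)) =
        (\<Sum>g\<in>box M. torus_coeff M (r g) g p / (\<Prod>k\<in>UNIV. of_real (r g k) ^ g k) * B g $$ (i, j)) +
        (\<Sum>g\<in>box M. c * (torus_coeff M (r g) g (\<lambda>z. zpow z h) / (\<Prod>k\<in>UNIV. of_real (r g k) ^ g k)) * B g $$ (i, j))"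
      by (simp add: torus_coeff_add torus_coeff_mult add_divide_distrib ring_distribs sum.distrib mult_ac)
    also have "(\<Sum>g\<in>box M. torus_coeff M (r g) g p / (\<Prod>k\<in>UNIV. of_real (r g k) ^ g k) * B g $$ (i, j)) = A $$ (i, j)"
    proof -
      have "M0 \<le> M" using M by (simp add: M1_def)
      show ?thesis
        by (rule M0[THEN spec, THEN mp, OF \<open>M0 \<le> M\<close>, THEN spec, of r, THEN spec, of B, THEN mp, OF r, THEN mp, OF B, rule_format, OF ij, symmetric])
    qed
    also have "(\<Sum>g\<in>box M. c * (torus_coeff M (r g) g (\<lambda>z. zpow z h) / (\<Prod>k\<in>UNIV. of_real (r g k) ^ g k)) * B g $$ (i, j)) =
        (\<Sum>g\<in>box M. if g = h then c * B h $$ (i, j) else 0)"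
      using tc by (intro sum.cong refl) simp
    also have "\<dots> = c * C $$ (i, j)" using hb B step.hyps(2) by simp
    finally show "(A + c \<cdot>\<^sub>m C) $$ (i, j) = (\<Sum>g\<in>box M. torus_coeff M (r g) g (\<lambda>z. p z + c * zpow z h) / (\<Prod>k\<in>UNIV. of_real (r g k) ^ g k) * B g $$ (i, j))"
      using Ac Cc ij by simp
  qed
qed

end

section \<open>Convergence of power series in a commuting row contraction\<close>

text \<open>
  A crude form of Stirling's formula; with \<open>k\<^sup>k \<le> k! e\<^sup>k\<close> it compares multinomial coefficients with powers.
\<close>

lemma fact_upper_bound: "(fact k :: real) \<le> exp 1 * real (k + 1) * (real k / exp 1) ^ k"
proof (cases "k = 0")
  case True
  then show ?thesis by simp
next
  case False
  then have "1 \<le> k" by simp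
  then have "(fact k :: real) \<le> exp 1 * real k * (real k / exp 1) ^ k"
  proof (induction k rule: dec_induct)
    case base
    then show ?case by simp
  next
    case (step k)
    have k: "0 < real k" using step by simp
    have "1 + (- (1 / real (Suc k))) \<le> exp (- (1 / real (Suc k)))" by (rule exp_ge_add_one_self)
    moreover have "1 + (- (1 / real (Suc k))) = real k / real (Suc k)" by (simp add: field_simps)
    ultimately have "real k / real (Suc k) \<le> 1 / exp (1 / real (Suc k))" by (simp add: exp_minus divide_inverse)
    then have "exp (1 / real (Suc k)) * real k \<le> real (Suc k)"
      by (simp add: field_simps del: of_nat_Suc)
    then have "(exp (1 / real (Suc k)) * real k) ^ Suc k \<le> real (Suc k) ^ Suc k"
      using k by (intro power_mono) auto
    moreover have "exp (1 / real (Suc k)) ^ Suc k = exp 1"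
      by (simp only: exp_of_nat_mult[symmetric]) simp
    ultimately have e: "exp 1 * real k ^ Suc k \<le> real (Suc k) ^ Suc k"
      by (simp only: power_mult_distrib)
    have "(fact (Suc k) :: real) = real (Suc k) * fact k" by simp
    also have "\<dots> \<le> real (Suc k) * (exp 1 * real k * (real k / exp 1) ^ k)"
      using step by (intro mult_left_mono) auto
    also have "\<dots> = real (Suc k) * (exp 1 * real k ^ Suc k) / exp 1 ^ k"
      by (simp add: power_divide)
    also have "\<dots> \<le> real (Suc k) * real (Suc k) ^ Suc k / exp 1 ^ k"
      by (intro divide_right_mono mult_left_mono e) auto
    also have "\<dots> = exp 1 * real (Suc k) * (real (Suc k) / exp 1) ^ Suc k"
      by (simp add: power_divide)
    finally show ?case .
  qed
  also have "\<dots> \<le> exp 1 * real (k + 1) * (real k / exp 1) ^ k"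
    by (intro mult_right_mono mult_left_mono) auto
  finally show ?thesis .
qed

text \<open>
  Up to a polynomial factor in the degree, the inverse of the multinomial coefficient is the product
  of the powers \<open>(g\<^sub>i / m)\<^bsup>g\<^sub>i\<^esup>\<close>.
\<close>

lemma multinomial_inverse_bound:
  fixes g :: "'d::finite \<Rightarrow> nat"
  defines "m \<equiv> \<Sum>i\<in>UNIV. g i"
  shows "(\<Prod>i\<in>UNIV. fact (g i)) \<le> fact m * ((exp 1 * (real m + 1)) ^ CARD('d) * (\<Prod>i\<in>UNIV. (real (g i) / real m) ^ g i))"
proof -
  have gm: "g i \<le> m" for i unfolding m_def by (rule member_le_sum) auto
  have pm: "(\<Prod>i\<in>UNIV. x ^ g i) = x ^ m" for x :: real unfolding m_def by (simp add: power_sum)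
  have "(\<Prod>i\<in>UNIV. fact (g i) :: real) \<le> (\<Prod>i\<in>UNIV. (exp 1 * (real m + 1)) * (real (g i) / exp 1) ^ g i)"
  proof (rule prod_mono, intro conjI)
    fix i
    have "(fact (g i) :: real) \<le> exp 1 * real (g i + 1) * (real (g i) / exp 1) ^ g i" by (rule fact_upper_bound)
    also have "\<dots> \<le> exp 1 * (real m + 1) * (real (g i) / exp 1) ^ g i"
      using gm[of i] by (intro mult_right_mono mult_left_mono) auto
    finally show "(fact (g i) :: real) \<le> exp 1 * (real m + 1) * (real (g i) / exp 1) ^ g i" .
  qed simp
  also have "\<dots> = (exp 1 * (real m + 1)) ^ CARD('d) * ((\<Prod>i\<in>UNIV. real (g i) ^ g i) / exp 1 ^ m)"
    by (simp add: prod.distrib power_divide prod_dividef pm)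
  also have "\<dots> \<le> (exp 1 * (real m + 1)) ^ CARD('d) * (fact m * ((\<Prod>i\<in>UNIV. real (g i) ^ g i) / real m ^ m))"
  proof (intro mult_left_mono)
    have "real m ^ m \<le> fact m * exp (real m)" by (rule power_le_fact_exp) simp
    then have a: "real m ^ m \<le> fact m * exp 1 ^ m" by (simp flip: exp_of_nat_mult)
    have mm: "0 < real m ^ m" by (cases "m = 0") auto
    have "1 / exp 1 ^ m \<le> fact m / real m ^ m" using a mm by (simp add: divide_simps)
    then have "(\<Prod>i\<in>UNIV. real (g i) ^ g i) * (1 / exp 1 ^ m) \<le> (\<Prod>i\<in>UNIV. real (g i) ^ g i) * (fact m / real m ^ m)"
      by (rule mult_left_mono) (auto intro!: prod_nonneg)
    then show "(\<Prod>i\<in>UNIV. real (g i) ^ g i) / exp 1 ^ m \<le> fact m * ((\<Prod>i\<in>UNIV. real (g i) ^ g i) / real m ^ m)"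
      by (simp add: mult.commute)
  qed simp
  also have "(\<Prod>i\<in>UNIV. real (g i) ^ g i) / real m ^ m = (\<Prod>i\<in>UNIV. (real (g i) / real m) ^ g i)"
    by (simp add: power_divide prod_dividef pm)
  finally show ?thesis by (simp add: mult_ac)
qed

lemma summable_poly_geometric:
  fixes \<theta> :: real
  assumes "0 < \<theta>" "\<theta> < 1"
  shows "summable (\<lambda>k. (real k + 1) ^ d * \<theta> ^ k)"
proof -
  define a where "a = - ln \<theta> / 2"
  have a: "0 < a" unfolding a_def using assms by simp
  define s where "s = exp a * \<theta>"
  have "s = exp (- ln \<theta> / 2) * exp (ln \<theta>)" unfolding s_def a_def using assms by simp
  also have "\<dots> = exp (ln \<theta> / 2)" by (simp flip: exp_add)
  finally have s: "0 < s" "s < 1" using assms by (auto simp: s_def)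
  have le: "(real k + 1) ^ d * \<theta> ^ k \<le> fact d * exp a / a ^ d * s ^ k" for k
  proof -
    have "(a * (real k + 1)) ^ d \<le> fact d * exp (a * (real k + 1))"
      using a by (intro power_le_fact_exp) auto
    then have "(real k + 1) ^ d \<le> fact d * exp (a * (real k + 1)) / a ^ d"
      using a by (simp add: power_mult_distrib le_divide_eq mult.commute)
    also have "exp (a * (real k + 1)) = exp a * exp a ^ k"
      by (simp add: ring_distribs exp_add mult.commute flip: exp_of_nat_mult)
    finally have "(real k + 1) ^ d * \<theta> ^ k \<le> (fact d * (exp a * exp a ^ k) / a ^ d) * \<theta> ^ k"
      using assms by (intro mult_right_mono) auto
    then show ?thesis unfolding s_def by (simp add: power_mult_distrib mult_ac)
  qed
  have "summable (\<lambda>k. fact d * exp a / a ^ d * s ^ k)"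
    using s by (intro summable_mult summable_geometric) simp
  then show ?thesis
  proof (rule summable_comparison_test')
    fix k
    have "0 \<le> (real k + 1) ^ d * \<theta> ^ k" using assms by (intro mult_nonneg_nonneg zero_le_power) auto
    then show "norm ((real k + 1) ^ d * \<theta> ^ k) \<le> fact d * exp a / a ^ d * s ^ k"
      unfolding real_norm_def using le[of k] by linarith
  qed
qed

lemma sum_plus_one_le_prod:
  fixes g :: "'b \<Rightarrow> nat"
  shows "finite A \<Longrightarrow> real (\<Sum>i\<in>A. g i) + 1 \<le> (\<Prod>i\<in>A. real (g i) + 1)"
proof (induction A rule: finite_induct)
  case (insert i A)
  have p: "1 \<le> (\<Prod>i\<in>A. real (g i) + 1)" by (rule prod_ge_1) auto
  have "real (\<Sum>i\<in>insert i A. g i) + 1 = real (g i) + (real (\<Sum>i\<in>A. g i) + 1)" using insert by simp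
  also have "\<dots> \<le> real (g i) * (\<Prod>i\<in>A. real (g i) + 1) + (\<Prod>i\<in>A. real (g i) + 1)"
    using insert.IH mult_left_mono[OF p, of "real (g i)"] by simp
  finally show ?case using insert by (simp add: algebra_simps)
qed simp

text \<open>
  The radii at which \<open>|z\<^sup>g|\<close> attains its maximum over the sphere of radius \<open>R\<close>.
\<close>

definition radius_for :: "real \<Rightarrow> ('d::finite \<Rightarrow> nat) \<Rightarrow> 'd \<Rightarrow> real" where
  "radius_for R g i = R * sqrt (real (g i) / real (\<Sum>j\<in>UNIV. g j))"

lemma radius_for_sq:
  assumes "0 < R"
  shows "sqrt (\<Sum>i\<in>UNIV. (radius_for R g i)\<^sup>2) \<le> R"
proof (rule real_le_lsqrt)
  define s where "s = real (\<Sum>j\<in>UNIV. g j)"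
  have s0: "0 \<le> s" unfolding s_def by (rule of_nat_0_le_iff)
  have "(\<Sum>i\<in>UNIV. (radius_for R g i)\<^sup>2) = (\<Sum>i\<in>UNIV. R\<^sup>2 * (real (g i) / s))"
    unfolding radius_for_def s_def[symmetric] using s0 by (simp add: power_mult_distrib)
  also have "\<dots> = R\<^sup>2 * (s / s)"
    unfolding sum_distrib_left[symmetric] sum_divide_distrib[symmetric] s_def by simp
  also have "\<dots> \<le> R\<^sup>2 * 1" by (intro mult_left_mono) auto
  finally show "(\<Sum>i\<in>UNIV. (radius_for R g i)\<^sup>2) \<le> R\<^sup>2" by simp
qed (use assms in auto)

text \<open>
  The coefficient of \<open>z\<^sup>g\<close> is at most \<open>D\<close> divided by the maximum of \<open>|z\<^sup>g|\<close> on the sphere of radius \<open>R\<close>.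
  That maximum is \<open>R\<^bsup>|g|\<^esup>\<close> times the square root of a product \<open>Q g\<close>, and the norm of \<open>X\<^sup>g\<close> contains the same
  square root, so they cancel. What remains is a convergent series of powers of \<open>\<theta> = \<rho> / R\<close> with polynomial factors.
\<close>

lemma span_mat_bound:
  fixes X :: "'d::finite \<Rightarrow> complex Matrix.mat"
  assumes X: "X \<in> comm_ball n"
  obtains R C where "0 < R" "R < 1" "0 \<le> C"
    "\<And>p A D i j. span_mat n X p A \<Longrightarrow> (\<And>z. norm z \<le> R \<Longrightarrow> cmod (p z) \<le> D) \<Longrightarrow> i < n \<Longrightarrow> j < n \<Longrightarrow> cmod (A $$ (i, j)) \<le> C * D"
proof -
  have Xc: "\<And>i. X i \<in> carrier_mat n n" and comm: "\<And>i j. X i * X j = X j * X i" and nX: "row_norm n X < 1"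
    using X by (auto simp: comm_ball_def)
  \<comment> \<open>Both radii lie strictly between the row norm and 1.\<close>
  define \<rho> where "\<rho> = (1 + row_norm n X) / 2"
  define R where "R = (1 + \<rho>) / 2"
  have \<rho>: "0 < \<rho>" "row_norm n X \<le> \<rho>" "\<rho> < 1" unfolding \<rho>_def using nX row_norm_nonneg[of n X] by auto
  have R: "0 < R" "\<rho> < R" "R < 1" unfolding R_def using \<rho> by auto
  define \<theta> where "\<theta> = \<rho> / R"
  have \<theta>: "0 < \<theta>" "\<theta> < 1" unfolding \<theta>_def using \<rho> R by auto
  let ?d = "CARD('d)"
  define W where "W = (\<Sum>k. (real k + 1) ^ ?d * \<theta> ^ k)"
  have W0: "0 \<le> W" unfolding W_def using \<theta> by (intro suminf_nonneg summable_poly_geometric) auto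
  define C where "C = exp 1 ^ ?d * W ^ ?d"
  have C0: "0 \<le> C" unfolding C_def using W0 by simp
  have col: "(\<Sum>i\<in>UNIV. (cvec_norm (mat_adjoint (X i) *\<^sub>v v))\<^sup>2) \<le> \<rho>\<^sup>2 * (cvec_norm v)\<^sup>2" if v: "v \<in> carrier_vec n" for v
  proof -
    have "(\<Sum>i\<in>UNIV. (cvec_norm (mat_adjoint (X i) *\<^sub>v v))\<^sup>2) \<le> (row_norm n X)\<^sup>2 * (cvec_norm v)\<^sup>2"
      using Xc v by (intro sum_adjoint_le_row_norm) auto
    also have "\<dots> \<le> \<rho>\<^sup>2 * (cvec_norm v)\<^sup>2" using \<rho> row_norm_nonneg[of n X] by (intro mult_right_mono power_mono) auto
    finally show ?thesis .
  qed
  \<comment> \<open>A choice of the monomials in \<open>X\<close> as a function of the exponent.\<close>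
  define B where "B g = (if \<exists>A. mono_mat n X g A then (SOME A. mono_mat n X g A) else 0\<^sub>m n n)" for g
  have B: "B g = A" if "mono_mat n X g A" for g A
  proof -
    have "mono_mat n X g (SOME A. mono_mat n X g A)" using that by (rule someI)
    then show ?thesis unfolding B_def using that mono_mat_unique[OF Xc comm] by auto
  qed
  define Q where "Q g = (\<Prod>i\<in>UNIV. (real (g i) / real (\<Sum>j\<in>UNIV. g j)) ^ g i)" for g :: "'d \<Rightarrow> nat"
  have Qpos: "0 < Q g" for g
    unfolding Q_def
  proof (rule prod_pos)
    fix i
    have "g i \<le> (\<Sum>j\<in>UNIV. g j)" by (rule member_le_sum) auto
    then have "g i \<noteq> 0 \<Longrightarrow> 0 < real (g i) / real (\<Sum>j\<in>UNIV. g j)" by (intro divide_pos_pos) linarith+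
    then show "0 < (real (g i) / real (\<Sum>j\<in>UNIV. g j)) ^ g i"
      by (cases "g i = 0") (simp, rule zero_less_power, blast)
  qed
  have rad: "(\<Prod>i\<in>UNIV. radius_for R g i ^ g i) = R ^ (\<Sum>j\<in>UNIV. g j) * sqrt (Q g)" for g :: "'d \<Rightarrow> nat"
  proof -
    have sp: "sqrt (\<Prod>i\<in>A. f i) = (\<Prod>i\<in>A. sqrt (f i))" for f and A :: "'d set"
      by (induction A rule: infinite_finite_induct) (auto simp: real_sqrt_mult)
    show ?thesis unfolding radius_for_def Q_def sp
      by (simp add: power_mult_distrib prod.distrib power_sum real_sqrt_power)
  qed
  have Bbound: "cmod (B g $$ (i, j)) \<le> (exp 1 * (real (\<Sum>j\<in>UNIV. g j) + 1)) ^ ?d * sqrt (Q g) * \<rho> ^ (\<Sum>j\<in>UNIV. g j)"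
    if ij: "i < n" "j < n" for g i j
  proof (cases "\<exists>A. mono_mat n X g A")
    case False
    then have "B g = 0\<^sub>m n n" unfolding B_def by (rule if_not_P)
    then have "cmod (B g $$ (i, j)) = 0" using ij by simp
    also have "0 \<le> (exp 1 * (real (\<Sum>j\<in>UNIV. g j) + 1)) ^ ?d * sqrt (Q g) * \<rho> ^ (\<Sum>j\<in>UNIV. g j)"
      using \<rho> less_imp_le[OF Qpos[of g]]
      by (intro mult_nonneg_nonneg zero_le_power add_nonneg_nonneg of_nat_0_le_iff real_sqrt_ge_zero) auto
    finally show ?thesis .
  next
    case True
    then obtain A where A: "mono_mat n X g A" by blast
    have Ac: "A \<in> carrier_mat n n" using mono_mat_carrier[OF Xc comm A] .
    define m where "m = (\<Sum>j\<in>UNIV. g j)"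
    define E where "E = (exp 1 * (real m + 1)) ^ ?d"
    have E1: "1 \<le> E" unfolding E_def
    proof (rule one_le_power)
      have "1 * 1 \<le> exp 1 * (real m + 1)" by (intro mult_mono) auto
      then show "1 \<le> exp 1 * (real m + 1)" by simp
    qed
    have "cvec_norm (mat_adjoint A *\<^sub>v v) \<le> E * sqrt (Q g) * \<rho> ^ m * cvec_norm v" if v: "v \<in> carrier_vec n" for v
    proof (rule power2_le_imp_le)
      have "fact m * (cvec_norm (mat_adjoint A *\<^sub>v v))\<^sup>2 \<le> (\<Prod>i\<in>UNIV. fact (g i)) * \<rho> ^ (2 * m) * (cvec_norm v)\<^sup>2"
        unfolding m_def by (rule mono_mat_adjoint_bound[OF Xc comm col A v])
      also have "\<dots> \<le> fact m * (E * Q g) * \<rho> ^ (2 * m) * (cvec_norm v)\<^sup>2"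
        unfolding E_def Q_def m_def by (intro mult_right_mono multinomial_inverse_bound) (use \<rho> in auto)
      also have "\<dots> = fact m * (E * Q g * \<rho> ^ (2 * m) * (cvec_norm v)\<^sup>2)" by (simp only: mult.assoc)
      finally have "(cvec_norm (mat_adjoint A *\<^sub>v v))\<^sup>2 \<le> E * Q g * \<rho> ^ (2 * m) * (cvec_norm v)\<^sup>2"
        by (rule mult_left_le_imp_le) simp
      also have "\<dots> \<le> (E * E) * Q g * \<rho> ^ (2 * m) * (cvec_norm v)\<^sup>2"
        using E1 less_imp_le[OF Qpos[of g]] \<rho> by (intro mult_right_mono) auto
      also have "\<dots> = (E * sqrt (Q g) * \<rho> ^ m * cvec_norm v)\<^sup>2"
        using less_imp_le[OF Qpos[of g]] by (simp add: power_mult_distrib power2_eq_square[of E] mult.commute flip: power_mult)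
      finally show "(cvec_norm (mat_adjoint A *\<^sub>v v))\<^sup>2 \<le> (E * sqrt (Q g) * \<rho> ^ m * cvec_norm v)\<^sup>2" .
      show "0 \<le> E * sqrt (Q g) * \<rho> ^ m * cvec_norm v" using E1 less_imp_le[OF Qpos[of g]] \<rho> by simp
    qed
    then have "opnorm A \<le> E * sqrt (Q g) * \<rho> ^ m"
      using E1 less_imp_le[OF Qpos[of g]] \<rho> by (intro opnorm_le_adjoint[OF Ac]) auto
    then show ?thesis using cmod_entry_le_opnorm[OF Ac ij] B[OF A] unfolding E_def m_def by simp
  qed
  show ?thesis
  proof (rule that[OF R(1) R(3) C0])
    fix p A D i j assume S: "span_mat n X p A" and D: "\<And>z. norm z \<le> R \<Longrightarrow> cmod (p z) \<le> D" and ij: "i < n" "j < n"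
    have D0: "0 \<le> D" using order_trans[OF norm_ge_zero D[of 0]] R by simp
    obtain M0 where M0: "\<forall>M\<ge>M0. \<forall>r B. (\<forall>g i. 0 < g i \<longrightarrow> r g i \<noteq> (0::real)) \<longrightarrow> (\<forall>g A. mono_mat n X g A \<longrightarrow> B g = A) \<longrightarrow>
      (\<forall>i<n. \<forall>j<n. A $$ (i, j) = (\<Sum>g\<in>box M. torus_coeff M (r g) g p / (\<Prod>k\<in>UNIV. of_real (r g k) ^ g k) * B g $$ (i, j)))"
      using span_mat_expansion[OF Xc comm S] by blast
    define M where "M = Suc M0"
    have rnz: "radius_for R g i \<noteq> 0" if "0 < g i" for g :: "'d \<Rightarrow> nat" and i
    proof -
      have "g i \<le> (\<Sum>j\<in>UNIV. g j)" by (rule member_le_sum) auto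
      then have "0 < real (g i) / real (\<Sum>j\<in>UNIV. g j)" using that by (intro divide_pos_pos) linarith+
      then have "0 < radius_for R g i" unfolding radius_for_def by (intro mult_pos_pos R(1) real_sqrt_gt_zero)
      then show ?thesis by simp
    qed
    have "A $$ (i, j) = (\<Sum>g\<in>box M. torus_coeff M (radius_for R g) g p / (\<Prod>k\<in>UNIV. of_real (radius_for R g k) ^ g k) * B g $$ (i, j))"
      using M0[rule_format, of M "radius_for R" B i j] rnz B ij unfolding M_def by simp
    also have "cmod \<dots> \<le> (\<Sum>g\<in>(box M :: ('d \<Rightarrow> nat) set). D * exp 1 ^ ?d * (\<Prod>k\<in>UNIV. (real (g k) + 1) ^ ?d * \<theta> ^ g k))"
    proof (rule sum_norm_le)
      fix g :: "'d \<Rightarrow> nat"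
      define m where "m = (\<Sum>j\<in>UNIV. g j)"
      have tc: "cmod (torus_coeff M (radius_for R g) g p) \<le> D"
        by (rule torus_coeff_bound) (use radius_for_sq[OF R(1), of g] D in \<open>auto simp: M_def\<close>)
      have Rq: "cmod (\<Prod>k\<in>UNIV. complex_of_real (radius_for R g k) ^ g k) = R ^ m * sqrt (Q g)"
      proof -
        have "(\<Prod>k\<in>UNIV. complex_of_real (radius_for R g k) ^ g k) = of_real (R ^ m * sqrt (Q g))"
          unfolding rad[symmetric] m_def by simp
        then show ?thesis using R less_imp_le[OF Qpos[of g]] by (simp only: norm_of_real) simp
      qed
      have "cmod (torus_coeff M (radius_for R g) g p / (\<Prod>k\<in>UNIV. of_real (radius_for R g k) ^ g k) * B g $$ (i, j))
          = cmod (torus_coeff M (radius_for R g) g p) / (R ^ m * sqrt (Q g)) * cmod (B g $$ (i, j))"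
        by (simp only: norm_mult norm_divide Rq)
      also have "\<dots> \<le> D / (R ^ m * sqrt (Q g)) * ((exp 1 * (real m + 1)) ^ ?d * sqrt (Q g) * \<rho> ^ m)"
        using Bbound[OF ij, of g] tc R Qpos[of g] D0 unfolding m_def by (intro mult_mono divide_right_mono) auto
      also have "\<dots> = D * (exp 1 * (real m + 1)) ^ ?d * \<theta> ^ m"
        using R Qpos[of g] unfolding \<theta>_def by (simp add: power_divide)
      also have "\<dots> \<le> D * (exp 1 * (\<Prod>k\<in>UNIV. real (g k) + 1)) ^ ?d * \<theta> ^ m"
      proof (intro mult_right_mono mult_left_mono power_mono)
        show "real m + 1 \<le> (\<Prod>k\<in>UNIV. real (g k) + 1)" unfolding m_def by (rule sum_plus_one_le_prod) simp
      qed (use D0 \<theta> in auto)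
      also have "\<dots> = D * exp 1 ^ ?d * (\<Prod>k\<in>UNIV. (real (g k) + 1) ^ ?d * \<theta> ^ g k)"
        unfolding m_def by (simp add: power_mult_distrib prod.distrib prod_power_distrib power_sum)
      finally show "cmod (torus_coeff M (radius_for R g) g p / (\<Prod>k\<in>UNIV. of_real (radius_for R g k) ^ g k) * B g $$ (i, j))
          \<le> D * exp 1 ^ ?d * (\<Prod>k\<in>UNIV. (real (g k) + 1) ^ ?d * \<theta> ^ g k)" .
    qed
    also have "\<dots> = D * exp 1 ^ ?d * (\<Sum>g\<in>(box M :: ('d \<Rightarrow> nat) set). \<Prod>k\<in>UNIV. (real (g k) + 1) ^ ?d * \<theta> ^ g k)"
      by (simp only: sum_distrib_left)
    also have "(\<Sum>g\<in>(box M :: ('d \<Rightarrow> nat) set). \<Prod>k\<in>UNIV. (real (g k) + 1) ^ ?d * \<theta> ^ g k) =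
        (\<Prod>k\<in>(UNIV :: 'd set). \<Sum>l<M. (real l + 1) ^ ?d * \<theta> ^ l)"
      by (rule prod_sum_PiE[symmetric]) auto
    also have "\<dots> = (\<Sum>l<M. (real l + 1) ^ ?d * \<theta> ^ l) ^ ?d" by simp
    also have "D * exp 1 ^ ?d * \<dots> \<le> D * exp 1 ^ ?d * W ^ ?d"
    proof (intro mult_left_mono power_mono)
      show "(\<Sum>l<M. (real l + 1) ^ ?d * \<theta> ^ l) \<le> W"
        unfolding W_def using \<theta> by (intro sum_le_suminf summable_poly_geometric) auto
    qed (use D0 \<theta> in \<open>auto intro!: sum_nonneg\<close>)
    finally show "cmod (A $$ (i, j)) \<le> C * D" unfolding C_def by (simp add: mult_ac)
  qed
qed

section \<open>The functional calculus\<close>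

text \<open>
  The graph of the functional calculus: limits of the values of polynomials that converge uniformly
  on a smaller closed ball.
\<close>

definition calc_approx :: "nat \<Rightarrow> ('d::finite \<Rightarrow> complex Matrix.mat) \<Rightarrow> real \<Rightarrow> (complex ^ 'd \<Rightarrow> complex) \<Rightarrow> complex Matrix.mat \<Rightarrow> bool" where
  "calc_approx n X R f A \<longleftrightarrow> A \<in> carrier_mat n n \<and>
    (\<exists>P B. (\<forall>k. span_mat n X (P k) (B k)) \<and> uniform_limit (cball 0 R) P f sequentially \<and>
      (\<forall>i<n. \<forall>j<n. (\<lambda>k. B k $$ (i, j)) \<longlonglongrightarrow> A $$ (i, j)))"

text \<open>
  By \<open>span_mat_bound\<close> the values of a uniformly Cauchy sequence of polynomials form a Cauchy sequence with a
  limit that depends on the limit function only. Sums, products and continuity pass to the limit.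
\<close>

lemma calculus_exists:
  fixes X :: "'d::finite \<Rightarrow> complex Matrix.mat"
  assumes X: "X \<in> comm_ball n"
  shows "\<exists>\<Phi>. is_calculus n X \<Phi>"
proof -
  have Xc: "\<And>i. X i \<in> carrier_mat n n" and comm: "\<And>i j. X i * X j = X j * X i"
    using X by (auto simp: comm_ball_def)
  obtain R C where R: "0 < R" "R < 1" and C: "0 \<le> C"
    and bound: "\<And>p A D i j. span_mat n X p A \<Longrightarrow> (\<And>z. norm z \<le> R \<Longrightarrow> cmod (p z) \<le> D) \<Longrightarrow> i < n \<Longrightarrow> j < n \<Longrightarrow> cmod (A $$ (i, j)) \<le> C * D"
    by (rule span_mat_bound[OF X]) blast
  note carr = span_mat_carrier[OF Xc comm]
  let ?K = "cball (0 :: complex ^ 'd) R"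
  have Kball: "?K \<subseteq> ball 0 1" using R by auto
  have diff: "cmod (A $$ (i, j) - B $$ (i, j)) \<le> C * D"
    if "span_mat n X p A" "span_mat n X q B" "\<And>z. norm z \<le> R \<Longrightarrow> cmod (p z - q z) \<le> D" "i < n" "j < n" for p q A B D i j
  proof -
    have "span_mat n X (\<lambda>z. p z + (-1) * q z) (A + (-1) \<cdot>\<^sub>m B)"
      by (intro span_mat_add[OF Xc comm] span_mat_smult[OF Xc comm] that)
    then have "cmod ((A + (-1) \<cdot>\<^sub>m B) $$ (i, j)) \<le> C * D"
      using that by (intro bound) auto
    then show ?thesis using carr[OF that(1)] carr[OF that(2)] that by simp
  qed
  have E: "\<exists>A. calc_approx n X R f A" if f: "holomorphic_on_ball f" for f
  proof -
    have "\<exists>p B. span_mat n X p B \<and> (\<forall>z\<in>?K. cmod (p z - f z) < 1 / real (Suc k))" for k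
    proof -
      obtain p where p: "p \<in> polyfun" "\<And>z. norm z \<le> R \<Longrightarrow> cmod (p z - f z) < 1 / real (Suc k)"
        using polyfun_dense[OF f R, of "1 / real (Suc k)"] by auto
      obtain B where "span_mat n X p B" using span_mat_polyfun[where X = X and n = n, OF Xc comm p(1)] by blast
      then show ?thesis using p(2) by (intro exI[of _ p] exI[of _ B]) (auto simp del: of_nat_Suc)
    qed
    then obtain P B where PB: "\<And>k. span_mat n X (P k) (B k)" "\<And>k z. z \<in> ?K \<Longrightarrow> cmod (P k z - f z) < 1 / real (Suc k)"
      by metis
    have ul: "uniform_limit ?K P f sequentially"
    proof (rule uniform_limitI)
      fix e :: real assume "0 < e"
      then obtain N where N: "0 < N" "1 / real N < e" using real_arch_inverse[of e] by (auto simp: inverse_eq_divide)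
      show "\<forall>\<^sub>F k in sequentially. \<forall>z\<in>?K. dist (P k z) (f z) < e"
      proof (rule eventually_sequentiallyI[of N], intro ballI)
        fix k z assume "N \<le> k" "z \<in> ?K"
        have "1 / real (Suc k) \<le> 1 / real N" using \<open>N \<le> k\<close> N by (intro divide_left_mono) auto
        then show "dist (P k z) (f z) < e" using PB(2)[OF \<open>z \<in> ?K\<close>, of k] N unfolding dist_norm by linarith
      qed
    qed
    have "\<exists>a. (\<lambda>k. B k $$ (i, j)) \<longlonglongrightarrow> a" if ij: "i < n" "j < n" for i j
    proof -
      have "Cauchy (\<lambda>k. B k $$ (i, j))"
      proof (rule metric_CauchyI)
        fix e :: real assume "0 < e"
        then have "0 < e / (2 * C + 1)" using C by simp
        then obtain N where N: "0 < N" "1 / real N < e / (2 * C + 1)"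
          using real_arch_inverse[of "e / (2 * C + 1)"] by (auto simp: inverse_eq_divide)
        have "dist (B k $$ (i, j)) (B l $$ (i, j)) < e" if "N \<le> k" "N \<le> l" for k l
        proof -
          have "cmod (B k $$ (i, j) - B l $$ (i, j)) \<le> C * (1 / real N + 1 / real N)"
          proof (rule diff[OF PB(1) PB(1) _ ij])
            fix z :: "complex ^ 'd" assume "norm z \<le> R"
            then have "z \<in> ?K" by simp
            have "1 / real (Suc k) \<le> 1 / real N" "1 / real (Suc l) \<le> 1 / real N"
              using that N by (auto intro!: divide_left_mono)
            moreover have "cmod (P k z - P l z) \<le> cmod (P k z - f z) + cmod (P l z - f z)"
              using norm_triangle_ineq4[of "P k z - f z" "P l z - f z"] by simp
            ultimately show "cmod (P k z - P l z) \<le> 1 / real N + 1 / real N"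
              using PB(2)[OF \<open>z \<in> ?K\<close>, of k] PB(2)[OF \<open>z \<in> ?K\<close>, of l] by linarith
          qed
          also have "\<dots> = (2 * C) * (1 / real N)" by simp
          also have "\<dots> \<le> (2 * C + 1) * (1 / real N)" by (intro mult_right_mono) auto
          also have "\<dots> < e" using N C by (simp add: field_simps)
          finally show ?thesis unfolding dist_norm .
        qed
        then show "\<exists>N. \<forall>k\<ge>N. \<forall>l\<ge>N. dist (B k $$ (i, j)) (B l $$ (i, j)) < e" by blast
      qed
      then show ?thesis by (simp add: Cauchy_convergent_iff convergent_def)
    qed
    then obtain a where a: "\<And>i j. i < n \<Longrightarrow> j < n \<Longrightarrow> (\<lambda>k. B k $$ (i, j)) \<longlonglongrightarrow> a i j" by metis
    then have "calc_approx n X R f (Matrix.mat n n (\<lambda>(i, j). a i j))"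
      unfolding calc_approx_def using PB ul by (intro conjI exI[of _ P] exI[of _ B]) auto
    then show ?thesis by blast
  qed
  have U: "cmod (A $$ (i, j) - A' $$ (i, j)) \<le> C * \<delta>"
    if A: "calc_approx n X R f A" and A': "calc_approx n X R g A'" and fg: "\<And>z. z \<in> ?K \<Longrightarrow> cmod (f z - g z) \<le> \<delta>"
      and ij: "i < n" "j < n" for f g A A' \<delta> i j
  proof (rule field_le_epsilon)
    fix e :: real assume e: "0 < e"
    define \<eta> where "\<eta> = e / (2 * C + 1)"
    have \<eta>: "0 < \<eta>" unfolding \<eta>_def using e C by simp
    obtain P B where P: "\<And>k. span_mat n X (P k) (B k)" "uniform_limit ?K P f sequentially" "(\<lambda>k. B k $$ (i, j)) \<longlonglongrightarrow> A $$ (i, j)"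
      using A ij unfolding calc_approx_def by blast
    obtain Q B' where Q: "\<And>k. span_mat n X (Q k) (B' k)" "uniform_limit ?K Q g sequentially" "(\<lambda>k. B' k $$ (i, j)) \<longlonglongrightarrow> A' $$ (i, j)"
      using A' ij unfolding calc_approx_def by blast
    have "\<forall>\<^sub>F k in sequentially. cmod (B k $$ (i, j) - B' k $$ (i, j)) \<le> C * (\<delta> + 2 * \<eta>)"
      using uniform_limitD[OF P(2) \<eta>] uniform_limitD[OF Q(2) \<eta>]
    proof eventually_elim
      fix k assume k: "\<forall>z\<in>?K. dist (P k z) (f z) < \<eta>" "\<forall>z\<in>?K. dist (Q k z) (g z) < \<eta>"
      show "cmod (B k $$ (i, j) - B' k $$ (i, j)) \<le> C * (\<delta> + 2 * \<eta>)"
      proof (rule diff[OF P(1) Q(1) _ ij])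
        fix z :: "complex ^ 'd" assume "norm z \<le> R"
        then have z: "z \<in> ?K" by simp
        have "P k z - Q k z = (P k z - f z) + (f z - g z) - (Q k z - g z)" by simp
        then have "cmod (P k z - Q k z) \<le> cmod (P k z - f z) + cmod (f z - g z) + cmod (Q k z - g z)"
          using norm_triangle_ineq4[of "(P k z - f z) + (f z - g z)" "Q k z - g z"]
            norm_triangle_ineq[of "P k z - f z" "f z - g z"] by simp
        moreover have "cmod (P k z - f z) < \<eta>" "cmod (Q k z - g z) < \<eta>" using k z by (auto simp: dist_norm)
        ultimately show "cmod (P k z - Q k z) \<le> \<delta> + 2 * \<eta>" using fg[OF z] by linarith
      qed
    qed
    moreover have "(\<lambda>k. cmod (B k $$ (i, j) - B' k $$ (i, j))) \<longlonglongrightarrow> cmod (A $$ (i, j) - A' $$ (i, j))"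
      by (intro tendsto_intros P Q)
    ultimately have "cmod (A $$ (i, j) - A' $$ (i, j)) \<le> C * (\<delta> + 2 * \<eta>)"
      by (intro tendsto_upperbound[of _ _ sequentially]) auto
    also have "\<dots> = C * \<delta> + 2 * C * \<eta>" by (simp add: algebra_simps)
    also have "2 * C * \<eta> \<le> (2 * C + 1) * \<eta>" using \<eta> by (intro mult_right_mono) auto
    also have "(2 * C + 1) * \<eta> = e" unfolding \<eta>_def using C by simp
    finally show "cmod (A $$ (i, j) - A' $$ (i, j)) \<le> C * \<delta> + e" by simp
  qed
  define \<Phi> where "\<Phi> f = (SOME A. calc_approx n X R f A)" for f
  have \<Phi>: "calc_approx n X R f (\<Phi> f)" if "holomorphic_on_ball f" for f
    unfolding \<Phi>_def using E[OF that] by (rule someI_ex)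
  have carrA: "A \<in> carrier_mat n n" if "calc_approx n X R f A" for f A using that by (simp add: calc_approx_def)
  have uniq: "\<Phi> f = A" if A: "calc_approx n X R f A" for f A
  proof -
    have \<Phi>f: "calc_approx n X R f (\<Phi> f)" unfolding \<Phi>_def using A by (rule someI)
    have "cmod (\<Phi> f $$ (i, j) - A $$ (i, j)) \<le> C * 0" if "i < n" "j < n" for i j
      using that by (intro U[OF \<Phi>f A]) auto
    then show ?thesis using carrA[OF \<Phi>f] carrA[OF A] by (intro eq_matI) auto
  qed
  have ex: "calc_approx n X R p A" if "span_mat n X p A" for p A
    unfolding calc_approx_def using that carr[OF that]
    by (intro conjI exI[of _ "\<lambda>_. p"] exI[of _ "\<lambda>_. A"]) (auto simp: uniform_limit_iff)
  have bddf: "bounded (f ` ?K)" if "holomorphic_on_ball f" for f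
    using Kball by (intro compact_imp_bounded compact_continuous_image holomorphic_on_ball_continuous[OF that]) auto
  have addA: "calc_approx n X R (\<lambda>z. f z + g z) (A + B)"
    if A: "calc_approx n X R f A" and B: "calc_approx n X R g B" for f g A B
  proof -
    obtain P A' where P: "\<And>k. span_mat n X (P k) (A' k)" "uniform_limit ?K P f sequentially" "\<And>i j. i < n \<Longrightarrow> j < n \<Longrightarrow> (\<lambda>k. A' k $$ (i, j)) \<longlonglongrightarrow> A $$ (i, j)"
      using A unfolding calc_approx_def by blast
    obtain Q B' where Q: "\<And>k. span_mat n X (Q k) (B' k)" "uniform_limit ?K Q g sequentially" "\<And>i j. i < n \<Longrightarrow> j < n \<Longrightarrow> (\<lambda>k. B' k $$ (i, j)) \<longlonglongrightarrow> B $$ (i, j)"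
      using B unfolding calc_approx_def by blast
    show ?thesis unfolding calc_approx_def
    proof (intro conjI exI[of _ "\<lambda>k z. P k z + Q k z"] exI[of _ "\<lambda>k. A' k + B' k"] allI impI)
      show "A + B \<in> carrier_mat n n" using carrA[OF A] carrA[OF B] by simp
      show "span_mat n X (\<lambda>z. P k z + Q k z) (A' k + B' k)" for k by (intro span_mat_add[OF Xc comm] P Q)
      show "uniform_limit ?K (\<lambda>k z. P k z + Q k z) (\<lambda>z. f z + g z) sequentially" by (intro uniform_limit_add P Q)
      fix i j assume ij: "i < n" "j < n"
      have "(\<lambda>k. A' k $$ (i, j) + B' k $$ (i, j)) \<longlonglongrightarrow> A $$ (i, j) + B $$ (i, j)"
        by (intro tendsto_add P Q ij)
      moreover have "(A' k + B' k) $$ (i, j) = A' k $$ (i, j) + B' k $$ (i, j)" for k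
        using carr[OF P(1), of k] carr[OF Q(1), of k] ij by simp
      ultimately show "(\<lambda>k. (A' k + B' k) $$ (i, j)) \<longlonglongrightarrow> (A + B) $$ (i, j)"
        using carrA[OF A] carrA[OF B] ij by simp
    qed
  qed
  have multA: "calc_approx n X R (\<lambda>z. f z * g z) (A * B)"
    if A: "calc_approx n X R f A" and B: "calc_approx n X R g B" and f: "holomorphic_on_ball f" and g: "holomorphic_on_ball g" for f g A B
  proof -
    obtain P A' where P: "\<And>k. span_mat n X (P k) (A' k)" "uniform_limit ?K P f sequentially" "\<And>i j. i < n \<Longrightarrow> j < n \<Longrightarrow> (\<lambda>k. A' k $$ (i, j)) \<longlonglongrightarrow> A $$ (i, j)"
      using A unfolding calc_approx_def by blast
    obtain Q B' where Q: "\<And>k. span_mat n X (Q k) (B' k)" "uniform_limit ?K Q g sequentially" "\<And>i j. i < n \<Longrightarrow> j < n \<Longrightarrow> (\<lambda>k. B' k $$ (i, j)) \<longlonglongrightarrow> B $$ (i, j)"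
      using B unfolding calc_approx_def by blast
    have ent: "(A * B) $$ (i, j) = (\<Sum>l<n. A $$ (i, l) * B $$ (l, j))"
      if "A \<in> carrier_mat n n" "B \<in> carrier_mat n n" "i < n" "j < n" for A B :: "complex Matrix.mat" and i j
      using that by (simp add: scalar_prod_def lessThan_atLeast0)
    show ?thesis unfolding calc_approx_def
    proof (intro conjI exI[of _ "\<lambda>k z. P k z * Q k z"] exI[of _ "\<lambda>k. A' k * B' k"] allI impI)
      show "A * B \<in> carrier_mat n n" using carrA[OF A] carrA[OF B] by (rule mult_carrier_mat)
      show "span_mat n X (\<lambda>z. P k z * Q k z) (A' k * B' k)" for k by (intro span_mat_mult[OF Xc comm] P Q)
      show "uniform_limit ?K (\<lambda>k z. P k z * Q k z) (\<lambda>z. f z * g z) sequentially"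
        by (intro uniform_lim_mult P Q bddf f g)
      fix i j assume ij: "i < n" "j < n"
      have "(\<lambda>k. \<Sum>l<n. A' k $$ (i, l) * B' k $$ (l, j)) \<longlonglongrightarrow> (\<Sum>l<n. A $$ (i, l) * B $$ (l, j))"
        by (intro tendsto_sum tendsto_mult P Q ij) auto
      then show "(\<lambda>k. (A' k * B' k) $$ (i, j)) \<longlonglongrightarrow> (A * B) $$ (i, j)"
        by (simp only: ent[OF carr[OF P(1)] carr[OF Q(1)] ij] ent[OF carrA[OF A] carrA[OF B] ij])
    qed
  qed
  have smultA: "calc_approx n X R (\<lambda>z. c * f z) (c \<cdot>\<^sub>m A)" if A: "calc_approx n X R f A" and f: "holomorphic_on_ball f" for c f A
  proof -
    have hc: "holomorphic_on_ball (\<lambda>z::complex ^ 'd. c)"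
      unfolding holomorphic_on_ball_def by (auto intro!: exI[of _ "\<lambda>_. 0"])
    have "(c \<cdot>\<^sub>m 1\<^sub>m n) * A = c \<cdot>\<^sub>m A" using carrA[OF A] by (simp add: mult_smult_assoc_mat[of _ n n _ n])
    then show ?thesis using multA[OF ex[OF span_mat_const[where c = c, OF Xc comm]] A hc f] by simp
  qed
  have "is_calculus n X \<Phi>"
    unfolding is_calculus_def
  proof (intro conjI allI impI)
    fix f :: "complex ^ 'd \<Rightarrow> complex" assume "holomorphic_on_ball f"
    then show "\<Phi> f \<in> carrier_mat n n" using carrA \<Phi> by blast
  next
    fix f g :: "complex ^ 'd \<Rightarrow> complex" assume f: "holomorphic_on_ball f" and g: "holomorphic_on_ball g"
    show "\<Phi> (\<lambda>z. f z + g z) = \<Phi> f + \<Phi> g" by (rule uniq[OF addA[OF \<Phi>[OF f] \<Phi>[OF g]]])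
    show "\<Phi> (\<lambda>z. f z * g z) = \<Phi> f * \<Phi> g" by (rule uniq[OF multA[OF \<Phi>[OF f] \<Phi>[OF g] f g]])
  next
    fix c and f :: "complex ^ 'd \<Rightarrow> complex" assume f: "holomorphic_on_ball f"
    show "\<Phi> (\<lambda>z. c * f z) = c \<cdot>\<^sub>m \<Phi> f" by (rule uniq[OF smultA[OF \<Phi>[OF f] f]])
  next
    have "1 \<cdot>\<^sub>m 1\<^sub>m n = (1\<^sub>m n :: complex Matrix.mat)" by (intro eq_matI) auto
    then show "\<Phi> (\<lambda>z. 1) = 1\<^sub>m n" using uniq[OF ex[OF span_mat_const[where c = 1, OF Xc comm]]] by simp
  next
    fix i show "\<Phi> (\<lambda>z. vec_nth z i) = X i" by (rule uniq[OF ex[OF span_mat_coord[OF Xc comm]]])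
  next
    fix f :: "complex ^ 'd \<Rightarrow> complex" and e :: real assume f: "holomorphic_on_ball f" and e: "0 < e"
    define \<delta> where "\<delta> = e / (real n * real n * C + 1)"
    have p: "0 < real n * real n * C + 1" using C by (intro add_nonneg_pos mult_nonneg_nonneg) auto
    have \<delta>: "0 < \<delta>" unfolding \<delta>_def using e p by simp
    show "\<exists>L \<delta>. compact L \<and> L \<subseteq> ball 0 1 \<and> 0 < \<delta> \<and>
        (\<forall>g. holomorphic_on_ball g \<longrightarrow> (\<forall>z\<in>L. cmod (g z - f z) < \<delta>) \<longrightarrow> opnorm (\<Phi> g - \<Phi> f) < e)"
    proof (intro exI[of _ ?K] exI[of _ \<delta>] conjI allI impI)
      fix g :: "complex ^ 'd \<Rightarrow> complex" assume g: "holomorphic_on_ball g" and d: "\<forall>z\<in>?K. cmod (g z - f z) < \<delta>"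
      have cc: "\<Phi> g \<in> carrier_mat n n" "\<Phi> f \<in> carrier_mat n n" using carrA \<Phi> f g by blast+
      have "opnorm (\<Phi> g - \<Phi> f) \<le> (\<Sum>i<n. \<Sum>j<n. cmod ((\<Phi> g - \<Phi> f) $$ (i, j)))"
        using cc by (intro opnorm_le_entries minus_carrier_mat)
      also have "\<dots> \<le> (\<Sum>i<n. \<Sum>j<n. C * \<delta>)"
      proof (intro sum_mono)
        fix i j assume ij: "i \<in> {..<n}" "j \<in> {..<n}"
        have "cmod (\<Phi> g $$ (i, j) - \<Phi> f $$ (i, j)) \<le> C * \<delta>"
          using ij d by (intro U[OF \<Phi>[OF g] \<Phi>[OF f]]) (auto intro: less_imp_le)
        then show "cmod ((\<Phi> g - \<Phi> f) $$ (i, j)) \<le> C * \<delta>" using ij cc by simp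
      qed
      also have "\<dots> = (real n * real n * C) * \<delta>" by simp
      also have "\<dots> < (real n * real n * C + 1) * \<delta>" using \<delta> by (intro mult_strict_right_mono) auto
      also have "\<dots> = e" unfolding \<delta>_def using p by simp
      finally show "opnorm (\<Phi> g - \<Phi> f) < e" .
    qed (use Kball \<delta> in auto)
  qed
  then show ?thesis by blast
qed

section \<open>Reproducing kernel Hilbert spaces from feature maps\<close>

definition ell2 :: "('i \<Rightarrow> complex) \<Rightarrow> bool" where
  "ell2 a \<longleftrightarrow> (\<lambda>i. (cmod (a i))\<^sup>2) summable_on UNIV"

lemma ell2_iff_bounded:
  "ell2 a \<longleftrightarrow> (\<exists>C. \<forall>F. finite F \<longrightarrow> (\<Sum>i\<in>F. (cmod (a i))\<^sup>2) \<le> C)"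
proof
  assume "ell2 a"
  then show "\<exists>C. \<forall>F. finite F \<longrightarrow> (\<Sum>i\<in>F. (cmod (a i))\<^sup>2) \<le> C"
    unfolding ell2_def by (intro exI[of _ "\<Sum>\<^sub>\<infinity>i. (cmod (a i))\<^sup>2"] allI impI finite_sum_le_infsum) auto
next
  assume "\<exists>C. \<forall>F. finite F \<longrightarrow> (\<Sum>i\<in>F. (cmod (a i))\<^sup>2) \<le> C"
  then obtain C where "\<And>F. finite F \<Longrightarrow> (\<Sum>i\<in>F. (cmod (a i))\<^sup>2) \<le> C" by blast
  then show "ell2 a" unfolding ell2_def
    by (intro nonneg_bdd_above_summable_on bdd_aboveI2[of _ _ C]) auto
qed

lemma cmod_add_sq_le: "(cmod (x + y))\<^sup>2 \<le> 2 * (cmod x)\<^sup>2 + 2 * (cmod y)\<^sup>2"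
proof -
  have "(cmod (x + y))\<^sup>2 \<le> (cmod x + cmod y)\<^sup>2" by (intro power_mono norm_triangle_ineq) auto
  also have "\<dots> \<le> 2 * (cmod x)\<^sup>2 + 2 * (cmod y)\<^sup>2"
    using zero_le_power2[of "cmod x - cmod y"] by (simp add: power2_eq_square algebra_simps)
  finally show ?thesis .
qed

lemma ell2_add:
  assumes "ell2 a" "ell2 b"
  shows "ell2 (\<lambda>i. a i + b i)"
proof -
  have "(\<lambda>i. 2 * (cmod (a i))\<^sup>2 + 2 * (cmod (b i))\<^sup>2) summable_on UNIV"
    using assms unfolding ell2_def by (intro summable_on_add summable_on_cmult_right)
  then show ?thesis unfolding ell2_def
    by (rule summable_on_comparison_test) (simp_all add: cmod_add_sq_le)
qed

lemma ell2_scale: "ell2 a \<Longrightarrow> ell2 (\<lambda>i. c * a i)"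
  unfolding ell2_def by (simp add: norm_mult power_mult_distrib summable_on_cmult_right)

lemma ell2_diff: "ell2 a \<Longrightarrow> ell2 b \<Longrightarrow> ell2 (\<lambda>i. a i - b i)"
  using ell2_add[of a "\<lambda>i. (-1) * b i"] ell2_scale[of b "-1"] by simp

lemma ell2_mult_summable:
  assumes "ell2 a" "ell2 b"
  shows "(\<lambda>i. a i * b i) summable_on UNIV"
proof (rule abs_summable_summable, rule abs_summable_product)
  show "(\<lambda>i. norm (a i * a i)) summable_on UNIV" "(\<lambda>i. norm (b i * b i)) summable_on UNIV"
    using assms unfolding ell2_def by (simp_all add: norm_mult power2_eq_square)
qed

lemma ell2_cnj: "ell2 a \<Longrightarrow> ell2 (\<lambda>i. cnj (a i))"
  by (simp add: ell2_def)

lemma ell2_complete: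
  fixes a :: "nat \<Rightarrow> 'i \<Rightarrow> complex"
  assumes a: "\<And>k. ell2 (a k)"
    and cauchy: "\<And>e. 0 < e \<Longrightarrow> \<exists>N. \<forall>j\<ge>N. \<forall>k\<ge>N. (\<Sum>\<^sub>\<infinity>i. (cmod (a j i - a k i))\<^sup>2) < e"
  obtains b where "ell2 b" "\<And>e. 0 < e \<Longrightarrow> \<exists>N. \<forall>k\<ge>N. (\<Sum>\<^sub>\<infinity>i. (cmod (a k i - b i))\<^sup>2) \<le> e"
proof -
  have fin: "(\<Sum>i\<in>F. (cmod (a j i - a k i))\<^sup>2) \<le> (\<Sum>\<^sub>\<infinity>i. (cmod (a j i - a k i))\<^sup>2)" if "finite F" for F j k
    using ell2_diff[OF a a, of j k] that unfolding ell2_def by (intro finite_sum_le_infsum) auto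
  have "\<exists>l. (\<lambda>k. a k i) \<longlonglongrightarrow> l" for i
  proof -
    have "Cauchy (\<lambda>k. a k i)"
    proof (rule metric_CauchyI)
      fix e :: real assume e: "0 < e"
      then obtain N where N: "\<forall>j\<ge>N. \<forall>k\<ge>N. (\<Sum>\<^sub>\<infinity>i. (cmod (a j i - a k i))\<^sup>2) < e\<^sup>2"
        using cauchy[of "e\<^sup>2"] by auto
      have "dist (a j i) (a k i) < e" if "N \<le> j" "N \<le> k" for j k
      proof -
        have "(cmod (a j i - a k i))\<^sup>2 < e\<^sup>2" using fin[of "{i}" j k] N that by fastforce
        then show ?thesis unfolding dist_norm using e by (intro power2_less_imp_less[of _ e]) auto
      qed
      then show "\<exists>N. \<forall>j\<ge>N. \<forall>k\<ge>N. dist (a j i) (a k i) < e" by blast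
    qed
    then show ?thesis by (simp add: Cauchy_convergent_iff convergent_def)
  qed
  then obtain b where b: "\<And>i. (\<lambda>k. a k i) \<longlonglongrightarrow> b i" by metis
  have lim: "(\<Sum>i\<in>F. (cmod (a k i - b i))\<^sup>2) \<le> e"
    if N: "\<forall>j\<ge>N. \<forall>k\<ge>N. (\<Sum>\<^sub>\<infinity>i. (cmod (a j i - a k i))\<^sup>2) < e" and "N \<le> k" "finite F" for N e k F
  proof (rule tendsto_upperbound)
    show "(\<lambda>j. \<Sum>i\<in>F. (cmod (a k i - a j i))\<^sup>2) \<longlonglongrightarrow> (\<Sum>i\<in>F. (cmod (a k i - b i))\<^sup>2)"
      by (intro tendsto_intros b)
    show "\<forall>\<^sub>F j in sequentially. (\<Sum>i\<in>F. (cmod (a k i - a j i))\<^sup>2) \<le> e"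
    proof (rule eventually_sequentiallyI[of N])
      fix j assume "N \<le> j"
      then show "(\<Sum>i\<in>F. (cmod (a k i - a j i))\<^sup>2) \<le> e" using fin[OF that(3), of k j] N that(2) by fastforce
    qed
  qed simp
  have d2: "ell2 (\<lambda>i. a k i - b i)" if N: "\<forall>j\<ge>N. \<forall>k\<ge>N. (\<Sum>\<^sub>\<infinity>i. (cmod (a j i - a k i))\<^sup>2) < e" and "N \<le> k" for N e k
    unfolding ell2_iff_bounded using lim[OF that] by blast
  show ?thesis
  proof
    obtain N where N: "\<forall>j\<ge>N. \<forall>k\<ge>N. (\<Sum>\<^sub>\<infinity>i. (cmod (a j i - a k i))\<^sup>2) < 1" using cauchy[of 1] by auto
    show "ell2 b" using ell2_diff[OF a[of N] d2[OF N order_refl]] by simp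
    fix e :: real assume "0 < e"
    then obtain N where N: "\<forall>j\<ge>N. \<forall>k\<ge>N. (\<Sum>\<^sub>\<infinity>i. (cmod (a j i - a k i))\<^sup>2) < e" using cauchy by blast
    have "(\<Sum>\<^sub>\<infinity>i. (cmod (a k i - b i))\<^sup>2) \<le> e" if "N \<le> k" for k
      using d2[OF N that] unfolding ell2_def by (rule infsum_le_finite_sums) (rule lim[OF N that])
    then show "\<exists>N. \<forall>k\<ge>N. (\<Sum>\<^sub>\<infinity>i. (cmod (a k i - b i))\<^sup>2) \<le> e" by blast
  qed
qed

definition feature_fun :: "'a set \<Rightarrow> ('i \<Rightarrow> 'a \<Rightarrow> complex) \<Rightarrow> ('i \<Rightarrow> complex) \<Rightarrow> 'a \<Rightarrow> complex" where
  "feature_fun S \<phi> a = (\<lambda>x. if x \<in> S then \<Sum>\<^sub>\<infinity>i. a i * \<phi> i x else 0)"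

definition feature_space :: "'a set \<Rightarrow> ('i \<Rightarrow> 'a \<Rightarrow> complex) \<Rightarrow> ('a \<Rightarrow> complex) set" where
  "feature_space S \<phi> = feature_fun S \<phi> ` {a. ell2 a}"

text \<open>
  The inner product of the coefficients. They are recovered by choice, and they are unique for an injective
  feature map.
\<close>

definition feature_inner :: "'a set \<Rightarrow> ('i \<Rightarrow> 'a \<Rightarrow> complex) \<Rightarrow> ('a \<Rightarrow> complex) \<Rightarrow> ('a \<Rightarrow> complex) \<Rightarrow> complex" where
  "feature_inner S \<phi> f g = (\<Sum>\<^sub>\<infinity>i. (SOME a. ell2 a \<and> f = feature_fun S \<phi> a) i * cnj ((SOME b. ell2 b \<and> g = feature_fun S \<phi> b) i))"

text \<open>
  Injectivity of the coefficient map makes the function space isometric to the sequence space, from which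
  completeness is inherited. The kernel at \<open>y\<close> has the coefficients \<open>cnj (\<phi> i y)\<close>, and the reproducing
  property is the definition of the functions.
\<close>

lemma rkhs_feature_space:
  fixes \<phi> :: "'i \<Rightarrow> 'a \<Rightarrow> complex"
  assumes sq: "\<And>x. x \<in> S \<Longrightarrow> ell2 (\<lambda>i. \<phi> i x)"
    and K: "\<And>x y. x \<in> S \<Longrightarrow> y \<in> S \<Longrightarrow> ((\<lambda>i. \<phi> i x * cnj (\<phi> i y)) has_sum K x y) UNIV"
    and inj: "\<And>a. ell2 a \<Longrightarrow> (\<And>x. x \<in> S \<Longrightarrow> (\<Sum>\<^sub>\<infinity>i. a i * \<phi> i x) = 0) \<Longrightarrow> a = (\<lambda>_. 0)"
  shows "rkhs S K (feature_space S \<phi>) (feature_inner S \<phi>)"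
proof -
  let ?ev = "feature_fun S \<phi>"
  let ?ip = "feature_inner S \<phi>"
  have ev_add: "?ev (\<lambda>i. a i + b i) = (\<lambda>x. ?ev a x + ?ev b x)" if "ell2 a" "ell2 b" for a b
    unfolding feature_fun_def using ell2_mult_summable[OF that(1) sq] ell2_mult_summable[OF that(2) sq]
    by (auto simp: ring_distribs infsum_add fun_eq_iff)
  have ev_scale: "?ev (\<lambda>i. c * a i) = (\<lambda>x. c * ?ev a x)" for c a
    unfolding feature_fun_def by (auto simp: mult.assoc infsum_cmult_right' fun_eq_iff)
  have ev_diff: "?ev (\<lambda>i. a i - b i) = (\<lambda>x. ?ev a x - ?ev b x)" if "ell2 a" "ell2 b" for a b
    using ev_add[OF that(1) ell2_scale[OF that(2), of "-1"]] ev_scale[of "-1" b] by simp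
  have ev_inj: "a = b" if "ell2 a" "ell2 b" "?ev a = ?ev b" for a b
  proof -
    have "(\<lambda>i. a i - b i) = (\<lambda>_. 0)"
    proof (rule inj[OF ell2_diff[OF that(1,2)]])
      fix x assume x: "x \<in> S"
      have "?ev (\<lambda>i. a i - b i) x = 0" unfolding ev_diff[OF that(1,2)] that(3) by simp
      then show "(\<Sum>\<^sub>\<infinity>i. (a i - b i) * \<phi> i x) = 0" using x by (simp add: feature_fun_def)
    qed
    then show ?thesis by (simp add: fun_eq_iff)
  qed
  have coef: "(SOME a'. ell2 a' \<and> ?ev a = ?ev a') = a" if "ell2 a" for a
    using that ev_inj by (intro some_equality) blast+
  have ip: "?ip (?ev a) (?ev b) = (\<Sum>\<^sub>\<infinity>i. a i * cnj (b i))" if "ell2 a" "ell2 b" for a b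
    unfolding feature_inner_def coef[OF that(1)] coef[OF that(2)] ..
  have ip_self: "?ip (?ev a) (?ev a) = of_real (\<Sum>\<^sub>\<infinity>i. (cmod (a i))\<^sup>2)" if a: "ell2 a" for a
  proof -
    have "((\<lambda>i. (cmod (a i))\<^sup>2) has_sum (\<Sum>\<^sub>\<infinity>i. (cmod (a i))\<^sup>2)) UNIV"
      using a unfolding ell2_def by (rule has_sum_infsum)
    then have "((\<lambda>i. complex_of_real ((cmod (a i))\<^sup>2)) has_sum of_real (\<Sum>\<^sub>\<infinity>i. (cmod (a i))\<^sup>2)) UNIV"
      by (rule has_sum_of_real)
    then have "((\<lambda>i. a i * cnj (a i)) has_sum of_real (\<Sum>\<^sub>\<infinity>i. (cmod (a i))\<^sup>2)) UNIV"
      by (simp only: complex_norm_square)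
    then show ?thesis unfolding ip[OF a a] by (rule infsumI)
  qed
  have in_sp: "?ev a \<in> feature_space S \<phi>" if "ell2 a" for a using that by (auto simp: feature_space_def)
  have spE: "\<exists>a. ell2 a \<and> f = ?ev a" if "f \<in> feature_space S \<phi>" for f using that by (auto simp: feature_space_def)
  have ker: "(\<lambda>z. if z \<in> S then K z w else 0) = ?ev (\<lambda>i. cnj (\<phi> i w))" if "w \<in> S" for w
    unfolding feature_fun_def using infsumI[OF K[OF _ that]] by (auto simp: mult.commute fun_eq_iff)
  have z2: "ell2 (\<lambda>_::'i. 0)" by (simp add: ell2_def)
  show ?thesis
  proof
    fix f x assume "f \<in> feature_space S \<phi>" "x \<notin> S"
    then show "f x = 0" by (auto simp: feature_space_def feature_fun_def)
  next
    have "?ev (\<lambda>_. 0) = (\<lambda>x. 0)" by (auto simp: feature_fun_def fun_eq_iff)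
    then show "(\<lambda>x. 0) \<in> feature_space S \<phi>" using in_sp[OF z2] by simp
  next
    fix f g assume "f \<in> feature_space S \<phi>" "g \<in> feature_space S \<phi>"
    then obtain a b where ab: "ell2 a" "f = ?ev a" "ell2 b" "g = ?ev b" using spE by meson
    show "(\<lambda>x. f x + g x) \<in> feature_space S \<phi>"
      using in_sp[OF ell2_add[OF ab(1) ab(3)]] unfolding ab ev_add[OF ab(1) ab(3)] .
    show "?ip g f = cnj (?ip f g)"
      unfolding ab(2) ab(4) ip[OF ab(1) ab(3)] ip[OF ab(3) ab(1)]
      by (simp add: mult.commute flip: infsum_cnj)
  next
    fix c f assume "f \<in> feature_space S \<phi>"
    then obtain a where a: "ell2 a" "f = ?ev a" using spE by meson
    show "(\<lambda>x. c * f x) \<in> feature_space S \<phi>"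
      using in_sp[OF ell2_scale[OF a(1)]] unfolding a ev_scale .
    show "0 \<le> Re (?ip f f)" unfolding a(2) ip_self[OF a(1)] by (auto intro: infsum_nonneg)
    assume "?ip f f = 0"
    then have "(\<Sum>\<^sub>\<infinity>i. (cmod (a i))\<^sup>2) = 0" unfolding a(2) ip_self[OF a(1)] by simp
    then have "(cmod (a i))\<^sup>2 = 0" for i
      using a(1) unfolding ell2_def by (intro nonneg_infsum_le_0D[of "\<lambda>i. (cmod (a i))\<^sup>2" UNIV]) auto
    then have "a = (\<lambda>_. 0)" by (auto simp: fun_eq_iff)
    then show "f = (\<lambda>x. 0)" unfolding a(2) by (auto simp: feature_fun_def fun_eq_iff)
  next
    fix f g h assume "f \<in> feature_space S \<phi>" "g \<in> feature_space S \<phi>" "h \<in> feature_space S \<phi>"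
    then obtain a b c where abc: "ell2 a" "f = ?ev a" "ell2 b" "g = ?ev b" "ell2 c" "h = ?ev c" using spE by meson
    show "?ip (\<lambda>x. f x + g x) h = ?ip f h + ?ip g h"
      unfolding abc(2,4,6) ev_add[OF abc(1,3), symmetric] ip[OF ell2_add[OF abc(1,3)] abc(5)] ip[OF abc(1,5)] ip[OF abc(3,5)]
      using ell2_mult_summable[OF abc(1) ell2_cnj[OF abc(5)]] ell2_mult_summable[OF abc(3) ell2_cnj[OF abc(5)]]
      by (simp add: ring_distribs infsum_add)
  next
    fix c f h assume "f \<in> feature_space S \<phi>" "h \<in> feature_space S \<phi>"
    then obtain a b where ab: "ell2 a" "f = ?ev a" "ell2 b" "h = ?ev b" using spE by meson
    show "?ip (\<lambda>x. c * f x) h = c * ?ip f h"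
      unfolding ab(2,4) ev_scale[symmetric] ip[OF ell2_scale[OF ab(1)] ab(3)] ip[OF ab(1,3)]
      by (simp add: mult.assoc infsum_cmult_right')
  next
    fix F :: "nat \<Rightarrow> 'a \<Rightarrow> complex"
    assume F: "\<And>k. F k \<in> feature_space S \<phi>"
      and C: "\<And>\<epsilon>. \<epsilon> > 0 \<Longrightarrow> \<exists>N. \<forall>j\<ge>N. \<forall>k\<ge>N. sqrt (Re (?ip (\<lambda>x. F j x - F k x) (\<lambda>x. F j x - F k x))) < \<epsilon>"
    obtain a where a: "\<And>k. ell2 (a k)" "\<And>k. F k = ?ev (a k)" using spE[OF F] by metis
    have D: "Re (?ip (\<lambda>x. ?ev b x - ?ev c x) (\<lambda>x. ?ev b x - ?ev c x)) = (\<Sum>\<^sub>\<infinity>i. (cmod (b i - c i))\<^sup>2)"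
      if "ell2 b" "ell2 c" for b c
      unfolding ev_diff[OF that, symmetric] ip_self[OF ell2_diff[OF that]] by simp
    have cau: "\<exists>N. \<forall>j\<ge>N. \<forall>k\<ge>N. (\<Sum>\<^sub>\<infinity>i. (cmod (a j i - a k i))\<^sup>2) < e" if "0 < e" for e
    proof -
      have "0 < sqrt e" using that by simp
      from C[OF this] obtain N where N: "\<forall>j\<ge>N. \<forall>k\<ge>N. sqrt (\<Sum>\<^sub>\<infinity>i. (cmod (a j i - a k i))\<^sup>2) < sqrt e"
        unfolding a(2) D[OF a(1) a(1)] by blast
      then show ?thesis by (intro exI[of _ N]) simp
    qed
    obtain b where b: "ell2 b" "\<And>e. 0 < e \<Longrightarrow> \<exists>N. \<forall>k\<ge>N. (\<Sum>\<^sub>\<infinity>i. (cmod (a k i - b i))\<^sup>2) \<le> e"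
      using ell2_complete[where a = a, OF a(1) cau] by blast
    have "(\<lambda>k. sqrt (Re (?ip (\<lambda>x. F k x - ?ev b x) (\<lambda>x. F k x - ?ev b x)))) \<longlonglongrightarrow> 0"
      unfolding a(2) D[OF a(1) b(1)]
    proof (rule LIMSEQ_I)
      fix e :: real assume e: "0 < e"
      then obtain N where N: "\<forall>k\<ge>N. (\<Sum>\<^sub>\<infinity>i. (cmod (a k i - b i))\<^sup>2) \<le> e\<^sup>2 / 2" using b(2)[of "e\<^sup>2 / 2"] by auto
      show "\<exists>N. \<forall>k\<ge>N. norm (sqrt (\<Sum>\<^sub>\<infinity>i. (cmod (a k i - b i))\<^sup>2) - 0) < e"
      proof (intro exI[of _ N] allI impI)
        fix k assume "N \<le> k"
        then have "(\<Sum>\<^sub>\<infinity>i. (cmod (a k i - b i))\<^sup>2) \<le> e\<^sup>2 / 2" using N by blast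
        also have "\<dots> < e\<^sup>2" using e by simp
        finally have "sqrt (\<Sum>\<^sub>\<infinity>i. (cmod (a k i - b i))\<^sup>2) < sqrt (e\<^sup>2)" by (rule real_sqrt_less_mono)
        moreover have "0 \<le> (\<Sum>\<^sub>\<infinity>i. (cmod (a k i - b i))\<^sup>2)" by (rule infsum_nonneg) simp
        ultimately show "norm (sqrt (\<Sum>\<^sub>\<infinity>i. (cmod (a k i - b i))\<^sup>2) - 0) < e" using e by simp
      qed
    qed
    then show "\<exists>f\<in>feature_space S \<phi>. (\<lambda>k. sqrt (Re (?ip (\<lambda>x. F k x - f x) (\<lambda>x. F k x - f x)))) \<longlonglongrightarrow> 0"
      using in_sp[OF b(1)] by blast
  next
    fix w assume w: "w \<in> S"
    show "(\<lambda>z. if z \<in> S then K z w else 0) \<in> feature_space S \<phi>"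
      unfolding ker[OF w] by (intro in_sp ell2_cnj sq w)
    fix f assume "f \<in> feature_space S \<phi>"
    then obtain a where a: "ell2 a" "f = ?ev a" using spE by meson
    show "?ip f (\<lambda>z. if z \<in> S then K z w else 0) = f w"
      unfolding ker[OF w] a(2) ip[OF a(1) ell2_cnj[OF sq[OF w]]] using w by (simp add: feature_fun_def)
  qed
qed

section \<open>The Drury--Arveson space\<close>

definition tdeg :: "('d::finite \<Rightarrow> nat) \<Rightarrow> nat" where
  "tdeg g = (\<Sum>i\<in>UNIV. g i)"

definition multinom :: "('d::finite \<Rightarrow> nat) \<Rightarrow> real" where
  "multinom g = fact (tdeg g) / (\<Prod>i\<in>UNIV. fact (g i))"

lemma multinom_pos [simp]: "0 < multinom g"
  unfolding multinom_def by (intro divide_pos_pos prod_pos) auto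

lemma multinom_neq_0 [simp]: "multinom g \<noteq> 0"
  using multinom_pos[of g] by linarith

lemma tdeg_Suc: "tdeg (g(i := Suc (g i))) = Suc (tdeg g)"
proof -
  have "(\<Sum>j\<in>UNIV. g j) = g i + (\<Sum>j\<in>UNIV - {i}. g j)" by (rule sum.remove) auto
  moreover have "(\<Sum>j\<in>UNIV. (g(i := Suc (g i))) j) = Suc (g i) + (\<Sum>j\<in>UNIV - {i}. g j)"
    by (subst sum.remove[of _ i]) auto
  ultimately show ?thesis unfolding tdeg_def by simp
qed

lemma multinom_Suc: "multinom (g(i := Suc (g i))) * real (Suc (g i)) = multinom g * real (Suc (tdeg g))"
proof -
  have "(\<Prod>j\<in>UNIV. fact (g j)) = fact (g i) * (\<Prod>j\<in>UNIV - {i}. fact (g j) :: real)" by (rule prod.remove) auto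
  moreover have "(\<Prod>j\<in>UNIV. fact ((g(i := Suc (g i))) j)) = fact (Suc (g i)) * (\<Prod>j\<in>UNIV - {i}. fact (g j) :: real)"
    by (subst prod.remove[of _ i]) auto
  ultimately have "(\<Prod>j\<in>UNIV. fact ((g(i := Suc (g i))) j)) = real (Suc (g i)) * (\<Prod>j\<in>UNIV. fact (g j) :: real)" by simp
  moreover have "(\<Prod>j\<in>UNIV. fact (g j) :: real) \<noteq> 0" by (simp add: prod_zero_iff)
  ultimately show ?thesis unfolding multinom_def tdeg_Suc by (simp add: field_simps del: of_nat_Suc)
qed

lemma zpow_Suc: "zpow z (g(i := Suc (g i))) = zpow z g * vec_nth z i"
proof -
  have "zpow z g = vec_nth z i ^ g i * (\<Prod>j\<in>UNIV - {i}. vec_nth z j ^ g j)" unfolding zpow_def by (rule prod.remove) auto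
  moreover have "zpow z (g(i := Suc (g i))) = vec_nth z i ^ Suc (g i) * (\<Prod>j\<in>UNIV - {i}. vec_nth z j ^ g j)"
    unfolding zpow_def by (subst prod.remove[of _ i]) auto
  ultimately show ?thesis by simp
qed

lemma finite_tdeg: "finite {g :: 'd::finite \<Rightarrow> nat. tdeg g = m}"
proof (rule finite_subset)
  show "{g. tdeg g = m} \<subseteq> (box (Suc m) :: ('d \<Rightarrow> nat) set)"
  proof
    fix g :: "'d \<Rightarrow> nat" assume "g \<in> {g. tdeg g = m}"
    then have "g i \<le> m" for i unfolding tdeg_def using member_le_sum[of i UNIV g] by auto
    then show "g \<in> box (Suc m)" by (auto simp: less_Suc_eq_le)
  qed
qed simp

text \<open>
  Induction on the degree: raising one exponent multiplies the multinomial coefficient by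
  \<open>(|g| + 1) / (g\<^sub>i + 1)\<close>, and the factors \<open>g\<^sub>i / |g|\<close> over all \<open>i\<close> add up to one.
\<close>

lemma multinomial_theorem:
  fixes z :: "complex ^ 'd::finite"
  shows "(\<Sum>g | tdeg g = m. of_real (multinom g) * zpow z g) = (\<Sum>i\<in>UNIV. vec_nth z i) ^ m"
proof (induction m)
  case 0
  have "{g :: 'd \<Rightarrow> nat. tdeg g = 0} = {\<lambda>_. 0}" by (auto simp: tdeg_def fun_eq_iff)
  then show ?case by (simp add: multinom_def tdeg_def zpow_def)
next
  case (Suc m)
  let ?D = "{g :: 'd \<Rightarrow> nat. tdeg g = Suc m}"
  have "(\<Sum>g\<in>?D. of_real (multinom g) * zpow z g) =
      (\<Sum>g\<in>?D. \<Sum>i\<in>UNIV. of_nat (g i) / of_nat (Suc m) * (of_real (multinom g) * zpow z g))"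
  proof (rule sum.cong[OF refl])
    fix g assume "g \<in> ?D"
    then have "(\<Sum>i\<in>UNIV. of_nat (g i)) = (of_nat (Suc m) :: complex)" by (simp add: tdeg_def flip: of_nat_sum)
    then have "(\<Sum>i\<in>UNIV. of_nat (g i) / of_nat (Suc m)) = (1 :: complex)"
      by (simp add: sum_divide_distrib[symmetric] del: of_nat_Suc)
    then show "of_real (multinom g) * zpow z g = (\<Sum>i\<in>UNIV. of_nat (g i) / of_nat (Suc m) * (of_real (multinom g) * zpow z g))"
      by (simp only: sum_distrib_right[symmetric]) simp
  qed
  also have "\<dots> = (\<Sum>i\<in>UNIV. \<Sum>g\<in>?D. of_nat (g i) / of_nat (Suc m) * (of_real (multinom g) * zpow z g))"
    by (rule sum.swap)
  also have "\<dots> = (\<Sum>i\<in>UNIV. vec_nth z i * (\<Sum>g | tdeg g = m. of_real (multinom g) * zpow z g))"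
  proof (rule sum.cong[OF refl])
    fix i
    have "(\<Sum>g\<in>?D. of_nat (g i) / of_nat (Suc m) * (of_real (multinom g) * zpow z g)) =
        (\<Sum>g\<in>{g \<in> ?D. g i \<noteq> 0}. of_nat (g i) / of_nat (Suc m) * (of_real (multinom g) * zpow z g))"
      using finite_tdeg by (intro sum.mono_neutral_right) auto
    also have "\<dots> = (\<Sum>h | tdeg h = m. vec_nth z i * (of_real (multinom h) * zpow z h))"
    proof (rule sum.reindex_bij_witness[where i = "\<lambda>h. h(i := Suc (h i))" and j = "\<lambda>g. g(i := g i - 1)"])
      fix g assume g: "g \<in> {g \<in> ?D. g i \<noteq> 0}"
      define h where "h = g(i := g i - 1)"
      have gh: "g = h(i := Suc (h i))" unfolding h_def using g by (auto simp: fun_eq_iff)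
      show "(g(i := g i - 1))(i := Suc ((g(i := g i - 1)) i)) = g" using g by (auto simp: fun_eq_iff)
      have td: "tdeg h = m" using g gh tdeg_Suc[of h i] by simp
      then show "g(i := g i - 1) \<in> {h. tdeg h = m}" unfolding h_def by simp
      have "complex_of_real (multinom g * real (g i)) = of_real (multinom h * real (Suc m))"
        using multinom_Suc[of h i] gh td by (metis fun_upd_same)
      then have e: "of_nat (g i) * complex_of_real (multinom g) = of_nat (Suc m) * of_real (multinom h)"
        by (simp add: mult.commute del: of_nat_Suc)
      have zg: "zpow z g = zpow z h * vec_nth z i" using zpow_Suc[of z h i] gh by simp
      have "of_nat (g i) / of_nat (Suc m) * (of_real (multinom g) * zpow z g) =
          (of_nat (g i) * complex_of_real (multinom g)) / of_nat (Suc m) * zpow z g" by simp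
      also have "\<dots> = of_real (multinom h) * zpow z g" unfolding e by (simp del: of_nat_Suc)
      finally show "vec_nth z i * (of_real (multinom (g(i := g i - 1))) * zpow z (g(i := g i - 1))) =
          of_nat (g i) / of_nat (Suc m) * (of_real (multinom g) * zpow z g)"
        unfolding h_def[symmetric] zg by simp
    next
      fix h :: "'d \<Rightarrow> nat" assume h: "h \<in> {h. tdeg h = m}"
      show "(h(i := Suc (h i)))(i := (h(i := Suc (h i))) i - 1) = h" by auto
      show "h(i := Suc (h i)) \<in> {g \<in> ?D. g i \<noteq> 0}" using h tdeg_Suc[of h i] by simp
    qed
    finally show "(\<Sum>g\<in>?D. of_nat (g i) / of_nat (Suc m) * (of_real (multinom g) * zpow z g)) =
        vec_nth z i * (\<Sum>g | tdeg g = m. of_real (multinom g) * zpow z g)"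
      by (simp only: sum_distrib_left)
  qed
  also have "\<dots> = (\<Sum>i\<in>UNIV. vec_nth z i) ^ Suc m"
    unfolding Suc by (simp add: sum_distrib_right)
  finally show ?case .
qed

lemma multinomial_series:
  fixes z :: "complex ^ 'd::finite"
  assumes "(\<Sum>i\<in>UNIV. cmod (vec_nth z i)) < 1"
  shows "((\<lambda>g. of_real (multinom g) * zpow z g) has_sum (1 / (1 - (\<Sum>i\<in>UNIV. vec_nth z i)))) UNIV"
proof -
  define A where "A N = {g :: 'd \<Rightarrow> nat. tdeg g < N}" for N
  have A: "A N = (\<Union>m<N. {g. tdeg g = m})" for N unfolding A_def by auto
  have finA: "finite (A N)" for N unfolding A using finite_tdeg by auto
  have sumA: "sum f (A N) = (\<Sum>m<N. \<Sum>g | tdeg g = m. f g)" for f :: "('d \<Rightarrow> nat) \<Rightarrow> complex" and N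
    unfolding A using finite_tdeg by (intro sum.UNION_disjoint) auto
  define u where "u = (\<chi> i. complex_of_real (cmod (vec_nth z i)))"
  define x where "x = (\<Sum>i\<in>UNIV. cmod (vec_nth z i))"
  have ux: "(\<Sum>i\<in>UNIV. vec_nth u i) = of_real x" by (simp add: u_def x_def)
  have zu: "complex_of_real (cmod (zpow z g)) = zpow u g" for g
    unfolding zpow_def u_def by (simp add: prod_norm[symmetric] norm_power)
  have x: "0 \<le> x" "x < 1" using assms by (auto simp: x_def intro: sum_nonneg)
  have bnd: "(\<Sum>g\<in>A N. cmod (of_real (multinom g) * zpow z g)) \<le> 1 / (1 - x)" for N
  proof -
    have "complex_of_real (\<Sum>g\<in>A N. cmod (of_real (multinom g) * zpow z g)) = (\<Sum>g\<in>A N. of_real (multinom g) * zpow u g)"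
      by (simp add: norm_mult zu less_imp_le)
    also have "\<dots> = (\<Sum>m<N. of_real (x ^ m))"
      unfolding sumA multinomial_theorem ux by simp
    also have "\<dots> = of_real (\<Sum>m<N. x ^ m)" by simp
    finally have "(\<Sum>g\<in>A N. cmod (of_real (multinom g) * zpow z g)) = (\<Sum>m<N. x ^ m)" by (simp only: of_real_eq_iff)
    also have "\<dots> \<le> (\<Sum>m. x ^ m)" using x by (intro sum_le_suminf summable_geometric) auto
    finally show ?thesis using x by (simp add: suminf_geometric)
  qed
  have sub: "\<exists>N. F \<subseteq> A N" if "finite F" for F
  proof -
    have "F \<subseteq> A (Suc (\<Sum>g\<in>F. tdeg g))"
      unfolding A_def using member_le_sum[of _ F tdeg] that by (auto simp: less_Suc_eq_le)
    then show ?thesis by blast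
  qed
  have "(\<lambda>g. norm (of_real (multinom g) * zpow z g)) summable_on UNIV"
  proof (rule nonneg_bdd_above_summable_on)
    show "bdd_above (sum (\<lambda>g. cmod (of_real (multinom g) * zpow z g)) ` {F. F \<subseteq> UNIV \<and> finite F})"
    proof (rule bdd_aboveI2)
      fix F :: "('d \<Rightarrow> nat) set" assume "F \<in> {F. F \<subseteq> UNIV \<and> finite F}"
      then obtain N where "F \<subseteq> A N" using sub by auto
      then have "(\<Sum>g\<in>F. cmod (of_real (multinom g) * zpow z g)) \<le> (\<Sum>g\<in>A N. cmod (of_real (multinom g) * zpow z g))"
        using finA by (intro sum_mono2) auto
      then show "(\<Sum>g\<in>F. cmod (of_real (multinom g) * zpow z g)) \<le> 1 / (1 - x)" using bnd[of N] by linarith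
    qed
  qed simp
  then have "(\<lambda>g. of_real (multinom g) * zpow z g) summable_on UNIV" by (rule abs_summable_summable)
  then obtain s where s: "((\<lambda>g. of_real (multinom g) * zpow z g) has_sum s) UNIV" by (auto simp: summable_on_def)
  have "filterlim A (finite_subsets_at_top UNIV) sequentially"
    unfolding filterlim_finite_subsets_at_top
  proof (intro allI impI)
    fix F :: "('d \<Rightarrow> nat) set" assume "finite F \<and> F \<subseteq> UNIV"
    then obtain N where N: "F \<subseteq> A N" using sub by auto
    show "\<forall>\<^sub>F n in sequentially. finite (A n) \<and> F \<subseteq> A n \<and> A n \<subseteq> UNIV"
    proof (rule eventually_sequentiallyI[of N])
      fix n assume "N \<le> n"
      then have "A N \<subseteq> A n" by (auto simp: A_def)
      then show "finite (A n) \<and> F \<subseteq> A n \<and> A n \<subseteq> UNIV" using N finA by auto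
    qed
  qed
  with s have "(\<lambda>N. \<Sum>g\<in>A N. of_real (multinom g) * zpow z g) \<longlonglongrightarrow> s"
    unfolding has_sum_def by (rule filterlim_compose)
  moreover have "(\<lambda>N. \<Sum>g\<in>A N. of_real (multinom g) * zpow z g) \<longlonglongrightarrow> 1 / (1 - (\<Sum>i\<in>UNIV. vec_nth z i))"
  proof -
    have "cmod (\<Sum>i\<in>UNIV. vec_nth z i) \<le> x" unfolding x_def by (rule norm_sum)
    then have "(\<lambda>m. (\<Sum>i\<in>UNIV. vec_nth z i) ^ m) sums (1 / (1 - (\<Sum>i\<in>UNIV. vec_nth z i)))"
      using x by (intro geometric_sums) simp
    then show ?thesis unfolding sumA multinomial_theorem sums_def .
  qed
  ultimately show ?thesis using s LIMSEQ_unique by metis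
qed

text \<open>
  The orthonormal basis of normalized monomials.
\<close>

definition da_feature :: "('d::finite \<Rightarrow> nat) \<Rightarrow> complex ^ 'd \<Rightarrow> complex" where
  "da_feature g z = of_real (sqrt (multinom g)) * zpow z g"

lemma sum_cmod_mult_le: "(\<Sum>i\<in>UNIV. cmod (vec_nth z i) * cmod (vec_nth w i)) \<le> norm z * norm (w :: complex ^ 'd::finite)"
proof -
  have "(\<Sum>i\<in>UNIV. \<bar>cmod (vec_nth z i)\<bar> * \<bar>cmod (vec_nth w i)\<bar>) \<le> L2_set (\<lambda>i. cmod (vec_nth z i)) UNIV * L2_set (\<lambda>i. cmod (vec_nth w i)) UNIV"
    by (rule L2_set_mult_ineq)
  then show ?thesis by (simp add: norm_vec_def)
qed

text \<open>
  The multinomial series evaluated at the products \<open>z\<^sub>i cnj (w\<^sub>i)\<close>; Cauchy--Schwarz puts them in its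
  domain of convergence.
\<close>

lemma da_kernel_series:
  fixes z w :: "complex ^ 'd::finite"
  assumes z: "z \<in> ball 0 1" and w: "w \<in> ball 0 1"
  shows "((\<lambda>g. da_feature g z * cnj (da_feature g w)) has_sum (1 / (1 - herm_inner z w))) UNIV"
proof -
  define u where "u = (\<chi> i. vec_nth z i * cnj (vec_nth w i))"
  have "(\<Sum>i\<in>UNIV. cmod (vec_nth u i)) \<le> norm z * norm w"
    unfolding u_def using sum_cmod_mult_le[of z w] by (simp add: norm_mult)
  also have "\<dots> < 1"
  proof -
    have "norm z * norm w \<le> norm z * 1" using w by (intro mult_left_mono) auto
    then show ?thesis using z by simp
  qed
  finally have "((\<lambda>g. of_real (multinom g) * zpow u g) has_sum (1 / (1 - (\<Sum>i\<in>UNIV. vec_nth u i)))) UNIV"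
    by (rule multinomial_series)
  moreover have "of_real (multinom g) * zpow u g = da_feature g z * cnj (da_feature g w)" for g
  proof -
    have "complex_of_real (multinom g) = of_real (sqrt (multinom g)) * of_real (sqrt (multinom g))"
      by (simp add: less_imp_le flip: of_real_mult)
    moreover have "zpow u g = zpow z g * cnj (zpow w g)"
      unfolding zpow_def u_def by (simp add: power_mult_distrib prod.distrib)
    ultimately show ?thesis unfolding da_feature_def by simp
  qed
  moreover have "(\<Sum>i\<in>UNIV. vec_nth u i) = herm_inner z w" by (simp add: u_def herm_inner_def)
  ultimately show ?thesis by simp
qed

lemma da_feature_ell2:
  assumes "z \<in> ball 0 1"
  shows "ell2 (\<lambda>g. da_feature g z)"
proof -
  have "(\<lambda>g. da_feature g z * cnj (da_feature g z)) summable_on UNIV"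
    using da_kernel_series[OF assms assms] by (auto simp: summable_on_def)
  then have "(\<lambda>g. cmod (da_feature g z * cnj (da_feature g z))) summable_on UNIV"
    by (simp only: summable_on_iff_abs_summable_on_complex)
  then show ?thesis unfolding ell2_def by (simp add: norm_mult power2_eq_square)
qed

lemma has_sum_difference:
  fixes f g :: "'i \<Rightarrow> 'b::real_normed_field"
  assumes "(f has_sum a) A" "(g has_sum b) A"
  shows "((\<lambda>i. f i - g i) has_sum (a - b)) A"
  using has_sum_add[OF assms(1) has_sum_uminusI[OF assms(2)]] by simp

lemma has_sum_finite_sum:
  fixes f :: "'j \<Rightarrow> 'i \<Rightarrow> 'b::real_normed_vector"
  assumes "\<And>j. j \<in> J \<Longrightarrow> (f j has_sum a j) A"
  shows "((\<lambda>i. \<Sum>j\<in>J. f j i) has_sum (\<Sum>j\<in>J. a j)) A"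
  using assms by (induction J rule: infinite_finite_induct) (auto intro: has_sum_add)

text \<open>
  The coefficient at \<open>g\<close> is an average of the vanishing function over a small torus, up to
  the coefficients of exponents congruent to \<open>g\<close>; these tend to zero as the order of the roots of unity grows.
\<close>

lemma da_feature_injective:
  fixes a :: "('d::finite \<Rightarrow> nat) \<Rightarrow> complex"
  assumes a: "ell2 a" and zero: "\<And>z. z \<in> ball 0 1 \<Longrightarrow> (\<Sum>\<^sub>\<infinity>g. a g * da_feature g z) = 0"
  shows "a = (\<lambda>_. 0)"
proof (rule ext)
  fix g :: "'d \<Rightarrow> nat"
  define \<rho> where "\<rho> = 1 / (2 * real CARD('d))"
  have \<rho>: "0 < \<rho>" unfolding \<rho>_def by simp
  define r where "r = (\<lambda>i::'d. \<rho>)"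
  have pt: "torus_point M r w \<in> ball 0 1" for M w
  proof -
    have "real CARD('d) * \<rho>\<^sup>2 = 1 / (4 * real CARD('d))" unfolding \<rho>_def by (simp add: power2_eq_square)
    also have "\<dots> < 1"
    proof -
      have "1 < 4 * real CARD('d)" using zero_less_card_finite[where 'a = 'd] by linarith
      then show ?thesis using divide_less_eq_1_pos[of "4 * real CARD('d)" 1] by linarith
    qed
    finally show ?thesis by (simp add: norm_torus_point r_def)
  qed
  define b where "b h = a h * of_real (sqrt (multinom h))" for h
  have hs: "((\<lambda>h. b h * zpow z h) has_sum 0) UNIV" if "z \<in> ball 0 1" for z
  proof -
    have "(\<lambda>h. a h * da_feature h z) summable_on UNIV" by (intro ell2_mult_summable a da_feature_ell2 that)
    then have "((\<lambda>h. a h * da_feature h z) has_sum 0) UNIV" using zero[OF that] by (metis has_sum_infsum)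
    then show ?thesis by (simp add: b_def da_feature_def mult.assoc)
  qed
  define c where "c h = b h * of_real (\<Prod>i\<in>UNIV. r i ^ h i)" for h
  have c_abs: "(\<lambda>h. cmod (c h)) summable_on UNIV"
  proof -
    have "zpow (torus_point 1 r (\<lambda>_. 0)) h = of_real (\<Prod>i\<in>UNIV. r i ^ h i)" for h
      by (simp add: zpow_def torus_point_def)
    then have "c summable_on UNIV" using hs[OF pt[of 1 "\<lambda>_. 0"]] unfolding c_def by (auto simp: summable_on_def)
    then show ?thesis by (simp only: summable_on_iff_abs_summable_on_complex)
  qed
  have ce: "cmod (c g) \<le> e" if e: "0 < e" for e
  proof -
    obtain F where F: "finite F" "F \<subseteq> UNIV" "dist (\<Sum>h\<in>F. cmod (c h)) (\<Sum>\<^sub>\<infinity>h. cmod (c h)) \<le> e"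
      using infsum_finite_approximation[OF c_abs e] by auto
    define M where "M = Suc (\<Sum>h\<in>insert g F. tdeg h)"
    have M: "0 < M" by (simp add: M_def)
    have small: "h i < M" if "h \<in> insert g F" for h i
    proof -
      have "h i \<le> tdeg h" unfolding tdeg_def by (rule member_le_sum) auto
      also have "\<dots> \<le> (\<Sum>h\<in>insert g F. tdeg h)" using F that by (intro member_le_sum) auto
      finally show ?thesis by (simp add: M_def)
    qed
    define t where "t h = (if \<forall>i. h i mod M = g i mod M then c h else 0)" for h
    have "((\<lambda>h. \<Sum>w\<in>(box M :: ('d \<Rightarrow> nat) set). (\<Prod>i\<in>UNIV. cnj (unity_root M ^ w i) ^ g i) * (b h * zpow (torus_point M r w) h)) has_sum
        (\<Sum>w\<in>(box M :: ('d \<Rightarrow> nat) set). (\<Prod>i\<in>UNIV. cnj (unity_root M ^ w i) ^ g i) * 0)) UNIV"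
      by (intro has_sum_finite_sum has_sum_cmult_right hs pt)
    then have "((\<lambda>h. (\<Sum>w\<in>(box M :: ('d \<Rightarrow> nat) set). (\<Prod>i\<in>UNIV. cnj (unity_root M ^ w i) ^ g i) * (b h * zpow (torus_point M r w) h)) * (1 / of_nat M ^ CARD('d))) has_sum
        (0 * (1 / of_nat M ^ CARD('d)))) UNIV"
      by (intro has_sum_cmult_left) simp
    moreover have "(\<Sum>w\<in>(box M :: ('d \<Rightarrow> nat) set). (\<Prod>i\<in>UNIV. cnj (unity_root M ^ w i) ^ g i) * (b h * zpow (torus_point M r w) h)) * (1 / of_nat M ^ CARD('d)) = t h" for h
    proof -
      have "(\<Sum>w\<in>(box M :: ('d \<Rightarrow> nat) set). (\<Prod>i\<in>UNIV. cnj (unity_root M ^ w i) ^ g i) * (b h * zpow (torus_point M r w) h)) * (1 / of_nat M ^ CARD('d))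
          = torus_coeff M r g (\<lambda>z. b h * zpow z h)"
        unfolding torus_coeff_def by simp
      also have "\<dots> = t h" unfolding torus_coeff_mult torus_coeff_zpow[OF M] t_def c_def by simp
      finally show ?thesis .
    qed
    ultimately have t0: "(t has_sum 0) UNIV" by simp
    have tg: "t g = c g" by (simp add: t_def)
    have "((\<lambda>h. t h - (if h = g then c g else 0)) has_sum (0 - c g)) UNIV"
    proof (rule has_sum_difference[OF t0])
      show "((\<lambda>h. if h = g then c g else 0) has_sum c g) UNIV"
        by (rule has_sum_finite_neutralI[of "{g}"]) auto
    qed
    then have s: "((\<lambda>h. t h - (if h = g then c g else 0)) has_sum (- c g)) UNIV" by simp
    define v where "v h = (if h \<in> F then 0 else cmod (c h))" for h
    have vs: "(v has_sum ((\<Sum>\<^sub>\<infinity>h. cmod (c h)) - (\<Sum>h\<in>F. cmod (c h)))) UNIV"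
    proof -
      have "((\<lambda>h. cmod (c h) - (if h \<in> F then cmod (c h) else 0)) has_sum ((\<Sum>\<^sub>\<infinity>h. cmod (c h)) - (\<Sum>h\<in>F. cmod (c h)))) UNIV"
      proof (rule has_sum_difference[OF has_sum_infsum[OF c_abs]])
        show "((\<lambda>h. if h \<in> F then cmod (c h) else 0) has_sum (\<Sum>h\<in>F. cmod (c h))) UNIV"
          by (rule has_sum_finite_neutralI[OF F(1)]) auto
      qed
      moreover have "cmod (c h) - (if h \<in> F then cmod (c h) else 0) = v h" for h by (simp add: v_def)
      ultimately show ?thesis by simp
    qed
    have "cmod (t h - (if h = g then c g else 0)) \<le> v h" for h
    proof (cases "h \<in> insert g F")
      case True
      then have "(\<forall>i. h i mod M = g i mod M) \<longleftrightarrow> h = g" using small[of h] small[of g] by (auto simp: fun_eq_iff)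
      then show ?thesis by (auto simp: t_def v_def)
    next
      case False
      then show ?thesis by (auto simp: t_def v_def)
    qed
    then have "cmod (- c g) \<le> (\<Sum>\<^sub>\<infinity>h. cmod (c h)) - (\<Sum>h\<in>F. cmod (c h))"
      by (intro norm_infsum_le[OF s vs]) auto
    then show ?thesis using F(3) by (simp add: dist_real_def)
  qed
  have "cmod (c g) \<le> 0"
  proof (rule field_le_epsilon)
    fix e :: real assume "0 < e"
    then show "cmod (c g) \<le> 0 + e" using ce[of e] by linarith
  qed
  then have "c g = 0" by simp
  moreover have "(\<Prod>i\<in>UNIV. complex_of_real (r i) ^ g i) \<noteq> 0" using \<rho> by (simp add: r_def prod_zero_iff)
  ultimately have "b g = 0" by (simp add: c_def)
  moreover have "complex_of_real (sqrt (multinom g)) \<noteq> 0" by simp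
  ultimately show "a g = 0" by (simp add: b_def)
qed

lemma drury_arveson_feature_space:
  "drury_arveson (feature_space (ball 0 1) da_feature) (feature_inner (ball 0 1) (da_feature :: ('d::finite \<Rightarrow> nat) \<Rightarrow> complex ^ 'd \<Rightarrow> complex))"
  unfolding drury_arveson_def
  by (rule rkhs_feature_space[OF da_feature_ell2 da_kernel_series da_feature_injective])

section \<open>A multiplier of the Drury--Arveson space\<close>

lemma omg_neq_0 [simp]: "omg m \<noteq> 0"
  using omg_pos[of m] by linarith

definition hump_fun :: "'d \<Rightarrow> 'd \<Rightarrow> complex ^ 'd::finite \<Rightarrow> complex" where
  "hump_fun a b z = (if z \<in> ball 0 1 then \<Sum>i. of_real (bcoef i) * (2 * vec_nth z a * vec_nth z b) ^ i else 0)"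

text \<open>
  The inequality between the arithmetic and the geometric mean; equality occurs on the boundary of the ball.
\<close>

lemma cmod_product_le_1:
  fixes z :: "complex ^ 'd::finite"
  assumes ab: "a \<noteq> b" and z: "norm z \<le> 1"
  shows "cmod (2 * vec_nth z a * vec_nth z b) \<le> 1"
proof -
  have "(cmod (vec_nth z a))\<^sup>2 + (cmod (vec_nth z b))\<^sup>2 = (\<Sum>i\<in>{a, b}. (cmod (vec_nth z i))\<^sup>2)" using ab by simp
  also have "\<dots> \<le> (\<Sum>i\<in>UNIV. (cmod (vec_nth z i))\<^sup>2)" by (intro sum_mono2) auto
  also have "\<dots> = (norm z)\<^sup>2" by (simp add: norm_vec_def L2_set_def sum_nonneg)
  also have "\<dots> \<le> 1" using z by (simp add: power_le_one)
  finally have "(cmod (vec_nth z a))\<^sup>2 + (cmod (vec_nth z b))\<^sup>2 \<le> 1" .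
  moreover have "2 * cmod (vec_nth z a) * cmod (vec_nth z b) \<le> (cmod (vec_nth z a))\<^sup>2 + (cmod (vec_nth z b))\<^sup>2"
    by (rule sum_squares_bound)
  ultimately show ?thesis by (simp add: norm_mult)
qed

text \<open>
  Since \<open>|w| \<le> 1\<close> on the closed ball, summability of the coefficients suffices.
\<close>

lemma hump_fun_summable:
  fixes z :: "complex ^ 'd::finite"
  assumes ab: "a \<noteq> b" and z: "norm z \<le> 1"
  shows "summable (\<lambda>i. norm (of_real (bcoef i) * (2 * vec_nth z a * vec_nth z b) ^ i))"
proof (rule summable_comparison_test'[OF summable_bcoef])
  fix i
  have "cmod (2 * vec_nth z a * vec_nth z b) ^ i \<le> 1"
    using cmod_product_le_1[OF ab z] by (intro power_le_one) auto
  then have "bcoef i * cmod (2 * vec_nth z a * vec_nth z b) ^ i \<le> bcoef i * 1" by (rule mult_left_mono) simp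
  then show "norm (norm (of_real (bcoef i) * (2 * vec_nth z a * vec_nth z b) ^ i)) \<le> bcoef i"
    by (simp only: norm_mult norm_power norm_of_real real_norm_def abs_mult abs_of_nonneg[OF bcoef_nonneg] abs_norm_cancel abs_power_minus power_abs)
qed

text \<open>
  The exponent of \<open>z\<^sup>g (z\<^sub>a z\<^sub>b)\<^sup>k\<close>.
\<close>

definition lift_index :: "'d \<Rightarrow> 'd \<Rightarrow> ('d \<Rightarrow> nat) \<Rightarrow> nat \<Rightarrow> 'd \<Rightarrow> nat" where
  "lift_index a b g k = (\<lambda>i. if i = a \<or> i = b then g i + k else g i)"

definition lower_index :: "'d \<Rightarrow> 'd \<Rightarrow> ('d \<Rightarrow> nat) \<Rightarrow> nat \<Rightarrow> 'd \<Rightarrow> nat" where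
  "lower_index a b g k = (\<lambda>i. if i = a \<or> i = b then g i - k else g i)"

text \<open>
  The largest power of \<open>z\<^sub>a z\<^sub>b\<close> that divides \<open>z\<^sup>g\<close>. Every exponent is obtained from one of level zero by
  lifting, so the exponents split into chains indexed by the level.
\<close>

definition level :: "'d \<Rightarrow> 'd \<Rightarrow> ('d \<Rightarrow> nat) \<Rightarrow> nat" where
  "level a b g = min (g a) (g b)"

lemma level_lift [simp]: "level a b (lift_index a b g k) = level a b g + k"
  by (auto simp: level_def lift_index_def)

lemma lower_lift [simp]: "lower_index a b (lift_index a b g k) k = g"
  by (auto simp: lower_index_def lift_index_def fun_eq_iff)

lemma lift_lower: "k \<le> level a b g \<Longrightarrow> lift_index a b (lower_index a b g k) k = g"
  by (auto simp: lower_index_def lift_index_def fun_eq_iff level_def)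

lemma level_lower: "level a b (lower_index a b g k) = level a b g - k"
  by (auto simp: lower_index_def level_def)

lemma lift_lift: "lift_index a b (lift_index a b g k) l = lift_index a b g (k + l)"
  by (auto simp: lift_index_def fun_eq_iff)

lemma lower_lift_le: "k \<le> l \<Longrightarrow> lower_index a b (lift_index a b g l) k = lift_index a b g (l - k)"
  by (auto simp: lower_index_def lift_index_def fun_eq_iff)

text \<open>
  Equality holds for \<open>q = m\<close> and \<open>n = 2m\<close>, the case of two variables with equal exponents. The left-hand side
  decreases in \<open>n\<close>, and for \<open>n = m + q\<close> it decreases in \<open>q\<close>.
\<close>

lemma weight_step_inequality:
  fixes m q n :: nat
  assumes "m \<le> q" "m + q \<le> n"
  shows "4 * (real m + 1) * (real q + 1) / ((real n + 1) * (real n + 2)) \<le> (2 * real m + 2) / (2 * real m + 1)"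
proof -
  obtain t where q: "q = m + t" using assms(1) le_Suc_ex by blast
  have "(real m + real q + 1) * (real m + real q + 2) - 2 * (real q + 1) * (2 * real m + 1) = (real t)\<^sup>2 + real t"
    unfolding q by (simp add: power2_eq_square algebra_simps)
  then have "2 * (real q + 1) * (2 * real m + 1) \<le> (real m + real q + 1) * (real m + real q + 2)"
    by (smt (verit) of_nat_0_le_iff zero_le_power2)
  also have "\<dots> \<le> (real n + 1) * (real n + 2)" using assms(2) by (intro mult_mono) auto
  finally have "(real m + 1) * 2 * (2 * (real q + 1) * (2 * real m + 1)) \<le> (real m + 1) * 2 * ((real n + 1) * (real n + 2))"
    by (intro mult_left_mono) auto
  then have "4 * (real m + 1) * (real q + 1) * (2 * real m + 1) \<le> (2 * real m + 2) * ((real n + 1) * (real n + 2))"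
    by (simp add: algebra_simps)
  then show ?thesis by (subst divide_le_eq, simp add: add_pos_pos) (simp add: le_divide_eq add_pos_pos mult.commute)
qed

lemma multinom_lift_one:
  fixes g :: "'d::finite \<Rightarrow> nat"
  assumes ab: "a \<noteq> b"
  shows "4 * multinom g * omg (level a b g) \<le> multinom (lift_index a b g 1) * omg (Suc (level a b g))"
proof -
  define n m q where "n = tdeg g" and "m = min (g a) (g b)" and "q = max (g a) (g b)"
  have mq: "m \<le> q" "m + q = g a + g b" by (auto simp: m_def q_def)
  have "g a + g b = (\<Sum>i\<in>{a, b}. g i)" using ab by simp
  also have "\<dots> \<le> tdeg g" unfolding tdeg_def by (intro sum_mono2) auto
  finally have mn: "m + q \<le> n" using mq by (simp add: n_def)
  define h where "h = g(a := Suc (g a))"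
  have hb: "h b = g b" using ab by (simp add: h_def)
  have l: "lift_index a b g 1 = h(b := Suc (h b))" using ab by (auto simp: lift_index_def h_def fun_eq_iff)
  have 1: "multinom h * (real (g a) + 1) = multinom g * (real n + 1)"
    using multinom_Suc[of g a] by (simp add: h_def n_def add.commute)
  have 2: "multinom (lift_index a b g 1) * (real (g b) + 1) = multinom h * (real n + 2)"
    using multinom_Suc[of h b] tdeg_Suc[of g a] unfolding l hb by (simp add: h_def n_def add_ac)
  define G where "G = multinom g" define L where "L = multinom (lift_index a b g 1)"
  have pos: "0 < G" "0 < L" by (auto simp: G_def L_def)
  have prod: "(real (g a) + 1) * (real (g b) + 1) = (real m + 1) * (real q + 1)"
    by (cases "g a \<le> g b") (simp_all add: m_def q_def mult.commute)
  have "L * ((real m + 1) * (real q + 1)) = (L * (real (g b) + 1)) * (real (g a) + 1)"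
    unfolding prod[symmetric] by (simp only: mult_ac)
  also have "\<dots> = (multinom h * (real (g a) + 1)) * (real n + 2)"
    using 2 unfolding L_def by (simp only: mult_ac)
  also have "\<dots> = G * ((real n + 1) * (real n + 2))" unfolding 1 G_def by (simp only: mult_ac)
  finally have LG: "L * ((real m + 1) * (real q + 1)) = G * ((real n + 1) * (real n + 2))" .
  have np: "0 < (real n + 1) * (real n + 2)" by (intro mult_pos_pos) auto
  have G: "G = L * ((real m + 1) * (real q + 1) / ((real n + 1) * (real n + 2)))"
    using LG np by (simp add: field_simps)
  have "4 * G * omg m = L * omg m * (4 * (real m + 1) * (real q + 1) / ((real n + 1) * (real n + 2)))"
    unfolding G by simp
  also have "\<dots> \<le> L * omg m * ((2 * real m + 2) / (2 * real m + 1))"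
    using pos mq mn by (intro mult_left_mono weight_step_inequality) auto
  finally show ?thesis unfolding omg_Suc level_def m_def[symmetric] G_def[symmetric] L_def[symmetric] by simp
qed

text \<open>
  The squared norm of multiplication by \<open>w\<^sup>k\<close> on the monomial \<open>z\<^sup>g\<close> is at most its value on
  \<open>w\<^bsup>level g\<^esup>\<close>. So the chain through the constant function dominates all the others.
\<close>

lemma multinom_lift:
  fixes g :: "'d::finite \<Rightarrow> nat"
  assumes ab: "a \<noteq> b"
  shows "4 ^ k * multinom g / multinom (lift_index a b g k) \<le> omg (level a b g + k) / omg (level a b g)"
proof (induction k)
  case 0
  have "lift_index a b g 0 = g" by (auto simp: lift_index_def fun_eq_iff)
  then show ?case by simp
next
  case (Suc k)
  define h where "h = lift_index a b g k"
  define l where "l = level a b g"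
  have lev: "level a b h = l + k" by (simp add: h_def l_def)
  have hs: "lift_index a b g (Suc k) = lift_index a b h 1" by (simp add: h_def lift_lift)
  have one: "4 * multinom h / multinom (lift_index a b h 1) \<le> omg (Suc (l + k)) / omg (l + k)"
    using multinom_lift_one[OF ab, of h] unfolding lev
    by (simp add: divide_le_eq le_divide_eq mult_ac)
  have "4 ^ Suc k * multinom g / multinom (lift_index a b g (Suc k)) =
      (4 ^ k * multinom g / multinom h) * (4 * multinom h / multinom (lift_index a b h 1))"
    unfolding hs by simp
  also have "\<dots> \<le> (omg (l + k) / omg l) * (omg (Suc (l + k)) / omg (l + k))"
    using Suc one unfolding h_def[symmetric] l_def[symmetric] by (intro mult_mono) (auto simp: less_imp_le)
  also have "\<dots> = omg (l + Suc k) / omg l" by simp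
  finally show ?case by (simp add: l_def)
qed

text \<open>
  The coefficients of the product of \<open>hump_fun\<close> with the function with coefficients \<open>x\<close>.
\<close>

definition hump_coeffs :: "'d \<Rightarrow> 'd \<Rightarrow> (('d::finite \<Rightarrow> nat) \<Rightarrow> complex) \<Rightarrow> ('d \<Rightarrow> nat) \<Rightarrow> complex" where
  "hump_coeffs a b x g = (\<Sum>k\<le>level a b g.
     of_real (bcoef k * 2 ^ k * sqrt (multinom (lower_index a b g k) / multinom g)) * x (lower_index a b g k))"

lemma zpow_lift:
  fixes z :: "complex ^ 'd::finite"
  assumes ab: "a \<noteq> b"
  shows "zpow z (lift_index a b g k) = zpow z g * (vec_nth z a * vec_nth z b) ^ k"
proof (induction k)
  case 0
  have "lift_index a b g 0 = g" by (auto simp: lift_index_def fun_eq_iff)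
  then show ?case by simp
next
  case (Suc k)
  define h where "h = lift_index a b g k"
  have "lift_index a b g (Suc k) = (h(a := Suc (h a)))(b := Suc ((h(a := Suc (h a))) b))"
    using ab by (auto simp: h_def lift_index_def fun_eq_iff)
  then have "zpow z (lift_index a b g (Suc k)) = zpow z h * vec_nth z a * vec_nth z b"
    by (simp only: zpow_Suc)
  then show ?case using Suc by (simp add: h_def)
qed

text \<open>
  On the chain above an exponent \<open>\<beta>\<close> of level zero, multiplication is dominated by the scalar matrix of
  \<open>bcoef_multiplier\<close>.
\<close>

lemma hump_coeffs_bound:
  assumes ab: "a \<noteq> b" and lev: "level a b \<beta> = 0"
  shows "cmod (hump_coeffs a b x (lift_index a b \<beta> l)) \<le>
    (\<Sum>m\<le>l. bcoef (l - m) * sqrt (omg l / omg m) * cmod (x (lift_index a b \<beta> m)))"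
proof -
  have "cmod (hump_coeffs a b x (lift_index a b \<beta> l)) \<le>
      (\<Sum>k\<le>l. bcoef k * sqrt (omg l / omg (l - k)) * cmod (x (lift_index a b \<beta> (l - k))))"
    unfolding hump_coeffs_def level_lift lev add_0
  proof (rule sum_norm_le)
    fix k assume k: "k \<in> {..l}"
    define m where "m = l - k"
    have l: "l = m + k" using k by (simp add: m_def)
    define \<delta> where "\<delta> = lift_index a b \<beta> m"
    have low: "lower_index a b (lift_index a b \<beta> l) k = \<delta>"
      using k unfolding \<delta>_def m_def by (intro lower_lift_le) simp
    have lifted: "lift_index a b \<beta> l = lift_index a b \<delta> k" unfolding \<delta>_def l by (simp add: lift_lift)
    have "2 ^ k * sqrt (multinom \<delta> / multinom (lift_index a b \<beta> l)) = sqrt (4 ^ k * multinom \<delta> / multinom (lift_index a b \<delta> k))"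
    proof -
      have "sqrt (4 ^ k) = 2 ^ k"
        by (rule real_sqrt_unique) (simp_all add: power2_eq_square flip: power_mult_distrib)
      then show ?thesis unfolding lifted by (simp add: real_sqrt_mult real_sqrt_divide)
    qed
    also have "\<dots> \<le> sqrt (omg (m + k) / omg m)"
      using multinom_lift[OF ab, of k \<delta>] by (intro real_sqrt_le_mono) (simp add: \<delta>_def lev)
    finally have w: "2 ^ k * sqrt (multinom \<delta> / multinom (lift_index a b \<beta> l)) \<le> sqrt (omg l / omg m)" unfolding l .
    have "cmod (of_real (bcoef k * 2 ^ k * sqrt (multinom \<delta> / multinom (lift_index a b \<beta> l))) * x \<delta>) =
        bcoef k * (2 ^ k * sqrt (multinom \<delta> / multinom (lift_index a b \<beta> l))) * cmod (x \<delta>)"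
    proof -
      have nn: "0 \<le> bcoef k * 2 ^ k * sqrt (multinom \<delta> / multinom (lift_index a b \<beta> l))"
        by (intro mult_nonneg_nonneg real_sqrt_ge_zero divide_nonneg_nonneg) (auto simp: less_imp_le)
      show ?thesis unfolding norm_mult norm_of_real abs_of_nonneg[OF nn] by (simp only: mult.assoc)
    qed
    also have "\<dots> \<le> bcoef k * sqrt (omg l / omg m) * cmod (x \<delta>)"
      by (intro mult_right_mono mult_left_mono w) auto
    finally show "cmod (of_real (bcoef k * 2 ^ k * sqrt (multinom (lower_index a b (lift_index a b \<beta> l) k) / multinom (lift_index a b \<beta> l))) *
        x (lower_index a b (lift_index a b \<beta> l) k)) \<le> bcoef k * sqrt (omg l / omg (l - k)) * cmod (x (lift_index a b \<beta> (l - k)))"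
      unfolding low m_def[symmetric] \<delta>_def[symmetric] .
  qed
  also have "\<dots> = (\<Sum>m\<le>l. bcoef (l - m) * sqrt (omg l / omg m) * cmod (x (lift_index a b \<beta> m)))"
    by (rule sum.reindex_bij_witness[where i = "\<lambda>m. l - m" and j = "\<lambda>k. l - k"]) auto
  finally show ?thesis .
qed

text \<open>
  The chains partition the exponents, and the bound 13 holds on each; hence the squared norm grows at
  most by the factor \<open>13\<^sup>2 = 169\<close>.
\<close>

lemma hump_coeffs_ell2:
  fixes x :: "('d::finite \<Rightarrow> nat) \<Rightarrow> complex"
  assumes ab: "a \<noteq> b" and x: "ell2 x"
  shows "ell2 (hump_coeffs a b x)"
proof -
  obtain C where C: "\<And>F. finite F \<Longrightarrow> (\<Sum>g\<in>F. (cmod (x g))\<^sup>2) \<le> C"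
    using x unfolding ell2_iff_bounded by blast
  have "(\<Sum>g\<in>F. (cmod (hump_coeffs a b x g))\<^sup>2) \<le> 169 * C" if F: "finite F" for F
  proof -
    define base where "base g = lower_index a b g (level a b g)" for g :: "'d \<Rightarrow> nat"
    define K where "K = (\<Sum>g\<in>F. level a b g)"
    let ?P = "base ` F \<times> {..K}"
    let ?L = "\<lambda>p. lift_index a b (fst p) (snd p)"
    have inj: "inj_on ?L ?P"
    proof (rule inj_onI)
      fix p q assume p: "p \<in> ?P" and q: "q \<in> ?P" and eq: "?L p = ?L q"
      have l: "level a b (fst p) = 0" "level a b (fst q) = 0" using p q by (auto simp: base_def level_lower)
      have "level a b (?L p) = level a b (?L q)" using eq by simp
      then have s: "snd p = snd q" using l by simp
      have "lower_index a b (?L p) (snd p) = lower_index a b (?L q) (snd q)" using eq s by simp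
      then have "fst p = fst q" by simp
      then show "p = q" using s by (simp add: prod_eq_iff)
    qed
    have fin: "finite ?P" using F by simp
    have sub: "F \<subseteq> ?L ` ?P"
    proof
      fix g assume g: "g \<in> F"
      have "level a b g \<le> K" unfolding K_def using F g by (intro member_le_sum) auto
      then have mem: "(base g, level a b g) \<in> ?P" using g by simp
      have "g = ?L (base g, level a b g)" by (simp add: base_def lift_lower)
      then show "g \<in> ?L ` ?P" using mem by (rule image_eqI)
    qed
    have "(\<Sum>g\<in>F. (cmod (hump_coeffs a b x g))\<^sup>2) \<le> (\<Sum>g\<in>?L ` ?P. (cmod (hump_coeffs a b x g))\<^sup>2)"
      using fin sub by (intro sum_mono2) auto
    also have "\<dots> = (\<Sum>p\<in>?P. (cmod (hump_coeffs a b x (?L p)))\<^sup>2)"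
      using sum.reindex[OF inj] by simp
    also have "\<dots> = (\<Sum>\<beta>\<in>base ` F. \<Sum>l\<le>K. (cmod (hump_coeffs a b x (lift_index a b \<beta> l)))\<^sup>2)"
      by (simp add: sum.cartesian_product split_beta)
    also have "\<dots> \<le> (\<Sum>\<beta>\<in>base ` F. 169 * (\<Sum>m\<le>K. (cmod (x (lift_index a b \<beta> m)))\<^sup>2))"
    proof (rule sum_mono)
      fix \<beta> assume "\<beta> \<in> base ` F"
      then have lev: "level a b \<beta> = 0" by (auto simp: base_def level_lower)
      define u where "u m = cmod (x (lift_index a b \<beta> m))" for m
      have "L2_set (\<lambda>l. cmod (hump_coeffs a b x (lift_index a b \<beta> l))) {..K} \<le>
          L2_set (\<lambda>l. \<Sum>m\<le>l. bcoef (l - m) * sqrt (omg l / omg m) * u m) {..K}"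
        unfolding u_def by (intro L2_set_mono hump_coeffs_bound[OF ab lev]) auto
      also have "\<dots> \<le> 13 * L2_set u {..K}" by (rule bcoef_multiplier)
      finally have "(L2_set (\<lambda>l. cmod (hump_coeffs a b x (lift_index a b \<beta> l))) {..K})\<^sup>2 \<le> (13 * L2_set u {..K})\<^sup>2"
        by (intro power_mono) auto
      then show "(\<Sum>l\<le>K. (cmod (hump_coeffs a b x (lift_index a b \<beta> l)))\<^sup>2) \<le> 169 * (\<Sum>m\<le>K. (cmod (x (lift_index a b \<beta> m)))\<^sup>2)"
        by (simp add: L2_set_def u_def power_mult_distrib sum_nonneg)
    qed
    also have "\<dots> = 169 * (\<Sum>p\<in>?P. (cmod (x (?L p)))\<^sup>2)"
      by (simp add: sum.cartesian_product split_beta sum_distrib_left)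
    also have "(\<Sum>p\<in>?P. (cmod (x (?L p)))\<^sup>2) = (\<Sum>g\<in>?L ` ?P. (cmod (x g))\<^sup>2)"
      using sum.reindex[OF inj, of "\<lambda>g. (cmod (x g))\<^sup>2"] by (simp add: o_def)
    also have "169 * \<dots> \<le> 169 * C" using fin by (intro mult_left_mono C) auto
    finally show ?thesis .
  qed
  then show ?thesis unfolding ell2_iff_bounded by blast
qed

text \<open>
  The terms of the product of the two series are indexed by pairs of an exponent and a power of \<open>w\<close>;
  collecting the pairs with the same lifted exponent yields the finite sums in \<open>hump_coeffs\<close>.
\<close>

lemma hump_fun_times_feature_fun:
  fixes x :: "('d::finite \<Rightarrow> nat) \<Rightarrow> complex"
  assumes ab: "a \<noteq> b" and x: "ell2 x"
  shows "(\<lambda>z. hump_fun a b z * feature_fun (ball 0 1) da_feature x z) = feature_fun (ball 0 1) da_feature (hump_coeffs a b x)"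
proof (rule ext)
  fix z :: "complex ^ 'd"
  show "hump_fun a b z * feature_fun (ball 0 1) da_feature x z = feature_fun (ball 0 1) da_feature (hump_coeffs a b x) z"
  proof (cases "z \<in> ball 0 1")
    case z: True
    define F where "F i = of_real (bcoef i) * (2 * vec_nth z a * vec_nth z b) ^ i" for i
    define G where "G g = x g * da_feature g z" for g
    have nz: "norm z \<le> 1" using z by simp
    have "F sums hump_fun a b z"
      using summable_norm_cancel[OF hump_fun_summable[OF ab nz]] z unfolding hump_fun_def F_def by (simp add: summable_sums)
    then have Fs: "(F has_sum hump_fun a b z) UNIV"
      using hump_fun_summable[OF ab nz] unfolding F_def by (intro norm_summable_imp_has_sum) auto
    have Gs: "(G has_sum feature_fun (ball 0 1) da_feature x z) UNIV"
      using ell2_mult_summable[OF x da_feature_ell2[OF z]] z unfolding G_def feature_fun_def by simp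
    have Fn: "(\<lambda>i. cmod (F i)) summable_on UNIV" using Fs by (metis summable_on_def summable_on_iff_abs_summable_on_complex)
    have Gn: "(\<lambda>g. cmod (G g)) summable_on UNIV" using Gs by (metis summable_on_def summable_on_iff_abs_summable_on_complex)
    have "(\<lambda>p. cmod (F (fst p) * G (snd p))) summable_on (UNIV \<times> UNIV)"
    proof (rule summable_on_SigmaI[where g = "\<lambda>i. cmod (F i) * (\<Sum>\<^sub>\<infinity>g. cmod (G g))"])
      show "((\<lambda>g. cmod (F (fst (i, g)) * G (snd (i, g)))) has_sum cmod (F i) * (\<Sum>\<^sub>\<infinity>g. cmod (G g))) UNIV" for i
        unfolding fst_conv snd_conv norm_mult by (intro has_sum_cmult_right has_sum_infsum Gn)
      show "(\<lambda>i. cmod (F i) * (\<Sum>\<^sub>\<infinity>g. cmod (G g))) summable_on UNIV" by (intro summable_on_cmult_left Fn)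
    qed auto
    then have "(\<lambda>p. F (fst p) * G (snd p)) summable_on (UNIV \<times> UNIV)" by (rule abs_summable_summable)
    then have prod: "((\<lambda>p. F (fst p) * G (snd p)) has_sum (hump_fun a b z * feature_fun (ball 0 1) da_feature x z)) (UNIV \<times> UNIV)"
      by (intro has_sum_SigmaI[where g = "\<lambda>i. F i * feature_fun (ball 0 1) da_feature x z"])
        (auto intro: has_sum_cmult_right Gs has_sum_cmult_left Fs)
    let ?S = "Sigma UNIV (\<lambda>g. {..level a b g}) :: (('d \<Rightarrow> nat) \<times> nat) set"
    have bij: "bij_betw (\<lambda>q. (snd q, lower_index a b (fst q) (snd q))) ?S (UNIV \<times> UNIV)"
      by (rule bij_betw_byWitness[where f' = "\<lambda>p. (lift_index a b (snd p) (fst p), fst p)"])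
        (auto simp: lift_lower)
    have "((\<lambda>q. F (snd q) * G (lower_index a b (fst q) (snd q))) has_sum (hump_fun a b z * feature_fun (ball 0 1) da_feature x z)) ?S"
      using prod has_sum_reindex_bij_betw[OF bij, of "\<lambda>p. F (fst p) * G (snd p)"] by simp
    then have "((\<lambda>g. \<Sum>k\<le>level a b g. F k * G (lower_index a b g k)) has_sum (hump_fun a b z * feature_fun (ball 0 1) da_feature x z)) UNIV"
      by (rule has_sum_SigmaD) auto
    moreover have "(\<Sum>k\<le>level a b g. F k * G (lower_index a b g k)) = hump_coeffs a b x g * da_feature g z" for g
      unfolding hump_coeffs_def sum_distrib_right
    proof (rule sum.cong[OF refl])
      fix k assume "k \<in> {..level a b g}"
      then have k: "k \<le> level a b g" by simp
      define \<delta> where "\<delta> = lower_index a b g k"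
      have zg: "zpow z g = zpow z \<delta> * (vec_nth z a * vec_nth z b) ^ k"
        using zpow_lift[OF ab, of z \<delta> k] lift_lower[OF k] by (simp add: \<delta>_def)
      have sq: "sqrt (multinom \<delta> / multinom g) * sqrt (multinom g) = sqrt (multinom \<delta>)"
        by (simp add: real_sqrt_divide)
      have "of_real (bcoef k * 2 ^ k * sqrt (multinom \<delta> / multinom g)) * x \<delta> * da_feature g z =
          of_real (bcoef k) * 2 ^ k * of_real (sqrt (multinom \<delta> / multinom g) * sqrt (multinom g)) * x \<delta> * zpow z g"
        unfolding da_feature_def by simp
      also have "\<dots> = F k * G \<delta>"
        unfolding sq zg F_def G_def da_feature_def by (simp add: power_mult_distrib mult_ac)
      finally show "F k * G (lower_index a b g k) =
          of_real (bcoef k * 2 ^ k * sqrt (multinom (lower_index a b g k) / multinom g)) * x (lower_index a b g k) * da_feature g z"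
        unfolding \<delta>_def by simp
    qed
    ultimately have "((\<lambda>g. hump_coeffs a b x g * da_feature g z) has_sum (hump_fun a b z * feature_fun (ball 0 1) da_feature x z)) UNIV"
      by simp
    then show ?thesis using z by (simp add: feature_fun_def infsumI)
  next
    case False
    then show ?thesis by (simp add: feature_fun_def)
  qed
qed

lemma hump_fun_multiplier:
  fixes a b :: "'d::finite"
  assumes ab: "a \<noteq> b"
  shows "hump_fun a b \<in> mult_drury_arveson"
proof -
  have "hump_fun a b \<in> multipliers (ball 0 1) (feature_space (ball 0 1) da_feature)"
    unfolding multipliers_def
  proof (intro CollectI conjI allI impI ballI)
    fix z :: "complex ^ 'd" assume "z \<notin> ball 0 1"
    then show "hump_fun a b z = 0" by (simp add: hump_fun_def)
  next
    fix h assume "h \<in> feature_space (ball 0 1) (da_feature :: ('d \<Rightarrow> nat) \<Rightarrow> _)"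
    then obtain x where x: "ell2 x" "h = feature_fun (ball 0 1) da_feature x" by (auto simp: feature_space_def)
    show "(\<lambda>z. hump_fun a b z * h z) \<in> feature_space (ball 0 1) da_feature"
      unfolding x(2) hump_fun_times_feature_fun[OF ab x(1)]
      using hump_coeffs_ell2[OF ab x(1)] by (auto simp: feature_space_def)
  qed
  then show ?thesis unfolding mult_drury_arveson_def using drury_arveson_feature_space by blast
qed

section \<open>Evaluating the multiplier on matrices\<close>

lemma polyfun_holomorphic: "p \<in> polyfun \<Longrightarrow> holomorphic_on_ball p"
proof (induction rule: polyfun.induct)
  case (const c)
  then show ?case unfolding holomorphic_on_ball_def by (auto intro!: exI[of _ "\<lambda>_. 0"])
next
  case (coord i)
  have "((\<lambda>z. vec_nth z i) has_derivative (\<lambda>z. vec_nth z i)) (at z)" for z :: "complex ^ 'a"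
    by (rule bounded_linear_imp_has_derivative[OF bounded_linear_vec_nth])
  then show ?case unfolding holomorphic_on_ball_def by (auto intro!: exI[of _ "\<lambda>z. vec_nth z i"])
next
  case (add p q)
  show ?case unfolding holomorphic_on_ball_def
  proof
    fix z :: "complex ^ 'a" assume z: "z \<in> ball 0 1"
    obtain D E where "(p has_derivative D) (at z)" "\<forall>c v. D (c *s v) = c * D v" "(q has_derivative E) (at z)" "\<forall>c v. E (c *s v) = c * E v"
      using add z unfolding holomorphic_on_ball_def by metis
    then show "\<exists>D. ((\<lambda>z. p z + q z) has_derivative D) (at z) \<and> (\<forall>c v. D (c *s v) = c * D v)"
      by (intro exI[of _ "\<lambda>v. D v + E v"]) (auto intro: has_derivative_add simp: ring_distribs)
  qed
next
  case (mult p q)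
  show ?case unfolding holomorphic_on_ball_def
  proof
    fix z :: "complex ^ 'a" assume z: "z \<in> ball 0 1"
    obtain D E where "(p has_derivative D) (at z)" "\<forall>c v. D (c *s v) = c * D v" "(q has_derivative E) (at z)" "\<forall>c v. E (c *s v) = c * E v"
      using mult z unfolding holomorphic_on_ball_def by metis
    then show "\<exists>D. ((\<lambda>z. p z * q z) has_derivative D) (at z) \<and> (\<forall>c v. D (c *s v) = c * D v)"
      by (intro exI[of _ "\<lambda>v. p z * E v + D v * q z"]) (intro conjI has_derivative_mult, auto simp: algebra_simps)
  qed
qed

lemma hump_fun_holomorphic:
  fixes a b :: "'d::finite"
  assumes ab: "a \<noteq> b"
  shows "holomorphic_on_ball (hump_fun a b)"
  unfolding holomorphic_on_ball_def
proof
  fix z :: "complex ^ 'd" assume z: "z \<in> ball 0 1"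
  define w where "w z = 2 * vec_nth z a * vec_nth z b" for z :: "complex ^ 'd"
  define g where "g t = (\<Sum>i. complex_of_real (bcoef i) * t ^ i)" for t
  have "w \<in> polyfun" unfolding w_def by (intro polyfun.intros)
  then obtain D where D: "(w has_derivative D) (at z)" "\<And>c v. D (c *s v) = c * D v"
    using polyfun_holomorphic z unfolding holomorphic_on_ball_def by blast
  have wz: "cmod (w z) < 1"
  proof (cases "z = 0")
    case True
    then show ?thesis by (simp add: w_def)
  next
    case False
    define y where "y = complex_of_real (1 / norm z) *s z"
    have ny: "norm y = 1"
      unfolding y_def norm_vector_scalar_mult norm_of_real using False by simp
    have zy: "z = complex_of_real (norm z) *s y"
      unfolding y_def using False by (simp add: Finite_Cartesian_Product.vec_eq_iff)
    have "w z = of_real ((norm z)\<^sup>2) * w y"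
      by (subst zy) (simp add: w_def power2_eq_square)
    then have "cmod (w z) = (norm z)\<^sup>2 * cmod (w y)" by (simp add: norm_mult norm_power)
    also have "\<dots> \<le> (norm z)\<^sup>2 * 1"
      using cmod_product_le_1[OF ab, of y] ny unfolding w_def by (intro mult_left_mono) auto
    also have "\<dots> < 1" using z by (simp add: power_less_one_iff abs_square_less_1)
    finally show ?thesis .
  qed
  have "summable (\<lambda>i. complex_of_real (bcoef i) * 1 ^ i)"
    using summable_of_real[OF summable_bcoef, where 'a = complex] by simp
  then obtain g' where g': "(g has_field_derivative g') (at (w z))"
    using termdiffs_strong[of "\<lambda>i. complex_of_real (bcoef i)" 1 "w z"] wz unfolding g_def by auto
  have gD: "((\<lambda>z. g (w z)) has_derivative (\<lambda>v. g' * D v)) (at z)"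
    using D(1) g'[unfolded has_field_derivative_def] by (rule has_derivative_compose)
  have eq: "g (w y) = hump_fun a b y" if "y \<in> ball 0 1" for y
    using that by (simp add: hump_fun_def g_def w_def)
  have "(hump_fun a b has_derivative (\<lambda>v. g' * D v)) (at z)"
    by (rule has_derivative_transform_within_open[OF gD open_ball z eq])
  then show "\<exists>D. (hump_fun a b has_derivative D) (at z) \<and> (\<forall>c v. D (c *s v) = c * D v)"
    using D(2) by (intro exI[of _ "\<lambda>v. g' * D v"]) auto
qed

text \<open>
  The value of the polynomial \<open>2 z\<^sub>a z\<^sub>b\<close> at \<open>X\<close>.
\<close>

definition prod_mat :: "'d \<Rightarrow> 'd \<Rightarrow> ('d \<Rightarrow> complex Matrix.mat) \<Rightarrow> complex Matrix.mat" where
  "prod_mat a b X = 2 \<cdot>\<^sub>m (X a * X b)"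

primrec hump_sum :: "nat \<Rightarrow> complex Matrix.mat \<Rightarrow> nat \<Rightarrow> complex Matrix.mat" where
  "hump_sum n T 0 = 0\<^sub>m n n"
| "hump_sum n T (Suc I) = hump_sum n T I + of_real (bcoef I) \<cdot>\<^sub>m (T ^\<^sub>m I)"

lemma hump_sum_carrier: "T \<in> carrier_mat n n \<Longrightarrow> hump_sum n T I \<in> carrier_mat n n"
  by (induction I) auto

lemma prod_mat_carrier: "(\<And>i. X i \<in> carrier_mat n n) \<Longrightarrow> prod_mat a b X \<in> carrier_mat n n"
  unfolding prod_mat_def by (metis mult_carrier_mat smult_carrier_mat)

lemma calculus_hump_sum:
  fixes X :: "'d::finite \<Rightarrow> complex Matrix.mat"
  assumes X: "\<And>i. X i \<in> carrier_mat n n" and \<Phi>: "is_calculus n X \<Phi>"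
  shows "\<Phi> (\<lambda>z. \<Sum>i<I. of_real (bcoef i) * (2 * vec_nth z a * vec_nth z b) ^ i) = hump_sum n (prod_mat a b X) I"
proof -
  have add: "\<Phi> (\<lambda>z. f z + g z) = \<Phi> f + \<Phi> g" and mult: "\<Phi> (\<lambda>z. f z * g z) = \<Phi> f * \<Phi> g"
    and sm: "\<Phi> (\<lambda>z. c * f z) = c \<cdot>\<^sub>m \<Phi> f"
    if "f \<in> polyfun" "g \<in> polyfun" for f g c
    using \<Phi> polyfun_holomorphic[OF that(1)] polyfun_holomorphic[OF that(2)] unfolding is_calculus_def by blast+
  have one: "\<Phi> (\<lambda>z. 1) = 1\<^sub>m n" and co: "\<Phi> (\<lambda>z. vec_nth z i) = X i" for i
    using \<Phi> unfolding is_calculus_def by blast+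
  note T = prod_mat_carrier[where X = X and a = a and b = b, OF X]
  have p: "(\<lambda>z. 2 * vec_nth z a) \<in> polyfun" "(\<lambda>z. (2 * vec_nth z a * vec_nth z b) ^ k) \<in> polyfun"
    "(\<lambda>z. 2 * vec_nth z a * vec_nth z b) \<in> polyfun" for k
    by (intro polyfun_power polyfun.intros)+
  have w: "\<Phi> (\<lambda>z. 2 * vec_nth z a * vec_nth z b) = prod_mat a b X"
    using mult[OF p(1) polyfun.coord[of b]] sm[OF polyfun.coord[of a] polyfun.coord[of a], of 2] co
    unfolding prod_mat_def by (simp add: mult_smult_assoc_mat[OF X X])
  have pw: "\<Phi> (\<lambda>z. (2 * vec_nth z a * vec_nth z b) ^ k) = prod_mat a b X ^\<^sub>m k" for k
  proof (induction k)
    case 0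
    then show ?case using one T by simp
  next
    case (Suc k)
    have "\<Phi> (\<lambda>z. (2 * vec_nth z a * vec_nth z b) ^ Suc k) = \<Phi> (\<lambda>z. (2 * vec_nth z a * vec_nth z b) ^ k * (2 * vec_nth z a * vec_nth z b))"
      by (simp only: power_Suc2)
    then show ?case using mult[OF p(2) p(3)] Suc w by simp
  qed
  show ?thesis
  proof (induction I)
    case 0
    have "0 \<cdot>\<^sub>m 1\<^sub>m n = (0\<^sub>m n n :: complex Matrix.mat)" by (intro eq_matI) auto
    then show ?case using sm[OF polyfun.const polyfun.const, of 0 1] one by simp
  next
    case (Suc I)
    have q: "(\<lambda>z. \<Sum>i<I. of_real (bcoef i) * (2 * vec_nth z a * vec_nth z b) ^ i) \<in> polyfun"
      "(\<lambda>z. of_real (bcoef I) * (2 * vec_nth z a * vec_nth z b) ^ I) \<in> polyfun"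
      by (intro polyfun_sum polyfun_power polyfun.intros)+
    show ?case using add[OF q] sm[OF p(2)[of I] p(2)[of I], of "of_real (bcoef I)"] Suc pw by simp
  qed
qed

text \<open>
  The partial sums converge to \<open>hump_fun\<close> uniformly on the ball, so continuity of the calculus determines
  its value; in particular any two calculi agree there, which is what the definite description requires.
\<close>

lemma eval_at_hump_fun:
  fixes X :: "'d::finite \<Rightarrow> complex Matrix.mat"
  assumes ab: "a \<noteq> b" and X: "X \<in> comm_ball n"
  shows "eval_at n (hump_fun a b) X \<in> carrier_mat n n"
    and "\<And>e. 0 < e \<Longrightarrow> \<exists>I0. \<forall>I\<ge>I0. opnorm (hump_sum n (prod_mat a b X) I - eval_at n (hump_fun a b) X) < e"
proof -
  have Xc: "\<And>i. X i \<in> carrier_mat n n" using X by (auto simp: comm_ball_def)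
  note T = prod_mat_carrier[where X = X and a = a and b = b, OF Xc]
  note S = hump_sum_carrier[OF T]
  let ?f = "hump_fun a b"
  have hf: "holomorphic_on_ball ?f" by (rule hump_fun_holomorphic[OF ab])
  have lim: "\<exists>I0. \<forall>I\<ge>I0. opnorm (hump_sum n (prod_mat a b X) I - \<Phi> ?f) < e" if \<Phi>: "is_calculus n X \<Phi>" and e: "0 < e" for \<Phi> e
  proof -
    have "\<forall>f. holomorphic_on_ball f \<longrightarrow> (\<forall>\<epsilon>>0. \<exists>L \<delta>. compact L \<and> L \<subseteq> ball 0 1 \<and> \<delta> > 0 \<and>
        (\<forall>g. holomorphic_on_ball g \<longrightarrow> (\<forall>z\<in>L. cmod (g z - f z) < \<delta>) \<longrightarrow> opnorm (\<Phi> g - \<Phi> f) < \<epsilon>))"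
      using \<Phi> unfolding is_calculus_def by (elim conjE)
    from this[rule_format, OF hf e] obtain L \<delta> where L: "L \<subseteq> ball 0 1" "\<delta> > 0"
      "\<And>g. holomorphic_on_ball g \<Longrightarrow> (\<forall>z\<in>L. cmod (g z - ?f z) < \<delta>) \<Longrightarrow> opnorm (\<Phi> g - \<Phi> ?f) < e"
      by blast
    have "(\<lambda>I. \<Sum>i. bcoef (i + I)) \<longlonglongrightarrow> 0" by (rule suminf_exist_split2[OF summable_bcoef])
    then have "\<forall>\<^sub>F I in sequentially. (\<Sum>i. bcoef (i + I)) < \<delta>" using L(2) by (rule order_tendstoD)
    then obtain I0 where I0: "\<And>I. I0 \<le> I \<Longrightarrow> (\<Sum>i. bcoef (i + I)) < \<delta>" by (auto simp: eventually_sequentially)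
    have "opnorm (hump_sum n (prod_mat a b X) I - \<Phi> ?f) < e" if I: "I0 \<le> I" for I
    proof -
      define g where "g z = (\<Sum>i<I. of_real (bcoef i) * (2 * vec_nth z a * vec_nth z b) ^ i)" for z :: "complex ^ 'd"
      have "g \<in> polyfun" unfolding g_def by (intro polyfun_sum polyfun_power polyfun.intros)
      then have hg: "holomorphic_on_ball g" by (rule polyfun_holomorphic)
      have "\<forall>z\<in>L. cmod (g z - ?f z) < \<delta>"
      proof
        fix z assume "z \<in> L"
        then have z: "z \<in> ball 0 1" using L by blast
        then have nz: "norm z \<le> 1" by simp
        define t where "t i = of_real (bcoef i) * (2 * vec_nth z a * vec_nth z b) ^ i" for i
        have ts: "summable (\<lambda>i. norm (t i))" unfolding t_def by (rule hump_fun_summable[OF ab nz])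
        have tb: "norm (t i) \<le> bcoef i" for i
        proof -
          have "cmod (2 * vec_nth z a * vec_nth z b) ^ i \<le> 1"
            using cmod_product_le_1[OF ab nz] by (intro power_le_one) auto
          then have "bcoef i * cmod (2 * vec_nth z a * vec_nth z b) ^ i \<le> bcoef i * 1" by (rule mult_left_mono) simp
          then show ?thesis unfolding t_def norm_mult norm_power norm_of_real abs_of_nonneg[OF bcoef_nonneg] by simp
        qed
        have "?f z - g z = (\<Sum>i. t (i + I))"
          unfolding g_def hump_fun_def using z suminf_minus_initial_segment[OF summable_norm_cancel[OF ts], of I] by (simp add: t_def)
        also have "cmod \<dots> \<le> (\<Sum>i. bcoef (i + I))"
          by (intro norm_suminf_le tb summable_ignore_initial_segment summable_bcoef)
        finally show "cmod (g z - ?f z) < \<delta>" using I0[OF I] by (simp add: norm_minus_commute)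
      qed
      from L(3)[OF hg this] show ?thesis unfolding g_def calculus_hump_sum[OF Xc \<Phi>] .
    qed
    then show ?thesis by blast
  qed
  have car: "\<Phi> ?f \<in> carrier_mat n n" if "is_calculus n X \<Phi>" for \<Phi>
    using that hf unfolding is_calculus_def by blast
  have uniq: "\<Phi> ?f = \<Psi> ?f" if \<Phi>: "is_calculus n X \<Phi>" and \<Psi>: "is_calculus n X \<Psi>" for \<Phi> \<Psi>
  proof (rule eq_matI)
    show "dim_row (\<Phi> ?f) = dim_row (\<Psi> ?f)" "dim_col (\<Phi> ?f) = dim_col (\<Psi> ?f)"
      using car[OF \<Phi>] car[OF \<Psi>] by auto
    fix i j assume "i < dim_row (\<Psi> ?f)" "j < dim_col (\<Psi> ?f)"
    then have ij: "i < n" "j < n" using car[OF \<Psi>] by auto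
    have "cmod (\<Phi> ?f $$ (i, j) - \<Psi> ?f $$ (i, j)) \<le> 0 + e" if e: "0 < e" for e
    proof -
      obtain I0 where I0: "\<forall>I\<ge>I0. opnorm (hump_sum n (prod_mat a b X) I - \<Phi> ?f) < e / 2" using lim[OF \<Phi>, of "e / 2"] e by auto
      obtain I1 where I1: "\<forall>I\<ge>I1. opnorm (hump_sum n (prod_mat a b X) I - \<Psi> ?f) < e / 2" using lim[OF \<Psi>, of "e / 2"] e by auto
      define H where "H = hump_sum n (prod_mat a b X) (max I0 I1)"
      have H: "H \<in> carrier_mat n n" unfolding H_def by (rule S)
      have "cmod (\<Phi> ?f $$ (i, j) - \<Psi> ?f $$ (i, j)) = cmod ((\<Phi> ?f - \<Psi> ?f) $$ (i, j))"
        using ij car[OF \<Phi>] car[OF \<Psi>] by simp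
      also have "\<dots> \<le> opnorm (\<Phi> ?f - \<Psi> ?f)" by (rule cmod_entry_le_opnorm[OF minus_carrier_mat[OF car[OF \<Psi>]] ij])
      also have "\<dots> \<le> opnorm (\<Phi> ?f - H) + opnorm (H - \<Psi> ?f)" by (rule opnorm_diff_triangle[OF car[OF \<Phi>] H car[OF \<Psi>]])
      also have "opnorm (\<Phi> ?f - H) = opnorm (H - \<Phi> ?f)" by (rule opnorm_minus_commute[OF car[OF \<Phi>] H])
      also have "opnorm (H - \<Phi> ?f) < e / 2" using I0 unfolding H_def by simp
      also have "opnorm (H - \<Psi> ?f) < e / 2" using I1 unfolding H_def by simp
      finally show ?thesis by simp
    qed
    then have "cmod (\<Phi> ?f $$ (i, j) - \<Psi> ?f $$ (i, j)) \<le> 0" by (rule field_le_epsilon)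
    then show "\<Phi> ?f $$ (i, j) = \<Psi> ?f $$ (i, j)" by simp
  qed
  obtain \<Phi> where \<Phi>: "is_calculus n X \<Phi>" using calculus_exists[OF X] by blast
  have ev: "eval_at n ?f X = \<Phi> ?f"
    unfolding eval_at_def by (rule the_equality) (use \<Phi> uniq in blast)+
  show "eval_at n ?f X \<in> carrier_mat n n" unfolding ev by (rule car[OF \<Phi>])
  show "\<And>e. 0 < e \<Longrightarrow> \<exists>I0. \<forall>I\<ge>I0. opnorm (hump_sum n (prod_mat a b X) I - eval_at n ?f X) < e"
    unfolding ev by (rule lim[OF \<Phi>])
qed

section \<open>Levelwise uniform continuity\<close>

lemma mat_adjoint_smult_vec:
  assumes A: "A \<in> carrier_mat n m" and v: "v \<in> carrier_vec n"
  shows "mat_adjoint (c \<cdot>\<^sub>m A) *\<^sub>v v = cnj c \<cdot>\<^sub>v (mat_adjoint A *\<^sub>v v)"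
proof -
  have cA: "c \<cdot>\<^sub>m A \<in> carrier_mat n m" using A by simp
  have "mat_adjoint (c \<cdot>\<^sub>m A) = cnj c \<cdot>\<^sub>m mat_adjoint A"
  proof (rule eq_matI)
    show "dim_row (mat_adjoint (c \<cdot>\<^sub>m A)) = dim_row (cnj c \<cdot>\<^sub>m mat_adjoint A)"
      "dim_col (mat_adjoint (c \<cdot>\<^sub>m A)) = dim_col (cnj c \<cdot>\<^sub>m mat_adjoint A)"
      using carrier_matD[OF mat_adjoint_carrier[OF A]] carrier_matD[OF mat_adjoint_carrier[OF cA]] by simp_all
    fix i j assume "i < dim_row (cnj c \<cdot>\<^sub>m mat_adjoint A)" "j < dim_col (cnj c \<cdot>\<^sub>m mat_adjoint A)"
    then have ij: "i < m" "j < n" using carrier_matD[OF mat_adjoint_carrier[OF A]] by simp_all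
    show "mat_adjoint (c \<cdot>\<^sub>m A) $$ (i, j) = (cnj c \<cdot>\<^sub>m mat_adjoint A) $$ (i, j)"
      using ij A carrier_matD[OF mat_adjoint_carrier[OF A]]
      by (simp add: mat_adjoint_index[OF cA ij] mat_adjoint_index[OF A ij])
  qed
  then show ?thesis using mat_adjoint_carrier[OF A] v by auto
qed

text \<open>
  The row condition on \<open>X\<close> is a column condition on the adjoints, so the bound for products is applied to
  \<open>X\<^sub>a\<^sup>*\<close> and \<open>X\<^sub>b\<^sup>*\<close>.
\<close>

lemma prod_mat_power_bound:
  obtains C where "0 \<le> C" "\<And>(X :: 'd::finite \<Rightarrow> complex Matrix.mat) a b k. X \<in> comm_ball n \<Longrightarrow> a \<noteq> b \<Longrightarrow>
    opnorm (prod_mat a b X ^\<^sub>m k) \<le> C * (real k + 1) powr (1/8)"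
proof -
  obtain C where C: "0 \<le> C"
    "\<And>Y1 Y2 k v. Y1 \<in> carrier_mat n n \<Longrightarrow> Y2 \<in> carrier_mat n n \<Longrightarrow> Y1 * Y2 = Y2 * Y1 \<Longrightarrow>
      (\<And>v. v \<in> carrier_vec n \<Longrightarrow> (cvec_norm (Y1 *\<^sub>v v))\<^sup>2 + (cvec_norm (Y2 *\<^sub>v v))\<^sup>2 \<le> (cvec_norm v)\<^sup>2) \<Longrightarrow>
      v \<in> carrier_vec n \<Longrightarrow>
      cvec_norm (((\<lambda>v. 2 \<cdot>\<^sub>v (Y1 *\<^sub>v (Y2 *\<^sub>v v))) ^^ k) v) \<le> C * (real k + 1) powr (1/8) * cvec_norm v"
    by (rule product_power_bound[of n]) blast
  have "opnorm (prod_mat a b X ^\<^sub>m k) \<le> C * (real k + 1) powr (1/8)"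
    if X: "X \<in> comm_ball n" and ab: "a \<noteq> b" for X :: "'d \<Rightarrow> complex Matrix.mat" and a b k
  proof -
    have Xc: "\<And>i. X i \<in> carrier_mat n n" and comm: "\<And>i j. X i * X j = X j * X i" and nX: "row_norm n X < 1"
      using X by (auto simp: comm_ball_def)
    note T = prod_mat_carrier[where X = X and a = a and b = b, OF Xc]
    define Y1 where "Y1 = mat_adjoint (X b)"
    define Y2 where "Y2 = mat_adjoint (X a)"
    have Y: "Y1 \<in> carrier_mat n n" "Y2 \<in> carrier_mat n n" unfolding Y1_def Y2_def using Xc by auto
    have Yc: "Y1 * Y2 = Y2 * Y1"
      unfolding Y1_def Y2_def mat_adjoint_mult[OF Xc Xc, symmetric] comm[of a b] ..
    have col: "(cvec_norm (Y1 *\<^sub>v v))\<^sup>2 + (cvec_norm (Y2 *\<^sub>v v))\<^sup>2 \<le> (cvec_norm v)\<^sup>2" if v: "v \<in> carrier_vec n" for v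
    proof -
      have "(cvec_norm (Y1 *\<^sub>v v))\<^sup>2 + (cvec_norm (Y2 *\<^sub>v v))\<^sup>2 = (\<Sum>i\<in>{a, b}. (cvec_norm (mat_adjoint (X i) *\<^sub>v v))\<^sup>2)"
        unfolding Y1_def Y2_def using ab by simp
      also have "\<dots> \<le> (\<Sum>i\<in>UNIV. (cvec_norm (mat_adjoint (X i) *\<^sub>v v))\<^sup>2)" by (intro sum_mono2) auto
      also have "\<dots> \<le> (row_norm n X)\<^sup>2 * (cvec_norm v)\<^sup>2" using Xc v by (intro sum_adjoint_le_row_norm) auto
      also have "\<dots> \<le> 1 * (cvec_norm v)\<^sup>2" using nX row_norm_nonneg[of n X] by (intro mult_right_mono power_le_one) auto
      finally show ?thesis by simp
    qed
    have Tv: "mat_adjoint (prod_mat a b X) *\<^sub>v v = 2 \<cdot>\<^sub>v (Y1 *\<^sub>v (Y2 *\<^sub>v v))" if v: "v \<in> carrier_vec n" for v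
    proof -
      have "mat_adjoint (prod_mat a b X) *\<^sub>v v = cnj 2 \<cdot>\<^sub>v (mat_adjoint (X a * X b) *\<^sub>v v)"
        unfolding prod_mat_def by (rule mat_adjoint_smult_vec[OF mult_carrier_mat[OF Xc Xc] v])
      also have "mat_adjoint (X a * X b) *\<^sub>v v = Y1 *\<^sub>v (Y2 *\<^sub>v v)"
        unfolding mat_adjoint_mult[OF Xc Xc] Y1_def[symmetric] Y2_def[symmetric] by (rule assoc_mult_mat_vec[OF Y v])
      finally show ?thesis by simp
    qed
    have adj: "mat_adjoint (prod_mat a b X ^\<^sub>m k) *\<^sub>v v = ((\<lambda>v. 2 \<cdot>\<^sub>v (Y1 *\<^sub>v (Y2 *\<^sub>v v))) ^^ k) v" if v: "v \<in> carrier_vec n" for v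
    proof (induction k)
      case 0
      have c: "(1\<^sub>m n :: complex Matrix.mat) \<in> carrier_mat n n" by simp
      have "mat_adjoint (1\<^sub>m n) = (1\<^sub>m n :: complex Matrix.mat)"
        by (rule eq_matI) (use carrier_matD[OF mat_adjoint_carrier[OF c]] in \<open>simp_all add: mat_adjoint_index[OF c]\<close>)
      then show ?case using T v by simp
    next
      case (Suc k)
      have Tk: "prod_mat a b X ^\<^sub>m k \<in> carrier_mat n n" by (rule pow_carrier_mat[OF T])
      have "mat_adjoint (prod_mat a b X ^\<^sub>m Suc k) *\<^sub>v v = mat_adjoint (prod_mat a b X) *\<^sub>v (mat_adjoint (prod_mat a b X ^\<^sub>m k) *\<^sub>v v)"
        unfolding pow_mat.simps mat_adjoint_mult[OF Tk T]
        by (rule assoc_mult_mat_vec[OF mat_adjoint_carrier[OF T] mat_adjoint_carrier[OF Tk] v])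
      also have "\<dots> = 2 \<cdot>\<^sub>v (Y1 *\<^sub>v (Y2 *\<^sub>v (mat_adjoint (prod_mat a b X ^\<^sub>m k) *\<^sub>v v)))"
        by (rule Tv[OF mult_mat_vec_carrier[OF mat_adjoint_carrier[OF Tk] v]])
      finally show ?case unfolding Suc by simp
    qed
    show ?thesis
      by (rule opnorm_le_adjoint[OF pow_carrier_mat[OF T]]) (use C(1) C(2)[OF Y Yc col] adj in auto)
  qed
  then show ?thesis using that C(1) by blast
qed

lemma mat_add_minus:
  fixes A B C :: "complex Matrix.mat"
  assumes "A \<in> carrier_mat n m" "B \<in> carrier_mat n m" "C \<in> carrier_mat n m"
  shows "(A + B) - C = (A - C) + B"
  using assms by (intro eq_matI) auto

lemma mat_diff_telescope:
  fixes A B C :: "complex Matrix.mat"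
  assumes "A \<in> carrier_mat n m" "B \<in> carrier_mat n m" "C \<in> carrier_mat n m"
  shows "A - C = (A - B) + (B - C)"
  using assms by (intro eq_matI) auto

lemma mat_diff_add_smult:
  fixes A B C D :: "complex Matrix.mat"
  assumes "A \<in> carrier_mat n m" "B \<in> carrier_mat n m" "C \<in> carrier_mat n m" "D \<in> carrier_mat n m"
  shows "(A + c \<cdot>\<^sub>m B) - (C + c \<cdot>\<^sub>m D) = (A - C) + c \<cdot>\<^sub>m (B - D)"
  using assms by (intro eq_matI) (auto simp: algebra_simps)

lemma mat_diff_smult_telescope:
  fixes A B C :: "complex Matrix.mat"
  assumes "A \<in> carrier_mat n m" "B \<in> carrier_mat n m" "C \<in> carrier_mat n m"
  shows "c \<cdot>\<^sub>m A - c \<cdot>\<^sub>m C = c \<cdot>\<^sub>m ((A - B) + (B - C))"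
  using assms by (intro eq_matI) (auto simp: algebra_simps)

lemma opnorm_diff_self:
  assumes A: "A \<in> carrier_mat n m"
  shows "opnorm (A - A) \<le> 0"
proof (rule opnorm_le[of _ n m])
  show "A - A \<in> carrier_mat n m" using minus_carrier_mat[OF A] .
  fix v :: "complex Matrix.vec" assume "v \<in> carrier_vec m"
  then have "(A - A) *\<^sub>v v = 0\<^sub>v n" using A by (intro eq_vecI) (auto simp: scalar_prod_def)
  then show "cvec_norm ((A - A) *\<^sub>v v) \<le> 0 * cvec_norm v" by simp
qed simp

lemma hump_sum_diff_le:
  assumes T: "T \<in> carrier_mat n n" and s: "\<And>k. opnorm (T ^\<^sub>m k) \<le> s k" and IJ: "I \<le> J"
  shows "opnorm (hump_sum n T J - hump_sum n T I) \<le> (\<Sum>k=I..<J. bcoef k * s k)"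
  using IJ
proof (induction J rule: dec_induct)
  case base
  have "opnorm (hump_sum n T I - hump_sum n T I) \<le> 0"
    by (rule opnorm_diff_self[OF hump_sum_carrier[OF T]])
  then show ?case by simp
next
  case (step J)
  note S = hump_sum_carrier[OF T]
  have Tk: "of_real (bcoef J) \<cdot>\<^sub>m (T ^\<^sub>m J) \<in> carrier_mat n n" using T by simp
  have "hump_sum n T (Suc J) - hump_sum n T I = (hump_sum n T J - hump_sum n T I) + of_real (bcoef J) \<cdot>\<^sub>m (T ^\<^sub>m J)"
    using mat_add_minus[OF S[of J] Tk S[of I]] by (simp add: hump_sum.simps)
  then have "opnorm (hump_sum n T (Suc J) - hump_sum n T I) \<le> opnorm (hump_sum n T J - hump_sum n T I) + opnorm (of_real (bcoef J) \<cdot>\<^sub>m (T ^\<^sub>m J))"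
    using opnorm_add[OF minus_carrier_mat[OF S] Tk] by simp
  also have "opnorm (of_real (bcoef J) \<cdot>\<^sub>m (T ^\<^sub>m J)) \<le> bcoef J * s J"
  proof -
    have "opnorm (of_real (bcoef J) \<cdot>\<^sub>m (T ^\<^sub>m J)) \<le> cmod (of_real (bcoef J)) * opnorm (T ^\<^sub>m J)"
      by (rule opnorm_smult[OF pow_carrier_mat[OF T]])
    also have "\<dots> \<le> bcoef J * s J" using s[of J] by (simp add: mult_left_mono)
    finally show ?thesis .
  qed
  finally show ?case using step by simp
qed

lemma opnorm_power_diff:
  assumes T: "T \<in> carrier_mat n n" and S: "S \<in> carrier_mat n n"
    and Tn: "opnorm T \<le> 2" and Sn: "opnorm S \<le> 2" and d: "opnorm (T - S) \<le> d"
  shows "opnorm (T ^\<^sub>m k - S ^\<^sub>m k) \<le> real k * 2 ^ k * d"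
proof (induction k)
  case 0
  have "opnorm (1\<^sub>m n - 1\<^sub>m n :: complex Matrix.mat) \<le> 0" by (rule opnorm_diff_self[of _ n n]) simp
  then show ?case using T S by simp
next
  case (Suc k)
  have d0: "0 \<le> d" using d opnorm_nonneg[OF minus_carrier_mat[OF S], of T] by linarith
  note Tk = pow_carrier_mat[OF T, of k] and Sk = pow_carrier_mat[OF S, of k]
  have Tkn: "opnorm (T ^\<^sub>m k) \<le> 2 ^ k"
  proof (induction k)
    case 0
    have "opnorm (1\<^sub>m n :: complex Matrix.mat) \<le> 1" by (intro opnorm_le[of _ n n]) auto
    then show ?case using T by simp
  next
    case (Suc k)
    have "opnorm (T ^\<^sub>m Suc k) \<le> opnorm (T ^\<^sub>m k) * opnorm T"
      using opnorm_mult[OF pow_carrier_mat[OF T] T] by simp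
    also have "\<dots> \<le> 2 ^ k * 2" using Suc Tn opnorm_nonneg[OF T] by (intro mult_mono) auto
    finally show ?case by simp
  qed
  have "T ^\<^sub>m Suc k - S ^\<^sub>m Suc k = T ^\<^sub>m k * (T - S) + (T ^\<^sub>m k - S ^\<^sub>m k) * S"
  proof -
    have "T ^\<^sub>m k * (T - S) = T ^\<^sub>m k * T - T ^\<^sub>m k * S" using T S Tk by (intro mult_minus_distrib_mat) auto
    moreover have "(T ^\<^sub>m k - S ^\<^sub>m k) * S = T ^\<^sub>m k * S - S ^\<^sub>m k * S" using S Tk Sk by (intro minus_mult_distrib_mat) auto
    moreover have "T ^\<^sub>m k * T - S ^\<^sub>m k * S = (T ^\<^sub>m k * T - T ^\<^sub>m k * S) + (T ^\<^sub>m k * S - S ^\<^sub>m k * S)"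
      by (rule mat_diff_telescope[OF mult_carrier_mat[OF Tk T] mult_carrier_mat[OF Tk S] mult_carrier_mat[OF Sk S]])
    ultimately show ?thesis by simp
  qed
  then have "opnorm (T ^\<^sub>m Suc k - S ^\<^sub>m Suc k) \<le> opnorm (T ^\<^sub>m k * (T - S)) + opnorm ((T ^\<^sub>m k - S ^\<^sub>m k) * S)"
    using opnorm_add[OF mult_carrier_mat[OF Tk minus_carrier_mat[OF S]] mult_carrier_mat[OF minus_carrier_mat[OF Sk] S]] by simp
  also have "opnorm (T ^\<^sub>m k * (T - S)) \<le> 2 ^ k * d"
    using opnorm_mult[OF Tk minus_carrier_mat[OF S], of T] Tkn d opnorm_nonneg[OF minus_carrier_mat[OF S], of T]
    by (meson mult_mono order_trans zero_le_numeral zero_le_power)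
  also have "opnorm ((T ^\<^sub>m k - S ^\<^sub>m k) * S) \<le> (real k * 2 ^ k * d) * 2"
    using opnorm_mult[OF minus_carrier_mat[OF Sk] S, of "T ^\<^sub>m k"] Suc Sn opnorm_nonneg[OF S] d0
    by (meson mult_mono order_trans of_nat_0_le_iff mult_nonneg_nonneg zero_le_numeral zero_le_power)
  also have "2 ^ k * d + real k * 2 ^ k * d * 2 \<le> real (Suc k) * 2 ^ Suc k * d"
    using d0 by (simp add: algebra_simps)
  finally show ?case by simp
qed

text \<open>
  A polynomial is Lipschitz on bounded sets of matrices; the constant is allowed to depend on the number of
  terms.
\<close>

lemma hump_sum_lipschitz:
  assumes T: "T \<in> carrier_mat n n" and S: "S \<in> carrier_mat n n"
    and "opnorm T \<le> 2" "opnorm S \<le> 2" "opnorm (T - S) \<le> d"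
  shows "opnorm (hump_sum n T I - hump_sum n S I) \<le> (\<Sum>k<I. bcoef k * (real k * 2 ^ k)) * d"
proof (induction I)
  case 0
  have "opnorm (0\<^sub>m n n - 0\<^sub>m n n :: complex Matrix.mat) \<le> 0" by (rule opnorm_diff_self[of _ n n]) simp
  then show ?case by simp
next
  case (Suc I)
  note HT = hump_sum_carrier[OF T, of I] and HS = hump_sum_carrier[OF S, of I]
  note Tk = pow_carrier_mat[OF T, of I] and Sk = pow_carrier_mat[OF S, of I]
  have "hump_sum n T (Suc I) - hump_sum n S (Suc I) =
      (hump_sum n T I - hump_sum n S I) + of_real (bcoef I) \<cdot>\<^sub>m (T ^\<^sub>m I - S ^\<^sub>m I)"
    using mat_diff_add_smult[OF HT Tk HS Sk] by (simp add: hump_sum.simps)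
  then have "opnorm (hump_sum n T (Suc I) - hump_sum n S (Suc I)) \<le>
      opnorm (hump_sum n T I - hump_sum n S I) + opnorm (of_real (bcoef I) \<cdot>\<^sub>m (T ^\<^sub>m I - S ^\<^sub>m I))"
    using opnorm_add[OF minus_carrier_mat[OF HS] smult_carrier_mat[OF minus_carrier_mat[OF Sk]]] by simp
  also have "opnorm (of_real (bcoef I) \<cdot>\<^sub>m (T ^\<^sub>m I - S ^\<^sub>m I)) \<le> bcoef I * (real I * 2 ^ I * d)"
  proof -
    have "opnorm (of_real (bcoef I) \<cdot>\<^sub>m (T ^\<^sub>m I - S ^\<^sub>m I)) \<le> cmod (of_real (bcoef I)) * opnorm (T ^\<^sub>m I - S ^\<^sub>m I)"
      by (rule opnorm_smult[OF minus_carrier_mat[OF Sk]])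
    also have "\<dots> \<le> bcoef I * (real I * 2 ^ I * d)"
      using opnorm_power_diff[OF assms, of I] by (simp add: mult_left_mono)
    finally show ?thesis .
  qed
  finally show ?case using Suc by (simp add: algebra_simps)
qed

lemma prod_mat_norm_bounds:
  fixes X Y :: "'d::finite \<Rightarrow> complex Matrix.mat"
  assumes X: "X \<in> comm_ball n" and Y: "Y \<in> comm_ball n"
  shows "opnorm (prod_mat a b X) \<le> 2"
    and "opnorm (prod_mat a b X - prod_mat a b Y) \<le> 4 * row_norm n (\<lambda>i. X i - Y i)"
proof -
  have Xc: "\<And>i. X i \<in> carrier_mat n n" and nX: "row_norm n X < 1" using X by (auto simp: comm_ball_def)
  have Yc: "\<And>i. Y i \<in> carrier_mat n n" and nY: "row_norm n Y < 1" using Y by (auto simp: comm_ball_def)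
  have Xn: "opnorm (X i) \<le> 1" for i
    using order_trans[OF opnorm_le_row_norm less_imp_le[OF nX]] Xc by blast
  have Yn: "opnorm (Y i) \<le> 1" for i
    using order_trans[OF opnorm_le_row_norm less_imp_le[OF nY]] Yc by blast
  define d where "d = row_norm n (\<lambda>i. X i - Y i)"
  have Dn: "opnorm (X i - Y i) \<le> d" for i
    unfolding d_def using opnorm_le_row_norm[of "\<lambda>i. X i - Y i" n i] Xc Yc by (auto intro: minus_carrier_mat)
  have d0: "0 \<le> d" unfolding d_def by (rule row_norm_nonneg)
  note XX = mult_carrier_mat[OF Xc Xc, of a b] and YY = mult_carrier_mat[OF Yc Yc, of a b]
  have "opnorm (prod_mat a b X) \<le> cmod 2 * opnorm (X a * X b)" unfolding prod_mat_def by (rule opnorm_smult[OF XX])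
  also have "opnorm (X a * X b) \<le> opnorm (X a) * opnorm (X b)" by (rule opnorm_mult[OF Xc Xc])
  also have "\<dots> \<le> 1 * 1" using Xn opnorm_nonneg[OF Xc] by (intro mult_mono) auto
  finally show "opnorm (prod_mat a b X) \<le> 2" by simp
  have "prod_mat a b X - prod_mat a b Y = 2 \<cdot>\<^sub>m (X a * (X b - Y b) + (X a - Y a) * Y b)"
  proof -
    have "X a * (X b - Y b) = X a * X b - X a * Y b" by (rule mult_minus_distrib_mat[OF Xc Xc Yc])
    moreover have "(X a - Y a) * Y b = X a * Y b - Y a * Y b" by (rule minus_mult_distrib_mat[OF Xc Yc Yc])
    ultimately show ?thesis unfolding prod_mat_def
      using mat_diff_smult_telescope[OF XX mult_carrier_mat[OF Xc[of a] Yc[of b]] YY] by simp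
  qed
  then have "opnorm (prod_mat a b X - prod_mat a b Y) \<le> cmod 2 * opnorm (X a * (X b - Y b) + (X a - Y a) * Y b)"
    using opnorm_smult[of "X a * (X b - Y b) + (X a - Y a) * Y b" n n 2] Xc Yc
    by (metis add_carrier_mat mult_carrier_mat minus_carrier_mat)
  also have "opnorm (X a * (X b - Y b) + (X a - Y a) * Y b) \<le> opnorm (X a * (X b - Y b)) + opnorm ((X a - Y a) * Y b)"
    by (rule opnorm_add[OF mult_carrier_mat[OF Xc minus_carrier_mat[OF Yc]] mult_carrier_mat[OF minus_carrier_mat[OF Yc] Yc]])
  also have "opnorm (X a * (X b - Y b)) \<le> 1 * d"
    using order_trans[OF opnorm_mult[OF Xc minus_carrier_mat[OF Yc]] mult_mono[OF Xn Dn _ opnorm_nonneg[OF minus_carrier_mat[OF Yc]]]] by simp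
  also have "opnorm ((X a - Y a) * Y b) \<le> d * 1"
    using order_trans[OF opnorm_mult[OF minus_carrier_mat[OF Yc] Yc] mult_mono[OF Dn Yn d0 opnorm_nonneg[OF Yc]]] by simp
  finally show "opnorm (prod_mat a b X - prod_mat a b Y) \<le> 4 * row_norm n (\<lambda>i. X i - Y i)" unfolding d_def by simp
qed

text \<open>
  By the power bound the series converges uniformly on the matrices of size \<open>n\<close>; a partial sum with tail
  at most \<open>e / 4\<close> is Lipschitz, and two tails and one Lipschitz estimate add up to less than \<open>e\<close>.
\<close>

lemma hump_fun_levelwise:
  fixes a b :: "'d::finite"
  assumes ab: "a \<noteq> b"
  shows "levelwise_uniformly_continuous_free (hump_fun a b)"
  unfolding levelwise_uniformly_continuous_free_def
proof (intro allI impI)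
  fix n :: nat and e :: real assume e: "0 < e"
  obtain C where C: "0 \<le> C" "\<And>(X :: 'd \<Rightarrow> complex Matrix.mat) a b k. X \<in> comm_ball n \<Longrightarrow> a \<noteq> b \<Longrightarrow>
    opnorm (prod_mat a b X ^\<^sub>m k) \<le> C * (real k + 1) powr (1/8)"
    by (rule prod_mat_power_bound[of n]) blast
  define s where "s k = C * (real k + 1) powr (1/8)" for k
  have sm: "summable (\<lambda>k. bcoef k * s k)"
    by (rule summable_bcoef_powr[where C = C]) (use C(1) in \<open>auto simp: s_def\<close>)
  have s0: "0 \<le> bcoef k * s k" for k using C(1) by (simp add: s_def)
  have "(\<lambda>I. \<Sum>k. bcoef (k + I) * s (k + I)) \<longlonglongrightarrow> 0" by (rule suminf_exist_split2[OF sm])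
  then have "\<forall>\<^sub>F I in sequentially. (\<Sum>k. bcoef (k + I) * s (k + I)) < e / 8" using e by (intro order_tendstoD) auto
  then obtain I where I: "(\<Sum>k. bcoef (k + I) * s (k + I)) < e / 8" by (auto simp: eventually_sequentially)
  define \<Lambda> where "\<Lambda> = (\<Sum>k<I. bcoef k * (real k * 2 ^ k)) * 4"
  have \<Lambda>0: "0 \<le> \<Lambda>" unfolding \<Lambda>_def by (intro mult_nonneg_nonneg sum_nonneg) auto
  define \<delta> where "\<delta> = e / 4 / (\<Lambda> + 1)"
  have \<delta>: "0 < \<delta>" unfolding \<delta>_def using e \<Lambda>0 by simp
  have tail: "opnorm (eval_at n (hump_fun a b) X - hump_sum n (prod_mat a b X) I) \<le> e / 4" if X: "X \<in> comm_ball n" for X :: "'d \<Rightarrow> complex Matrix.mat"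
  proof -
    have Xc: "\<And>i. X i \<in> carrier_mat n n" using X by (auto simp: comm_ball_def)
    note T = prod_mat_carrier[where X = X and a = a and b = b, OF Xc]
    note ev = eval_at_hump_fun[OF ab X]
    obtain I0 where I0: "\<forall>I\<ge>I0. opnorm (hump_sum n (prod_mat a b X) I - eval_at n (hump_fun a b) X) < e / 8"
      using ev(2)[of "e / 8"] e by auto
    define J where "J = max I I0"
    have "opnorm (eval_at n (hump_fun a b) X - hump_sum n (prod_mat a b X) I) \<le>
        opnorm (eval_at n (hump_fun a b) X - hump_sum n (prod_mat a b X) J) + opnorm (hump_sum n (prod_mat a b X) J - hump_sum n (prod_mat a b X) I)"
      by (rule opnorm_diff_triangle[OF ev(1) hump_sum_carrier[OF T] hump_sum_carrier[OF T]])
    also have "opnorm (eval_at n (hump_fun a b) X - hump_sum n (prod_mat a b X) J) = opnorm (hump_sum n (prod_mat a b X) J - eval_at n (hump_fun a b) X)"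
      by (rule opnorm_minus_commute[OF ev(1) hump_sum_carrier[OF T]])
    also have "\<dots> \<le> e / 8" using I0 by (simp add: J_def less_imp_le)
    also have "opnorm (hump_sum n (prod_mat a b X) J - hump_sum n (prod_mat a b X) I) \<le> (\<Sum>k=I..<J. bcoef k * s k)"
      by (rule hump_sum_diff_le[OF T]) (use C(2)[OF X ab] in \<open>auto simp: s_def J_def\<close>)
    also have "\<dots> = (\<Sum>k<J - I. bcoef (k + I) * s (k + I))"
      using sum.shift_bounds_nat_ivl[of "\<lambda>k. bcoef k * s k" 0 I "J - I"] by (simp add: J_def lessThan_atLeast0)
    also have "\<dots> \<le> (\<Sum>k. bcoef (k + I) * s (k + I))"
      by (intro sum_le_suminf summable_ignore_initial_segment[OF sm] s0) auto
    also have "\<dots> \<le> e / 8" using I by simp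
    finally show ?thesis by simp
  qed
  show "\<exists>\<delta>>0. \<forall>X\<in>comm_ball n. \<forall>Y\<in>comm_ball n. row_norm n (\<lambda>i. X i - Y i) < \<delta> \<longrightarrow>
      opnorm (eval_at n (hump_fun a b) X - eval_at n (hump_fun a b) Y) < e"
  proof (intro exI[of _ \<delta>] conjI \<delta> ballI impI)
    fix X Y :: "'d \<Rightarrow> complex Matrix.mat"
    assume X: "X \<in> comm_ball n" and Y: "Y \<in> comm_ball n" and d: "row_norm n (\<lambda>i. X i - Y i) < \<delta>"
    have Xc: "\<And>i. X i \<in> carrier_mat n n" using X by (auto simp: comm_ball_def)
    have Yc: "\<And>i. Y i \<in> carrier_mat n n" using Y by (auto simp: comm_ball_def)
    note TX = prod_mat_carrier[where X = X and a = a and b = b, OF Xc] and TY = prod_mat_carrier[where X = Y and a = a and b = b, OF Yc]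
    let ?HX = "hump_sum n (prod_mat a b X) I" and ?HY = "hump_sum n (prod_mat a b Y) I"
    let ?EX = "eval_at n (hump_fun a b) X" and ?EY = "eval_at n (hump_fun a b) Y"
    note EX = eval_at_hump_fun(1)[OF ab X] and EY = eval_at_hump_fun(1)[OF ab Y]
    note HX = hump_sum_carrier[OF TX, of I] and HY = hump_sum_carrier[OF TY, of I]
    have "opnorm (?HX - ?HY) \<le> (\<Sum>k<I. bcoef k * (real k * 2 ^ k)) * (4 * row_norm n (\<lambda>i. X i - Y i))"
      by (rule hump_sum_lipschitz[OF TX TY prod_mat_norm_bounds(1)[OF X X] prod_mat_norm_bounds(1)[OF Y Y] prod_mat_norm_bounds(2)[OF X Y]])
    also have "\<dots> = \<Lambda> * row_norm n (\<lambda>i. X i - Y i)" unfolding \<Lambda>_def by simp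
    also have "\<dots> \<le> \<Lambda> * \<delta>" using d \<Lambda>0 by (intro mult_left_mono) auto
    also have "\<dots> \<le> (\<Lambda> + 1) * \<delta>" using \<delta> by (intro mult_right_mono) auto
    also have "\<dots> = e / 4"
    proof -
      have "\<Lambda> + 1 \<noteq> 0" using \<Lambda>0 by linarith
      then show ?thesis unfolding \<delta>_def by (subst times_divide_eq_right) (rule nonzero_mult_div_cancel_left)
    qed
    finally have mid: "opnorm (?HX - ?HY) \<le> e / 4" .
    have "opnorm (?EX - ?EY) \<le> opnorm (?EX - ?HX) + opnorm (?HX - ?EY)" by (rule opnorm_diff_triangle[OF EX HX EY])
    also have "opnorm (?HX - ?EY) \<le> opnorm (?HX - ?HY) + opnorm (?HY - ?EY)" by (rule opnorm_diff_triangle[OF HX HY EY])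
    also have "opnorm (?HY - ?EY) = opnorm (?EY - ?HY)" by (rule opnorm_minus_commute[OF HY EY])
    finally show "opnorm (?EX - ?EY) < e" using tail[OF X] tail[OF Y] mid e by linarith
  qed
qed

section \<open>The truncated d-shift\<close>

text \<open>
  The basis vector \<open>q\<close> is mapped to \<open>c q\<close> times the basis vector \<open>q + d\<close>, or to zero if this falls
  outside. Products, scalar multiples and powers of such matrices have the same form.
\<close>

definition wshift :: "nat \<Rightarrow> nat \<Rightarrow> (nat \<Rightarrow> real) \<Rightarrow> complex Matrix.mat" where
  "wshift N d c = Matrix.mat N N (\<lambda>(p, q). if p = q + d then of_real (c q) else 0)"

lemma wshift_carrier [simp]: "wshift N d c \<in> carrier_mat N N"
  by (simp add: wshift_def)

lemma wshift_index: "p < N \<Longrightarrow> q < N \<Longrightarrow> wshift N d c $$ (p, q) = (if p = q + d then of_real (c q) else 0)"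
  by (simp add: wshift_def)

lemma wshift_mult: "wshift N d c * wshift N d' c' = wshift N (d + d') (\<lambda>q. c (q + d') * c' q)"
proof (rule eq_matI)
  fix p q assume "p < dim_row (wshift N (d + d') (\<lambda>q. c (q + d') * c' q))"
    and "q < dim_col (wshift N (d + d') (\<lambda>q. c (q + d') * c' q))"
  then have p: "p < N" and q: "q < N" by (auto simp: wshift_def)
  have "(wshift N d c * wshift N d' c') $$ (p, q) = (\<Sum>r<N. wshift N d c $$ (p, r) * wshift N d' c' $$ (r, q))"
    using p q by (simp add: wshift_def scalar_prod_def lessThan_atLeast0)
  also have "\<dots> = (\<Sum>r<N. if r = q + d' then wshift N d c $$ (p, r) * of_real (c' q) else 0)"
    using q by (intro sum.cong) (auto simp: wshift_index)
  also have "\<dots> = (if q + d' < N then wshift N d c $$ (p, q + d') * of_real (c' q) else 0)"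
    by (simp add: sum.delta)
  also have "\<dots> = wshift N (d + d') (\<lambda>q. c (q + d') * c' q) $$ (p, q)"
    using p q by (auto simp: wshift_index)
  finally show "(wshift N d c * wshift N d' c') $$ (p, q) = wshift N (d + d') (\<lambda>q. c (q + d') * c' q) $$ (p, q)" .
qed (auto simp: wshift_def)

lemma wshift_smult: "of_real x \<cdot>\<^sub>m wshift N d c = wshift N d (\<lambda>q. x * c q)"
  unfolding wshift_def by (intro eq_matI) auto

lemma wshift_diff: "wshift N d c - wshift N d c' = wshift N d (\<lambda>q. c q - c' q)"
  unfolding wshift_def by (intro eq_matI) auto

lemma wshift_pow: "wshift N d c ^\<^sub>m k = wshift N (k * d) (\<lambda>q. \<Prod>i<k. c (q + i * d))"
proof (induction k)
  case 0
  show ?case by (simp, simp add: wshift_def, intro eq_matI) auto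
next
  case (Suc k)
  have "wshift N d c ^\<^sub>m Suc k = wshift N (k * d + d) (\<lambda>q. (\<Prod>i<k. c (q + d + i * d)) * c q)"
    using Suc by (simp add: wshift_mult)
  also have "\<dots> = wshift N (Suc k * d) (\<lambda>q. \<Prod>i<Suc k. c (q + i * d))"
    by (simp only: prod.lessThan_Suc_shift) (simp add: algebra_simps)
  finally show ?case .
qed

lemma hump_sum_wshift:
  assumes "p < N" "q < N"
  shows "hump_sum N (wshift N d c) I $$ (p, q) =
    (\<Sum>k<I. if p = q + k * d then of_real (bcoef k * (\<Prod>i<k. c (q + i * d))) else 0)"
proof (induction I)
  case 0
  show ?case using assms by simp
next
  case (Suc I)
  have "hump_sum N (wshift N d c) (Suc I) $$ (p, q) =
     hump_sum N (wshift N d c) I $$ (p, q) + of_real (bcoef I) * wshift N (I * d) (\<lambda>q. \<Prod>i<I. c (q + i * d)) $$ (p, q)"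
    using assms hump_sum_carrier[OF wshift_carrier[of N d c], of I] wshift_carrier[of N "I * d" "\<lambda>q. \<Prod>i<I. c (q + i * d)"]
    by (simp add: wshift_pow del: wshift_carrier)
  then show ?case using assms Suc by (simp add: wshift_index)
qed

text \<open>
  The weight \<open>c q\<close> is bounded in terms of the target \<open>q + d\<close>, so that several shifts can share the
  energy at each basis vector.
\<close>

lemma wshift_adjoint_norm:
  assumes v: "v \<in> carrier_vec N" and e: "\<And>p. 0 \<le> e p" and ce: "\<And>q. (c q)\<^sup>2 \<le> e (q + d)"
  shows "(cvec_norm (mat_adjoint (wshift N d c) *\<^sub>v v))\<^sup>2 \<le> (\<Sum>p<N. e p * (cmod (vec_index v p))\<^sup>2)"
proof -
  note A = mat_adjoint_carrier[OF wshift_carrier[of N d c]]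
  have ent: "vec_index (mat_adjoint (wshift N d c) *\<^sub>v v) q = (if q + d < N then of_real (c q) * vec_index v (q + d) else 0)"
    if q: "q < N" for q
  proof -
    have "vec_index (mat_adjoint (wshift N d c) *\<^sub>v v) q = (\<Sum>p<N. mat_adjoint (wshift N d c) $$ (q, p) * vec_index v p)"
      by (rule mult_mat_vec_index[OF A v q])
    also have "\<dots> = (\<Sum>p<N. if p = q + d then of_real (c q) * vec_index v p else 0)"
      using q by (intro sum.cong) (auto simp: mat_adjoint_index[OF wshift_carrier] wshift_index)
    finally show ?thesis by (simp add: sum.delta)
  qed
  have "(cvec_norm (mat_adjoint (wshift N d c) *\<^sub>v v))\<^sup>2 = (\<Sum>q<N. (cmod (vec_index (mat_adjoint (wshift N d c) *\<^sub>v v) q))\<^sup>2)"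
    unfolding cvec_norm_def L2_set_def by (simp add: sum_nonneg carrier_matD(1)[OF A] del: index_mult_mat_vec)
  also have "\<dots> = (\<Sum>q<N. if q + d < N then (c q)\<^sup>2 * (cmod (vec_index v (q + d)))\<^sup>2 else 0)"
    by (intro sum.cong) (auto simp: ent norm_mult power_mult_distrib simp del: index_mult_mat_vec)
  also have "\<dots> \<le> (\<Sum>q<N. if q + d < N then e (q + d) * (cmod (vec_index v (q + d)))\<^sup>2 else 0)"
    by (intro sum_mono) (auto intro: mult_right_mono ce)
  also have "\<dots> = (\<Sum>q\<in>{q \<in> {..<N}. q + d < N}. e (q + d) * (cmod (vec_index v (q + d)))\<^sup>2)"
    by (rule sum.inter_filter[symmetric]) simp
  also have "\<dots> = (\<Sum>p\<in>(\<lambda>q. q + d) ` {q \<in> {..<N}. q + d < N}. e p * (cmod (vec_index v p))\<^sup>2)"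
    by (subst sum.reindex) (auto simp: inj_on_def)
  also have "\<dots> \<le> (\<Sum>p<N. e p * (cmod (vec_index v p))\<^sup>2)"
    by (intro sum_mono2) (auto intro!: mult_nonneg_nonneg e)
  finally show ?thesis .
qed

text \<open>
  The index \<open>q\<close> stands for the monomial \<open>z\<^sub>a\<^sup>i z\<^sub>b\<^sup>j\<close> with \<open>i = q div D\<close> and \<open>j = q mod D\<close>, and \<open>row_wt\<close> and \<open>col_wt\<close> are the
  weights of multiplication by \<open>z\<^sub>a\<close> and \<open>z\<^sub>b\<close> on normalized monomials. In the second direction the
  truncation has to be put into the weight, since \<open>q + 1\<close> may pass to the next row.
\<close>

definition row_wt :: "nat \<Rightarrow> nat \<Rightarrow> real" where
  "row_wt D q = sqrt (real (q div D + 1) / real (q div D + q mod D + 1))"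

definition col_wt :: "nat \<Rightarrow> nat \<Rightarrow> real" where
  "col_wt D q = (if q mod D + 1 < D then sqrt (real (q mod D + 1) / real (q div D + q mod D + 1)) else 0)"

lemma mod_div_Suc:
  fixes q D :: nat
  assumes "q mod D + 1 < D"
  shows "(q + 1) mod D = q mod D + 1" "(q + 1) div D = q div D"
proof -
  show m: "(q + 1) mod D = q mod D + 1" using assms by (simp add: mod_Suc)
  then show "(q + 1) div D = q div D" by (simp add: div_Suc)
qed

text \<open>
  The multiple \<open>s\<close> of the compression of the $d$-shift to the monomials with exponents less than \<open>D\<close> in the
  variables \<open>a\<close> and \<open>b\<close>; the other coordinates are zero.
\<close>

definition shift_tuple :: "nat \<Rightarrow> 'd \<Rightarrow> 'd \<Rightarrow> real \<Rightarrow> 'd \<Rightarrow> complex Matrix.mat" where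
  "shift_tuple D a b s i = wshift (D * D) (if i = a then D else if i = b then 1 else 0)
     (\<lambda>q. s * (if i = a then row_wt D q else if i = b then col_wt D q else 0))"

lemma wt_commute:
  assumes D: "1 \<le> D"
  shows "row_wt D (q + 1) * col_wt D q = col_wt D (q + D) * row_wt D q"
proof (cases "q mod D + 1 < D")
  case True
  have "(q + D) div D = q div D + 1" "(q + D) mod D = q mod D" using D by auto
  then show ?thesis using True unfolding row_wt_def col_wt_def
    by (simp add: mod_div_Suc[OF True, simplified] real_sqrt_mult[symmetric] mult.commute add.commute add.left_commute)
qed (simp add: col_wt_def)

text \<open>
  The squared weights that lead to the monomial with exponents \<open>i, j\<close> are \<open>i / (i + j)\<close> and
  \<open>j / (i + j)\<close>, and they add up to at most one.
\<close>

lemma shift_tuple_row_norm: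
  fixes a b :: "'d::finite"
  assumes ab: "a \<noteq> b" and D: "1 \<le> D" and s: "0 \<le> s"
  shows "row_norm (D * D) (shift_tuple D a b s) \<le> s"
proof (rule row_norm_le[OF _ s])
  show "\<forall>i. shift_tuple D a b s i \<in> carrier_mat (D * D) (D * D)" by (simp add: shift_tuple_def)
  fix v :: "complex Matrix.vec" assume v: "v \<in> carrier_vec (D * D)"
  define e1 where "e1 p = s\<^sup>2 * (real (p div D) / real (p div D + p mod D))" for p
  define e2 where "e2 p = s\<^sup>2 * (real (p mod D) / real (p div D + p mod D))" for p
  let ?e = "\<lambda>i p. (if i = a then e1 p else 0) + (if i = b then e2 p else 0)"
  have "(\<Sum>i\<in>UNIV. (cvec_norm (mat_adjoint (shift_tuple D a b s i) *\<^sub>v v))\<^sup>2) \<le>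
      (\<Sum>i\<in>UNIV. \<Sum>p<D * D. ?e i p * (cmod (vec_index v p))\<^sup>2)"
  proof (rule sum_mono)
    fix i
    have e: "0 \<le> ?e i p" for p by (auto simp: e1_def e2_def)
    show "(cvec_norm (mat_adjoint (shift_tuple D a b s i) *\<^sub>v v))\<^sup>2 \<le> (\<Sum>p<D * D. ?e i p * (cmod (vec_index v p))\<^sup>2)"
      unfolding shift_tuple_def
    proof (rule wshift_adjoint_norm[OF v e])
      fix q
      have 1: "(s * row_wt D q)\<^sup>2 \<le> e1 (q + D)"
        using D by (simp add: row_wt_def e1_def power_mult_distrib algebra_simps)
      have 2: "(s * col_wt D q)\<^sup>2 \<le> e2 (q + 1)"
        using mod_div_Suc[of q D] by (auto simp: col_wt_def e2_def power_mult_distrib add_ac)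
      show "(s * (if i = a then row_wt D q else if i = b then col_wt D q else 0))\<^sup>2 \<le>
          ?e i (q + (if i = a then D else if i = b then 1 else 0))"
        using 1 2 ab by auto
    qed
  qed
  also have "\<dots> = (\<Sum>p<D * D. \<Sum>i\<in>UNIV. ?e i p * (cmod (vec_index v p))\<^sup>2)" by (rule sum.swap)
  also have "\<dots> = (\<Sum>p<D * D. (e1 p + e2 p) * (cmod (vec_index v p))\<^sup>2)"
  proof (rule sum.cong[OF refl])
    fix p
    have "(\<Sum>i\<in>UNIV. ?e i p) = e1 p + e2 p" by (simp only: sum.distrib sum.delta finite UNIV_I if_True)
    then show "(\<Sum>i\<in>UNIV. ?e i p * (cmod (vec_index v p))\<^sup>2) = (e1 p + e2 p) * (cmod (vec_index v p))\<^sup>2"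
      by (simp only: sum_distrib_right[symmetric])
  qed
  also have "\<dots> \<le> (\<Sum>p<D * D. s\<^sup>2 * (cmod (vec_index v p))\<^sup>2)"
  proof (intro sum_mono mult_right_mono)
    fix p
    have "e1 p + e2 p = s\<^sup>2 * (real (p div D + p mod D) / real (p div D + p mod D))"
      unfolding e1_def e2_def by (simp only: distrib_left[symmetric] add_divide_distrib[symmetric] of_nat_add)
    also have "\<dots> \<le> s\<^sup>2 * 1" by (intro mult_left_mono) auto
    finally show "e1 p + e2 p \<le> s\<^sup>2" by simp
  qed simp
  also have "\<dots> = s\<^sup>2 * (cvec_norm v)\<^sup>2"
    using v unfolding cvec_norm_def L2_set_def by (simp add: sum_nonneg sum_distrib_left)
  finally show "(\<Sum>i\<in>UNIV. (cvec_norm (mat_adjoint (shift_tuple D a b s i) *\<^sub>v v))\<^sup>2) \<le> s\<^sup>2 * (cvec_norm v)\<^sup>2" .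
qed

lemma shift_tuple_comm_ball:
  fixes a b :: "'d::finite"
  assumes ab: "a \<noteq> b" and D: "1 \<le> D" and s: "0 \<le> s" "s < 1"
  shows "shift_tuple D a b s \<in> comm_ball (D * D)"
  unfolding comm_ball_def mem_Collect_eq
proof (intro conjI allI)
  show "shift_tuple D a b s i \<in> carrier_mat (D * D) (D * D)" for i by (simp add: shift_tuple_def)
  show "row_norm (D * D) (shift_tuple D a b s) < 1"
    using shift_tuple_row_norm[OF ab D s(1)] s(2) by linarith
  show "shift_tuple D a b s i * shift_tuple D a b s j = shift_tuple D a b s j * shift_tuple D a b s i" for i j
  proof -
    have ab_comm: "wshift (D * D) D (\<lambda>q. s * row_wt D q) * wshift (D * D) 1 (\<lambda>q. s * col_wt D q) =
        wshift (D * D) 1 (\<lambda>q. s * col_wt D q) * wshift (D * D) D (\<lambda>q. s * row_wt D q)"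
    proof -
      have "s * row_wt D (q + 1) * (s * col_wt D q) = s * col_wt D (q + D) * (s * row_wt D q)" for q
        using wt_commute[OF D, of q] by (simp add: algebra_simps)
      then have "(\<lambda>q. s * row_wt D (q + 1) * (s * col_wt D q)) = (\<lambda>q. s * col_wt D (q + D) * (s * row_wt D q))" by (rule ext)
      then show ?thesis unfolding wshift_mult by (simp only: add.commute[of D 1])
    qed
    have other: "shift_tuple D a b s i * shift_tuple D a b s j = shift_tuple D a b s j * shift_tuple D a b s i"
      if "i \<noteq> a" "i \<noteq> b" for i j
      using that unfolding shift_tuple_def wshift_mult by simp
    have ab_comm': "shift_tuple D a b s a * shift_tuple D a b s b = shift_tuple D a b s b * shift_tuple D a b s a"
      using ab_comm ab unfolding shift_tuple_def by simp
    consider "i \<noteq> a" "i \<noteq> b" | "j \<noteq> a" "j \<noteq> b" | "i = j" | "i = a" "j = b" | "i = b" "j = a" by blast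
    then show ?thesis
    proof cases
      case 1 then show ?thesis by (rule other)
    next
      case 2 then show ?thesis by (rule other[symmetric])
    next
      case 3 then show ?thesis by simp
    next
      case 4 then show ?thesis using ab_comm' by simp
    next
      case 5 then show ?thesis using ab_comm' by simp
    qed
  qed
qed

lemma shift_tuple_diff:
  "(\<lambda>i. shift_tuple D a b s i - shift_tuple D a b t i) = shift_tuple D a b (s - t)"
  unfolding shift_tuple_def wshift_diff by (simp add: left_diff_distrib)

lemma diag_div_mod:
  fixes m D :: nat
  assumes "m < D"
  shows "(m * (D + 1)) div D = m" "(m * (D + 1)) mod D = m"
proof -
  have "m * (D + 1) = m + D * m" by simp
  then show "(m * (D + 1)) div D = m" "(m * (D + 1)) mod D = m"
    using assms by (simp_all only: mod_mult_self2 mod_less div_mult_self2) simp_all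
qed

text \<open>
  The weights of \<open>2 z\<^sub>a z\<^sub>b\<close>. They matter on the diagonal \<open>q = m * (D + 1)\<close>, which stands for \<open>(z\<^sub>a z\<^sub>b)\<^sup>m\<close>.
\<close>

definition diag_wt :: "nat \<Rightarrow> real \<Rightarrow> nat \<Rightarrow> real" where
  "diag_wt D s q = 2 * (s * row_wt D (q + 1) * (s * col_wt D q))"

lemma prod_mat_shift_tuple:
  assumes "a \<noteq> b"
  shows "prod_mat a b (shift_tuple D a b s) = wshift (D * D) (D + 1) (diag_wt D s)"
proof -
  have "prod_mat a b (shift_tuple D a b s) = of_real 2 \<cdot>\<^sub>m wshift (D * D) (D + 1) (\<lambda>q. s * row_wt D (q + 1) * (s * col_wt D q))"
    using assms unfolding prod_mat_def shift_tuple_def by (simp add: wshift_mult)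
  then show ?thesis unfolding wshift_smult by (simp add: diag_wt_def[abs_def])
qed

lemma diag_wt_diag:
  assumes "m + 1 < D"
  shows "diag_wt D s (m * (D + 1)) = s\<^sup>2 * sqrt (omg (Suc m) / omg m)"
proof -
  let ?q = "m * (D + 1)"
  have q: "?q div D = m" "?q mod D = m" using diag_div_mod[of m D] assms by auto
  have q1: "(?q + 1) div D = m" "(?q + 1) mod D = m + 1" using mod_div_Suc[of ?q D] q assms by auto
  have e: "m + (m + 1) + 1 = 2 * (m + 1)" "m + m + 1 = 2 * m + 1" by simp_all
  have half: "real (m + 1) / real (2 * (m + 1)) = 1 / 2" by (simp only: of_nat_mult) simp
  have row: "row_wt D (?q + 1) = sqrt (1 / 2)" by (simp only: row_wt_def q1 e half)
  have col: "col_wt D ?q = sqrt (real (m + 1) / real (2 * m + 1))" using assms by (simp only: col_wt_def q e if_True)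
  have "diag_wt D s ?q = s\<^sup>2 * (sqrt 4 * (row_wt D (?q + 1) * col_wt D ?q))"
    unfolding diag_wt_def by (simp add: power2_eq_square mult_ac)
  also have "\<dots> = s\<^sup>2 * sqrt (4 * (1 / 2 * (real (m + 1) / real (2 * m + 1))))"
    by (simp only: row col real_sqrt_mult)
  also have "4 * (1 / 2 * (real (m + 1) / real (2 * m + 1))) = omg (Suc m) / omg m"
  proof -
    have "4 * (1 / 2 * y) = 2 * y" for y :: real by simp
    also have "2 * (real (m + 1) / real (2 * m + 1)) = (2 * real m + 2) / (2 * real m + 1)"
      by (simp only: times_divide_eq_right of_nat_add of_nat_mult distrib_left of_nat_1 of_nat_numeral mult_1_right)
    finally show ?thesis using omg_pos[of m] by (simp only: omg_Suc) simp
  qed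
  finally show ?thesis .
qed

lemma diag_wt_prod:
  assumes "m + k < D"
  shows "(\<Prod>i<k. diag_wt D s (m * (D + 1) + i * (D + 1))) = s ^ (2 * k) * sqrt (omg (m + k) / omg m)"
  using assms
proof (induction k)
  case (Suc k)
  have "diag_wt D s (m * (D + 1) + k * (D + 1)) = s\<^sup>2 * sqrt (omg (Suc (m + k)) / omg (m + k))"
    using diag_wt_diag[of "m + k" D s] Suc.prems unfolding add_mult_distrib[symmetric] by simp
  then have "(\<Prod>i<Suc k. diag_wt D s (m * (D + 1) + i * (D + 1))) =
      s ^ (2 * k) * s\<^sup>2 * (sqrt (omg (m + k) / omg m) * sqrt (omg (Suc (m + k)) / omg (m + k)))"
    using Suc by simp
  also have "sqrt (omg (m + k) / omg m) * sqrt (omg (Suc (m + k)) / omg (m + k)) = sqrt (omg (m + Suc k) / omg m)"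
    unfolding real_sqrt_mult[symmetric] using omg_pos[of "m + k"] by simp
  finally show ?case by (simp add: power_add[symmetric])
qed simp

lemma diag_less: "l < D \<Longrightarrow> l * (D + 1) < D * (D::nat)"
proof -
  assume l: "l < D"
  then have "l * (D + 1) \<le> (D - 1) * (D + 1)" by (intro mult_right_mono) auto
  also have "\<dots> < D * D" using l by (cases D) (auto simp: algebra_simps)
  finally show ?thesis .
qed

text \<open>
  Restricted to the diagonal, \<open>f\<close> acts on the truncated shift as the scalar matrix of \<open>bcoef_multiplier\<close>, scaled by
  powers of \<open>s\<close>; the partial sums are constant at this entry from \<open>D\<close> on.
\<close>

lemma eval_at_shift_tuple:
  fixes a b :: "'d::finite"
  assumes ab: "a \<noteq> b" and D: "1 \<le> D" and s: "0 \<le> s" "s < 1" and ml: "m \<le> l" "l < D"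
  shows "eval_at (D * D) (hump_fun a b) (shift_tuple D a b s) $$ (l * (D + 1), m * (D + 1)) =
     of_real (bcoef (l - m) * (s ^ (2 * (l - m)) * sqrt (omg l / omg m)))"
proof -
  let ?E = "eval_at (D * D) (hump_fun a b) (shift_tuple D a b s)"
  let ?T = "prod_mat a b (shift_tuple D a b s)"
  let ?p = "l * (D + 1)" and ?q = "m * (D + 1)"
  let ?c = "of_real (bcoef (l - m) * (s ^ (2 * (l - m)) * sqrt (omg l / omg m))) :: complex"
  note X = shift_tuple_comm_ball[OF ab D s]
  note ev = eval_at_hump_fun[OF ab X]
  have T: "?T \<in> carrier_mat (D * D) (D * D)" by (simp add: prod_mat_shift_tuple[OF ab])
  have p: "?p < D * D" and q: "?q < D * D" using diag_less ml by auto
  have ent: "hump_sum (D * D) ?T I $$ (?p, ?q) = ?c" if I: "D \<le> I" for I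
  proof -
    have "hump_sum (D * D) ?T I $$ (?p, ?q) =
        (\<Sum>k<I. if ?p = ?q + k * (D + 1) then of_real (bcoef k * (\<Prod>i<k. diag_wt D s (?q + i * (D + 1)))) else 0)"
      unfolding prod_mat_shift_tuple[OF ab] by (rule hump_sum_wshift[OF p q])
    also have "\<dots> = (\<Sum>k<I. if k = l - m then of_real (bcoef (l - m) * (\<Prod>i<l - m. diag_wt D s (?q + i * (D + 1)))) else 0)"
    proof (intro sum.cong refl)
      fix k
      have "(?p = ?q + k * (D + 1)) = (k = l - m)"
      proof -
        have "(?p = ?q + k * (D + 1)) = (l * (D + 1) = (m + k) * (D + 1))" by (simp only: add_mult_distrib)
        also have "\<dots> = (l = m + k)" by (subst mult_cancel2) simp
        finally show ?thesis using ml by auto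
      qed
      then show "(if ?p = ?q + k * (D + 1) then of_real (bcoef k * (\<Prod>i<k. diag_wt D s (?q + i * (D + 1)))) else 0) =
        (if k = l - m then of_real (bcoef (l - m) * (\<Prod>i<l - m. diag_wt D s (?q + i * (D + 1)))) else (0::complex))"
        by simp
    qed
    also have "\<dots> = of_real (bcoef (l - m) * (\<Prod>i<l - m. diag_wt D s (?q + i * (D + 1))))"
      using I ml by (simp add: sum.delta)
    also have "(\<Prod>i<l - m. diag_wt D s (?q + i * (D + 1))) = s ^ (2 * (l - m)) * sqrt (omg l / omg m)"
      using diag_wt_prod[of m "l - m" D s] ml by simp
    finally show ?thesis .
  qed
  have "cmod (?c - ?E $$ (?p, ?q)) < e" if e: "0 < e" for e
  proof -
    obtain I0 where I0: "\<forall>I\<ge>I0. opnorm (hump_sum (D * D) ?T I - ?E) < e" using ev(2)[OF e] by blast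
    define I where "I = max I0 D"
    note H = hump_sum_carrier[OF T, of I]
    have "cmod ((hump_sum (D * D) ?T I - ?E) $$ (?p, ?q)) \<le> opnorm (hump_sum (D * D) ?T I - ?E)"
      by (rule cmod_entry_le_opnorm[OF minus_carrier_mat[OF ev(1)] p q])
    moreover have "(hump_sum (D * D) ?T I - ?E) $$ (?p, ?q) = ?c - ?E $$ (?p, ?q)"
      using p q H ev(1) ent[of I] by (simp add: I_def)
    ultimately show ?thesis using I0 by (simp add: I_def) (meson le_less_trans max.cobounded1)
  qed
  then have "?c - ?E $$ (?p, ?q) = 0" by (metis less_irrefl zero_less_norm_iff)
  then show ?thesis by simp
qed

section \<open>Failure of uniform continuity\<close>

text \<open>
  A block of a matrix has at most the norm of the matrix.
\<close>

lemma opnorm_compression: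
  assumes A: "A \<in> carrier_mat n n" and inj: "inj_on e (B \<union> C)" and e: "e ` (B \<union> C) \<subseteq> {..<n}"
    and fin: "finite B" "finite C"
  shows "(\<Sum>l\<in>B. (cmod (\<Sum>m\<in>C. A $$ (e l, e m) * u m))\<^sup>2) \<le> (opnorm A)\<^sup>2 * (\<Sum>m\<in>C. (cmod (u m))\<^sup>2)"
proof -
  have iB: "inj_on e B" and iC: "inj_on e C" using inj by (auto simp: inj_on_Un)
  define h where "h = Matrix.vec n (\<lambda>q. if q \<in> e ` C then u (the_inv_into C e q) else 0)"
  have h: "h \<in> carrier_vec n" by (simp add: h_def)
  have he: "(\<Sum>q<n. f q (vec_index h q)) = (\<Sum>m\<in>C. f (e m) (u m))" if f0: "\<And>q. f q 0 = 0" for f :: "nat \<Rightarrow> complex \<Rightarrow> 'x::comm_monoid_add"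
  proof -
    have "(\<Sum>q<n. f q (vec_index h q)) = (\<Sum>q\<in>e ` C. f q (vec_index h q))"
      using e by (intro sum.mono_neutral_right) (auto simp: h_def f0)
    also have "\<dots> = (\<Sum>m\<in>C. f (e m) (vec_index h (e m)))" by (simp add: sum.reindex[OF iC])
    also have "\<dots> = (\<Sum>m\<in>C. f (e m) (u m))"
      using e by (intro sum.cong) (auto simp: h_def the_inv_into_f_f[OF iC])
    finally show ?thesis .
  qed
  have "(\<Sum>l\<in>B. (cmod (\<Sum>m\<in>C. A $$ (e l, e m) * u m))\<^sup>2) = (\<Sum>l\<in>B. (cmod (vec_index (A *\<^sub>v h) (e l)))\<^sup>2)"
  proof (intro sum.cong refl arg_cong[of _ _ "\<lambda>x. (cmod x)\<^sup>2"])
    fix l assume "l \<in> B"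
    then have "e l < n" using e by auto
    then have "vec_index (A *\<^sub>v h) (e l) = (\<Sum>q<n. A $$ (e l, q) * vec_index h q)" by (rule mult_mat_vec_index[OF A h])
    also have "\<dots> = (\<Sum>m\<in>C. A $$ (e l, e m) * u m)" by (rule he) simp
    finally show "(\<Sum>m\<in>C. A $$ (e l, e m) * u m) = vec_index (A *\<^sub>v h) (e l)" by simp
  qed
  also have "\<dots> = (\<Sum>p\<in>e ` B. (cmod (vec_index (A *\<^sub>v h) p))\<^sup>2)" by (simp add: sum.reindex[OF iB])
  also have "\<dots> \<le> (\<Sum>p<n. (cmod (vec_index (A *\<^sub>v h) p))\<^sup>2)" using e by (intro sum_mono2) auto
  also have "\<dots> = (cvec_norm (A *\<^sub>v h))\<^sup>2" using A unfolding cvec_norm_def L2_set_def by (simp add: sum_nonneg)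
  also have "\<dots> \<le> (opnorm A * cvec_norm h)\<^sup>2"
    by (intro power_mono cvec_norm_le_opnorm[OF A h]) (simp add: cvec_norm_def)
  also have "(cvec_norm h)\<^sup>2 = (\<Sum>m\<in>C. (cmod (u m))\<^sup>2)"
  proof -
    have "(cvec_norm h)\<^sup>2 = (\<Sum>q<n. (cmod (vec_index h q))\<^sup>2)" using h unfolding cvec_norm_def L2_set_def by (simp add: sum_nonneg)
    also have "\<dots> = (\<Sum>m\<in>C. (cmod (u m))\<^sup>2)" by (rule he) simp
    finally show ?thesis .
  qed
  then have "(opnorm A * cvec_norm h)\<^sup>2 = (opnorm A)\<^sup>2 * (\<Sum>m\<in>C. (cmod (u m))\<^sup>2)" by (simp add: power_mult_distrib)
  finally show ?thesis .
qed

text \<open>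
  The test vector has the coordinates \<open>sqrt (\<omega>\<^sub>m)\<close> on the diagonal for \<open>m < 2M\<close>; they cancel the
  denominators \<open>sqrt (\<omega>\<^sub>m)\<close> of the matrix entries. Its squared norm is at most \<open>6 L\<^sup>6\<close>. Each of the \<open>M = L\<^sup>4\<close> output levels
  just above \<open>L\<^bsup>16\<^esup> + M\<close> receives \<open>M\<close> equal contributions of size at least \<open>L\<^bsup>-7\<^esup> sqrt (\<omega>\<^sub>l) / 4\<close>, and
  \<open>\<omega>\<^sub>l \<ge> L\<^sup>8\<close>, which gives a squared norm of at least \<open>L\<^sup>6 / 16\<close>.
\<close>

lemma hump_fun_shift_gap:
  fixes a b :: "'d::finite"
  assumes ab: "a \<noteq> b" and r: "0 \<le> r" "r < 1"
  shows "\<exists>D\<ge>1. \<exists>s. 0 \<le> s \<and> s < 1 \<and>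
    1 / 10 \<le> opnorm (eval_at (D * D) (hump_fun a b) (shift_tuple D a b s) -
                     eval_at (D * D) (hump_fun a b) (shift_tuple D a b (r * s)))"
proof -
  \<comment> \<open>The hump lies so far out that scaling by \<open>r\<close> at least halves it.\<close>
  obtain k where k: "r ^ k < 1 / 2" using real_arch_pow_inv[OF _ r(2), of "1 / 2"] by auto
  define L where "L = blk k"
  define M where "M = L ^ 4"
  define n where "n = L ^ 16"
  define D where "D = n + 2 * M"
  \<comment> \<open>So close to 1 that the powers up to \<open>2D\<close> stay above one half, yet inside the ball.\<close>
  define s where "s = 1 - 1 / (4 * real D)"
  have L2: "2 \<le> L" using blk_ge(2)[of k] by (simp add: L_def)
  have n_blk: "n = blk (Suc k)" by (simp add: n_def L_def blk_Suc)
  have D1: "1 \<le> D" unfolding D_def n_def using L2 by (intro trans_le_add1 one_le_power) simp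
  have s0: "0 \<le> s" "s < 1" using D1 by (auto simp: s_def field_simps)
  have t0: "0 \<le> r * s" "r * s < 1" using s0 r mult_le_one[of r s] by (auto intro: mult_nonneg_nonneg) (metis mult_left_le_one_le le_less_trans less_imp_le)
  have sD: "1 / 2 \<le> s ^ (2 * D)"
    using Bernoulli_inequality[of "- 1 / (4 * real D)" "2 * D"] D1 by (simp add: s_def field_simps)
  let ?E = "\<lambda>s. eval_at (D * D) (hump_fun a b) (shift_tuple D a b s)"
  define G where "G = ?E s - ?E (r * s)"
  note X = shift_tuple_comm_ball[OF ab D1 s0] and Y = shift_tuple_comm_ball[OF ab D1 t0]
  note EX = eval_at_hump_fun(1)[OF ab X] and EY = eval_at_hump_fun(1)[OF ab Y]
  have G: "G \<in> carrier_mat (D * D) (D * D)" unfolding G_def by (rule minus_carrier_mat[OF EY])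
  define g where "g l m = bcoef (l - m) * ((s ^ (2 * (l - m)) - (r * s) ^ (2 * (l - m))) * sqrt (omg l / omg m))" for l m
  have Gg: "G $$ (l * (D + 1), m * (D + 1)) = of_real (g l m)" if "m \<le> l" "l < D" for l m
  proof -
    have pq: "l * (D + 1) < D * D" "m * (D + 1) < D * D" using diag_less that by auto
    show ?thesis unfolding G_def g_def
      using EX EY pq eval_at_shift_tuple[OF ab D1 s0 that] eval_at_shift_tuple[OF ab D1 t0 that]
      by (simp add: left_diff_distrib right_diff_distrib)
  qed
  have pw: "(r * s) ^ j \<le> s ^ j" for j
    using r s0 by (intro power_mono) (auto intro: mult_left_le_one_le mult_nonneg_nonneg)
  have g0: "0 \<le> g l m" for l m
    unfolding g_def using pw by (intro mult_nonneg_nonneg) auto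
  define B where "B = {n + M..<n + 2 * M}"
  define C where "C = {..<2 * M}"
  have row: "real M / real L ^ 7 / 4 * sqrt (omg l) \<le> (\<Sum>m\<in>C. g l m * sqrt (omg m))" if l: "l \<in> B" for l
  proof -
    \<comment> \<open>The inputs that hump \<open>k\<close> sends to \<open>l\<close>; for \<open>l\<close> in \<open>B\<close> all of them lie in \<open>C\<close>.\<close>
    let ?W = "{l - n - M + 1..l - n}"
    have W: "?W \<subseteq> C" "card ?W = M" using l by (auto simp: B_def C_def)
    have "real M / real L ^ 7 / 4 * sqrt (omg l) = (\<Sum>m\<in>?W. 1 / real L ^ 7 * (1 / 4 * sqrt (omg l)))"
      by (simp only: sum_constant W(2)) (simp add: field_simps)
    also have "\<dots> \<le> (\<Sum>m\<in>?W. g l m * sqrt (omg m))"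
    proof (rule sum_mono)
      fix m assume m: "m \<in> ?W"
      define j where "j = l - m"
      have j: "n \<le> j" "j < n + M" "j \<le> D" using m l by (auto simp: B_def j_def D_def)
      have "hump k j = 1 / real L ^ 7" unfolding hump_def using j n_blk by (simp add: L_def M_def)
      then have bj: "1 / real L ^ 7 \<le> bcoef j" using hump_le_bcoef[of k j] by simp
      have "k \<le> 2 * j" using blk_gt[of "Suc k"] j n_blk by linarith
      then have rj: "r ^ (2 * j) \<le> 1 / 2" using power_decreasing[of k "2 * j" r] r k by linarith
      have "s ^ (2 * D) \<le> s ^ (2 * j)" using s0 j by (intro power_decreasing) auto
      then have sj: "1 / 2 \<le> s ^ (2 * j)" using sD by linarith
      have "1 / 4 \<le> s ^ (2 * j) * (1 - r ^ (2 * j))"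
        using mult_mono[OF sj, of "1 / 2" "1 - r ^ (2 * j)"] rj s0 by simp
      then have d: "1 / 4 \<le> s ^ (2 * j) - (r * s) ^ (2 * j)"
        by (simp add: power_mult_distrib algebra_simps)
      have "g l m * sqrt (omg m) = bcoef j * ((s ^ (2 * j) - (r * s) ^ (2 * j)) * (sqrt (omg l / omg m) * sqrt (omg m)))"
        unfolding g_def j_def by simp
      also have "sqrt (omg l / omg m) * sqrt (omg m) = sqrt (omg l)"
        unfolding real_sqrt_mult[symmetric] using omg_pos[of m] by simp
      finally have e: "g l m * sqrt (omg m) = bcoef j * ((s ^ (2 * j) - (r * s) ^ (2 * j)) * sqrt (omg l))" .
      show "1 / real L ^ 7 * (1 / 4 * sqrt (omg l)) \<le> g l m * sqrt (omg m)"
        unfolding e using bj d by (intro mult_mono mult_right_mono) auto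
    qed
    also have "\<dots> \<le> (\<Sum>m\<in>C. g l m * sqrt (omg m))"
      using W by (intro sum_mono2) (auto simp: C_def g0)
    finally show ?thesis .
  qed
  have BD: "l < D" if "l \<in> B" for l using that by (simp add: B_def D_def)
  have CD: "m < D" if "m \<in> C" for m using that L2 by (simp add: C_def D_def n_def)
  have CB: "m \<le> l" if "m \<in> C" "l \<in> B" for m l
  proof -
    have "2 * M \<le> n"
    proof -
      have "2 * L ^ 4 \<le> L * L ^ 4" using L2 by simp
      also have "\<dots> = L ^ 5" by (simp add: eval_nat_numeral)
      also have "\<dots> \<le> L ^ 16" using L2 by (intro power_increasing) auto
      finally show ?thesis by (simp add: M_def n_def)
    qed
    then show ?thesis using that by (simp add: B_def C_def)
  qed
  have "real L ^ 6 / 16 \<le> (\<Sum>l\<in>B. (\<Sum>m\<in>C. g l m * sqrt (omg m))\<^sup>2)"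
  proof -
    have "real L ^ 6 / 16 = (\<Sum>l\<in>B. (real M / real L ^ 7 / 4)\<^sup>2 * real L ^ 8)"
    proof -
      have "card B = M" by (simp add: B_def)
      moreover have "real L \<noteq> 0" using L2 by simp
      ultimately show ?thesis by (simp add: M_def power_divide field_simps power_add[symmetric] power_mult[symmetric])
    qed
    also have "\<dots> \<le> (\<Sum>l\<in>B. (\<Sum>m\<in>C. g l m * sqrt (omg m))\<^sup>2)"
    proof (rule sum_mono)
      fix l assume l: "l \<in> B"
      have "real n \<le> real l" using l by (simp add: B_def)
      moreover have "(real L ^ 8)\<^sup>2 = real n" by (simp add: n_def power_mult[symmetric])
      ultimately have "(real L ^ 8)\<^sup>2 \<le> 2 * real l + 1" by linarith
      then have ol: "real L ^ 8 \<le> omg l" by (rule order_trans[OF real_le_rsqrt omg_lower])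
      have "(real M / real L ^ 7 / 4)\<^sup>2 * real L ^ 8 \<le> (real M / real L ^ 7 / 4)\<^sup>2 * omg l"
        using ol by (intro mult_left_mono) auto
      also have "\<dots> = (real M / real L ^ 7 / 4 * sqrt (omg l))\<^sup>2"
        by (simp only: power_mult_distrib real_sqrt_pow2[OF omg_nonneg])
      also have "\<dots> \<le> (\<Sum>m\<in>C. g l m * sqrt (omg m))\<^sup>2"
        by (intro power_mono row[OF l]) simp
      finally show "(real M / real L ^ 7 / 4)\<^sup>2 * real L ^ 8 \<le> (\<Sum>m\<in>C. g l m * sqrt (omg m))\<^sup>2" .
    qed
    finally show ?thesis .
  qed
  also have "(\<Sum>l\<in>B. (\<Sum>m\<in>C. g l m * sqrt (omg m))\<^sup>2) =
     (\<Sum>l\<in>B. (cmod (\<Sum>m\<in>C. G $$ (l * (D + 1), m * (D + 1)) * of_real (sqrt (omg m))))\<^sup>2)"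
  proof (intro sum.cong refl)
    fix l assume l: "l \<in> B"
    have "(\<Sum>m\<in>C. G $$ (l * (D + 1), m * (D + 1)) * of_real (sqrt (omg m))) = of_real (\<Sum>m\<in>C. g l m * sqrt (omg m))"
      unfolding of_real_sum of_real_mult by (intro sum.cong refl arg_cong2[of _ _ _ _ "(*)"] Gg CB BD l)
    then show "(\<Sum>m\<in>C. g l m * sqrt (omg m))\<^sup>2 = (cmod (\<Sum>m\<in>C. G $$ (l * (D + 1), m * (D + 1)) * of_real (sqrt (omg m))))\<^sup>2"
      by (simp only: norm_of_real power2_abs)
  qed
  also have "\<dots> \<le> (opnorm G)\<^sup>2 * (\<Sum>m\<in>C. (cmod (of_real (sqrt (omg m))))\<^sup>2)"
    by (rule opnorm_compression[OF G])
       (use BD CD diag_less in \<open>auto simp: inj_on_def B_def C_def simp del: mult_Suc_right add_Suc_right\<close>)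
  also have "\<dots> \<le> (opnorm G)\<^sup>2 * (6 * real L ^ 6)"
  proof (rule mult_left_mono)
    have "(\<Sum>m\<in>C. (cmod (of_real (sqrt (omg m))))\<^sup>2) = (\<Sum>m\<in>C. omg m)" by simp
    also have "\<dots> \<le> (\<Sum>m\<in>C. 3 * real L ^ 2)"
    proof (rule sum_mono)
      fix m assume "m \<in> C"
      then have "real m \<le> 2 * real M" by (simp add: C_def)
      moreover have "1 \<le> real L ^ 4" using L2 by simp
      ultimately have "4 * real m + 1 \<le> (3 * real L ^ 2)\<^sup>2" by (simp add: M_def power_mult_distrib power_mult[symmetric])
      then have "sqrt (4 * real m + 1) \<le> 3 * real L ^ 2" by (intro real_le_lsqrt) auto
      then show "omg m \<le> 3 * real L ^ 2" using omg_upper[of m] by linarith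
    qed
    also have "\<dots> = 6 * real L ^ 6" by (simp add: C_def M_def power_add[symmetric])
    finally show "(\<Sum>m\<in>C. (cmod (of_real (sqrt (omg m))))\<^sup>2) \<le> 6 * real L ^ 6" .
  qed simp
  finally have main: "real L ^ 6 / 16 \<le> (opnorm G)\<^sup>2 * (6 * real L ^ 6)" .
  have "1 / 10 \<le> opnorm G"
  proof -
    have L0: "0 < real L ^ 6" using L2 by simp
    have "1 / 96 * real L ^ 6 \<le> (opnorm G)\<^sup>2 * real L ^ 6" using main by simp
    then have "1 / 96 \<le> (opnorm G)\<^sup>2" using L0 by (simp only: mult_le_cancel_right_pos)
    then have "(1 / 10)\<^sup>2 \<le> (opnorm G)\<^sup>2" by (simp add: power2_eq_square)
    then show ?thesis using opnorm_nonneg[OF G] by (rule power2_le_imp_le)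
  qed
  then show ?thesis using D1 s0 unfolding G_def by blast
qed

text \<open>
  The gap \<open>1 / 10\<close> does not depend on \<open>r\<close>, while the distance of the two tuples is at most \<open>1 - r\<close>.
\<close>

lemma hump_fun_not_uniformly_continuous:
  fixes a b :: "'d::finite"
  assumes ab: "a \<noteq> b"
  shows "\<not> uniformly_continuous_free (hump_fun a b)"
proof
  assume "uniformly_continuous_free (hump_fun a b)"
  from this[unfolded uniformly_continuous_free_def, rule_format, of "1 / 10"]
  obtain \<delta> where \<delta>: "0 < \<delta>" and uc: "\<And>n X Y. 1 \<le> n \<Longrightarrow> X \<in> comm_ball n \<Longrightarrow> Y \<in> comm_ball n \<Longrightarrow>
     row_norm n (\<lambda>i. X i - Y i) < \<delta> \<Longrightarrow> opnorm (eval_at n (hump_fun a b) X - eval_at n (hump_fun a b) Y) < 1 / 10"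
    by auto
  define r where "r = 1 - min (\<delta> / 2) (1 / 2)"
  have r: "0 \<le> r" "r < 1" "1 - r < \<delta>" using \<delta> by (auto simp: r_def min_def)
  obtain D s where D: "1 \<le> D" and s: "0 \<le> s" "s < 1"
    and gap: "1 / 10 \<le> opnorm (eval_at (D * D) (hump_fun a b) (shift_tuple D a b s) -
                     eval_at (D * D) (hump_fun a b) (shift_tuple D a b (r * s)))"
    using hump_fun_shift_gap[OF ab r(1,2)] by blast
  have rs: "0 \<le> r * s" "r * s \<le> s" using r s by (auto intro: mult_left_le_one_le)
  have t: "0 \<le> s - r * s" "s - r * s < \<delta>"
  proof -
    have "s - r * s = s * (1 - r)" by (simp add: algebra_simps)
    also have "\<dots> \<le> 1 * (1 - r)" using s r by (intro mult_right_mono) auto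
    finally have "s - r * s \<le> 1 - r" by (simp only: mult_1)
    then show "s - r * s < \<delta>" using r(3) by (rule le_less_trans)
  qed (use rs in simp)
  have "opnorm (eval_at (D * D) (hump_fun a b) (shift_tuple D a b s) -
      eval_at (D * D) (hump_fun a b) (shift_tuple D a b (r * s))) < 1 / 10"
  proof (rule uc)
    show "1 \<le> D * D" using D by simp
    show "shift_tuple D a b s \<in> comm_ball (D * D)" by (rule shift_tuple_comm_ball[OF ab D s])
    show "shift_tuple D a b (r * s) \<in> comm_ball (D * D)"
      using rs s by (intro shift_tuple_comm_ball[OF ab D]) auto
    show "row_norm (D * D) (\<lambda>i. shift_tuple D a b s i - shift_tuple D a b (r * s) i) < \<delta>"
      unfolding shift_tuple_diff using shift_tuple_row_norm[OF ab D t(1)] t(2) by linarith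
  qed
  then show False using gap by linarith
qed

theorem proposition7p2:
  assumes "CARD('d::finite) \<ge> 2"
  shows "\<exists>f :: complex ^ 'd \<Rightarrow> complex.
           f \<in> mult_drury_arveson \<and>
           levelwise_uniformly_continuous_free f \<and>
           \<not> uniformly_continuous_free f"
proof -
  obtain a b :: 'd where "a \<noteq> b"
    using assms card_le_Suc0_iff_eq[of "UNIV :: 'd set"] by auto
  then show ?thesis
    using hump_fun_multiplier hump_fun_levelwise hump_fun_not_uniformly_continuous by blast
qed

end
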